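(* In the setting of the context, assume $0<T<\infty$ almost surely under $\mathcal{P}(dN|\rho,\eta)$. Let $n\ge1$ be an integer and $\theta$ real with $\theta+n>0$; if $\theta\ne0$ assume $E[T^{-\theta}|\rho,\eta]<\infty$ and $E[T^{-(\theta+n)}|\rho,\eta]<\infty$. Let $N$ have law $\tilde{\mathcal{P}}(dN|\rho,\eta,\theta)$ (equal to $\mathcal{P}(dN|\rho,\eta)$ if $\theta=0$), let $P=\mu/T$, and given $P$ (and $N$) let $Y_1,\dots,Y_n$ be i.i.d. with distribution $P$. Then: (i) The marginal distribution of $\mathbf{Y}=(\mathbf{Y}^*,\mathbf{p})$ is $$\pi(d\mathbf{Y})=\int_0^\infty\Big[\prod_{j=1}^{n(\mathbf{p})}\Pr(dY_j^*|e^{-vh}\rho,\eta)\Big]\pi_{\theta+n,\theta}(dv,\mathbf{p}|\rho,\eta).$$ Consequently $\pi_{\theta+n,\theta}(\mathbf{p}|\rho,\eta)=\int_0^\infty\pi_{\theta+n,\theta}(dv,\mathbf{p}|\rho,\eta)$ is an exchangeable partition probability function (EPPF). When $\rho(ds|y)=\rho(ds)$ does not depend on $y$, $\pi(d\mathbf{Y})=\pi_{\theta+n,\theta}(\mathbf{p}|\rho,\eta)\prod_{j=1}^{n(\mathbf{p})}H(dY_j^* )$, where $H=\eta/\eta(\mathcal{Y})$. (ii) The posterior distributions of $N$ and of $\mu$ given $\mathbf{Y}$ are, respectively, the mixtures $$\int_{(0,\infty)\times\mathcal{S}^{n(\mathbf{p})}}\mathcal{P}(dN,d\mathbf{J}|e^{-vh}\rho,\eta,\mathbf{Y}^*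 )\,\pi_{\theta+n}(dv|\mathbf{p},\mathbf{Y}^* ),\qquad\int_0^\infty\mathcal{P}(d\mu|e^{-vh}\rho,\eta,\mathbf{Y}^* )\,\pi_{\theta+n}(dv|\mathbf{p},\mathbf{Y}^* ).$$ (iii) The posterior distribution of $P$ given $\mathbf{Y}$ is the distribution of the random probability measure $$p_n^*P^*(\cdot)+(1-p_n^* )\frac{\sum_{j=1}^{n(\mathbf{p})}h(J_{j,n})\delta_{Y_j^*}(\cdot)}{\sum_{j=1}^{n(\mathbf{p})}h(J_{j,n})},\qquad p_n^*=\frac{\mu^*(\mathcal{Y})}{\mu^*(\mathcal{Y})+\sum_{j=1}^{n(\mathbf{p})}h(J_{j,n})},\quad P^*=\frac{\mu^*}{\mu^*(\mathcal{Y})},$$ where $V|\mathbf{Y}$ has law $\pi_{\theta+n}(dv|\mathbf{p},\mathbf{Y}^* )$ and, given $\mathbf{Y}$ and $V=v$, $\mu^*\sim\mathcal{P}(d\mu|e^{-vh}\rho,\eta)$ is independent of the mutually independent $J_{j,n}$, whose laws are $h(s)^{e_{j,n}}e^{-vh(s)}\rho(ds|Y_j^* )/\kappa_{e_{j,n}}(e^{-vh}\rho|Y_j^* )$.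
   Context: $\mathcal{S},\mathcal{Y}$ are Polish spaces; $\eta$ is a $\sigma$-finite non-atomic measure on $\mathcal{Y}$; $\rho(ds|y)$ is a measurable kernel of ($\sigma$-finite) measures on $\mathcal{S}$; $h:\mathcal{S}\to(0,\infty)$ is measurable. If $\rho$ does not depend on $y$, $\eta$ is a finite measure. $\mathcal{P}(dN|\rho,\eta)$ is the law of a Poisson random measure on $\mathcal{S}\times\mathcal{Y}$ with intensity $\rho(ds|y)\eta(dy)$; $\mu(dy)=\int_{\mathcal{S}}h(s)N(ds,dy)$ has law $\mathcal{P}(d\mu|\rho,\eta)$; $T=\mu(\mathcal{Y})$, a.s. finite. $E[\cdot|\rho,\eta]$ is expectation under $\mathcal{P}(dN|\rho,\eta)$. $\tilde{\mathcal{P}}(dN|\rho,\eta,\theta)=T^{-\theta}\mathcal{P}(dN|\rho,\eta)/E[T^{-\theta}|\rho,\eta]$. $e^{-vh}\rho$ is the kernel $e^{-vh(s)}\rho(ds|y)$. $\kappa_m(e^{-vh}\rho|y)=\int h(s)^me^{-vh(s)}\rho(ds|y)$, $\kappa_m(e^{-vh}\Omega)=\int_{\mathcal{Y}}\kappa_m(e^{-vh}\rho|y)\eta(dy)$. $\mathbf{Y}=(Y_1,\dots,Y_n)$ is encoded as $(\mathbf{Y}^*,\mathbf{p})$: $Y_1^*,\dots,Y^*_{n(\mathbf{p})}$ are the distinct values, $\mathbf{p}=\{C_1,\dots,C_{n(\mathbf{p})}\}$ is the partition of $\{1,\dots,n\}$ with $Y_i=Y_j^*$ iff $i\in C_j$,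 $e_{j,n}=|C_j|$. An EPPF is the function giving, for each $n$ and each partition of $\{1,\dots,n\}$, the probability that an exchangeable random partition (here: by ties of the exchangeable sequence $Y_1,Y_2,\dots$) equals it. $\Pr(dY_j^*|e^{-vh}\rho,\eta)=\kappa_{e_{j,n}}(e^{-vh}\rho|Y_j^* )\eta(dY_j^* )/\kappa_{e_{j,n}}(e^{-vh}\Omega)$. $\pi_{\theta+n,\theta}(dv,\mathbf{p}|\rho,\eta)=\frac{[\prod_{j}\kappa_{e_{j,n}}(e^{-vh}\Omega)]v^{\theta+n-1}E[e^{-vT}|\rho,\eta]dv}{\Gamma(\theta+n)E[T^{-\theta}|\rho,\eta]}$ on $(0,\infty)\times\{\text{partitions}\}$. $\pi_{\theta+n}(dv|\mathbf{p},\mathbf{Y}^* )$ is the probability measure on $(0,\infty)$ proportional to $[\prod_{j}\kappa_{e_{j,n}}(e^{-vh}\rho|Y_j^* )]v^{\theta+n-1}E[e^{-vT}|\rho,\eta]dv$. $\mathcal{P}(dN,d\mathbf{J}|e^{-vh}\rho,\eta,\mathbf{Y}^* )$ is the joint law of $N=N^*+\sum_j\delta_{(J_{j,n},Y_j^* )}$ and $\mathbf{J}$, where $N^*\sim\mathcal{P}(dN|e^{-vh}\rho,\eta)$ is independent of the independent $J_{j,n}$ with laws $h(s)^{e_{j,n}}e^{-vh(s)}\rho(ds|Y_j^* )/\kappa_{e_{j,n}}(e^{-vh}\rho|Y_j^* )$; $\mathcal{P}(d\mu|e^{-vh}\rho,\eta,\mathbf{Y}^* )$ is the law of the corresponding $\mu^*+\sum_jh(J_{j,n})\delta_{Y_j^*}$,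 $\mu^*(dy)=\int h(s)N^*(ds,dy)$. *)

theory Defs
  imports "HOL-Probability.Probability"
begin

section \<open>Spaces of measures\<close>

text \<open>The space of all (not necessarily finite) measures on a measurable space, with the
  sigma-algebra generated by the evaluations. It is built like \<open>subprob_algebra\<close>.\<close>

definition measure_algebra :: "'a measure \<Rightarrow> 'a measure measure" where
  "measure_algebra K =
     (SUP A \<in> sets K. vimage_algebra {M. sets M = sets K} (\<lambda>M. emeasure M A) borel)"

definition add_measure :: "'a measure \<Rightarrow> 'a measure \<Rightarrow> 'a measure" where
  "add_measure M N = measure_of (space M) (sets M) (\<lambda>A. emeasure M A + emeasure N A)"

definition normalize_measure :: "'a measure \<Rightarrow> 'a measure" where
  "normalize_measure M = scale_measure (inverse (emeasure M (space M))) M"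

text \<open>The sum over \<open>j \<in> I\<close> of \<open>w j\<close> times the Dirac mass at \<open>x j\<close>.\<close>

definition weighted_diracs :: "'i set \<Rightarrow> ('i \<Rightarrow> ennreal) \<Rightarrow> ('i \<Rightarrow> 'a::topological_space) \<Rightarrow> 'a measure"
  where "weighted_diracs I w x = distr (point_measure I w) borel x"

text \<open>The mixture of the measures \<open>Q v\<close> on \<open>S\<close>, where \<open>v\<close> is distributed according to \<open>m\<close>.\<close>

definition mixture :: "'b measure \<Rightarrow> 'a measure \<Rightarrow> ('a \<Rightarrow> 'b measure) \<Rightarrow> 'b measure" where
  "mixture S m Q = measure_of (space S) (sets S) (\<lambda>A. \<integral>\<^sup>+v. emeasure (Q v) A \<partial>m)"

definition nonatomic :: "'a measure \<Rightarrow> bool" where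
  "nonatomic M \<longleftrightarrow>
     (\<forall>A\<in>sets M. 0 < emeasure M A \<longrightarrow>
        (\<exists>B\<in>sets M. B \<subseteq> A \<and> 0 < emeasure M B \<and> emeasure M B < emeasure M A))"

definition sigma_finite_kernel ::
  "('y::topological_space \<Rightarrow> 's::topological_space measure) \<Rightarrow> bool" where
  "sigma_finite_kernel \<rho> \<longleftrightarrow>
     (\<forall>y. sets (\<rho> y) = sets borel \<and> sigma_finite_measure (\<rho> y)) \<and>
     (\<forall>A\<in>sets borel. (\<lambda>y. emeasure (\<rho> y) A) \<in> borel_measurable borel)"

section \<open>Poisson random measures\<close>

text \<open>The measure \<open>\<rho>(ds|y) \<eta>(dy)\<close>.\<close>

definition intensity ::
  "('y::topological_space \<Rightarrow> 's::topological_space measure) \<Rightarrow> 'y measure \<Rightarrow> ('s \<times> 'y) measure"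
  where
  "intensity \<rho> \<eta> = measure_of UNIV (sets borel)
     (\<lambda>B. \<integral>\<^sup>+y. emeasure (\<rho> y) {s. (s, y) \<in> B} \<partial>\<eta>)"

definition is_poisson_law :: "'a measure \<Rightarrow> 'a measure measure \<Rightarrow> bool" where
  "is_poisson_law \<nu> L \<longleftrightarrow>
     prob_space L \<and> sets L = sets (measure_algebra \<nu>) \<and>
     (\<forall>A\<in>sets \<nu>.
        if emeasure \<nu> A = \<infinity> then AE N in L. emeasure N A = \<infinity>
        else \<forall>k::nat. measure L {N \<in> space L. emeasure N A = of_nat k} =
               measure \<nu> A ^ k / fact k * exp (- measure \<nu> A)) \<and>
     (\<forall>F. finite F \<longrightarrow> F \<subseteq> sets \<nu> \<longrightarrow> disjoint F \<longrightarrow>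
        prob_space.indep_vars L (\<lambda>_. borel) (\<lambda>A N. emeasure N A) F)"

text \<open>There is at most one Poisson law with a given intensity, since the counts of disjoint sets
  generate the evaluation sigma-algebra.\<close>

definition poisson_law :: "'a measure \<Rightarrow> 'a measure measure" where
  "poisson_law \<nu> = (THE L. is_poisson_law \<nu> L)"

section \<open>The random measures \<open>\<mu>\<close> and \<open>P\<close>\<close>

definition mu_of :: "('s \<Rightarrow> real) \<Rightarrow> ('s::topological_space \<times> 'y::topological_space) measure \<Rightarrow> 'y measure"
  where "mu_of h N = distr (density N (\<lambda>(s, y). ennreal (h s))) borel snd"

definition total_mass :: "('s \<Rightarrow> real) \<Rightarrow> ('s::topological_space \<times> 'y::topological_space) measure \<Rightarrow> ennreal"
  where "total_mass h N = emeasure (mu_of h N) UNIV"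

definition P_of :: "('s \<Rightarrow> real) \<Rightarrow> ('s::topological_space \<times> 'y::topological_space) measure \<Rightarrow> 'y measure"
  where "P_of h N = normalize_measure (mu_of h N)"

text \<open>In the following definitions \<open>PN\<close> is the law of \<open>N\<close>. Values on the event that the total
  mass is \<open>0\<close> or infinite are irrelevant, because this event has probability zero.\<close>

definition neg_moment ::
  "('s \<Rightarrow> real) \<Rightarrow> ('s::topological_space \<times> 'y::topological_space) measure measure \<Rightarrow> real \<Rightarrow> ennreal"
  where "neg_moment h PN \<theta> = (\<integral>\<^sup>+N. ennreal (enn2real (total_mass h N) powr (- \<theta>)) \<partial>PN)"

definition laplace ::
  "('s \<Rightarrow> real) \<Rightarrow> ('s::topological_space \<times> 'y::topological_space) measure measure \<Rightarrow> real \<Rightarrow> ennreal"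
  where "laplace h PN v = (\<integral>\<^sup>+N. ennreal (exp (- v * enn2real (total_mass h N))) \<partial>PN)"

text \<open>For \<open>\<theta> = 0\<close> the density below is almost surely \<open>1\<close>.\<close>

definition weighted_law ::
  "('s \<Rightarrow> real) \<Rightarrow> ('s::topological_space \<times> 'y::topological_space) measure measure \<Rightarrow> real \<Rightarrow>
   ('s \<times> 'y) measure measure" where
  "weighted_law h PN \<theta> =
     density PN (\<lambda>N. ennreal (enn2real (total_mass h N) powr (- \<theta>)) / neg_moment h PN \<theta>)"

section \<open>Tilted kernels and their moments\<close>

definition tilt ::
  "('s \<Rightarrow> real) \<Rightarrow> real \<Rightarrow> ('y \<Rightarrow> 's measure) \<Rightarrow> 'y \<Rightarrow> 's measure" where
  "tilt h v \<rho> y = density (\<rho> y) (\<lambda>s. ennreal (exp (- v * h s)))"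

definition kappa :: "('s \<Rightarrow> real) \<Rightarrow> nat \<Rightarrow> ('y \<Rightarrow> 's measure) \<Rightarrow> 'y \<Rightarrow> ennreal" where
  "kappa h m \<rho> y = (\<integral>\<^sup>+s. ennreal (h s ^ m) \<partial>\<rho> y)"

definition kappa_total ::
  "('s \<Rightarrow> real) \<Rightarrow> nat \<Rightarrow> ('y \<Rightarrow> 's measure) \<Rightarrow> 'y measure \<Rightarrow> ennreal" where
  "kappa_total h m \<rho> \<eta> = (\<integral>\<^sup>+y. kappa h m \<rho> y \<partial>\<eta>)"

definition value_law ::
  "('s \<Rightarrow> real) \<Rightarrow> nat \<Rightarrow> ('y \<Rightarrow> 's measure) \<Rightarrow> 'y measure \<Rightarrow> 'y measure" where
  "value_law h m \<rho> \<eta> = density \<eta> (\<lambda>y. kappa h m \<rho> y / kappa_total h m \<rho> \<eta>)"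

definition jump_law ::
  "('s \<Rightarrow> real) \<Rightarrow> nat \<Rightarrow> ('y \<Rightarrow> 's measure) \<Rightarrow> 'y \<Rightarrow> 's measure" where
  "jump_law h m \<rho> y = density (\<rho> y) (\<lambda>s. ennreal (h s ^ m) / kappa h m \<rho> y)"

section \<open>Partitions\<close>

text \<open>A vector \<open>y\<close> indexed by \<open>I\<close> is encoded by its partition \<open>ties I y\<close> and its distinct values.
  The latter are indexed by the blocks themselves, rather than by an enumeration of the blocks.\<close>

definition ties :: "nat set \<Rightarrow> (nat \<Rightarrow> 'y) \<Rightarrow> nat set set" where
  "ties I y = (\<lambda>i. {j \<in> I. y j = y i}) ` I"

definition block_values :: "nat set set \<Rightarrow> (nat \<Rightarrow> 'y) \<Rightarrow> nat set \<Rightarrow> 'y" where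
  "block_values p y = (\<lambda>C\<in>p. y (Min C))"

definition exchangeable_seq :: "(nat \<Rightarrow> 'y::topological_space) measure \<Rightarrow> bool" where
  "exchangeable_seq Q \<longleftrightarrow>
     prob_space Q \<and> sets Q = sets (Pi\<^sub>M {1..} (\<lambda>_. borel)) \<and>
     (\<forall>J f. finite J \<longrightarrow> J \<subseteq> {1..} \<longrightarrow> f permutes J \<longrightarrow> distr Q Q (\<lambda>y. y \<circ> f) = Q)"

definition sample_vec :: "nat \<Rightarrow> (nat \<Rightarrow> 'w \<Rightarrow> 'y) \<Rightarrow> 'w \<Rightarrow> nat \<Rightarrow> 'y" where
  "sample_vec n Y w = (\<lambda>i\<in>{1..n}. Y i w)"

text \<open>The EPPF of the random partition of the positive integers by the ties of an exchangeable
  sequence with law \<open>Q\<close>, at a partition \<open>p\<close> of \<open>{1..m}\<close>.\<close>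

definition eppf :: "(nat \<Rightarrow> 'y::topological_space) measure \<Rightarrow> nat \<Rightarrow> nat set set \<Rightarrow> ennreal" where
  "eppf Q m p = emeasure Q {y \<in> space Q. ties {1..m} y = p}"

text \<open>The measure \<open>\<pi>\<^bsub>\<theta>+n,\<theta>\<^esub>(dv, p | \<rho>, \<eta>)\<close> in \<open>v\<close> on the open half-line, for fixed \<open>n\<close> and \<open>p\<close>.\<close>

definition mix_joint ::
  "('s \<Rightarrow> real) \<Rightarrow> ('y \<Rightarrow> 's measure) \<Rightarrow> 'y measure \<Rightarrow>
   ('s::topological_space \<times> 'y::topological_space) measure measure \<Rightarrow>
   real \<Rightarrow> nat \<Rightarrow> nat set set \<Rightarrow> real measure" where
  "mix_joint h \<rho> \<eta> PN \<theta> n p = density (restrict_space lborel {0<..})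
     (\<lambda>v. (\<Prod>C\<in>p. kappa_total h (card C) (tilt h v \<rho>) \<eta>) * ennreal (v powr (\<theta> + real n - 1)) *
          laplace h PN v / (ennreal (Gamma (\<theta> + real n)) * neg_moment h PN \<theta>))"

definition partition_prob ::
  "('s \<Rightarrow> real) \<Rightarrow> ('y \<Rightarrow> 's measure) \<Rightarrow> 'y measure \<Rightarrow>
   ('s::topological_space \<times> 'y::topological_space) measure measure \<Rightarrow>
   real \<Rightarrow> nat \<Rightarrow> nat set set \<Rightarrow> ennreal" where
  "partition_prob h \<rho> \<eta> PN \<theta> n p =
     emeasure (mix_joint h \<rho> \<eta> PN \<theta> n p) (space (mix_joint h \<rho> \<eta> PN \<theta> n p))"

text \<open>The probability measure \<open>\<pi>\<^bsub>\<theta>+n\<^esub>(dv | p, Y\<^sup>*)\<close>.\<close>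

definition mix_posterior ::
  "('s \<Rightarrow> real) \<Rightarrow> ('y \<Rightarrow> 's measure) \<Rightarrow>
   ('s::topological_space \<times> 'y::topological_space) measure measure \<Rightarrow>
   real \<Rightarrow> nat \<Rightarrow> nat set set \<Rightarrow> (nat set \<Rightarrow> 'y) \<Rightarrow> real measure" where
  "mix_posterior h \<rho> PN \<theta> n p ys = normalize_measure (density (restrict_space lborel {0<..})
     (\<lambda>v. (\<Prod>C\<in>p. kappa h (card C) (tilt h v \<rho>) (ys C)) * ennreal (v powr (\<theta> + real n - 1)) *
          laplace h PN v))"

section \<open>Posterior laws\<close>

text \<open>The joint law of \<open>N\<^sup>*\<close> and the jumps \<open>J\<close>. For the tilted kernel \<open>e\<^bsup>-vh\<^esup> \<rho>\<close> the argument
  \<open>\<rho>\<close> below is \<open>tilt h v \<rho>\<close>.\<close>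

definition star_jumps_law ::
  "('s \<Rightarrow> real) \<Rightarrow> ('y \<Rightarrow> 's measure) \<Rightarrow> 'y measure \<Rightarrow> nat set set \<Rightarrow> (nat set \<Rightarrow> 'y) \<Rightarrow>
   (('s::topological_space \<times> 'y::topological_space) measure \<times> (nat set \<Rightarrow> 's)) measure" where
  "star_jumps_law h \<rho> \<eta> p ys =
     poisson_law (intensity \<rho> \<eta>) \<Otimes>\<^sub>M Pi\<^sub>M p (\<lambda>C. jump_law h (card C) \<rho> (ys C))"

definition N_jumps_law ::
  "('s \<Rightarrow> real) \<Rightarrow> ('y \<Rightarrow> 's measure) \<Rightarrow> 'y measure \<Rightarrow> nat set set \<Rightarrow> (nat set \<Rightarrow> 'y) \<Rightarrow>
   (('s::topological_space \<times> 'y::topological_space) measure \<times> (nat set \<Rightarrow> 's)) measure" where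
  "N_jumps_law h \<rho> \<eta> p ys =
     distr (star_jumps_law h \<rho> \<eta> p ys) (measure_algebra borel \<Otimes>\<^sub>M Pi\<^sub>M p (\<lambda>_. borel))
       (\<lambda>(N, J). (add_measure N (weighted_diracs p (\<lambda>_. 1) (\<lambda>C. (J C, ys C))), J))"

definition mu_law ::
  "('s::topological_space \<Rightarrow> real) \<Rightarrow> ('y \<Rightarrow> 's measure) \<Rightarrow> 'y measure \<Rightarrow> nat set set \<Rightarrow> (nat set \<Rightarrow> 'y) \<Rightarrow>
   'y::topological_space measure measure" where
  "mu_law h \<rho> \<eta> p ys =
     distr (star_jumps_law h \<rho> \<eta> p ys) (measure_algebra borel)
       (\<lambda>(N, J). add_measure (mu_of h N)
          (weighted_diracs p (\<lambda>C. ennreal (h (J C))) ys))"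

text \<open>If \<open>\<mu>\<^sup>*\<close> vanishes then \<open>q = 0\<close>, and \<open>P_of h N\<close> is the zero measure.\<close>

definition post_P ::
  "('s \<Rightarrow> real) \<Rightarrow> nat set set \<Rightarrow> (nat set \<Rightarrow> 'y) \<Rightarrow>
   ('s::topological_space \<times> 'y::topological_space) measure \<Rightarrow> (nat set \<Rightarrow> 's) \<Rightarrow> 'y measure" where
  "post_P h p ys N J =
     (let H = (\<Sum>C\<in>p. ennreal (h (J C)));
          q = total_mass h N / (total_mass h N + H)
      in add_measure (scale_measure q (P_of h N))
           (scale_measure (1 - q)
             (scale_measure (inverse H) (weighted_diracs p (\<lambda>C. ennreal (h (J C))) ys))))"

definition P_law ::
  "('s \<Rightarrow> real) \<Rightarrow> ('y \<Rightarrow> 's::topological_space measure) \<Rightarrow> 'y measure \<Rightarrow> nat set set \<Rightarrow>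
   (nat set \<Rightarrow> 'y) \<Rightarrow> 'y::topological_space measure measure" where
  "P_law h \<rho> \<eta> p ys =
     distr (star_jumps_law h \<rho> \<eta> p ys) (measure_algebra borel) (\<lambda>(N, J). post_P h p ys N J)"

section \<open>Conditional distributions\<close>

text \<open>Given \<open>X\<close>, the variables \<open>Y i\<close>, \<open>i \<in> I\<close>, are i.i.d. with distribution \<open>K X\<close>.\<close>

definition cond_iid ::
  "'w measure \<Rightarrow> 'x measure \<Rightarrow> ('w \<Rightarrow> 'x) \<Rightarrow> 'i set \<Rightarrow> ('i \<Rightarrow> 'w \<Rightarrow> 'y) \<Rightarrow>
   ('x \<Rightarrow> 'y::topological_space measure) \<Rightarrow> bool" where
  "cond_iid M S X I Y K \<longleftrightarrow>
     X \<in> M \<rightarrow>\<^sub>M S \<and> (\<forall>i\<in>I. Y i \<in> M \<rightarrow>\<^sub>M borel) \<and>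
     (\<forall>A\<in>sets S. \<forall>B. (\<forall>i\<in>I. B i \<in> sets borel) \<longrightarrow>
        emeasure M {w \<in> space M. X w \<in> A \<and> (\<forall>i\<in>I. Y i w \<in> B i)} =
        (\<integral>\<^sup>+x\<in>A. (\<Prod>i\<in>I. emeasure (K x) (B i)) \<partial>distr M S X))"

text \<open>\<open>Q\<close> gives the conditional distribution of \<open>X\<close> given \<open>Y\<close>. Such a \<open>Q\<close> is determined only
  almost everywhere, so it has to agree almost everywhere with a regular conditional
  distribution \<open>K\<close>.\<close>

definition is_posterior ::
  "'w measure \<Rightarrow> 'x measure \<Rightarrow> ('w \<Rightarrow> 'x) \<Rightarrow> 'y measure \<Rightarrow> ('w \<Rightarrow> 'y) \<Rightarrow> ('y \<Rightarrow> 'x measure) \<Rightarrow> bool"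
  where
  "is_posterior M S X R Y Q \<longleftrightarrow>
     X \<in> M \<rightarrow>\<^sub>M S \<and> Y \<in> M \<rightarrow>\<^sub>M R \<and>
     (\<exists>K \<in> R \<rightarrow>\<^sub>M prob_algebra S.
        (\<forall>A\<in>sets S. \<forall>B\<in>sets R.
           emeasure M {w \<in> space M. X w \<in> A \<and> Y w \<in> B} =
           (\<integral>\<^sup>+y\<in>B. emeasure (K y) A \<partial>distr M R Y)) \<and>
        (AE y in distr M R Y. K y = Q y))"

end

theory Submission
  imports Defs
begin

text \<open>A Poisson law is determined by its Laplace functional, so tilting it by \<open>exp (- v T)\<close> gives, up to
  normalization, the Poisson law with intensity \<open>exp (- v h(s)) \<rho>(ds|y) \<eta>(dy)\<close>. Iterating the Mecke
  equation, which comes from differentiating the Laplace functional, expresses the expectation of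
  \<open>F(N) \<mu>(B\<^sub>1) \<dots> \<mu>(B\<^sub>n)\<close> as a sum over partitions of \<open>{1,\<dots>,n}\<close>, in which each block contributes one extra
  atom of \<open>N\<close>. Since \<open>T powr (- (\<theta> + n))\<close> is \<open>1 / \<Gamma>(\<theta> + n)\<close> times the integral of
  \<open>v powr (\<theta> + n - 1) exp (- v T)\<close> over \<open>v > 0\<close>, the joint law of \<open>N\<close> and a sample from \<open>P = \<mu> / T\<close> is a
  mixture over \<open>v\<close> of such sums. As \<open>\<eta>\<close> has no atoms, the values attached to different blocks are almost
  surely distinct, so the term of a partition is exactly the part of the joint law on the event
  that the ties of the sample form this partition; both the marginal and the posterior laws are
  read off from it.\<close>

text \<open>The obstacle throughout is missing finiteness. A realization of N may give infinite mass
  to sets, and \<rho>(ds|y) is only sigma-finite, so neither moments of counts nor joint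
  measurability in y come for free. Against the first, \<open>expn\<close> sends \<infinity> to 0:
  Laplace functionals become bounded and continuous on all extended values and still determine laws
  on the space of measures, so identities between laws of random measures are checked on them.
  Against the second, there is the weight \<open>g\<close> = 1 - exp (- h). Almost sure finiteness
  of T makes it integrable against \<rho>(ds|y) \<eta>(dy); being positive, it normalizes \<rho> to
  a probability kernel wherever its mass is positive and finite, and it dominates, up to constants,
  every h^m exp (- v h) with v > 0 and m \<ge> 1, whence the moments \<kappa> are finite. Objects
  receive default values on exceptional sets, so as to be measurable kernels everywhere, and are
  compared with the stated formulas only almost everywhere. The Mecke argument is carried out for
  fixed v > 0, where these moments are finite, and v is integrated out afterwards by Fubini.\<close>

definition expn :: "ennreal \<Rightarrow> real" where
  "expn x = (if x = \<infinity> then 0 else exp (- enn2real x))"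

lemma expn_0 [simp]: "expn 0 = 1" and expn_top [simp]: "expn \<top> = 0"
  by (auto simp: expn_def)

lemma expn_ennreal: "0 \<le> x \<Longrightarrow> expn (ennreal x) = exp (- x)"
  by (auto simp: expn_def)

lemma expn_nonneg [simp]: "0 \<le> expn x" and expn_le_1 [simp]: "expn x \<le> 1"
  by (auto simp: expn_def)

lemma expn_add: "expn (x + y) = expn x * expn y"
  by (cases x; cases y) (auto simp: expn_ennreal exp_add[symmetric] simp flip: ennreal_plus)

lemma expn_mono: "x \<le> y \<Longrightarrow> expn y \<le> expn x"
  by (cases x; cases y) (auto simp: expn_ennreal top_unique)

lemma expn_sum: "expn (\<Sum>i\<in>I. f i) = (\<Prod>i\<in>I. expn (f i))"
  by (induction I rule: infinite_finite_induct) (auto simp: expn_add)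

lemma borel_measurable_expn [measurable]: "expn \<in> borel_measurable borel"
  unfolding expn_def by measurable

text \<open>The value 0 at \<infinity> makes \<open>expn\<close> continuous on all extended values.
  This allows increasing approximations of an integrand to pass through a Laplace functional even
  when the limiting integral is infinite.\<close>

lemma tendsto_expn:
  assumes "(f \<longlongrightarrow> l) F"
  shows "((\<lambda>x. expn (f x)) \<longlongrightarrow> expn l) F"
proof (cases l)
  case (real r)
  have "eventually (\<lambda>x. f x < \<top>) F"
    using assms real by (intro order_tendstoD(2)) auto
  then have "eventually (\<lambda>x. exp (- enn2real (f x)) = expn (f x)) F"
    by eventually_elim (auto simp: expn_def)
  moreover have "((\<lambda>x. exp (- enn2real (f x))) \<longlongrightarrow> exp (- r)) F"
    using assms real by (intro tendsto_exp tendsto_minus tendsto_enn2real) auto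
  ultimately show ?thesis
    using real by (simp add: expn_ennreal) (rule Lim_transform_eventually)
next
  case top
  show ?thesis
    unfolding top expn_top
  proof (rule order_tendstoI)
    fix a :: real assume "a < 0"
    then show "eventually (\<lambda>x. a < expn (f x)) F"
      by (auto intro!: always_eventually less_le_trans[OF _ expn_nonneg])
  next
    fix a :: real assume a: "0 < a"
    have "eventually (\<lambda>x. ennreal (max 0 (- ln a)) < f x) F"
      using assms top by (intro order_tendstoD(1)) auto
    then show "eventually (\<lambda>x. expn (f x) < a) F"
    proof eventually_elim
      case (elim x)
      show ?case
      proof (cases "f x")
        case (real r)
        have "\<not> r \<le> max 0 (- ln a)"
          using elim real ennreal_leI[of r "max 0 (- ln a)"] by (metis not_le)
        then have "- r < ln a" by simp
        then have "exp (- r) < exp (ln a)" by (simp only: exp_less_cancel_iff)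
        then show ?thesis using real a by (simp add: expn_ennreal)
      qed (use a in auto)
    qed
  qed
qed

lemma expn_pos: "x < \<top> \<Longrightarrow> 0 < expn x"
  by (auto simp: expn_def)

text \<open>The polynomials \<open>1 - (1 - x ^ k) ^ (2 ^ k)\<close> approximate a jump at \<open>x = 1/2\<close>.
  Moving the jump point slightly with the degree makes the limit an exact indicator.\<close>

lemma indicator_approx:
  fixes b :: real and y :: ennreal
  assumes b: "0 < b"
  defines "x \<equiv> \<lambda>m. expn (ennreal ((1 + 1 / Suc m) * ln 2 / b) * y)"
  shows "(\<lambda>m. 1 - (1 - x m ^ (Suc m)\<^sup>2) ^ (2 ^ (Suc m)\<^sup>2)) \<longlonglongrightarrow> indicator {..<ennreal b} y"
proof -
  have x01: "0 \<le> x m" "x m \<le> 1" for m by (auto simp: x_def)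
  show ?thesis
  proof (cases "y < ennreal b")
    case True
    then obtain r where r: "0 \<le> r" "r < b" "y = ennreal r"
      by (cases y) (auto simp: ennreal_less_iff)
    have xm: "x m = exp (- ((1 + 1 / Suc m) * ln 2 / b * r))" for m
      using r b by (simp add: x_def ennreal_mult''[symmetric] expn_ennreal)
    \<comment> \<open>Halfway between r/b and 1: the perturbed exponent (1 + 1/Suc m) * (r/b)
      eventually stays below \<open>q\<close>, while 2 powr (1 - q) is still larger than 1, so its
      powers diverge.\<close>
    define q where "q = (1 + r / b) / 2"
    have q: "r / b < q" "q < 1" "0 \<le> r / b" using r b by (auto simp: q_def field_simps)
    have "(\<lambda>m. (1 + 1 / Suc m) * (r / b)) \<longlonglongrightarrow> (1 + 0) * (r / b)"
      by (intro tendsto_intros LIMSEQ_Suc[OF lim_1_over_n])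
    then have "eventually (\<lambda>m. (1 + 1 / Suc m) * (r / b) < q) sequentially"
      using q by (intro order_tendstoD(2)) auto
    then have ev: "eventually (\<lambda>m. (1 - x m ^ (Suc m)\<^sup>2) ^ (2 ^ (Suc m)\<^sup>2) \<le> exp (- ((2 powr (1 - q)) ^ Suc m))) sequentially"
    proof eventually_elim
      case (elim m)
      let ?k = "(Suc m)\<^sup>2"
      have "(1 + 1 / Suc m) * ln 2 / b * r \<le> q * ln 2"
        using mult_right_mono[OF less_imp_le[OF elim], of "ln 2"] by (simp add: mult_ac)
      then have "exp (- (q * ln 2)) \<le> x m" unfolding xm by simp
      then have "2 powr (1 - q) \<le> 2 * x m"
        by (simp add: powr_def exp_diff exp_minus field_simps)
      then have "(2 powr (1 - q)) ^ ?k \<le> (2 * x m) ^ ?k"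
        by (intro power_mono) auto
      moreover have "(2 powr (1 - q)) ^ Suc m \<le> (2 powr (1 - q)) ^ ?k"
        using q by (intro power_increasing) (auto simp: power2_eq_square intro: ge_one_powr_ge_zero)
      ultimately have le: "(2 powr (1 - q)) ^ Suc m \<le> (2 * x m) ^ ?k" by simp
      have "(1 - x m ^ ?k) ^ (2 ^ ?k) \<le> exp (- (x m ^ ?k)) ^ (2 ^ ?k)"
        using exp_ge_add_one_self[of "- (x m ^ ?k)"] x01
        by (intro power_mono) (auto simp: power_le_one)
      also have "\<dots> = exp (- ((2 * x m) ^ ?k))"
        by (simp add: exp_of_nat_mult[symmetric] power_mult_distrib)
      also have "\<dots> \<le> exp (- ((2 powr (1 - q)) ^ Suc m))" using le by simp
      finally show ?case .
    qed
    have "filterlim (\<lambda>m. (2 powr (1 - q)) ^ Suc m) at_top sequentially"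
      using q by (intro filterlim_compose[OF filterlim_at_infinity_imp_filterlim_at_top filterlim_Suc] filterlim_realpow_sequentially_gt1)
        (auto intro: gr_one_powr)
    then have "(\<lambda>m. exp (- ((2 powr (1 - q)) ^ Suc m))) \<longlonglongrightarrow> 0"
      by (intro filterlim_compose[OF exp_at_bot] filterlim_uminus_at_bot[THEN iffD2]) simp
    then have "(\<lambda>m. (1 - x m ^ (Suc m)\<^sup>2) ^ (2 ^ (Suc m)\<^sup>2)) \<longlonglongrightarrow> 0"
      by (rule tendsto_sandwich[OF _ ev tendsto_const, rotated])
         (auto intro!: always_eventually zero_le_power simp: x01 power_le_one)
    from tendsto_diff[OF tendsto_const this, of 1] show ?thesis using True by simp
  next
    case False
    \<comment> \<open>At y = b the factor 1 + 1/Suc m makes 2 * x m only as small as 2 powr (- 1/Suc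
      m). The exponent (Suc m)^2, rather than Suc m, turns this slight gap into the vanishing bound
      (1/2)^Suc m.\<close>
    have le: "1 - (1 - x m ^ (Suc m)\<^sup>2) ^ (2 ^ (Suc m)\<^sup>2) \<le> (1 / 2) ^ Suc m" for m
    proof -
      let ?k = "(Suc m)\<^sup>2"
      have "x m \<le> expn (ennreal ((1 + 1 / Suc m) * ln 2 / b) * ennreal b)"
        unfolding x_def using False by (intro expn_mono mult_left_mono) auto
      also have "\<dots> = exp (- ((1 + 1 / Suc m) * ln 2))"
        using b by (simp add: ennreal_mult''[symmetric] expn_ennreal)
      also have "\<dots> = exp (- (ln 2 / Suc m)) / 2"
        by (simp add: ring_distribs exp_diff exp_minus inverse_eq_divide)
      finally have "2 * x m \<le> exp (- (ln 2 / Suc m))" by simp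
      then have "(2 * x m) ^ ?k \<le> exp (- (ln 2 / Suc m)) ^ ?k"
        using x01 by (intro power_mono) auto
      also have "\<dots> = exp (- (ln 2 * Suc m))"
        by (subst exp_of_nat_mult[symmetric]) (simp add: power2_eq_square del: of_nat_Suc mult_Suc mult_Suc_right)
      also have "\<dots> = (1 / 2) ^ Suc m"
        by (simp add: exp_minus exp_of_nat2_mult power_divide inverse_eq_divide del: of_nat_Suc)
      finally have 2: "(2 * x m) ^ ?k \<le> (1 / 2) ^ Suc m" .
      have "1 + real (2 ^ ?k) * (- (x m ^ ?k)) \<le> (1 + - (x m ^ ?k)) ^ (2 ^ ?k)"
        using x01 by (intro Bernoulli_inequality) (auto simp: power_le_one)
      then have "1 - (1 - x m ^ ?k) ^ (2 ^ ?k) \<le> (2 * x m) ^ ?k"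
        by (simp add: power_mult_distrib)
      with 2 show ?thesis by simp
    qed
    have "(\<lambda>m. (1 / 2 :: real) ^ Suc m) \<longlonglongrightarrow> 0"
      by (intro LIMSEQ_Suc LIMSEQ_power_zero) auto
    then have "(\<lambda>m. 1 - (1 - x m ^ (Suc m)\<^sup>2) ^ (2 ^ (Suc m)\<^sup>2)) \<longlonglongrightarrow> 0"
      by (rule tendsto_sandwich[OF _ _ tendsto_const, rotated 2])
         (use le in \<open>auto intro!: always_eventually simp: x01 power_le_one\<close>)
    then show ?thesis using False by simp
  qed
qed

text \<open>A multiplicative system theorem: the exponential functionals form a multiplicative class,
  so every linear property stable under bounded pointwise limits extends from them to the
  generated sigma-algebra.\<close>

lemma exponential_system:
  fixes X :: "'i \<Rightarrow> 'a \<Rightarrow> ennreal" and P :: "('a \<Rightarrow> real) \<Rightarrow> bool"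
  assumes lin: "\<And>f g a b. P f \<Longrightarrow> P g \<Longrightarrow> P (\<lambda>\<omega>. a * f \<omega> + b * g \<omega>)"
    and lim: "\<And>(F :: nat \<Rightarrow> 'a \<Rightarrow> real) f. (\<And>m. P (F m)) \<Longrightarrow>
        (\<And>m \<omega>. \<omega> \<in> \<Omega> \<Longrightarrow> 0 \<le> F m \<omega> \<and> F m \<omega> \<le> 1) \<Longrightarrow>
        (\<And>\<omega>. \<omega> \<in> \<Omega> \<Longrightarrow> (\<lambda>m. F m \<omega>) \<longlonglongrightarrow> f \<omega>) \<Longrightarrow> P f"
    and base: "\<And>J t. finite J \<Longrightarrow> J \<subseteq> I \<Longrightarrow> (\<And>i. 0 \<le> t i) \<Longrightarrow>
        P (\<lambda>\<omega>. expn (\<Sum>i\<in>J. ennreal (t i) * X i \<omega>))"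
    and A: "A \<in> sigma_sets \<Omega> {X i -` {..<ennreal b} \<inter> \<Omega> | i b. i \<in> I \<and> 0 < b}"
  shows "P (indicator A)"
proof -
  \<comment> \<open>Induction on the number of indicator factors. Each is a limit of polynomials in
    an exponential of the same \<open>X i\<close>, and the exponential factor with \<open>J\<close>
    and \<open>t\<close> is kept general in order to absorb their monomials.\<close>
  have step: "P (\<lambda>\<omega>. (\<Prod>(i, b)\<in>K. indicator {..<ennreal b} (X i \<omega>)) * expn (\<Sum>i\<in>J. ennreal (t i) * X i \<omega>))"
    if "finite K" "K \<subseteq> I \<times> {0<..}" "finite J" "J \<subseteq> I" "\<And>i. 0 \<le> t i" for K J t
    using that
  proof (induction K arbitrary: J t rule: finite_induct)
    case empty
    then show ?case using base by simp
  next
    case (insert k K)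
    obtain i b where k: "k = (i, b)" by force
    then have ib: "i \<in> I" "0 < b" using insert.prems by auto
    let ?G = "\<lambda>\<omega>. \<Prod>(i, b)\<in>K. indicator {..<ennreal b} (X i \<omega>) :: real"
    let ?E = "\<lambda>J t \<omega>. expn (\<Sum>i\<in>J. ennreal (t i) * X i \<omega>)"
    have pol: "P (\<lambda>\<omega>. ?G \<omega> * (poly q (expn (ennreal s * X i \<omega>)) * ?E J t \<omega>))"
      if "0 \<le> s" "finite J" "J \<subseteq> I" "\<And>i. 0 \<le> t i" for q s J t
      using that(2-)
    proof (induction q arbitrary: J t)
      case 0
      have "P (\<lambda>\<omega>. 0 * (?G \<omega> * ?E J t \<omega>) + 0 * (?G \<omega> * ?E J t \<omega>))"
        using 0 insert.prems(1) by (intro lin insert.IH) auto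
      then show ?case by simp
    next
      case (pCons a q)
      \<comment> \<open>As in Horner's scheme, one more exponential of \<open>X i\<close> only
        raises the coefficient of \<open>X i\<close> in the exponent by s. The old coefficient is
        cut off outside \<open>J\<close>, because \<open>t\<close> is arbitrary there and i need not
        lie in \<open>J\<close>.\<close>
      define t' where "t' j = (if j \<in> J then t j else 0) + (if j = i then s else 0)" for j
      have E': "?E (insert i J) t' \<omega> = expn (ennreal s * X i \<omega>) * ?E J t \<omega>" for \<omega>
      proof -
        have "(\<Sum>j\<in>insert i J. ennreal (t' j) * X j \<omega>) =
          (\<Sum>j\<in>insert i J. (if j = i then ennreal s * X i \<omega> else 0) + (if j \<in> J then ennreal (t j) * X j \<omega> else 0))"
          using pCons.prems that(1) by (intro sum.cong) (auto simp: t'_def ring_distribs add.commute)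
        also have "\<dots> = ennreal s * X i \<omega> + (\<Sum>j\<in>J. ennreal (t j) * X j \<omega>)"
          using pCons.prems by (subst sum.distrib) (auto simp: sum.inter_restrict[symmetric] sum.If_cases insert_absorb Int_absorb1 Int_insert_left intro!: sum.cong)
        finally show ?thesis by (simp add: expn_add)
      qed
      have "P (\<lambda>\<omega>. ?G \<omega> * ?E J t \<omega>)"
        using pCons.prems insert.prems by (intro insert.IH) auto
      moreover have "P (\<lambda>\<omega>. ?G \<omega> * (poly q (expn (ennreal s * X i \<omega>)) * ?E (insert i J) t' \<omega>))"
        using pCons.prems ib that(1) by (intro pCons.IH) (auto simp: t'_def)
      ultimately have "P (\<lambda>\<omega>. a * (?G \<omega> * ?E J t \<omega>) + 1 * (?G \<omega> * (poly q (expn (ennreal s * X i \<omega>)) * ?E (insert i J) t' \<omega>)))"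
        by (rule lin)
      moreover have "(\<lambda>\<omega>. a * (?G \<omega> * ?E J t \<omega>) + 1 * (?G \<omega> * (poly q (expn (ennreal s * X i \<omega>)) * ?E (insert i J) t' \<omega>)))
        = (\<lambda>\<omega>. ?G \<omega> * (poly (pCons a q) (expn (ennreal s * X i \<omega>)) * ?E J t \<omega>))"
        by (rule ext) (simp add: E' algebra_simps)
      ultimately show ?case by simp
    qed
    define q :: "nat \<Rightarrow> real poly" where
      "q m = 1 - (1 - monom 1 ((Suc m)\<^sup>2)) ^ (2 ^ (Suc m)\<^sup>2)" for m
    have pq: "poly (q m) x = 1 - (1 - x ^ (Suc m)\<^sup>2) ^ (2 ^ (Suc m)\<^sup>2)" for m x
      by (simp add: q_def poly_monom)
    have G01: "0 \<le> ?G \<omega>" "?G \<omega> \<le> 1" for \<omega>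
      by (auto intro!: prod_nonneg prod_le_1 simp: split_beta)
    have "P (\<lambda>\<omega>. ?G \<omega> * (indicator {..<ennreal b} (X i \<omega>) * ?E J t \<omega>))"
    proof (rule lim)
      show "P (\<lambda>\<omega>. ?G \<omega> * (poly (q m) (expn (ennreal ((1 + 1 / Suc m) * ln 2 / b) * X i \<omega>)) * ?E J t \<omega>))" for m
        using ib insert.prems by (intro pol) auto
      show "(\<lambda>m. ?G \<omega> * (poly (q m) (expn (ennreal ((1 + 1 / Suc m) * ln 2 / b) * X i \<omega>)) * ?E J t \<omega>))
        \<longlonglongrightarrow> ?G \<omega> * (indicator {..<ennreal b} (X i \<omega>) * ?E J t \<omega>)" for \<omega>
        unfolding pq by (intro tendsto_mult tendsto_const indicator_approx ib)
      have "0 \<le> poly (q m) x \<and> poly (q m) x \<le> 1" if "0 \<le> x" "x \<le> 1" for m x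
        unfolding pq using that by (auto simp: power_le_one)
      then show "0 \<le> ?G \<omega> * (poly (q m) (expn (ennreal ((1 + 1 / Suc m) * ln 2 / b) * X i \<omega>)) * ?E J t \<omega>) \<and>
         ?G \<omega> * (poly (q m) (expn (ennreal ((1 + 1 / Suc m) * ln 2 / b) * X i \<omega>)) * ?E J t \<omega>) \<le> 1" for m \<omega>
        using G01 by (intro conjI mult_nonneg_nonneg mult_le_one) auto
    qed
    then show ?case
      using insert.hyps by (simp add: k mult_ac)
  qed
  \<comment> \<open>Finite sets \<open>K\<close> of constraints, so that intersections correspond to
    unions of the index sets.\<close>
  define G where "G = {{\<omega>\<in>\<Omega>. \<forall>(i, b)\<in>K. X i \<omega> < ennreal b} | K. finite K \<and> K \<subseteq> I \<times> {0::real<..}}"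
  have PG: "P (indicator B)" if B: "B \<in> G" for B
  proof -
    obtain K where K: "finite K" "K \<subseteq> I \<times> {0<..}" "B = {\<omega>\<in>\<Omega>. \<forall>(i, b)\<in>K. X i \<omega> < ennreal b}"
      using B by (auto simp: G_def)
    have "P (\<lambda>\<omega>. \<Prod>(i, b)\<in>K. indicator {..<ennreal b} (X i \<omega>))"
      using step[of K "{}" "\<lambda>_. 0"] K by simp
    have "(\<Prod>(i, b)\<in>K. indicator {..<ennreal b} (X i \<omega>)) = (indicator B \<omega> :: real)" if "\<omega> \<in> \<Omega>" for \<omega>
    proof (cases "\<omega> \<in> B")
      case True
      then show ?thesis using K by (auto intro!: prod.neutral)
    next
      case False
      then obtain i b where ib: "(i, b) \<in> K" "\<not> X i \<omega> < ennreal b" using K \<open>\<omega> \<in> \<Omega>\<close> by blast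
      then show ?thesis using False K(1) by (auto intro!: prod_zero bexI[of _ "(i, b)"])
    qed
    \<comment> \<open>The limit rule for a constant sequence serves to replace a function by another
      one that agrees with it on \<Omega>.\<close>
    then show ?thesis
      using \<open>P (\<lambda>\<omega>. \<Prod>(i, b)\<in>K. indicator {..<ennreal b} (X i \<omega>))\<close>
      by - (rule lim[of "\<lambda>_ \<omega>. \<Prod>(i, b)\<in>K. indicator {..<ennreal b} (X i \<omega>)"], simp_all add: indicator_def)
  qed
  have stab: "Int_stable G"
  proof (rule Int_stableI)
    fix a b assume "a \<in> G" "b \<in> G"
    then obtain K L where "finite K" "K \<subseteq> I \<times> {0<..}" "a = {\<omega>\<in>\<Omega>. \<forall>(i, b)\<in>K. X i \<omega> < ennreal b}"
      "finite L" "L \<subseteq> I \<times> {0<..}" "b = {\<omega>\<in>\<Omega>. \<forall>(i, b)\<in>L. X i \<omega> < ennreal b}"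
      unfolding G_def by blast
    then show "a \<inter> b \<in> G"
      unfolding G_def by (intro CollectI exI[of _ "K \<union> L"]) auto
  qed
  have sub: "sigma_sets \<Omega> {X i -` {..<ennreal b} \<inter> \<Omega> | i b. i \<in> I \<and> 0 < b} \<subseteq> sigma_sets \<Omega> G"
  proof (rule sigma_sets_mono, safe)
    fix i :: 'i and b :: real assume "i \<in> I" "0 < b"
    then show "X i -` {..<ennreal b} \<inter> \<Omega> \<in> sigma_sets \<Omega> G"
      unfolding G_def by (intro sigma_sets.Basic CollectI exI[of _ "{(i, b)}"]) auto
  qed
  have P1: "P (\<lambda>\<omega>. 1)" using base[of "{}" "\<lambda>_. 0"] by simp
  have AG: "A \<in> sigma_sets \<Omega> G" using A sub by auto
  have GP: "G \<subseteq> Pow \<Omega>" by (auto simp: G_def)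
  from stab GP AG show ?thesis
  proof (induction rule: sigma_sets_induct_disjoint)
    case (basic B)
    then show ?case by (rule PG)
  next
    case empty
    show ?case using lin[OF P1 P1, of 0 0] by simp
  next
    case (compl B)
    have "P (\<lambda>\<omega>. 1 * 1 + (-1) * indicator B \<omega>)" by (rule lin[OF P1 compl(2)])
    then show ?case
      by (rule lim[of "\<lambda>_ \<omega>. 1 * 1 + (-1) * indicator B \<omega>"]) (auto simp: indicator_def)
  next
    case (union B)
    have "P (\<lambda>\<omega>. \<Sum>i<m. indicator (B i) \<omega>)" for m
    proof (induction m)
      case 0
      show ?case using lin[OF P1 P1, of 0 0] by simp
    next
      case (Suc m)
      show ?case using lin[OF Suc union(3)[of m], of 1 1] by simp
    qed
    moreover have "(\<Sum>i<m. indicator (B i) \<omega>) = (indicator (\<Union>i<m. B i) \<omega> :: real)" for m \<omega>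
      by (rule indicator_UN_disjoint[symmetric])
         (use union(1) in \<open>auto simp: disjoint_family_on_def\<close>)
    ultimately show ?case
      by - (rule lim[of "\<lambda>m \<omega>. \<Sum>i<m. indicator (B i) \<omega>"], simp_all add: LIMSEQ_indicator_UN)
  qed
qed

section \<open>Exponential functionals determine measures and kernels\<close>

lemma sigma_sets_ennreal_vimage:
  fixes X :: "'i \<Rightarrow> 'a \<Rightarrow> ennreal"
  shows "sigma_sets \<Omega> {X i -` B \<inter> \<Omega> | i B. i \<in> I \<and> B \<in> sets borel} =
         sigma_sets \<Omega> {X i -` {..<ennreal b} \<inter> \<Omega> | i b. i \<in> I \<and> 0 < b}" (is "_ = sigma_sets \<Omega> ?G")
proof (rule sigma_sets_eqI)
  fix A assume "A \<in> {X i -` B \<inter> \<Omega> | i B. i \<in> I \<and> B \<in> sets borel}"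
  then obtain i B where A: "A = X i -` B \<inter> \<Omega>" and i: "i \<in> I" and B: "B \<in> sets borel" by blast
  have G: "?G \<subseteq> Pow \<Omega>" by auto
  have "X i \<in> borel_measurable (sigma \<Omega> ?G)"
  proof (rule borel_measurableI_less)
    fix y :: ennreal
    \<comment> \<open>Levels r \<le> 0 give the empty set, so the generators with 0 < b already
      cover every finite level; the level \<infinity> below is the union of the integer
      ones.\<close>
    have fin: "{x \<in> space (sigma \<Omega> ?G). X i x < ennreal r} \<in> sets (sigma \<Omega> ?G)" for r
    proof (cases "0 < r")
      case True
      have "{x \<in> space (sigma \<Omega> ?G). X i x < ennreal r} = X i -` {..<ennreal r} \<inter> \<Omega>"
        by (auto simp: space_measure_of_conv)
      also have "\<dots> \<in> sets (sigma \<Omega> ?G)" using i True by (auto intro!: sigma_sets.Basic)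
      finally show ?thesis .
    qed (simp add: ennreal_neg)
    show "{x \<in> space (sigma \<Omega> ?G). X i x < y} \<in> sets (sigma \<Omega> ?G)"
    proof (cases y)
      case (real r)
      then show ?thesis using fin by simp
    next
      case top
      have "{x \<in> space (sigma \<Omega> ?G). X i x < y} = (\<Union>n::nat. {x \<in> space (sigma \<Omega> ?G). X i x < ennreal (real n)})"
        using ennreal_Ex_less_of_nat
        by (auto simp: top ennreal_of_nat_eq_real_of_nat elim!: less_trans[OF _ ennreal_less_top])
      also have "\<dots> \<in> sets (sigma \<Omega> ?G)" using fin by auto
      finally show ?thesis .
    qed
  qed
  from measurable_sets[OF this B] show "A \<in> sigma_sets \<Omega> ?G"
    unfolding A space_measure_of[OF G] sets_measure_of[OF G] .
next
  fix A assume "A \<in> ?G"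
  then obtain i b where "A = X i -` {..<ennreal b} \<inter> \<Omega>" "i \<in> I" by blast
  then show "A \<in> sigma_sets \<Omega> {X i -` B \<inter> \<Omega> | i B. i \<in> I \<and> B \<in> sets borel}"
    by (intro sigma_sets.Basic CollectI exI[of _ i] exI[of _ "{..<ennreal b}"]) auto
qed

lemma space_eq_of_sigma_sets: "sets M = sigma_sets \<Omega> G \<Longrightarrow> G \<subseteq> Pow \<Omega> \<Longrightarrow> space M = \<Omega>"
  by (metis sets_measure_of space_measure_of sets_eq_imp_space_eq)

text \<open>The property passed to the system theorem is that both integrals exist and agree;
  dominated convergence makes it stable. The empty \<open>J\<close> gives equality of the total
  masses, so finiteness of \<open>M2\<close> follows from that of \<open>M1\<close>.\<close>

lemma exponential_measure_eqI:
  fixes X :: "'i \<Rightarrow> 'a \<Rightarrow> ennreal"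
  assumes fin: "finite_measure M1" and sets: "sets M1 = sigma_sets \<Omega> {X i -` B \<inter> \<Omega> | i B. i \<in> I \<and> B \<in> sets borel}"
    "sets M2 = sets M1"
    and eq: "\<And>J t. finite J \<Longrightarrow> J \<subseteq> I \<Longrightarrow> (\<And>i. 0 \<le> t i) \<Longrightarrow>
       (\<integral>\<^sup>+\<omega>. expn (\<Sum>i\<in>J. ennreal (t i) * X i \<omega>) \<partial>M1) = (\<integral>\<^sup>+\<omega>. expn (\<Sum>i\<in>J. ennreal (t i) * X i \<omega>) \<partial>M2)"
  shows "M1 = M2"
proof (rule measure_eqI)
  interpret M1: finite_measure M1 by fact
  have sp: "space M1 = \<Omega>" "space M2 = \<Omega>"
    using space_eq_of_sigma_sets[OF sets(1)] sets_eq_imp_space_eq[OF sets(2)] by auto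
  have "emeasure M1 (space M1) = emeasure M2 (space M2)"
    using eq[of "{}" "\<lambda>_. 0"] by simp
  then interpret M2: finite_measure M2 by (intro finite_measureI) (metis M1.emeasure_finite infinity_ennreal_def)
  have X[measurable]: "X i \<in> borel_measurable M1" "X i \<in> borel_measurable M2" if "i \<in> I" for i
    using that by (auto simp: measurable_def sp sets intro!: sigma_sets.Basic)
  have B: "integrable M1 f" "integrable M2 f"
    if "f \<in> borel_measurable M1" "\<And>\<omega>. 0 \<le> f \<omega>" "\<And>\<omega>. f \<omega> \<le> 1" for f :: "'a \<Rightarrow> real"
  proof -
    have "f \<in> borel_measurable M2" using that(1) measurable_cong_sets[OF sets(2) refl] by blast
    then show "integrable M2 f" by (intro M2.integrable_const_bound[of _ 1]) (auto simp: that)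
    show "integrable M1 f" using that by (intro M1.integrable_const_bound[of _ 1]) (auto simp: that)
  qed
  fix A assume A: "A \<in> sets M1"
  let ?P = "\<lambda>f :: 'a \<Rightarrow> real. integrable M1 f \<and> integrable M2 f \<and> integral\<^sup>L M1 f = integral\<^sup>L M2 f"
  have "?P (indicator A)"
  proof (rule exponential_system[where I = I and X = X and \<Omega> = \<Omega>])
    fix f g :: "'a \<Rightarrow> real" and a b :: real
    assume "?P f" "?P g"
    then show "?P (\<lambda>\<omega>. a * f \<omega> + b * g \<omega>)" by simp
  next
    fix F :: "nat \<Rightarrow> 'a \<Rightarrow> real" and f
    assume P: "\<And>m. ?P (F m)" and F: "\<And>m \<omega>. \<omega> \<in> \<Omega> \<Longrightarrow> 0 \<le> F m \<omega> \<and> F m \<omega> \<le> 1"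
      and l: "\<And>\<omega>. \<omega> \<in> \<Omega> \<Longrightarrow> (\<lambda>m. F m \<omega>) \<longlonglongrightarrow> f \<omega>"
    have fm: "f \<in> borel_measurable M1" "f \<in> borel_measurable M2"
      by (rule borel_measurable_LIMSEQ_real[of _ F]; use P l sp in auto)+
    have *: "AE x in M1. (\<lambda>i. F i x) \<longlonglongrightarrow> f x" "AE x in M2. (\<lambda>i. F i x) \<longlonglongrightarrow> f x"
      "AE x in M1. norm (F m x) \<le> 1" "AE x in M2. norm (F m x) \<le> 1" for m
      using F l sp by (auto intro!: AE_I2)
    have c: "integrable M1 (\<lambda>_. 1::real)" "integrable M2 (\<lambda>_. 1::real)" by auto
    have Fm: "F m \<in> borel_measurable M1" "F m \<in> borel_measurable M2" for m using P by auto
    have "(\<lambda>m. integral\<^sup>L M1 (F m)) \<longlonglongrightarrow> integral\<^sup>L M1 f"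
      by (rule integral_dominated_convergence[OF fm(1) Fm(1) c(1) *(1) *(3)])
    moreover have "(\<lambda>m. integral\<^sup>L M2 (F m)) \<longlonglongrightarrow> integral\<^sup>L M2 f"
      by (rule integral_dominated_convergence[OF fm(2) Fm(2) c(2) *(2) *(4)])
    ultimately have "integral\<^sup>L M1 f = integral\<^sup>L M2 f"
      using P LIMSEQ_unique by auto
    then show "?P f"
      using integrable_dominated_convergence[OF fm(1) Fm(1) c(1) *(1) *(3)]
        integrable_dominated_convergence[OF fm(2) Fm(2) c(2) *(2) *(4)] by simp
  next
    fix J :: "'i set" and t :: "'i \<Rightarrow> real" assume J: "finite J" "J \<subseteq> I" "\<And>i. 0 \<le> t i"
    let ?E = "\<lambda>\<omega>. expn (\<Sum>i\<in>J. ennreal (t i) * X i \<omega>)"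
    have [measurable]: "X i \<in> borel_measurable M1" if "i \<in> J" for i using that J X by auto
    have i: "integrable M1 ?E" "integrable M2 ?E"
      by (intro B; simp)+
    have "ennreal (integral\<^sup>L M1 ?E) = ennreal (integral\<^sup>L M2 ?E)"
      using nn_integral_eq_integral[OF i(1)] nn_integral_eq_integral[OF i(2)] eq[OF J] by simp
    then show "?P ?E" using i by (simp add: ennreal_inj[OF integral_nonneg integral_nonneg])
  next
    show "A \<in> sigma_sets \<Omega> {X i -` {..<ennreal b} \<inter> \<Omega> |i b. i \<in> I \<and> 0 < b}"
      using A by (simp add: sets sigma_sets_ennreal_vimage)
  qed
  then have "measure M1 A = measure M2 A" using A sets by simp
  then show "emeasure M1 A = emeasure M2 A"
    by (simp add: M1.emeasure_eq_measure M2.emeasure_eq_measure)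
qed (simp add: sets)

text \<open>The system theorem again, now for the property that the integral against
  \<open>K x\<close> is measurable in x; dominated convergence under each \<open>K x\<close> gives
  stability.\<close>

lemma exponential_kernel:
  fixes X :: "'i \<Rightarrow> 'a \<Rightarrow> ennreal"
  assumes sets: "sets M = sigma_sets \<Omega> {X i -` B \<inter> \<Omega> | i B. i \<in> I \<and> B \<in> sets borel}"
    and K: "\<And>x. x \<in> space N \<Longrightarrow> prob_space (K x)" "\<And>x. x \<in> space N \<Longrightarrow> sets (K x) = sets M"
    and meas: "\<And>J t. finite J \<Longrightarrow> J \<subseteq> I \<Longrightarrow> (\<And>i. 0 \<le> t i) \<Longrightarrow>
       (\<lambda>x. \<integral>\<^sup>+\<omega>. expn (\<Sum>i\<in>J. ennreal (t i) * X i \<omega>) \<partial>K x) \<in> borel_measurable N"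
  shows "K \<in> N \<rightarrow>\<^sub>M prob_algebra M"
proof (rule measurable_prob_algebraI[OF K(1)])
  have sp: "space M = \<Omega>"
    by (rule space_eq_of_sigma_sets[OF sets]) auto
  have spK: "space (K x) = \<Omega>" if "x \<in> space N" for x
    using K(2)[OF that] sp sets_eq_imp_space_eq by auto
  have X: "X i \<in> borel_measurable M" if "i \<in> I" for i
    using that by (auto simp: measurable_def sp sets intro!: sigma_sets.Basic)
  show "K \<in> N \<rightarrow>\<^sub>M subprob_algebra M"
  proof (rule measurable_subprob_algebra)
    fix A assume A: "A \<in> sets M"
    let ?P = "\<lambda>f :: 'a \<Rightarrow> real. (\<forall>x\<in>space N. integrable (K x) f) \<and> (\<lambda>x. integral\<^sup>L (K x) f) \<in> borel_measurable N"
    have "?P (indicator A)"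
    proof (rule exponential_system[where I = I and X = X and \<Omega> = \<Omega>])
      fix f g :: "'a \<Rightarrow> real" and a b :: real
      assume *: "?P f" "?P g"
      then have "(\<lambda>x. a * integral\<^sup>L (K x) f + b * integral\<^sup>L (K x) g) \<in> borel_measurable N"
        by (intro borel_measurable_add borel_measurable_times borel_measurable_const) auto
      then have "(\<lambda>x. integral\<^sup>L (K x) (\<lambda>\<omega>. a * f \<omega> + b * g \<omega>)) \<in> borel_measurable N"
        using * by (subst measurable_cong[where g="\<lambda>x. a * integral\<^sup>L (K x) f + b * integral\<^sup>L (K x) g"]) auto
      then show "?P (\<lambda>\<omega>. a * f \<omega> + b * g \<omega>)" using * by simp
    next
      fix F :: "nat \<Rightarrow> 'a \<Rightarrow> real" and f
      assume P: "\<And>m. ?P (F m)" and F: "\<And>m \<omega>. \<omega> \<in> \<Omega> \<Longrightarrow> 0 \<le> F m \<omega> \<and> F m \<omega> \<le> 1"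
        and l: "\<And>\<omega>. \<omega> \<in> \<Omega> \<Longrightarrow> (\<lambda>m. F m \<omega>) \<longlonglongrightarrow> f \<omega>"
      have *: "integrable (K x) f \<and> (\<lambda>m. integral\<^sup>L (K x) (F m)) \<longlonglongrightarrow> integral\<^sup>L (K x) f" if x: "x \<in> space N" for x
      proof -
        interpret K: prob_space "K x" using K x by auto
        have Fm: "F m \<in> borel_measurable (K x)" for m using P x by auto
        have fm: "f \<in> borel_measurable (K x)"
          by (rule borel_measurable_LIMSEQ_real[of _ F]; use P l spK[OF x] x in auto)+
        have 1: "AE \<omega> in K x. (\<lambda>i. F i \<omega>) \<longlonglongrightarrow> f \<omega>" and 2: "AE \<omega> in K x. norm (F m \<omega>) \<le> 1" for m
          using F l spK[OF x] by (auto intro!: AE_I2)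
        have c: "integrable (K x) (\<lambda>_. 1::real)" by simp
        show ?thesis
          using integral_dominated_convergence[OF fm Fm c 1 2] integrable_dominated_convergence[OF fm Fm c 1 2] by simp
      qed
      then show "?P f"
        using P by (auto intro: borel_measurable_LIMSEQ_real[of _ "\<lambda>m x. integral\<^sup>L (K x) (F m)"])
    next
      fix J :: "'i set" and t :: "'i \<Rightarrow> real" assume J: "finite J" "J \<subseteq> I" "\<And>i. 0 \<le> t i"
      let ?E = "\<lambda>\<omega>. expn (\<Sum>i\<in>J. ennreal (t i) * X i \<omega>)"
      have [measurable]: "X i \<in> borel_measurable M" if "i \<in> J" for i using that J X by auto
      have "?E \<in> borel_measurable M" by measurable
      then have E: "?E \<in> borel_measurable (K x)" if "x \<in> space N" for x
        using measurable_cong_sets[OF K(2)[OF that] refl] by blast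
      have i: "integrable (K x) ?E" if "x \<in> space N" for x
        using prob_space.finite_measure[OF K(1)[OF that]] E[OF that]
        by (intro finite_measure.integrable_const_bound[of _ _ 1]) auto
      have "(\<lambda>x. enn2real (\<integral>\<^sup>+\<omega>. ?E \<omega> \<partial>K x)) \<in> borel_measurable N"
        using meas[OF J] by measurable
      moreover have "enn2real (\<integral>\<^sup>+\<omega>. ?E \<omega> \<partial>K x) = integral\<^sup>L (K x) ?E" if "x \<in> space N" for x
        using i[OF that] by (simp add: nn_integral_eq_integral enn2real_ennreal integral_nonneg)
      ultimately show "?P ?E" using i by (simp cong: measurable_cong)
    next
      show "A \<in> sigma_sets \<Omega> {X i -` {..<ennreal b} \<inter> \<Omega> |i b. i \<in> I \<and> 0 < b}"
        using A by (simp add: sets sigma_sets_ennreal_vimage)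
    qed
    then have "(\<lambda>x. ennreal (integral\<^sup>L (K x) (indicator A))) \<in> borel_measurable N" by simp
    moreover have "ennreal (integral\<^sup>L (K x) (indicator A)) = emeasure (K x) A" if "x \<in> space N" for x
    proof -
      interpret K: prob_space "K x" using K that by auto
      show ?thesis using A K(2)[OF that] by (simp add: K.emeasure_eq_measure)
    qed
    ultimately show "(\<lambda>x. emeasure (K x) A) \<in> borel_measurable N" by (rule measurable_cong[THEN iffD1, rotated])
  qed (use K in \<open>auto simp: prob_space_imp_subprob_space\<close>)
qed

section \<open>The space of measures\<close>

lemma space_measure_algebra: "space (measure_algebra K) = {M. sets M = sets K}"
  by (auto simp: measure_algebra_def space_Sup_eq_UN)

lemma measure_algebra_cong: "sets M = sets N \<Longrightarrow> measure_algebra M = measure_algebra N"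
  by (simp add: measure_algebra_def)

lemma measurable_emeasure_measure_algebra [measurable]:
  "A \<in> sets K \<Longrightarrow> (\<lambda>M. emeasure M A) \<in> borel_measurable (measure_algebra K)"
  by (auto intro!: measurable_Sup1 measurable_vimage_algebra1 simp: measure_algebra_def)

lemma measurable_measure_algebra:
  "(\<And>a. a \<in> space M \<Longrightarrow> sets (f a) = sets K) \<Longrightarrow>
   (\<And>A. A \<in> sets K \<Longrightarrow> (\<lambda>a. emeasure (f a) A) \<in> borel_measurable M) \<Longrightarrow> f \<in> M \<rightarrow>\<^sub>M measure_algebra K"
  by (auto intro!: measurable_Sup2 measurable_vimage_algebra2 simp: measure_algebra_def)

text \<open>Puts the evaluation sigma-algebra into the shape required by the exponential criteria,
  with the evaluations at the sets \<open>A\<close> in the role of the functions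
  \<open>X A\<close>.\<close>

lemma sets_measure_algebra:
  "sets (measure_algebra K) = sigma_sets {M. sets M = sets K}
     {(\<lambda>M. emeasure M A) -` B \<inter> {M. sets M = sets K} | A B. A \<in> sets K \<and> B \<in> sets borel}"
proof -
  let ?\<Omega> = "{M. sets M = sets K}"
  have "sets (measure_algebra K) = sigma_sets ?\<Omega> (\<Union>A\<in>sets K. sets (vimage_algebra ?\<Omega> (\<lambda>M. emeasure M A) borel))"
    unfolding measure_algebra_def by (subst sets_Sup_eq[where X="?\<Omega>"]) auto
  also have "(\<Union>A\<in>sets K. sets (vimage_algebra ?\<Omega> (\<lambda>M. emeasure M A) borel)) =
    {(\<lambda>M. emeasure M A) -` B \<inter> ?\<Omega> | A B. A \<in> sets K \<and> B \<in> sets borel}"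
    by (auto simp: sets_vimage_algebra2)
  finally show ?thesis .
qed

lemma nn_integral_measurable_measure_algebra [measurable]:
  assumes f: "f \<in> borel_measurable K"
  shows "(\<lambda>M. \<integral>\<^sup>+x. f x \<partial>M) \<in> borel_measurable (measure_algebra K)"
  using f
proof (induction rule: borel_measurable_induct)
  case (cong f g)
  have "(\<integral>\<^sup>+x. f x \<partial>M) = (\<integral>\<^sup>+x. g x \<partial>M)" if "M \<in> space (measure_algebra K)" for M
    using cong(3) that by (intro nn_integral_cong) (auto simp: space_measure_algebra dest: sets_eq_imp_space_eq)
  with cong show ?case by (simp cong: measurable_cong)
next
  case (set A)
  have "(\<integral>\<^sup>+x. indicator A x \<partial>M) = emeasure M A" if "M \<in> space (measure_algebra K)" for M
    using set that by (simp add: space_measure_algebra)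
  with set show ?case by (simp cong: measurable_cong)
next
  case (mult u c)
  have "(\<integral>\<^sup>+x. c * u x \<partial>M) = c * (\<integral>\<^sup>+x. u x \<partial>M)" if "M \<in> space (measure_algebra K)" for M
    using mult(2) that by (intro nn_integral_cmult) (simp add: space_measure_algebra cong: measurable_cong_sets)
  with mult show ?case by (simp cong: measurable_cong)
next
  case (add u v)
  have "(\<integral>\<^sup>+x. v x + u x \<partial>M) = (\<integral>\<^sup>+x. v x \<partial>M) + (\<integral>\<^sup>+x. u x \<partial>M)" if "M \<in> space (measure_algebra K)" for M
    using add(1-4) that by (intro nn_integral_add) (simp_all add: space_measure_algebra cong: measurable_cong_sets)
  with add show ?case by (simp cong: measurable_cong)
next
  case (seq U)
  have "(\<integral>\<^sup>+x. (SUP i. U i) x \<partial>M) = (SUP i. \<integral>\<^sup>+x. U i x \<partial>M)" if "M \<in> space (measure_algebra K)" for M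
    using seq that unfolding SUP_apply
    by (intro nn_integral_monotone_convergence_SUP) (simp_all add: space_measure_algebra cong: measurable_cong_sets)
  with seq show ?case by (simp cong: measurable_cong)
qed

lemma nn_integral_sum_scaled_emeasure:
  assumes "finite J" "J \<subseteq> sets N"
  shows "(\<integral>\<^sup>+x. (\<Sum>A\<in>J. c A * indicator A x) \<partial>N) = (\<Sum>A\<in>J. c A * emeasure N A)"
  using assms by (subst nn_integral_sum) (auto intro!: sum.cong simp: nn_integral_cmult_indicator subset_iff)

text \<open>A finite nonnegative combination of evaluations is the integral of a simple function, so
  Laplace functionals contain all exponentials demanded by the criterion. The measures N may have
  infinite mass, as \<open>expn\<close> gives infinite integrals the weight 0.\<close>

lemma measure_algebra_eqI:
  fixes K :: "'a measure"
  assumes "finite_measure L1" "sets L1 = sets (measure_algebra K)" "sets L2 = sets (measure_algebra K)"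
    and eq: "\<And>f. f \<in> borel_measurable K \<Longrightarrow>
      (\<integral>\<^sup>+N. expn (\<integral>\<^sup>+x. f x \<partial>N) \<partial>L1) = (\<integral>\<^sup>+N. expn (\<integral>\<^sup>+x. f x \<partial>N) \<partial>L2)"
  shows "L1 = L2"
proof (rule exponential_measure_eqI[where I = "sets K" and X = "\<lambda>A N. emeasure N A" and \<Omega> = "{M. sets M = sets K}"])
  have sp: "space L1 = {M. sets M = sets K}" "space L2 = {M. sets M = sets K}"
    using assms(2,3)[THEN sets_eq_imp_space_eq] by (simp_all add: space_measure_algebra)
  fix J :: "'a set set" and t :: "'a set \<Rightarrow> real"
  assume J: "finite J" "J \<subseteq> sets K" "\<And>i. 0 \<le> t i"
  have fm: "(\<lambda>x. \<Sum>A\<in>J. ennreal (t A) * indicator A x) \<in> borel_measurable K"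
    using J by (intro borel_measurable_sum borel_measurable_times borel_measurable_indicator) auto
  have "(\<integral>\<^sup>+N. expn (\<Sum>A\<in>J. ennreal (t A) * emeasure N A) \<partial>L) =
        (\<integral>\<^sup>+N. expn (\<integral>\<^sup>+x. (\<Sum>A\<in>J. ennreal (t A) * indicator A x) \<partial>N) \<partial>L)"
    if "space L = {M. sets M = sets K}" for L
    using J that by (intro nn_integral_cong, subst nn_integral_sum_scaled_emeasure) auto
  then show "(\<integral>\<^sup>+N. expn (\<Sum>A\<in>J. ennreal (t A) * emeasure N A) \<partial>L1) =
        (\<integral>\<^sup>+N. expn (\<Sum>A\<in>J. ennreal (t A) * emeasure N A) \<partial>L2)"
    using eq[OF fm] by (simp only: sp)
next
  show "finite_measure L1" by fact
  show "sets L1 = sigma_sets {M. sets M = sets K}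
     {(\<lambda>N. emeasure N A) -` B \<inter> {M. sets M = sets K} | A B. A \<in> sets K \<and> B \<in> sets borel}"
    unfolding assms(2) by (rule sets_measure_algebra)
  show "sets L2 = sets L1" by (simp only: assms)
qed

text \<open>The form in which measurability of the posterior law in v and in the distinct values is
  obtained: only an explicit Laplace functional has to be inspected.\<close>

lemma measurable_prob_algebra_measure_algebra:
  fixes K :: "'a measure"
  assumes Q: "\<And>x. x \<in> space N \<Longrightarrow> prob_space (Q x)" "\<And>x. x \<in> space N \<Longrightarrow> sets (Q x) = sets (measure_algebra K)"
    and meas: "\<And>f. f \<in> borel_measurable K \<Longrightarrow> (\<lambda>x. \<integral>\<^sup>+N. expn (\<integral>\<^sup>+x. f x \<partial>N) \<partial>Q x) \<in> borel_measurable N"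
  shows "Q \<in> N \<rightarrow>\<^sub>M prob_algebra (measure_algebra K)"
proof (rule exponential_kernel[where I = "sets K" and X = "\<lambda>A N. emeasure N A", OF sets_measure_algebra Q])
  fix J :: "'a set set" and t :: "'a set \<Rightarrow> real"
  assume J: "finite J" "J \<subseteq> sets K" "\<And>i. 0 \<le> t i"
  have fm: "(\<lambda>x. \<Sum>A\<in>J. ennreal (t A) * indicator A x) \<in> borel_measurable K"
    using J by (intro borel_measurable_sum borel_measurable_times borel_measurable_indicator) auto
  have "(\<integral>\<^sup>+N. expn (\<Sum>A\<in>J. ennreal (t A) * emeasure N A) \<partial>Q x) =
        (\<integral>\<^sup>+N. expn (\<integral>\<^sup>+x. (\<Sum>A\<in>J. ennreal (t A) * indicator A x) \<partial>N) \<partial>Q x)"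
    if "x \<in> space N" for x
    using J sets_eq_imp_space_eq[OF Q(2)[OF that]]
    by (intro nn_integral_cong, subst nn_integral_sum_scaled_emeasure) (auto simp: space_measure_algebra)
  then show "(\<lambda>x. \<integral>\<^sup>+N. expn (\<Sum>A\<in>J. ennreal (t A) * emeasure N A) \<partial>Q x) \<in> borel_measurable N"
    using meas[OF fm] by (rule measurable_cong[THEN iffD2])
qed

section \<open>Laplace functionals of Poisson laws\<close>

lemma expn_of_nat_mult: "expn (c * of_nat k) = expn c ^ k"
  by (induction k) (auto simp: ring_distribs expn_add)

lemma expn_less_1_iff: "expn x < 1 \<longleftrightarrow> x \<noteq> 0"
  by (cases x) (auto simp: expn_ennreal)

text \<open>Rate 0 is the point mass at 0, for which the formula for the weights remains true with
  0^0 = 1. The second clause is the Poisson generating function at \<open>expn c\<close>, which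
  includes c = \<infinity>.\<close>

lemma poisson_pmf_exists:
  assumes "0 \<le> a"
  obtains p :: "nat pmf" where "\<And>k. pmf p k = a ^ k / fact k * exp (- a)"
    "\<And>c. (\<integral>\<^sup>+k. expn (c * of_nat k) \<partial>measure_pmf p) = expn (ennreal (1 - expn c) * ennreal a)"
proof -
  have "\<exists>p :: nat pmf. \<forall>k. pmf p k = a ^ k / fact k * exp (- a)"
  proof (cases "a = 0")
    case True
    then show ?thesis by (intro exI[of _ "return_pmf 0"]) (auto simp: pmf_return indicator_def)
  qed (use assms in \<open>auto intro!: exI[of _ "poisson_pmf a"]\<close>)
  then obtain p :: "nat pmf" where p: "\<And>k. pmf p k = a ^ k / fact k * exp (- a)" by blast
  have "(\<integral>\<^sup>+k. expn (c * of_nat k) \<partial>measure_pmf p) = expn (ennreal (1 - expn c) * ennreal a)" for c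
  proof -
    have "(\<integral>\<^sup>+k. expn (c * of_nat k) \<partial>measure_pmf p) = (\<Sum>k. ennreal ((a * expn c) ^ k /\<^sub>R fact k * exp (- a)))"
      by (simp add: nn_integral_measure_pmf nn_integral_count_space_nat p expn_of_nat_mult
          ennreal_mult''[symmetric] assms power_mult_distrib field_simps)
    also have "\<dots> = ennreal (exp (a * expn c) * exp (- a))"
      using assms by (intro suminf_ennreal_eq sums_mult2 exp_converges) auto
    also have "exp (a * expn c) * exp (- a) = expn (ennreal (1 - expn c) * ennreal a)"
    proof -
      have "0 \<le> a * (1 - expn c)" using assms by simp
      then show ?thesis
        using expn_ennreal[of "a * (1 - expn c)"] assms
        by (simp add: ennreal_mult''[symmetric] exp_add[symmetric] algebra_simps)
    qed
    finally show ?thesis .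
  qed
  with p that show thesis by blast
qed

lemma nn_integral_poisson_count:
  assumes L: "is_poisson_law \<nu> L" and A: "A \<in> sets \<nu>"
  shows "(\<integral>\<^sup>+N. expn (c * emeasure N A) \<partial>L) = expn (ennreal (1 - expn c) * emeasure \<nu> A)"
proof -
  interpret L: prob_space L using L by (simp add: is_poisson_law_def)
  have sL: "sets L = sets (measure_algebra \<nu>)" using L by (simp add: is_poisson_law_def)
  have m[measurable]: "(\<lambda>N. emeasure N A) \<in> borel_measurable L"
    using measurable_emeasure_measure_algebra[OF A] by (simp add: measurable_cong_sets[OF sL refl])
  show ?thesis
  proof (cases "emeasure \<nu> A = \<infinity>")
    case True
    then have "AE N in L. emeasure N A = \<infinity>" using L A by (auto simp: is_poisson_law_def)
    then have "(\<integral>\<^sup>+N. expn (c * emeasure N A) \<partial>L) = (\<integral>\<^sup>+N. expn (c * \<infinity>) \<partial>L)"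
      by (intro nn_integral_cong_AE) auto
    also have "\<dots> = expn (c * \<infinity>)" by (simp add: L.emeasure_space_1)
    also have "\<dots> = expn (ennreal (1 - expn c) * emeasure \<nu> A)"
      using True expn_less_1_iff[of c] by (cases "c = 0") (auto simp: ennreal_mult_top)
    finally show ?thesis .
  next
    case False
    define a where "a = measure \<nu> A"
    have a: "0 \<le> a" "emeasure \<nu> A = ennreal a" using False by (auto simp: a_def emeasure_eq_ennreal_measure)
    obtain p :: "nat pmf" where p: "\<And>k. pmf p k = a ^ k / fact k * exp (- a)"
      "\<And>c. (\<integral>\<^sup>+k. expn (c * of_nat k) \<partial>measure_pmf p) = expn (ennreal (1 - expn c) * ennreal a)"
      using poisson_pmf_exists[OF a(1)] by blast
    let ?D = "distr L borel (\<lambda>N. emeasure N A)" and ?D' = "distr (measure_pmf p) borel (of_nat :: nat \<Rightarrow> ennreal)"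
    \<comment> \<open>Only the masses of the integers are known, which bounds the law of the count
      from below. As both laws have mass one, the same bound on the complement turns the inequality
      into an equality.\<close>
    have le: "emeasure ?D' B \<le> emeasure ?D B" if B[measurable]: "B \<in> sets borel" for B
    proof -
      let ?S = "\<lambda>k::nat. {N \<in> space L. emeasure N A = of_nat k \<and> of_nat k \<in> B}"
      have "emeasure ?D' B = (\<integral>\<^sup>+k. indicator B (of_nat k) \<partial>measure_pmf p)"
        by (simp add: nn_integral_distr flip: nn_integral_indicator)
      also have "\<dots> = (\<Sum>k. ennreal (pmf p k) * indicator B (of_nat k))"
        by (simp add: nn_integral_measure_pmf nn_integral_count_space_nat)
      also have "\<dots> = (\<Sum>k. emeasure L (?S k))"
      proof (rule suminf_cong)
        fix k
        have "measure L {N \<in> space L. emeasure N A = of_nat k} = pmf p k"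
          using L A False p by (auto simp: is_poisson_law_def a_def)
        then show "ennreal (pmf p k) * indicator B (of_nat k) = emeasure L (?S k)"
          by (cases "of_nat k \<in> B") (auto simp: L.emeasure_eq_measure)
      qed
      also have "\<dots> = emeasure L (\<Union>k. ?S k)"
        by (intro suminf_emeasure) (auto simp: disjoint_family_on_def)
      also have "\<dots> \<le> emeasure ?D B"
        by (subst emeasure_distr) (auto intro!: emeasure_mono)
      finally show ?thesis .
    qed
    interpret D: prob_space ?D by (rule L.prob_space_distr) simp
    interpret D': prob_space ?D' by (rule prob_space.prob_space_distr[OF measure_pmf.prob_space_axioms]) simp
    have "?D' = ?D"
    proof (rule measure_eqI)
      fix B assume "B \<in> sets ?D'"
      then have B: "B \<in> sets borel" by simp
      have "measure ?D' B \<le> measure ?D B" "measure ?D' (UNIV - B) \<le> measure ?D (UNIV - B)"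
        using le[OF B] le[of "UNIV - B"] B by (auto simp: D.emeasure_eq_measure D'.emeasure_eq_measure)
      then show "emeasure ?D' B = emeasure ?D B"
        using D.prob_compl[of B] D'.prob_compl[of B] B by (simp add: D.emeasure_eq_measure D'.emeasure_eq_measure)
    qed simp
    have "(\<integral>\<^sup>+N. expn (c * emeasure N A) \<partial>L) = (\<integral>\<^sup>+x. expn (c * x) \<partial>?D)"
      by (simp add: nn_integral_distr)
    also have "\<dots> = (\<integral>\<^sup>+k. expn (c * of_nat k) \<partial>measure_pmf p)"
      unfolding \<open>?D' = ?D\<close>[symmetric] by (simp add: nn_integral_distr)
    finally show ?thesis by (simp add: p a)
  qed
qed

text \<open>At each point at most one summand differs from 0, so \<phi> acts on that summand
  alone.\<close>

lemma disjoint_sum_indicator: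
  fixes \<phi> :: "ennreal \<Rightarrow> ennreal"
  assumes F: "finite F" "disjoint F" and 0: "\<phi> 0 = 0"
  shows "\<phi> (\<Sum>A\<in>F. g A * indicator A x) = (\<Sum>A\<in>F. \<phi> (g A) * indicator A x)"
proof (cases "\<exists>A\<in>F. x \<in> A")
  case True
  then obtain A where A: "A \<in> F" "x \<in> A" by auto
  have "x \<notin> B" if "B \<in> F - {A}" for B
    using that A F(2) by (auto simp: disjoint_def)
  then have "(\<Sum>B\<in>F. h B * indicator B x) = h A" for h :: "'a set \<Rightarrow> ennreal"
    using A F(1) by (subst sum.remove[of _ A]) (auto intro!: sum.neutral)
  then show ?thesis by simp
next
  case False
  then have "(\<Sum>B\<in>F. h B * indicator B x) = 0" for h :: "'a set \<Rightarrow> ennreal"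
    by (intro sum.neutral) auto
  then show ?thesis using 0 by simp
qed

lemma nn_integral_poisson_disjoint:
  assumes L: "is_poisson_law \<nu> L" and F: "finite F" "F \<subseteq> sets \<nu>" "disjoint F"
  shows "(\<integral>\<^sup>+N. expn (\<Sum>A\<in>F. g A * emeasure N A) \<partial>L) =
    expn (\<integral>\<^sup>+x. ennreal (1 - expn (\<Sum>A\<in>F. g A * indicator A x)) \<partial>\<nu>)"
proof -
  interpret L: prob_space L using L by (simp add: is_poisson_law_def)
  have "(\<integral>\<^sup>+x. ennreal (1 - expn (\<Sum>A\<in>F. g A * indicator A x)) \<partial>\<nu>) =
        (\<integral>\<^sup>+x. (\<Sum>A\<in>F. ennreal (1 - expn (g A)) * indicator A x) \<partial>\<nu>)"
    by (subst disjoint_sum_indicator[OF F(1,3), where \<phi> = "\<lambda>c. ennreal (1 - expn c)"]) auto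
  also have "\<dots> = (\<Sum>A\<in>F. ennreal (1 - expn (g A)) * emeasure \<nu> A)"
    using F by (intro nn_integral_sum_scaled_emeasure)
  finally have 1: "expn (\<integral>\<^sup>+x. ennreal (1 - expn (\<Sum>A\<in>F. g A * indicator A x)) \<partial>\<nu>) =
    (\<Prod>A\<in>F. expn (ennreal (1 - expn (g A)) * emeasure \<nu> A))"
    by (simp only: expn_sum)
  have "L.indep_vars (\<lambda>_. borel) (\<lambda>A N. emeasure N A) F"
    using L F by (auto simp: is_poisson_law_def)
  then have ind: "L.indep_vars (\<lambda>_. borel) (\<lambda>A N. ennreal (expn (g A * emeasure N A))) F"
    by (rule L.indep_vars_compose2[where Y="\<lambda>A x. ennreal (expn (g A * x))"]) simp
  have "(\<integral>\<^sup>+N. expn (\<Sum>A\<in>F. g A * emeasure N A) \<partial>L) = (\<integral>\<^sup>+N. (\<Prod>A\<in>F. ennreal (expn (g A * emeasure N A))) \<partial>L)"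
    by (simp add: expn_sum prod_ennreal)
  also have "\<dots> = (\<Prod>A\<in>F. \<integral>\<^sup>+N. expn (g A * emeasure N A) \<partial>L)"
    by (intro L.indep_vars_nn_integral F ind) simp
  also have "\<dots> = (\<Prod>A\<in>F. ennreal (expn (ennreal (1 - expn (g A)) * emeasure \<nu> A)))"
    using F by (intro prod.cong refl nn_integral_poisson_count[OF L]) auto
  finally show ?thesis by (simp add: 1 prod_ennreal)
qed

text \<open>The exponential formula for Poisson random measures. A simple function is split along
  its level sets, whose counts are independent; the general case follows by increasing
  approximation, with dominated convergence on the left and monotone convergence inside the exponent
  on the right.\<close>

lemma poisson_laplace:
  assumes L: "is_poisson_law \<nu> L" and f: "f \<in> borel_measurable \<nu>"
  shows "(\<integral>\<^sup>+N. expn (\<integral>\<^sup>+x. f x \<partial>N) \<partial>L) = expn (\<integral>\<^sup>+x. ennreal (1 - expn (f x)) \<partial>\<nu>)"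
proof -
  interpret L: prob_space L using L by (simp add: is_poisson_law_def)
  have sL: "sets L = sets (measure_algebra \<nu>)" using L by (simp add: is_poisson_law_def)
  have spL: "space L = {M. sets M = sets \<nu>}" using sets_eq_imp_space_eq[OF sL] by (simp add: space_measure_algebra)
  obtain u where u: "incseq u" "\<And>i. simple_function \<nu> (u i)" "\<And>x. (SUP i. u i x) = f x"
    using borel_measurable_implies_simple_function_sequence'[OF f] by metis
  have um[measurable]: "u i \<in> borel_measurable \<nu>" for i by (rule borel_measurable_simple_function[OF u(2)])
  have *: "(\<integral>\<^sup>+N. expn (\<integral>\<^sup>+x. u i x \<partial>N) \<partial>L) = expn (\<integral>\<^sup>+x. ennreal (1 - expn (u i x)) \<partial>\<nu>)" for i
  proof -
    define F where "F = (\<lambda>c. u i -` {c} \<inter> space \<nu>) ` (u i ` space \<nu>)"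
    define g where "g A = u i (SOME x. x \<in> A)" for A
    have F: "finite F" "F \<subseteq> sets \<nu>" "disjoint F"
      using u(2)[of i] by (auto simp: F_def simple_function_def disjoint_def)
    have uF: "u i x = (\<Sum>A\<in>F. g A * indicator A x)" if x: "x \<in> space \<nu>" for x
    proof -
      let ?A = "u i -` {u i x} \<inter> space \<nu>"
      have "g ?A = u i x"
        using someI[of "\<lambda>y. y \<in> ?A" x] x by (auto simp: g_def)
      moreover have "(\<Sum>A\<in>F. g A * indicator A x) = g ?A * indicator ?A x + (\<Sum>A\<in>F - {?A}. g A * indicator A x)"
        using F(1) x by (intro sum.remove) (auto simp: F_def)
      moreover have "(\<Sum>A\<in>F - {?A}. g A * indicator A x) = 0"
        using x by (intro sum.neutral) (auto simp: F_def indicator_def split: if_splits)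
      ultimately show ?thesis using x by simp
    qed
    have "(\<integral>\<^sup>+N. expn (\<integral>\<^sup>+x. u i x \<partial>N) \<partial>L) = (\<integral>\<^sup>+N. expn (\<Sum>A\<in>F. g A * emeasure N A) \<partial>L)"
    proof (rule nn_integral_cong)
      fix N assume "N \<in> space L"
      then have N: "sets N = sets \<nu>" by (simp add: spL)
      then have "(\<integral>\<^sup>+x. u i x \<partial>N) = (\<integral>\<^sup>+x. (\<Sum>A\<in>F. g A * indicator A x) \<partial>N)"
        using uF sets_eq_imp_space_eq[OF N] by (intro nn_integral_cong) simp
      also have "\<dots> = (\<Sum>A\<in>F. g A * emeasure N A)"
        using F N by (intro nn_integral_sum_scaled_emeasure) auto
      finally show "ennreal (expn (\<integral>\<^sup>+x. u i x \<partial>N)) = ennreal (expn (\<Sum>A\<in>F. g A * emeasure N A))" by simp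
    qed
    also have "\<dots> = expn (\<integral>\<^sup>+x. ennreal (1 - expn (\<Sum>A\<in>F. g A * indicator A x)) \<partial>\<nu>)"
      by (rule nn_integral_poisson_disjoint[OF L F])
    also have "(\<integral>\<^sup>+x. ennreal (1 - expn (\<Sum>A\<in>F. g A * indicator A x)) \<partial>\<nu>) = (\<integral>\<^sup>+x. ennreal (1 - expn (u i x)) \<partial>\<nu>)"
      using uF by (intro nn_integral_cong) simp
    finally show ?thesis .
  qed
  have inc: "incseq (\<lambda>i. u i x)" for x using u(1) by (auto simp: incseq_def le_fun_def)
  have "(\<lambda>i. \<integral>\<^sup>+N. expn (\<integral>\<^sup>+x. u i x \<partial>N) \<partial>L) \<longlonglongrightarrow> (\<integral>\<^sup>+N. expn (\<integral>\<^sup>+x. f x \<partial>N) \<partial>L)"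
  proof (rule nn_integral_dominated_convergence[where w="\<lambda>_. 1"])
    show "(\<lambda>N. ennreal (expn (\<integral>\<^sup>+x. u i x \<partial>N))) \<in> borel_measurable L" for i
      unfolding measurable_cong_sets[OF sL refl] by measurable
    show "(\<lambda>N. ennreal (expn (\<integral>\<^sup>+x. f x \<partial>N))) \<in> borel_measurable L"
      unfolding measurable_cong_sets[OF sL refl] using f by measurable
    show "AE N in L. (\<lambda>i. ennreal (expn (\<integral>\<^sup>+x. u i x \<partial>N))) \<longlonglongrightarrow> ennreal (expn (\<integral>\<^sup>+x. f x \<partial>N))"
    proof (rule AE_I2)
      fix N assume "N \<in> space L"
      then have N: "sets N = sets \<nu>" by (simp add: spL)
      have "(\<lambda>i. \<integral>\<^sup>+x. u i x \<partial>N) \<longlonglongrightarrow> (SUP i. \<integral>\<^sup>+x. u i x \<partial>N)"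
        using u(1) by (intro LIMSEQ_SUP) (auto simp: incseq_def le_fun_def intro!: nn_integral_mono)
      also have "(SUP i. \<integral>\<^sup>+x. u i x \<partial>N) = (\<integral>\<^sup>+x. f x \<partial>N)"
        using u(1) um by (subst nn_integral_monotone_convergence_SUP[symmetric])
          (auto simp: u(3) measurable_cong_sets[OF N refl])
      finally show "(\<lambda>i. ennreal (expn (\<integral>\<^sup>+x. u i x \<partial>N))) \<longlonglongrightarrow> ennreal (expn (\<integral>\<^sup>+x. f x \<partial>N))"
        by (intro tendsto_ennrealI tendsto_expn)
    qed
  qed (auto simp: L.emeasure_space_1)
  moreover have "(\<lambda>i. \<integral>\<^sup>+x. ennreal (1 - expn (u i x)) \<partial>\<nu>) \<longlonglongrightarrow> (\<integral>\<^sup>+x. ennreal (1 - expn (f x)) \<partial>\<nu>)"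
  proof (rule nn_integral_LIMSEQ)
    show "incseq (\<lambda>i x. ennreal (1 - expn (u i x)))"
      using u(1) by (auto simp: incseq_def le_fun_def intro!: ennreal_leI expn_mono)
    show "(\<lambda>i. ennreal (1 - expn (u i x))) \<longlonglongrightarrow> ennreal (1 - expn (f x))" for x
      using LIMSEQ_SUP[OF inc[of x]] unfolding u(3) by (intro tendsto_ennrealI tendsto_intros tendsto_expn)
  qed simp
  then have "(\<lambda>i. ennreal (expn (\<integral>\<^sup>+x. ennreal (1 - expn (u i x)) \<partial>\<nu>))) \<longlonglongrightarrow> ennreal (expn (\<integral>\<^sup>+x. ennreal (1 - expn (f x)) \<partial>\<nu>))"
    by (intro tendsto_ennrealI tendsto_expn)
  ultimately show ?thesis unfolding * by (rule LIMSEQ_unique)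
qed

text \<open>Converse of the exponential formula, needed since tilted laws are known through their
  Laplace functionals. Evaluating it at combinations of indicators of disjoint sets gives the joint
  Laplace transform of the counts, which factorizes.\<close>

lemma is_poisson_lawI:
  assumes "prob_space L" and sL: "sets L = sets (measure_algebra \<nu>)"
    and lap: "\<And>f. f \<in> borel_measurable \<nu> \<Longrightarrow>
      (\<integral>\<^sup>+N. expn (\<integral>\<^sup>+x. f x \<partial>N) \<partial>L) = expn (\<integral>\<^sup>+x. ennreal (1 - expn (f x)) \<partial>\<nu>)"
  shows "is_poisson_law \<nu> L"
proof -
  interpret L: prob_space L by fact
  have spL: "space L = {M. sets M = sets \<nu>}" using sets_eq_imp_space_eq[OF sL] by (simp add: space_measure_algebra)
  have m[measurable]: "(\<lambda>N. emeasure N A) \<in> borel_measurable L" if "A \<in> sets \<nu>" for A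
    using measurable_emeasure_measure_algebra[OF that] by (simp add: measurable_cong_sets[OF sL refl])
  have disj: "(\<integral>\<^sup>+N. expn (\<Sum>A\<in>F. g A * emeasure N A) \<partial>L) =
    (\<Prod>A\<in>F. ennreal (expn (ennreal (1 - expn (g A)) * emeasure \<nu> A)))"
    if F: "finite F" "F \<subseteq> sets \<nu>" "disjoint F" for F g
  proof -
    have "(\<integral>\<^sup>+N. expn (\<Sum>A\<in>F. g A * emeasure N A) \<partial>L) =
      (\<integral>\<^sup>+N. expn (\<integral>\<^sup>+x. (\<Sum>A\<in>F. g A * indicator A x) \<partial>N) \<partial>L)"
      using F by (intro nn_integral_cong, subst nn_integral_sum_scaled_emeasure) (auto simp: spL)
    also have "\<dots> = expn (\<integral>\<^sup>+x. ennreal (1 - expn (\<Sum>A\<in>F. g A * indicator A x)) \<partial>\<nu>)"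
      using F by (intro lap borel_measurable_sum borel_measurable_times borel_measurable_indicator) auto
    also have "(\<integral>\<^sup>+x. ennreal (1 - expn (\<Sum>A\<in>F. g A * indicator A x)) \<partial>\<nu>) =
          (\<integral>\<^sup>+x. (\<Sum>A\<in>F. ennreal (1 - expn (g A)) * indicator A x) \<partial>\<nu>)"
      by (subst disjoint_sum_indicator[OF F(1,3), where \<phi> = "\<lambda>c. ennreal (1 - expn c)"]) auto
    also have "\<dots> = (\<Sum>A\<in>F. ennreal (1 - expn (g A)) * emeasure \<nu> A)"
      using F by (intro nn_integral_sum_scaled_emeasure)
    finally show ?thesis by (simp add: expn_sum prod_ennreal)
  qed
  have single: "(\<integral>\<^sup>+N. expn (c * emeasure N A) \<partial>L) = expn (ennreal (1 - expn c) * emeasure \<nu> A)"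
    if "A \<in> sets \<nu>" for A c
    using disj[of "{A}" "\<lambda>_. c"] that by simp
  \<comment> \<open>At an infinite mean the transform with parameter 1 is \<open>expn \<top>\<close>
    = 0. A nonnegative variable with integral zero vanishes almost surely, and \<open>expn\<close>
    vanishes only at \<infinity>.\<close>
  have inf: "AE N in L. emeasure N A = \<infinity>" if A: "A \<in> sets \<nu>" "emeasure \<nu> A = \<infinity>" for A
  proof -
    have "(\<integral>\<^sup>+N. expn (1 * emeasure N A) \<partial>L) = 0"
      using expn_less_1_iff[of 1] by (subst single[OF A(1)]) (auto simp: A ennreal_mult_top)
    then have "AE N in L. ennreal (expn (1 * emeasure N A)) = 0"
      using A by (subst (asm) nn_integral_0_iff_AE) auto
    then show ?thesis
    proof eventually_elim
      case (elim N)
      then show ?case using expn_pos[of "emeasure N A"] by (cases "emeasure N A = \<top>") (auto simp: less_top)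
    qed
  qed
  have pois: "measure L {N \<in> space L. emeasure N A = of_nat k} = measure \<nu> A ^ k / fact k * exp (- measure \<nu> A)"
    if A: "A \<in> sets \<nu>" "emeasure \<nu> A \<noteq> \<infinity>" for A k
  proof -
    obtain p :: "nat pmf" where p: "\<And>k. pmf p k = measure \<nu> A ^ k / fact k * exp (- measure \<nu> A)"
      "\<And>c. (\<integral>\<^sup>+k. expn (c * of_nat k) \<partial>measure_pmf p) = expn (ennreal (1 - expn c) * ennreal (measure \<nu> A))"
      using poisson_pmf_exists[OF measure_nonneg] by blast
    let ?D = "distr L borel (\<lambda>N. emeasure N A)" and ?D' = "distr (measure_pmf p) borel (of_nat :: nat \<Rightarrow> ennreal)"
    have "?D = ?D'"
    proof (rule exponential_measure_eqI[where I="{()}" and X="\<lambda>_ x. x" and \<Omega>=UNIV])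
      show "finite_measure ?D" using A by (intro L.finite_measure_distr) simp
      have "{(\<lambda>x. x) -` B \<inter> UNIV | i B. i \<in> {()} \<and> B \<in> sets borel} = (sets borel :: ennreal set set)" by auto
      then show "sets ?D = sigma_sets UNIV {(\<lambda>x. x) -` B \<inter> UNIV | i B. i \<in> {()} \<and> B \<in> sets borel}"
        using sets.sigma_sets_eq[of "borel :: ennreal measure"] by simp
      fix J :: "unit set" and t :: "unit \<Rightarrow> real"
      assume "finite J" "J \<subseteq> {()}"
      have "(\<integral>\<^sup>+x. expn (c * x) \<partial>?D) = (\<integral>\<^sup>+x. expn (c * x) \<partial>?D')" for c
        using A single[OF A(1)] p(2) by (simp add: nn_integral_distr emeasure_eq_ennreal_measure)
      from this[of "\<Sum>i\<in>J. ennreal (t i)"]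
      show "(\<integral>\<^sup>+x. expn (\<Sum>i\<in>J. ennreal (t i) * x) \<partial>?D) = (\<integral>\<^sup>+x. expn (\<Sum>i\<in>J. ennreal (t i) * x) \<partial>?D')"
        by (simp only: sum_distrib_right)
    qed simp
    then have "measure ?D {of_nat k} = measure ?D' {of_nat k}" by simp
    also have "\<dots> = measure (measure_pmf p) {k}"
      by (subst measure_distr) (auto intro!: arg_cong[of _ _ "measure (measure_pmf p)"])
    also have "measure ?D {of_nat k} = measure L {N \<in> space L. emeasure N A = of_nat k}"
      using A by (subst measure_distr) (auto intro!: arg_cong[of _ _ "measure L"])
    finally show ?thesis by (simp add: p measure_pmf_single)
  qed
  have ind: "L.indep_vars (\<lambda>_. borel) (\<lambda>A N. emeasure N A) F"
    if F: "finite F" "F \<subseteq> sets \<nu>" "disjoint F" for F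
  proof (cases "F = {}")
    case True
    then show ?thesis by (simp add: L.indep_vars_def2 L.indep_sets_def)
  next
    case False
    have FX[measurable]: "(\<lambda>N. emeasure N A) \<in> borel_measurable L" if "A \<in> F" for A using that F by auto
    let ?X = "\<lambda>N. \<lambda>A\<in>F. emeasure N A"
    have "distr L (Pi\<^sub>M F (\<lambda>_. borel)) ?X = Pi\<^sub>M F (\<lambda>A. distr L borel (\<lambda>N. emeasure N A))" (is "?D = ?D'")
    proof (rule exponential_measure_eqI[where I=F and X="\<lambda>A \<omega>. \<omega> A" and \<Omega>="\<Pi>\<^sub>E A\<in>F. UNIV"])
      show "finite_measure ?D" by (intro L.finite_measure_distr) measurable
      have "{{f \<in> \<Pi>\<^sub>E i\<in>F. UNIV. f i \<in> A} |i A. i \<in> F \<and> A \<in> sets borel} =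
         {(\<lambda>\<omega>. \<omega> i) -` B \<inter> (\<Pi>\<^sub>E A\<in>F. UNIV) |i B. i \<in> F \<and> B \<in> sets (borel :: ennreal measure)}"
        by (auto; blast)
      then show "sets ?D = sigma_sets (\<Pi>\<^sub>E A\<in>F. UNIV)
          {(\<lambda>\<omega>. \<omega> i) -` B \<inter> (\<Pi>\<^sub>E A\<in>F. UNIV) |i B. i \<in> F \<and> B \<in> sets borel}"
        by (simp add: sets_PiM_single)
      show "sets ?D' = sets ?D" by (simp cong: sets_PiM_cong)
      fix J :: "'a set set" and t :: "'a set \<Rightarrow> real"
      assume J: "finite J" "J \<subseteq> F"
      define s where "s A = (if A \<in> J then ennreal (t A) else 0)" for A
      have ts: "(\<Sum>A\<in>J. ennreal (t A) * h A) = (\<Sum>A\<in>F. s A * h A)" for h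
        using J F by (intro sum.mono_neutral_cong_left) (auto simp: s_def)
      \<comment> \<open>Extended by a point mass outside \<open>F\<close>, because the product
        locale asks for a probability measure at every index.\<close>
      define M where "M A = (if A \<in> F then distr L borel (\<lambda>N. emeasure N A) else return borel 0)" for A
      interpret M: prob_space "M A" for A
        by (auto simp: M_def prob_space_return intro!: L.prob_space_distr)
      interpret M: product_sigma_finite M ..
      have D': "?D' = Pi\<^sub>M F M" by (intro PiM_cong) (auto simp: M_def)
      have "(\<integral>\<^sup>+\<omega>. expn (\<Sum>A\<in>J. ennreal (t A) * \<omega> A) \<partial>?D') = (\<integral>\<^sup>+\<omega>. (\<Prod>A\<in>F. ennreal (expn (s A * \<omega> A))) \<partial>Pi\<^sub>M F M)"
        unfolding ts D' by (simp add: expn_sum prod_ennreal)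
      also have "\<dots> = (\<Prod>A\<in>F. \<integral>\<^sup>+x. expn (s A * x) \<partial>M A)"
        by (intro M.product_nn_integral_prod F) (auto simp: M_def)
      also have "\<dots> = (\<Prod>A\<in>F. ennreal (expn (ennreal (1 - expn (s A)) * emeasure \<nu> A)))"
        using F single by (intro prod.cong) (auto simp: M_def nn_integral_distr)
      also have "\<dots> = (\<integral>\<^sup>+N. expn (\<Sum>A\<in>F. s A * emeasure N A) \<partial>L)"
        using F by (rule disj[symmetric])
      also have "\<dots> = (\<integral>\<^sup>+\<omega>. expn (\<Sum>A\<in>J. ennreal (t A) * \<omega> A) \<partial>?D)"
        unfolding ts by (subst nn_integral_distr) (auto intro!: nn_integral_cong arg_cong[of _ _ expn] arg_cong[of _ _ ennreal] sum.cong)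
      finally show "(\<integral>\<^sup>+\<omega>. expn (\<Sum>A\<in>J. ennreal (t A) * \<omega> A) \<partial>?D) = (\<integral>\<^sup>+\<omega>. expn (\<Sum>A\<in>J. ennreal (t A) * \<omega> A) \<partial>?D')" ..
    qed
    then show ?thesis using False by (subst L.indep_vars_iff_distr_eq_PiM') auto
  qed
  show ?thesis
    unfolding is_poisson_law_def using inf pois ind sL L.prob_space_axioms by auto
qed

text \<open>The description operator is legitimate because the Laplace functional determines the
  law; existence is supplied by \<open>L\<close>. Laws for tilted intensities can thus be
  constructed by hand and then recognized.\<close>

lemma poisson_law_eq:
  assumes L: "is_poisson_law \<nu> L"
  shows "poisson_law \<nu> = L"
  unfolding poisson_law_def
proof (rule the_equality)
  fix L' assume L': "is_poisson_law \<nu> L'"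
  show "L' = L"
    using L L' by (intro measure_algebra_eqI[of L' \<nu>])
      (auto simp: is_poisson_law_def poisson_laplace prob_space.finite_measure)
qed fact

text \<open>An infinite exponent would make the expectation of the exponential zero, and hence the
  integral over N infinite almost surely. This is how almost sure finiteness of a Poisson integral
  turns into integrability against the intensity.\<close>

lemma poisson_laplace_pos:
  assumes L: "is_poisson_law \<nu> L" and g: "g \<in> borel_measurable \<nu>" and fin: "AE N in L. (\<integral>\<^sup>+x. g x \<partial>N) < \<infinity>"
  shows "(\<integral>\<^sup>+x. ennreal (1 - expn (g x)) \<partial>\<nu>) < \<infinity>"
proof (rule ccontr)
  interpret L: prob_space L using L by (simp add: is_poisson_law_def)
  have sL: "sets L = sets (measure_algebra \<nu>)" using L by (simp add: is_poisson_law_def)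
  assume "\<not> ?thesis"
  then have "(\<integral>\<^sup>+N. expn (\<integral>\<^sup>+x. g x \<partial>N) \<partial>L) = 0"
    by (simp add: poisson_laplace[OF L g] less_top[symmetric])
  then have "AE N in L. ennreal (expn (\<integral>\<^sup>+x. g x \<partial>N)) = 0"
    by (subst (asm) nn_integral_0_iff_AE) (use g in \<open>simp_all add: measurable_cong_sets[OF sL refl]\<close>)
  with fin have "AE N in L. False"
  proof eventually_elim
    case (elim N)
    then show ?case using expn_pos[of "\<integral>\<^sup>+x. g x \<partial>N"] by auto
  qed
  then show False by simp
qed

text \<open>The Laplace exponent splits as 1 - exp (- (g + f)) = (1 - exp (- g)) + exp (- g) * (1 -
  exp (- f)). The first term has a finite integral and cancels against the normalizing constant; the
  second is the exponent for the tilted intensity.\<close>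

lemma is_poisson_law_density:
  assumes L: "is_poisson_law \<nu> L" and g[measurable]: "g \<in> borel_measurable \<nu>" and fin: "AE N in L. (\<integral>\<^sup>+x. g x \<partial>N) < \<infinity>"
  shows "is_poisson_law (density \<nu> (\<lambda>x. ennreal (expn (g x))))
    (density L (\<lambda>N. ennreal (expn (\<integral>\<^sup>+x. g x \<partial>N)) / (\<integral>\<^sup>+N. expn (\<integral>\<^sup>+x. g x \<partial>N) \<partial>L)))"
    (is "is_poisson_law ?\<nu> ?L")
proof -
  have sL: "sets L = sets (measure_algebra \<nu>)" using L by (simp add: is_poisson_law_def)
  have spL: "space L = {M. sets M = sets \<nu>}" using sets_eq_imp_space_eq[OF sL] by (simp add: space_measure_algebra)
  define I where "I = (\<integral>\<^sup>+x. ennreal (1 - expn (g x)) \<partial>\<nu>)"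
  have I: "I < \<top>" using poisson_laplace_pos[OF L g fin] by (simp add: I_def)
  have Z: "(\<integral>\<^sup>+N. expn (\<integral>\<^sup>+x. g x \<partial>N) \<partial>L) = expn I"
    unfolding I_def by (rule poisson_laplace[OF L g])
  have m[measurable]: "(\<lambda>N. \<integral>\<^sup>+x. f x \<partial>N) \<in> borel_measurable L" if "f \<in> borel_measurable \<nu>" for f
    unfolding measurable_cong_sets[OF sL refl] using that by measurable
  have lap: "(\<integral>\<^sup>+N. expn (\<integral>\<^sup>+x. f x \<partial>N) \<partial>?L) = expn (\<integral>\<^sup>+x. ennreal (1 - expn (f x)) \<partial>?\<nu>)"
    if f[measurable]: "f \<in> borel_measurable \<nu>" for f
  proof -
    have "(\<integral>\<^sup>+N. expn (\<integral>\<^sup>+x. f x \<partial>N) \<partial>?L) =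
      (\<integral>\<^sup>+N. ennreal (expn (\<integral>\<^sup>+x. g x \<partial>N)) / expn I * expn (\<integral>\<^sup>+x. f x \<partial>N) \<partial>L)"
      unfolding Z by (subst nn_integral_density) auto
    also have "\<dots> = (\<integral>\<^sup>+N. inverse (ennreal (expn I)) * expn (\<integral>\<^sup>+x. g x + f x \<partial>N) \<partial>L)"
    proof (rule nn_integral_cong)
      fix N assume "N \<in> space L"
      then have N: "sets N = sets \<nu>" by (simp add: spL)
      have "(\<integral>\<^sup>+x. g x + f x \<partial>N) = (\<integral>\<^sup>+x. g x \<partial>N) + (\<integral>\<^sup>+x. f x \<partial>N)"
        by (intro nn_integral_add) (simp_all add: measurable_cong_sets[OF N refl])
      then show "ennreal (expn (\<integral>\<^sup>+x. g x \<partial>N)) / expn I * expn (\<integral>\<^sup>+x. f x \<partial>N) =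
        inverse (ennreal (expn I)) * expn (\<integral>\<^sup>+x. g x + f x \<partial>N)"
        by (simp add: expn_add divide_ennreal_def ennreal_mult'' mult_ac)
    qed
    also have "\<dots> = inverse (ennreal (expn I)) * expn (\<integral>\<^sup>+x. ennreal (1 - expn (g x + f x)) \<partial>\<nu>)"
      by (subst nn_integral_cmult) (simp_all add: poisson_laplace[OF L])
    also have "(\<integral>\<^sup>+x. ennreal (1 - expn (g x + f x)) \<partial>\<nu>) =
      (\<integral>\<^sup>+x. ennreal (1 - expn (g x)) + ennreal (expn (g x)) * ennreal (1 - expn (f x)) \<partial>\<nu>)"
      by (intro nn_integral_cong, subst ennreal_mult[symmetric]) (auto simp: expn_add ring_distribs mult_left_le simp flip: ennreal_plus)
    also have "\<dots> = I + (\<integral>\<^sup>+x. ennreal (1 - expn (f x)) \<partial>?\<nu>)"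
      unfolding I_def by (subst nn_integral_add) (simp_all add: nn_integral_density)
    also have "inverse (ennreal (expn I)) * ennreal (expn (I + (\<integral>\<^sup>+x. ennreal (1 - expn (f x)) \<partial>?\<nu>))) =
      expn (\<integral>\<^sup>+x. ennreal (1 - expn (f x)) \<partial>?\<nu>)"
      using expn_pos[OF I] by (simp add: expn_add inverse_ennreal ennreal_mult''[symmetric])
    finally show ?thesis .
  qed
  show ?thesis
  proof (rule is_poisson_lawI)
    show "prob_space ?L"
      using lap[of "\<lambda>_. 0"] by (intro prob_spaceI) (simp add: space_density)
    show "sets ?L = sets (measure_algebra ?\<nu>)"
      by (simp add: sL measure_algebra_cong[of ?\<nu> \<nu>])
  qed (use lap in simp)
qed

section \<open>The Mecke equation and joint moments\<close>

lemma sets_add_measure [simp]: "sets (add_measure M N) = sets M"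
  and space_add_measure [simp]: "space (add_measure M N) = space M"
  by (simp_all add: add_measure_def)

lemma emeasure_add_measure:
  assumes "sets N = sets M" and A: "A \<in> sets M"
  shows "emeasure (add_measure M N) A = emeasure M A + emeasure N A"
  unfolding add_measure_def
proof (rule emeasure_measure_of_sigma)
  show "countably_additive (sets M) (\<lambda>A. emeasure M A + emeasure N A)"
    using assms(1) by (auto simp: countably_additive_def suminf_add[symmetric] suminf_emeasure)
qed (use A in \<open>auto simp: positive_def sets.sigma_algebra_axioms\<close>)

lemma nn_integral_add_measure:
  assumes "sets N = sets M" and f: "f \<in> borel_measurable M"
  shows "(\<integral>\<^sup>+x. f x \<partial>add_measure M N) = (\<integral>\<^sup>+x. f x \<partial>M) + (\<integral>\<^sup>+x. f x \<partial>N)"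
proof -
  have sp: "space N = space M" using assms(1) by (rule sets_eq_imp_space_eq)
  have mN: "measurable N borel = measurable M borel" and mS: "measurable (add_measure M N) borel = measurable M borel"
    using measurable_cong_sets[OF assms(1) refl] by (simp_all cong: measurable_cong_sets)
  show ?thesis
    using f
  proof (induction rule: borel_measurable_induct)
    case (cong f g)
    then have "(\<integral>\<^sup>+x. f x \<partial>L) = (\<integral>\<^sup>+x. g x \<partial>L)" if "space L = space M" for L
      using that by (intro nn_integral_cong) simp
    from this[of "add_measure M N"] this[of M] this[of N] cong(4) show ?case by (simp add: sp)
  next
    case (set A)
    then show ?case using assms(1) by (simp add: emeasure_add_measure)
  next
    case (mult u c)
    then show ?case by (simp add: nn_integral_cmult mN mS ring_distribs)
  next
    case (add u v)
    then show ?case by (simp add: nn_integral_add mN mS add_ac)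
  next
    case (seq U)
    have inc: "incseq (\<lambda>i. \<integral>\<^sup>+x. U i x \<partial>L)" for L
      using seq(3) by (auto simp: incseq_def le_fun_def intro!: nn_integral_mono)
    have "(\<integral>\<^sup>+x. (SUP i. U i) x \<partial>L) = (SUP i. \<integral>\<^sup>+x. U i x \<partial>L)" if "measurable L borel = measurable M (borel :: ennreal measure)" for L
      unfolding SUP_apply using seq that by (intro nn_integral_monotone_convergence_SUP) auto
    from this[of "add_measure M N"] this[of M] this[of N] show ?case
      using seq inc[of M] inc[of N] by (simp add: mN mS ennreal_SUP_add)
  qed
qed

lemma measurable_add_point [measurable]:
  "(\<lambda>(x, N). add_measure N (return \<nu> x)) \<in> \<nu> \<Otimes>\<^sub>M measure_algebra \<nu> \<rightarrow>\<^sub>M measure_algebra \<nu>"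
proof (rule measurable_measure_algebra)
  fix A assume A[measurable]: "A \<in> sets \<nu>"
  have "(\<lambda>z. emeasure (snd z) A + indicator A (fst z)) \<in> borel_measurable (\<nu> \<Otimes>\<^sub>M measure_algebra \<nu>)"
    by measurable
  then show "(\<lambda>z. emeasure (case z of (x, N) \<Rightarrow> add_measure N (return \<nu> x)) A) \<in> borel_measurable (\<nu> \<Otimes>\<^sub>M measure_algebra \<nu>)"
    using A by (subst measurable_cong[where g="\<lambda>z. emeasure (snd z) A + indicator A (fst z)"])
      (auto simp: space_pair_measure space_measure_algebra emeasure_add_measure)
next
  fix z assume "z \<in> space (\<nu> \<Otimes>\<^sub>M measure_algebra \<nu>)"
  then show "sets (case z of (x, N) \<Rightarrow> add_measure N (return \<nu> x)) = sets \<nu>"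
    by (cases z) (simp add: space_pair_measure space_measure_algebra)
qed

text \<open>A monotone difference quotient of \<open>1 - exp (- t y)\<close> at \<open>t = 0\<close>: it lets Laplace functionals be
  differentiated by monotone convergence, without integrability assumptions.\<close>

definition diffq :: "nat \<Rightarrow> ennreal \<Rightarrow> ennreal" where
  "diffq j y = of_nat (Suc j) * ennreal (1 - expn (ennreal (1 / Suc j) * y))"

lemma diffq_measurable [measurable]: "diffq j \<in> borel_measurable borel"
  unfolding diffq_def by measurable

lemma diffq_mono: "x \<le> y \<Longrightarrow> diffq j x \<le> diffq j y"
  unfolding diffq_def by (intro mult_left_mono ennreal_leI diff_left_mono expn_mono) auto

lemma diffq_ennreal: "0 \<le> y \<Longrightarrow> diffq j (ennreal y) = ennreal (Suc j * (1 - exp (- (y / Suc j))))"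
  by (simp add: diffq_def ennreal_mult''[symmetric] expn_ennreal ennreal_of_nat_eq_real_of_nat ennreal_mult[symmetric] del: of_nat_Suc)

lemma diffq_top: "diffq j \<top> = of_nat (Suc j)"
  by (simp add: diffq_def ennreal_mult_top del: of_nat_Suc)

lemma diffq_incseq: "incseq (\<lambda>j. diffq j y)"
proof (rule incseq_SucI)
  fix j
  show "diffq j y \<le> diffq (Suc j) y"
  proof (cases y)
    case (real r)
    define s t where "s = real (Suc j)" and "t = real (Suc (Suc j))"
    have st: "0 < s" "s < t" by (auto simp: s_def t_def)
    \<comment> \<open>Convexity of exp, with - (r/t) written as the combination of 0 and - (r/s)
      with weight s/t on the latter.\<close>
    have "exp ((1 - s / t) *\<^sub>R 0 + (s / t) *\<^sub>R (- (r / s))) \<le> (1 - s / t) * exp 0 + (s / t) * exp (- (r / s))"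
      using st by (intro convex_onD[OF exp_convex]) auto
    then have "exp (- (r / t)) \<le> 1 - s / t + (s / t) * exp (- (r / s))" using st by (simp add: field_simps)
    then have "t * exp (- (r / t)) \<le> t * (1 - s / t + (s / t) * exp (- (r / s)))"
      using st by (intro mult_left_mono) auto
    also have "\<dots> = t - s + s * exp (- (r / s))" using st by (simp add: algebra_simps)
    finally have "s * (1 - exp (- (r / s))) \<le> t * (1 - exp (- (r / t)))" by (simp add: algebra_simps)
    then show ?thesis using real by (simp add: diffq_ennreal s_def t_def ennreal_leI del: of_nat_Suc)
  qed (simp add: diffq_top)
qed

lemma diffq_SUP: "(SUP j. diffq j y) = y"
proof -
  have "(\<lambda>j. diffq j y) \<longlonglongrightarrow> y"
  proof (cases y)
    case (real r)
    have "((\<lambda>t. (exp (- (r * t)) - 1) / t) \<longlongrightarrow> - r) (at_right 0)"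
    proof -
      have "((\<lambda>t. exp (- (r * t))) has_real_derivative - r) (at 0)"
        by (auto intro!: derivative_eq_intros)
      then show ?thesis
        by (auto simp: has_field_derivative_iff intro: filterlim_mono[OF _ order_refl at_le])
    qed
    moreover have "filterlim (\<lambda>j. 1 / real (Suc j)) (at_right 0) sequentially"
      unfolding filterlim_at by (auto intro!: LIMSEQ_Suc[OF lim_1_over_n] simp del: of_nat_Suc)
    ultimately have "(\<lambda>j. (exp (- (r * (1 / Suc j))) - 1) / (1 / Suc j)) \<longlonglongrightarrow> - r"
      by (rule filterlim_compose)
    from tendsto_minus[OF this] have "(\<lambda>j. Suc j * (1 - exp (- (r / Suc j)))) \<longlonglongrightarrow> r"
      by (simp add: algebra_simps)
    then show ?thesis
      using real by (simp add: diffq_ennreal tendsto_ennrealI del: of_nat_Suc)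
  next
    case top
    then show ?thesis unfolding top diffq_top by (intro LIMSEQ_Suc of_nat_tendsto_top_ennreal)
  qed
  then show ?thesis by (intro LIMSEQ_unique[OF LIMSEQ_SUP[OF diffq_incseq]])
qed

text \<open>\<open>diffq j y\<close> increases in j and in y, so the iterated supremum can be taken
  along the diagonal. Needed because the argument of the quotient will itself be built from
  quotients with the same step.\<close>

lemma diffq_SUP_diagonal:
  assumes "incseq c"
  shows "(SUP j. diffq j (c j)) = (SUP j. c j)"
proof (rule antisym)
  have "diffq j y \<le> y" for j y
    using diffq_SUP[of y] SUP_upper[of j UNIV "\<lambda>j. diffq j y"] by simp
  then show "(SUP j. diffq j (c j)) \<le> (SUP j. c j)" by (intro SUP_mono) auto
  have "diffq j (c m) \<le> diffq (max j m) (c (max j m))" for j m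
    using incseqD[OF diffq_incseq, of j "max j m" "c m"] incseqD[OF assms, of m "max j m"]
    by (meson diffq_mono max.cobounded1 max.cobounded2 order_trans)
  then have "(SUP j. diffq j (c m)) \<le> (SUP j. diffq j (c j))" for m by (intro SUP_mono) auto
  then show "(SUP j. c j) \<le> (SUP j. diffq j (c j))" unfolding diffq_SUP by (intro SUP_least)
qed

locale poisson =
  fixes \<nu> :: "'a measure" and L :: "'a measure measure"
  assumes law: "is_poisson_law \<nu> L"
begin

sublocale L: prob_space L using law by (simp add: is_poisson_law_def)

lemma sets_L: "sets L = sets (measure_algebra \<nu>)" using law by (simp add: is_poisson_law_def)

lemma space_L: "space L = {M. sets M = sets \<nu>}"
  using sets_eq_imp_space_eq[OF sets_L] by (simp add: space_measure_algebra)

lemma measurable_L: "measurable L K = measurable (measure_algebra \<nu>) K"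
  by (rule measurable_cong_sets[OF sets_L refl])

lemma measurable_integral_L [measurable]:
  "f \<in> borel_measurable \<nu> \<Longrightarrow> (\<lambda>N. \<integral>\<^sup>+x. f x \<partial>N) \<in> borel_measurable L"
  by (simp add: measurable_L)

text \<open>Differentiation at t = 0 of the exponential formula for f + t * k, along the steps t = 1
  / Suc j. The quotients \<open>diffq\<close> are monotone in j, so infinite values are allowed on
  both sides.\<close>

lemma laplace_linear:
  assumes f[measurable]: "f \<in> borel_measurable \<nu>" and k[measurable]: "k \<in> borel_measurable \<nu>"
  shows "(\<integral>\<^sup>+N. (\<integral>\<^sup>+x. k x \<partial>N) * ennreal (expn (\<integral>\<^sup>+x. f x \<partial>N)) \<partial>L) =
    (\<integral>\<^sup>+x. k x * ennreal (expn (f x)) \<partial>\<nu>) * (\<integral>\<^sup>+N. expn (\<integral>\<^sup>+x. f x \<partial>N) \<partial>L)"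
proof -
  define c where "c j = (\<integral>\<^sup>+x. diffq j (k x) * ennreal (expn (f x)) \<partial>\<nu>)" for j
  have c: "incseq c" unfolding c_def
    using diffq_incseq by (auto simp: incseq_def intro!: nn_integral_mono mult_right_mono)
  have Sc: "(SUP j. c j) = (\<integral>\<^sup>+x. k x * ennreal (expn (f x)) \<partial>\<nu>)"
  proof -
    have "incseq (\<lambda>j x. diffq j (k x) * ennreal (expn (f x)))"
      using diffq_incseq by (auto simp: incseq_def le_fun_def intro!: mult_right_mono)
    then have "(SUP j. c j) = (\<integral>\<^sup>+x. (SUP j. diffq j (k x) * ennreal (expn (f x))) \<partial>\<nu>)"
      unfolding c_def by (subst nn_integral_monotone_convergence_SUP) auto
    also have "\<dots> = (\<integral>\<^sup>+x. k x * ennreal (expn (f x)) \<partial>\<nu>)"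
      by (simp add: SUP_mult_right_ennreal[symmetric] diffq_SUP)
    finally show ?thesis .
  qed
  let ?E = "\<integral>\<^sup>+N. expn (\<integral>\<^sup>+x. f x \<partial>N) \<partial>L"
  \<comment> \<open>Difference of the exponential formulas for f and f + t * k with t = 1 / Suc j.
    Subtraction of extended numbers is harmless, since all Laplace functionals are at most
    1.\<close>
  have j: "(\<integral>\<^sup>+N. diffq j (\<integral>\<^sup>+x. k x \<partial>N) * ennreal (expn (\<integral>\<^sup>+x. f x \<partial>N)) \<partial>L) = diffq j (c j) * ?E" for j
  proof -
    let ?t = "ennreal (1 / Suc j)"
    let ?\<psi> = "\<integral>\<^sup>+x. ennreal (1 - expn (f x)) \<partial>\<nu>"
    have tj: "of_nat (Suc j) * ?t = 1"
      by (simp add: ennreal_of_nat_eq_real_of_nat ennreal_mult[symmetric] del: of_nat_Suc)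
    let ?q = "\<integral>\<^sup>+x. ennreal (expn (f x)) * ennreal (1 - expn (?t * k x)) \<partial>\<nu>"
    have q: "?q = ?t * c j"
    proof -
      have "?t * c j = (\<integral>\<^sup>+x. ?t * (diffq j (k x) * ennreal (expn (f x))) \<partial>\<nu>)"
        unfolding c_def by (rule nn_integral_cmult[symmetric]) measurable
      also have "\<dots> = ?q"
      proof (intro nn_integral_cong)
        fix x
        have "?t * (diffq j (k x) * ennreal (expn (f x))) = (of_nat (Suc j) * ?t) * (ennreal (1 - expn (?t * k x)) * ennreal (expn (f x)))"
          by (simp only: diffq_def mult_ac)
        then show "?t * (diffq j (k x) * ennreal (expn (f x))) = ennreal (expn (f x)) * ennreal (1 - expn (?t * k x))"
          unfolding tj by (simp add: mult_ac)
      qed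
      finally show ?thesis ..
    qed
    have "(\<integral>\<^sup>+x. ennreal (1 - expn (f x + ?t * k x)) \<partial>\<nu>) =
      (\<integral>\<^sup>+x. ennreal (1 - expn (f x)) + ennreal (expn (f x)) * ennreal (1 - expn (?t * k x)) \<partial>\<nu>)"
      by (intro nn_integral_cong, subst ennreal_mult[symmetric]) (auto simp: expn_add ring_distribs mult_left_le simp flip: ennreal_plus)
    also have "\<dots> = ?\<psi> + ?t * c j"
      unfolding q[symmetric] by (rule nn_integral_add) measurable
    finally have \<psi>: "(\<integral>\<^sup>+x. ennreal (1 - expn (f x + ?t * k x)) \<partial>\<nu>) = ?\<psi> + ?t * c j" .
    have E: "?E = expn ?\<psi>" by (rule poisson_laplace[OF law f])
    have split: "(\<integral>\<^sup>+x. f x + ?t * k x \<partial>N) = (\<integral>\<^sup>+x. f x \<partial>N) + ?t * (\<integral>\<^sup>+x. k x \<partial>N)" if "N \<in> space L" for N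
    proof -
      have N: "sets N = sets \<nu>" using that by (simp add: space_L)
      then have [measurable]: "f \<in> borel_measurable N" "k \<in> borel_measurable N"
        by (simp_all add: measurable_cong_sets[OF N refl])
      show ?thesis by (simp add: nn_integral_add nn_integral_cmult)
    qed
    have E2: "(\<integral>\<^sup>+N. ennreal (expn (\<integral>\<^sup>+x. f x \<partial>N) * expn (?t * (\<integral>\<^sup>+x. k x \<partial>N))) \<partial>L) = expn ?\<psi> * expn (?t * c j)"
    proof -
      have "(\<integral>\<^sup>+N. ennreal (expn (\<integral>\<^sup>+x. f x \<partial>N) * expn (?t * (\<integral>\<^sup>+x. k x \<partial>N))) \<partial>L) = (\<integral>\<^sup>+N. expn (\<integral>\<^sup>+x. f x + ?t * k x \<partial>N) \<partial>L)"
        by (intro nn_integral_cong) (simp only: split expn_add)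
      also have "\<dots> = expn (?\<psi> + ?t * c j)"
        unfolding \<psi>[symmetric] by (rule poisson_laplace[OF law]) measurable
      finally show ?thesis by (simp only: expn_add)
    qed
    have "(\<integral>\<^sup>+N. diffq j (\<integral>\<^sup>+x. k x \<partial>N) * ennreal (expn (\<integral>\<^sup>+x. f x \<partial>N)) \<partial>L) =
      (\<integral>\<^sup>+N. of_nat (Suc j) * (ennreal (expn (\<integral>\<^sup>+x. f x \<partial>N)) - ennreal (expn (\<integral>\<^sup>+x. f x \<partial>N) * expn (?t * (\<integral>\<^sup>+x. k x \<partial>N)))) \<partial>L)"
      by (intro nn_integral_cong)
        (simp add: diffq_def mult.assoc ennreal_minus ennreal_mult[symmetric] algebra_simps del: of_nat_Suc)
    also have "\<dots> = of_nat (Suc j) * (?E - expn ?\<psi> * expn (?t * c j))"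
      unfolding E2[symmetric]
      by (subst nn_integral_cmult, measurable, subst nn_integral_diff) (auto simp: E2 mult_left_le simp del: of_nat_Suc)
    also have "\<dots> = diffq j (c j) * ?E"
      unfolding E by (simp add: diffq_def mult.assoc ennreal_minus ennreal_mult[symmetric] algebra_simps del: of_nat_Suc)
    finally show ?thesis .
  qed
  have "(\<integral>\<^sup>+N. (\<integral>\<^sup>+x. k x \<partial>N) * ennreal (expn (\<integral>\<^sup>+x. f x \<partial>N)) \<partial>L) =
    (\<integral>\<^sup>+N. (SUP j. diffq j (\<integral>\<^sup>+x. k x \<partial>N) * ennreal (expn (\<integral>\<^sup>+x. f x \<partial>N))) \<partial>L)"
    by (simp add: SUP_mult_right_ennreal[symmetric] diffq_SUP)
  also have "\<dots> = (SUP j. \<integral>\<^sup>+N. diffq j (\<integral>\<^sup>+x. k x \<partial>N) * ennreal (expn (\<integral>\<^sup>+x. f x \<partial>N)) \<partial>L)"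
    using diffq_incseq
    by (intro nn_integral_monotone_convergence_SUP) (auto simp: incseq_def le_fun_def intro!: mult_right_mono)
  also have "\<dots> = (SUP j. diffq j (c j)) * ?E"
    unfolding j by (rule SUP_mult_right_ennreal[symmetric])
  finally show ?thesis unfolding diffq_SUP_diagonal[OF c] Sc .
qed

text \<open>For integrable k both sides are integrals of \<open>F\<close> against finite measures on
  the space of measures. Their Laplace functionals agree by \<open>laplace_linear\<close>, since an
  added point x contributes the factor exp (- f x).\<close>

lemma mecke_finite:
  assumes k[measurable]: "k \<in> borel_measurable \<nu>" and fin: "(\<integral>\<^sup>+x. k x \<partial>\<nu>) < \<infinity>"
    and F[measurable]: "F \<in> borel_measurable (measure_algebra \<nu>)"
  shows "(\<integral>\<^sup>+N. (\<integral>\<^sup>+x. k x \<partial>N) * F N \<partial>L) = (\<integral>\<^sup>+x. k x * (\<integral>\<^sup>+N. F (add_measure N (return \<nu> x)) \<partial>L) \<partial>\<nu>)"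
proof -
  have FL[measurable]: "F \<in> borel_measurable L" by (simp add: measurable_L)
  interpret k: finite_measure "density \<nu> k"
    using fin by (intro finite_measureI) (simp add: emeasure_density cong: nn_integral_cong)
  interpret P: pair_sigma_finite "density \<nu> k" L ..
  have ap: "(\<lambda>(x, N). add_measure N (return \<nu> x)) \<in> density \<nu> k \<Otimes>\<^sub>M L \<rightarrow>\<^sub>M measure_algebra \<nu>"
    by (subst measurable_cong_sets[OF sets_pair_measure_cong[of "density \<nu> k" \<nu> L "measure_algebra \<nu>"] refl])
      (auto simp: sets_L)
  let ?R = "distr (density \<nu> k \<Otimes>\<^sub>M L) (measure_algebra \<nu>) (\<lambda>(x, N). add_measure N (return \<nu> x))"
  have R: "(\<integral>\<^sup>+N. G N \<partial>?R) = (\<integral>\<^sup>+x. k x * (\<integral>\<^sup>+N. G (add_measure N (return \<nu> x)) \<partial>L) \<partial>\<nu>)"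
    if G[measurable]: "G \<in> borel_measurable (measure_algebra \<nu>)" for G
  proof -
    have m: "(\<lambda>(x, N). G (add_measure N (return \<nu> x))) \<in> borel_measurable (density \<nu> k \<Otimes>\<^sub>M L)"
      using measurable_compose[OF ap G] by (simp add: split_beta')
    have m2: "(\<lambda>(x, N). G (add_measure N (return \<nu> x))) \<in> borel_measurable (\<nu> \<Otimes>\<^sub>M L)"
      using m by (subst (asm) measurable_cong_sets[OF sets_pair_measure_cong[of "density \<nu> k" \<nu> L L] refl]) auto
    have "(\<integral>\<^sup>+N. G N \<partial>?R) = (\<integral>\<^sup>+x. \<integral>\<^sup>+N. G (add_measure N (return \<nu> x)) \<partial>L \<partial>density \<nu> k)"
      using m by (subst nn_integral_distr[OF ap]) (auto simp: split_beta' L.nn_integral_fst[symmetric])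
    also have "\<dots> = (\<integral>\<^sup>+x. k x * (\<integral>\<^sup>+N. G (add_measure N (return \<nu> x)) \<partial>L) \<partial>\<nu>)"
      using L.borel_measurable_nn_integral_fst[OF m2] by (subst nn_integral_density) auto
    finally show ?thesis .
  qed
  have "density L (\<lambda>N. \<integral>\<^sup>+x. k x \<partial>N) = ?R"
  proof (rule measure_algebra_eqI[where K=\<nu>])
    have "(\<integral>\<^sup>+N. (\<integral>\<^sup>+x. k x \<partial>N) \<partial>L) = (\<integral>\<^sup>+x. k x \<partial>\<nu>)"
      using laplace_linear[of "\<lambda>_. 0" k] by (simp add: L.emeasure_space_1)
    then show "finite_measure (density L (\<lambda>N. \<integral>\<^sup>+x. k x \<partial>N))"
      using fin by (intro finite_measureI) (simp add: emeasure_density cong: nn_integral_cong)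
    fix f :: "'a \<Rightarrow> ennreal" assume f[measurable]: "f \<in> borel_measurable \<nu>"
    have "(\<integral>\<^sup>+N. expn (\<integral>\<^sup>+x. f x \<partial>N) \<partial>?R) =
      (\<integral>\<^sup>+x. k x * (\<integral>\<^sup>+N. expn (\<integral>\<^sup>+x. f x \<partial>add_measure N (return \<nu> x)) \<partial>L) \<partial>\<nu>)"
      by (rule R) measurable
    also have "\<dots> = (\<integral>\<^sup>+x. k x * (expn (f x) * (\<integral>\<^sup>+N. expn (\<integral>\<^sup>+x. f x \<partial>N) \<partial>L)) \<partial>\<nu>)"
    proof (intro nn_integral_cong arg_cong2[of _ _ _ _ "(*)"] refl)
      fix x assume x: "x \<in> space \<nu>"
      have "(\<integral>\<^sup>+N. expn (\<integral>\<^sup>+x. f x \<partial>add_measure N (return \<nu> x)) \<partial>L) = (\<integral>\<^sup>+N. expn (f x) * expn (\<integral>\<^sup>+x. f x \<partial>N) \<partial>L)"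
      proof (intro nn_integral_cong)
        fix N assume "N \<in> space L"
        then have N: "sets N = sets \<nu>" by (simp add: space_L)
        have "(\<integral>\<^sup>+x. f x \<partial>add_measure N (return \<nu> x)) = (\<integral>\<^sup>+x. f x \<partial>N) + (\<integral>\<^sup>+x. f x \<partial>return \<nu> x)"
          by (intro nn_integral_add_measure) (simp_all add: N measurable_cong_sets[OF N refl])
        then show "ennreal (expn (\<integral>\<^sup>+x. f x \<partial>add_measure N (return \<nu> x))) = ennreal (expn (f x) * expn (\<integral>\<^sup>+x. f x \<partial>N))"
          using x by (simp add: nn_integral_return expn_add mult.commute)
      qed
      then show "(\<integral>\<^sup>+N. expn (\<integral>\<^sup>+x. f x \<partial>add_measure N (return \<nu> x)) \<partial>L) = expn (f x) * (\<integral>\<^sup>+N. expn (\<integral>\<^sup>+x. f x \<partial>N) \<partial>L)"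
        by (simp add: ennreal_mult'' nn_integral_cmult)
    qed
    also have "\<dots> = (\<integral>\<^sup>+x. k x * ennreal (expn (f x)) \<partial>\<nu>) * (\<integral>\<^sup>+N. expn (\<integral>\<^sup>+x. f x \<partial>N) \<partial>L)"
      by (simp add: mult.assoc[symmetric] nn_integral_multc)
    also have "\<dots> = (\<integral>\<^sup>+N. expn (\<integral>\<^sup>+x. f x \<partial>N) \<partial>density L (\<lambda>N. \<integral>\<^sup>+x. k x \<partial>N))"
      by (subst nn_integral_density) (simp_all add: laplace_linear)
    finally show "(\<integral>\<^sup>+N. expn (\<integral>\<^sup>+x. f x \<partial>N) \<partial>density L (\<lambda>N. \<integral>\<^sup>+x. k x \<partial>N)) = (\<integral>\<^sup>+N. expn (\<integral>\<^sup>+x. f x \<partial>N) \<partial>?R)" ..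
  qed (simp_all add: sets_L)
  then have "(\<integral>\<^sup>+N. F N \<partial>density L (\<lambda>N. \<integral>\<^sup>+x. k x \<partial>N)) = (\<integral>\<^sup>+N. F N \<partial>?R)" by simp
  then show ?thesis by (simp add: R nn_integral_density)
qed

lemma mecke:
  assumes "sigma_finite_measure \<nu>" and k[measurable]: "k \<in> borel_measurable \<nu>"
    and F[measurable]: "F \<in> borel_measurable (measure_algebra \<nu>)"
  shows "(\<integral>\<^sup>+N. (\<integral>\<^sup>+x. k x \<partial>N) * F N \<partial>L) = (\<integral>\<^sup>+x. k x * (\<integral>\<^sup>+N. F (add_measure N (return \<nu> x)) \<partial>L) \<partial>\<nu>)"
proof -
  interpret \<nu>: sigma_finite_measure \<nu> by fact
  obtain A where A: "range A \<subseteq> sets \<nu>" "(\<Union>i. A i) = space \<nu>" "\<And>i. emeasure \<nu> (A i) \<noteq> \<infinity>" "incseq A"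
    using \<nu>.sigma_finite_incseq by blast
  have [measurable]: "A i \<in> sets \<nu>" for i using A(1) by auto
  \<comment> \<open>Truncation in height and in support gives integrable functions increasing to k,
    which reduces the claim to the integrable case by monotone convergence.\<close>
  define u where "u i x = min (k x) (of_nat i) * indicator (A i) x" for i x
  have um[measurable]: "u i \<in> borel_measurable \<nu>" for i unfolding u_def by measurable
  have ui: "incseq u"
    using A(4) by (auto simp: incseq_def le_fun_def u_def indicator_def min_le_iff_disj intro: of_nat_mono)
  have us: "(SUP i. u i x) = k x" if x: "x \<in> space \<nu>" for x
  proof (rule antisym)
    show "(SUP i. u i x) \<le> k x" by (intro SUP_least) (auto simp: u_def indicator_def)
    obtain m where m: "x \<in> A m" using A(2) x by auto
    show "k x \<le> (SUP i. u i x)"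
    proof (rule dense_le)
      fix y assume y: "y < k x"
      then have "y < \<top>" using less_le_trans top_greatest by blast
      then obtain j where j: "y < of_nat j" using ennreal_Ex_less_of_nat by auto
      have "x \<in> A (max m j)" using m incseqD[OF A(4), of m "max m j"] by auto
      then have "u (max m j) x = min (k x) (of_nat (max m j))" by (simp add: u_def)
      moreover have "y \<le> min (k x) (of_nat (max m j))"
        using y j less_le_trans[OF j, of "of_nat (max m j)"] by auto
      ultimately show "y \<le> (SUP i. u i x)" by (intro SUP_upper2[of "max m j"]) auto
    qed
  qed
  have ufin: "(\<integral>\<^sup>+x. u i x \<partial>\<nu>) < \<infinity>" for i
  proof -
    have "(\<integral>\<^sup>+x. u i x \<partial>\<nu>) \<le> (\<integral>\<^sup>+x. of_nat i * indicator (A i) x \<partial>\<nu>)"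
      by (intro nn_integral_mono) (auto simp: u_def indicator_def)
    also have "\<dots> = of_nat i * emeasure \<nu> (A i)" by (simp add: nn_integral_cmult_indicator)
    also have "\<dots> < \<infinity>" using A(3)[of i] by (simp add: ennreal_mult_less_top of_nat_less_top less_top)
    finally show ?thesis .
  qed
  have FL[measurable]: "F \<in> borel_measurable L" by (simp add: measurable_L)
  have ap: "(\<lambda>(x, N). add_measure N (return \<nu> x)) \<in> \<nu> \<Otimes>\<^sub>M L \<rightarrow>\<^sub>M measure_algebra \<nu>"
    by (subst measurable_cong_sets[OF sets_pair_measure_cong[of \<nu> \<nu> L "measure_algebra \<nu>"] refl])
      (auto simp: sets_L)
  have "(\<lambda>(x, N). F (add_measure N (return \<nu> x))) \<in> borel_measurable (\<nu> \<Otimes>\<^sub>M L)"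
    using measurable_compose[OF ap F] by (simp add: split_beta')
  from L.borel_measurable_nn_integral_fst[OF this]
  have m[measurable]: "(\<lambda>x. \<integral>\<^sup>+N. F (add_measure N (return \<nu> x)) \<partial>L) \<in> borel_measurable \<nu>" by simp
  have mono: "(\<integral>\<^sup>+x. u i x \<partial>N) \<le> (\<integral>\<^sup>+x. u j x \<partial>N)" if "i \<le> j" for i j N
    using ui that by (auto simp: incseq_def le_fun_def intro!: nn_integral_mono)
  have "(\<integral>\<^sup>+N. (\<integral>\<^sup>+x. k x \<partial>N) * F N \<partial>L) = (\<integral>\<^sup>+N. (SUP i. (\<integral>\<^sup>+x. u i x \<partial>N) * F N) \<partial>L)"
  proof (intro nn_integral_cong)
    fix N assume "N \<in> space L"
    then have N: "sets N = sets \<nu>" by (simp add: space_L)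
    have "(\<integral>\<^sup>+x. k x \<partial>N) = (\<integral>\<^sup>+x. (SUP i. u i x) \<partial>N)"
      using us sets_eq_imp_space_eq[OF N] by (intro nn_integral_cong) simp
    also have "\<dots> = (SUP i. \<integral>\<^sup>+x. u i x \<partial>N)"
      using ui by (intro nn_integral_monotone_convergence_SUP) (simp_all add: measurable_cong_sets[OF N refl])
    finally show "(\<integral>\<^sup>+x. k x \<partial>N) * F N = (SUP i. (\<integral>\<^sup>+x. u i x \<partial>N) * F N)"
      by (simp add: SUP_mult_right_ennreal)
  qed
  also have "\<dots> = (SUP i. \<integral>\<^sup>+N. (\<integral>\<^sup>+x. u i x \<partial>N) * F N \<partial>L)"
    by (intro nn_integral_monotone_convergence_SUP) (auto simp: incseq_def le_fun_def intro!: mult_right_mono mono)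
  also have "\<dots> = (SUP i. \<integral>\<^sup>+x. u i x * (\<integral>\<^sup>+N. F (add_measure N (return \<nu> x)) \<partial>L) \<partial>\<nu>)"
    using ufin by (intro SUP_cong refl mecke_finite) auto
  also have "\<dots> = (\<integral>\<^sup>+x. (SUP i. u i x * (\<integral>\<^sup>+N. F (add_measure N (return \<nu> x)) \<partial>L)) \<partial>\<nu>)"
    using ui by (intro nn_integral_monotone_convergence_SUP[symmetric]) (auto simp: incseq_def le_fun_def intro!: mult_right_mono)
  also have "\<dots> = (\<integral>\<^sup>+x. k x * (\<integral>\<^sup>+N. F (add_measure N (return \<nu> x)) \<partial>L) \<partial>\<nu>)"
    by (intro nn_integral_cong) (simp add: SUP_mult_right_ennreal[symmetric] us)
  finally show ?thesis .
qed

end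

text \<open>A partition of \<open>insert a I\<close> is determined by the block
  \<open>insert a X\<close> that contains a, together with a partition of \<open>I - X\<close>. This
  recursion is the one produced by iterating the Mecke equation.\<close>

lemma sum_partition_on_insert:
  fixes m :: "'i set \<Rightarrow> 'b :: comm_semiring_1"
  assumes I: "finite I" "a \<notin> I"
  shows "(\<Sum>p | partition_on (insert a I) p. \<Prod>C\<in>p. m C) =
    (\<Sum>X\<in>Pow I. m (insert a X) * (\<Sum>q | partition_on (I - X) q. \<Prod>C\<in>q. m C))"
proof -
  let ?S = "SIGMA X : Pow I. {q. partition_on (I - X) q}"
  let ?b = "\<lambda>(X, q). insert (insert a X) q"
  have fin: "finite {q. partition_on (I - X) q}" for X using I by (intro finitely_many_partition_on) auto
  have notin: "insert a X \<notin> q" if "partition_on (I - X) q" for X q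
    using that I by (auto simp: partition_on_def)
  have finq: "finite q" if "partition_on (I - X) q" for X q
    using that I finite_elements[of "I - X" q] by auto
  have "(\<Sum>X\<in>Pow I. m (insert a X) * (\<Sum>q | partition_on (I - X) q. \<Prod>C\<in>q. m C)) =
    (\<Sum>(X, q)\<in>?S. m (insert a X) * (\<Prod>C\<in>q. m C))"
    using I fin by (subst sum.Sigma[symmetric]) (auto simp: sum_distrib_left)
  also have "\<dots> = (\<Sum>z\<in>?S. \<Prod>C\<in>?b z. m C)"
    by (intro sum.cong refl) (auto simp: finq notin)
  also have "\<dots> = (\<Sum>p\<in>?b ` ?S. \<Prod>C\<in>p. m C)"
  proof (subst sum.reindex)
    show "inj_on ?b ?S"
    proof (rule inj_onI, clarsimp)
      fix X q X' q' assume *: "X \<subseteq> I" "partition_on (I - X) q" "X' \<subseteq> I" "partition_on (I - X') q'"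
        and eq: "insert (insert a X) q = insert (insert a X') q'"
      have na: "a \<notin> C" if "C \<in> q \<or> C \<in> q'" for C
        using that *(2,4) I by (auto simp: partition_on_def)
      have "insert a X = insert a X'" using eq na by (metis insertCI insertE)
      moreover have "X = insert a X - {a}" "X' = insert a X' - {a}" using * I by auto
      ultimately have X: "X = X'" by simp
      moreover have "q = q'" using eq notin[OF *(2)] notin[OF *(4)] unfolding X by (metis insert_ident)
      ultimately show "X = X' \<and> q = q'" ..
    qed
  qed simp
  also have "?b ` ?S = {p. partition_on (insert a I) p}"
  proof (intro equalityI subsetI)
    fix p assume "p \<in> ?b ` ?S"
    then obtain X q where Xq: "X \<subseteq> I" "partition_on (I - X) q" "p = insert (insert a X) q" by auto
    have "disjnt (insert a X) (\<Union>q)" using Xq I by (auto simp: partition_on_def disjnt_def)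
    from partition_on_insert[OF this, of "insert a I"] Xq I
    show "p \<in> {p. partition_on (insert a I) p}" by (auto simp: Diff_insert[symmetric] insert_Diff_if)
  next
    fix p assume "p \<in> {p. partition_on (insert a I) p}"
    then have p: "partition_on (insert a I) p" by simp
    then obtain C where C: "C \<in> p" "a \<in> C" by (auto simp: partition_on_def)
    have "disjnt C (\<Union>(p - {C}))" using p C by (auto simp: partition_on_def disjoint_def disjnt_def)
    from partition_on_insert[OF this, of "insert a I"]
    have "partition_on (insert a I - C) (p - {C})" using p C by (simp add: insert_absorb)
    moreover have "insert a I - C = I - (C - {a})" using C I by auto
    ultimately have q: "partition_on (I - (C - {a})) (p - {C})" by simp
    have "C - {a} \<subseteq> I" using p C by (auto simp: partition_on_def)
    then have "(C - {a}, p - {C}) \<in> ?S" using q by simp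
    moreover have "p = ?b (C - {a}, p - {C})" using C by (auto simp: insert_absorb)
    ultimately show "p \<in> ?b ` ?S" by (rule rev_image_eqI)
  qed
  finally show ?thesis ..
qed

context poisson
begin

text \<open>The Mecke equation applied to one factor a adds a point x to N. When the product of the
  other factors is expanded, the subset \<open>X\<close> of factors evaluated at x joins a in one
  block, and the remaining factors are left to the induction hypothesis; hence the induction over
  proper subsets.\<close>

lemma joint_moment:
  assumes sf: "sigma_finite_measure \<nu>" and "finite I"
    and f[measurable]: "f \<in> borel_measurable \<nu>" and k: "\<And>i. i \<in> I \<Longrightarrow> k i \<in> borel_measurable \<nu>"
  shows "(\<integral>\<^sup>+N. (\<Prod>i\<in>I. \<integral>\<^sup>+x. k i x \<partial>N) * ennreal (expn (\<integral>\<^sup>+x. f x \<partial>N)) \<partial>L) =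
    (\<Sum>p | partition_on I p. \<Prod>C\<in>p. \<integral>\<^sup>+x. (\<Prod>i\<in>C. k i x) * ennreal (expn (f x)) \<partial>\<nu>) *
    (\<integral>\<^sup>+N. expn (\<integral>\<^sup>+x. f x \<partial>N) \<partial>L)"
  using \<open>finite I\<close> k
proof (induction I rule: finite_psubset_induct)
  case (psubset I)
  let ?E = "\<integral>\<^sup>+N. expn (\<integral>\<^sup>+x. f x \<partial>N) \<partial>L"
  let ?m = "\<lambda>C. \<integral>\<^sup>+x. (\<Prod>i\<in>C. k i x) * ennreal (expn (f x)) \<partial>\<nu>"
  show ?case
  proof (cases "I = {}")
    case True
    then show ?thesis by (simp add: partition_on_empty)
  next
    case False
    then obtain a I' where I: "I = insert a I'" "a \<notin> I'" by (metis all_not_in_conv mk_disjoint_insert)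
    have fI: "finite I'" using psubset(1) I by simp
    have km[measurable]: "i \<in> I \<Longrightarrow> k i \<in> borel_measurable \<nu>" for i using psubset by auto
    have km'[measurable]: "i \<in> I' \<Longrightarrow> k i \<in> borel_measurable \<nu>" and ka[measurable]: "k a \<in> borel_measurable \<nu>" for i
      using I by auto
    let ?F = "\<lambda>N. (\<Prod>i\<in>I'. \<integral>\<^sup>+x. k i x \<partial>N) * ennreal (expn (\<integral>\<^sup>+x. f x \<partial>N))"
    have Fm: "?F \<in> borel_measurable (measure_algebra \<nu>)" by measurable
    have F: "(\<integral>\<^sup>+N. ?F (add_measure N (return \<nu> x)) \<partial>L) =
       (\<Sum>X\<in>Pow I'. (\<Prod>i\<in>X. k i x) * ennreal (expn (f x)) *
          ((\<Sum>q | partition_on (I' - X) q. \<Prod>C\<in>q. ?m C) * ?E))" if x: "x \<in> space \<nu>" for x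
    proof -
      have "(\<integral>\<^sup>+N. ?F (add_measure N (return \<nu> x)) \<partial>L) =
        (\<integral>\<^sup>+N. (\<Sum>X\<in>Pow I'. ((\<Prod>i\<in>X. k i x) * ennreal (expn (f x))) *
            ((\<Prod>i\<in>I' - X. \<integral>\<^sup>+x. k i x \<partial>N) * ennreal (expn (\<integral>\<^sup>+x. f x \<partial>N)))) \<partial>L)"
      proof (intro nn_integral_cong)
        fix N assume "N \<in> space L"
        then have N: "sets N = sets \<nu>" by (simp add: space_L)
        have *: "(\<integral>\<^sup>+x. g x \<partial>add_measure N (return \<nu> x)) = g x + (\<integral>\<^sup>+x. g x \<partial>N)"
          if "g \<in> borel_measurable \<nu>" for g
          using that x by (subst nn_integral_add_measure) (simp_all add: N measurable_cong_sets[OF N refl] nn_integral_return add.commute)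
        have "?F (add_measure N (return \<nu> x)) =
          (\<Prod>i\<in>I'. k i x + (\<integral>\<^sup>+x. k i x \<partial>N)) * ennreal (expn (f x + (\<integral>\<^sup>+x. f x \<partial>N)))"
          by (simp add: * km')
        also have "\<dots> = (\<Sum>X\<in>Pow I'. (\<Prod>i\<in>X. k i x) * (\<Prod>i\<in>I' - X. \<integral>\<^sup>+x. k i x \<partial>N)) *
            ennreal (expn (f x + (\<integral>\<^sup>+x. f x \<partial>N)))"
          by (simp add: prod_add[OF fI])
        also have "\<dots> = (\<Sum>X\<in>Pow I'. ((\<Prod>i\<in>X. k i x) * ennreal (expn (f x))) *
            ((\<Prod>i\<in>I' - X. \<integral>\<^sup>+x. k i x \<partial>N) * ennreal (expn (\<integral>\<^sup>+x. f x \<partial>N))))"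
          unfolding sum_distrib_right by (intro sum.cong refl) (simp add: expn_add ennreal_mult mult_ac)
        finally show "?F (add_measure N (return \<nu> x)) = \<dots>" .
      qed
      also have "\<dots> = (\<Sum>X\<in>Pow I'. ((\<Prod>i\<in>X. k i x) * ennreal (expn (f x))) *
          (\<integral>\<^sup>+N. (\<Prod>i\<in>I' - X. \<integral>\<^sup>+x. k i x \<partial>N) * ennreal (expn (\<integral>\<^sup>+x. f x \<partial>N)) \<partial>L))"
      proof -
        have mm: "(\<lambda>N. (\<Prod>i\<in>I' - X. \<integral>\<^sup>+x. k i x \<partial>N) * ennreal (expn (\<integral>\<^sup>+x. f x \<partial>N))) \<in> borel_measurable L" for X
          using km' by measurable
        then show ?thesis
          by (subst nn_integral_sum) (auto intro!: sum.cong nn_integral_cmult borel_measurable_times)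
      qed
      also have "\<dots> = (\<Sum>X\<in>Pow I'. (\<Prod>i\<in>X. k i x) * ennreal (expn (f x)) *
          ((\<Sum>q | partition_on (I' - X) q. \<Prod>C\<in>q. ?m C) * ?E))"
        using I by (intro sum.cong arg_cong2[of _ _ _ _ "(*)"] refl psubset.IH) auto
      finally show ?thesis .
    qed
    have fX: "finite X" "a \<notin> X" if "X \<in> Pow I'" for X using that fI I finite_subset by auto
    have "(\<integral>\<^sup>+N. (\<Prod>i\<in>I. \<integral>\<^sup>+x. k i x \<partial>N) * ennreal (expn (\<integral>\<^sup>+x. f x \<partial>N)) \<partial>L) =
      (\<integral>\<^sup>+N. (\<integral>\<^sup>+x. k a x \<partial>N) * ?F N \<partial>L)"
      using fI I by (simp add: mult_ac)
    also have "\<dots> = (\<integral>\<^sup>+x. k a x * (\<integral>\<^sup>+N. ?F (add_measure N (return \<nu> x)) \<partial>L) \<partial>\<nu>)"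
      by (rule mecke[OF sf ka Fm])
    also have "\<dots> = (\<integral>\<^sup>+x. (\<Sum>X\<in>Pow I'. ((\<Prod>i\<in>insert a X. k i x) * ennreal (expn (f x))) *
          ((\<Sum>q | partition_on (I' - X) q. \<Prod>C\<in>q. ?m C) * ?E)) \<partial>\<nu>)"
    proof (intro nn_integral_cong)
      fix x assume x: "x \<in> space \<nu>"
      show "k a x * (\<integral>\<^sup>+N. ?F (add_measure N (return \<nu> x)) \<partial>L) =
        (\<Sum>X\<in>Pow I'. ((\<Prod>i\<in>insert a X. k i x) * ennreal (expn (f x))) *
          ((\<Sum>q | partition_on (I' - X) q. \<Prod>C\<in>q. ?m C) * ?E))"
        unfolding F[OF x] sum_distrib_left[of "k a x"]
        by (intro sum.cong refl) (simp add: fX mult.assoc)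
    qed
    also have "\<dots> = (\<Sum>X\<in>Pow I'. ?m (insert a X) * ((\<Sum>q | partition_on (I' - X) q. \<Prod>C\<in>q. ?m C) * ?E))"
    proof (subst nn_integral_sum)
      have m: "(\<lambda>x. (\<Prod>i\<in>insert a X. k i x) * ennreal (expn (f x))) \<in> borel_measurable \<nu>" if "X \<in> Pow I'" for X
      proof -
        have [measurable]: "k i \<in> borel_measurable \<nu>" if "i \<in> insert a X" for i
          using that \<open>X \<in> Pow I'\<close> I km by auto
        show ?thesis by measurable
      qed
      show "(\<lambda>x. (\<Prod>i\<in>insert a X. k i x) * ennreal (expn (f x)) *
          ((\<Sum>q | partition_on (I' - X) q. \<Prod>C\<in>q. ?m C) * ?E)) \<in> borel_measurable \<nu>" if "X \<in> Pow I'" for X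
        by (rule borel_measurable_times_ennreal[OF m[OF that] borel_measurable_const])
      show "(\<Sum>X\<in>Pow I'. \<integral>\<^sup>+x. (\<Prod>i\<in>insert a X. k i x) * ennreal (expn (f x)) *
          ((\<Sum>q | partition_on (I' - X) q. \<Prod>C\<in>q. ?m C) * ?E) \<partial>\<nu>) =
        (\<Sum>X\<in>Pow I'. ?m (insert a X) * ((\<Sum>q | partition_on (I' - X) q. \<Prod>C\<in>q. ?m C) * ?E))"
        by (intro sum.cong refl nn_integral_multc m)
    qed
    also have "\<dots> = (\<Sum>p | partition_on I p. \<Prod>C\<in>p. ?m C) * ?E"
      unfolding I(1) sum_partition_on_insert[OF fI I(2)] by (simp add: sum_distrib_right mult.assoc)
    finally show ?thesis .
  qed
qed

end

section \<open>Mixtures of measures\<close>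

text \<open>\<open>K\<close> is only required to have the values of a mixture, so that the rule also
  applies to the intensity and its marginal, which are not built by \<open>mixture\<close>.\<close>

lemma nn_integral_mixture_eq:
  assumes Q: "Q \<in> m \<rightarrow>\<^sub>M measure_algebra S" and K: "sets K = sets S"
    and eq: "\<And>A. A \<in> sets S \<Longrightarrow> emeasure K A = (\<integral>\<^sup>+v. emeasure (Q v) A \<partial>m)"
    and f: "f \<in> borel_measurable S"
  shows "(\<integral>\<^sup>+x. f x \<partial>K) = (\<integral>\<^sup>+v. \<integral>\<^sup>+x. f x \<partial>Q v \<partial>m)"
proof -
  have sQ: "sets (Q v) = sets S" if "v \<in> space m" for v
    using measurable_space[OF Q that] by (simp add: space_measure_algebra)
  have mQ: "measurable (Q v) borel = measurable S (borel :: ennreal measure)" if "v \<in> space m" for v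
    by (rule measurable_cong_sets[OF sQ[OF that] refl])
  have spQ: "space (Q v) = space S" if "v \<in> space m" for v
    by (rule sets_eq_imp_space_eq[OF sQ[OF that]])
  have mK: "measurable K borel = measurable S (borel :: ennreal measure)"
    by (rule measurable_cong_sets[OF K refl])
  have spK: "space K = space S" by (rule sets_eq_imp_space_eq[OF K])
  have mi: "(\<lambda>v. \<integral>\<^sup>+x. f x \<partial>Q v) \<in> borel_measurable m" if "f \<in> borel_measurable S" for f
    using measurable_compose[OF Q nn_integral_measurable_measure_algebra[OF that]] .
  show ?thesis
    using f
  proof (induction rule: borel_measurable_induct)
    case (cong f g)
    have "(\<integral>\<^sup>+x. f x \<partial>K) = (\<integral>\<^sup>+x. g x \<partial>K)" using cong by (intro nn_integral_cong) (simp add: spK)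
    moreover have "(\<integral>\<^sup>+v. \<integral>\<^sup>+x. f x \<partial>Q v \<partial>m) = (\<integral>\<^sup>+v. \<integral>\<^sup>+x. g x \<partial>Q v \<partial>m)"
      using cong by (intro nn_integral_cong) (simp add: spQ)
    ultimately show ?case using cong by simp
  next
    case (set A)
    have "(\<integral>\<^sup>+v. \<integral>\<^sup>+x. indicator A x \<partial>Q v \<partial>m) = (\<integral>\<^sup>+v. emeasure (Q v) A \<partial>m)"
      using set by (intro nn_integral_cong) (simp add: sQ)
    then show ?case using set by (simp add: K eq)
  next
    case (mult u c)
    have "(\<integral>\<^sup>+v. \<integral>\<^sup>+x. c * u x \<partial>Q v \<partial>m) = (\<integral>\<^sup>+v. c * \<integral>\<^sup>+x. u x \<partial>Q v \<partial>m)"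
      using mult by (intro nn_integral_cong nn_integral_cmult) (simp add: mQ)
    then show ?case using mult by (simp add: nn_integral_cmult mK mi)
  next
    case (add u v)
    have "(\<integral>\<^sup>+w. \<integral>\<^sup>+x. v x + u x \<partial>Q w \<partial>m) = (\<integral>\<^sup>+w. (\<integral>\<^sup>+x. v x \<partial>Q w) + (\<integral>\<^sup>+x. u x \<partial>Q w) \<partial>m)"
      using add by (intro nn_integral_cong nn_integral_add) (simp_all add: mQ)
    then show ?case using add by (simp add: nn_integral_add mK mi)
  next
    case (seq U)
    have inc: "incseq (\<lambda>i. \<integral>\<^sup>+x. U i x \<partial>L)" for L
      using seq(3) by (auto simp: incseq_def le_fun_def intro!: nn_integral_mono)
    have "(\<integral>\<^sup>+x. (SUP i. U i) x \<partial>K) = (SUP i. \<integral>\<^sup>+x. U i x \<partial>K)"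
      unfolding SUP_apply using seq by (intro nn_integral_monotone_convergence_SUP) (simp_all add: mK)
    also have "\<dots> = (SUP i. \<integral>\<^sup>+v. \<integral>\<^sup>+x. U i x \<partial>Q v \<partial>m)"
      using seq by simp
    also have "\<dots> = (\<integral>\<^sup>+v. (SUP i. \<integral>\<^sup>+x. U i x \<partial>Q v) \<partial>m)"
      using seq inc by (intro nn_integral_monotone_convergence_SUP[symmetric]) (auto simp: incseq_def le_fun_def intro!: mi)
    also have "\<dots> = (\<integral>\<^sup>+v. \<integral>\<^sup>+x. (SUP i. U i) x \<partial>Q v \<partial>m)"
      unfolding SUP_apply using seq by (intro nn_integral_cong nn_integral_monotone_convergence_SUP[symmetric]) (simp_all add: mQ)
    finally show ?case .
  qed
qed

lemma sets_mixture [simp]: "sets (mixture S m Q) = sets S"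
  and space_mixture [simp]: "space (mixture S m Q) = space S"
  by (simp_all add: mixture_def)

lemma mixture_cong_AE:
  assumes "AE v in m. Q v = Q' v"
  shows "mixture S m Q = mixture S m Q'"
proof -
  have "(\<integral>\<^sup>+v. emeasure (Q v) A \<partial>m) = (\<integral>\<^sup>+v. emeasure (Q' v) A \<partial>m)" for A
    using assms by (intro nn_integral_cong_AE) auto
  then show ?thesis by (simp add: mixture_def)
qed

lemma emeasure_mixture:
  assumes Q: "Q \<in> m \<rightarrow>\<^sub>M measure_algebra S" and A: "A \<in> sets S"
  shows "emeasure (mixture S m Q) A = (\<integral>\<^sup>+v. emeasure (Q v) A \<partial>m)"
  unfolding mixture_def
proof (rule emeasure_measure_of_sigma)
  have sQ: "sets (Q v) = sets S" if "v \<in> space m" for v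
    using measurable_space[OF Q that] by (simp add: space_measure_algebra)
  show "countably_additive (sets S) (\<lambda>A. \<integral>\<^sup>+v. emeasure (Q v) A \<partial>m)"
  proof (rule countably_additiveI)
    fix A :: "nat \<Rightarrow> _" assume A: "range A \<subseteq> sets S" "disjoint_family A" "(\<Union>i. A i) \<in> sets S"
    then have "(\<Sum>i. \<integral>\<^sup>+v. emeasure (Q v) (A i) \<partial>m) = (\<integral>\<^sup>+v. (\<Sum>i. emeasure (Q v) (A i)) \<partial>m)"
      using measurable_compose[OF Q measurable_emeasure_measure_algebra]
      by (intro nn_integral_suminf[symmetric]) auto
    also have "\<dots> = (\<integral>\<^sup>+v. emeasure (Q v) (\<Union>i. A i) \<partial>m)"
      using A sQ by (intro nn_integral_cong suminf_emeasure) auto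
    finally show "(\<Sum>i. \<integral>\<^sup>+v. emeasure (Q v) (A i) \<partial>m) = (\<integral>\<^sup>+v. emeasure (Q v) (\<Union>i. A i) \<partial>m)" .
  qed
qed (use A in \<open>auto simp: positive_def sets.sigma_algebra_axioms\<close>)

lemma nn_integral_mixture:
  assumes "Q \<in> m \<rightarrow>\<^sub>M measure_algebra S" "f \<in> borel_measurable S"
  shows "(\<integral>\<^sup>+x. f x \<partial>mixture S m Q) = (\<integral>\<^sup>+v. \<integral>\<^sup>+x. f x \<partial>Q v \<partial>m)"
  by (rule nn_integral_mixture_eq[OF assms(1) sets_mixture emeasure_mixture[OF assms(1)] assms(2)])

lemma measurable_measure_algebra_of_prob_algebra:
  "Q \<in> m \<rightarrow>\<^sub>M prob_algebra S \<Longrightarrow> Q \<in> m \<rightarrow>\<^sub>M measure_algebra S"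
  by (intro measurable_measure_algebra)
    (auto dest: measurable_prob_algebraD measurable_emeasure_kernel sets_kernel)

text \<open>Transfers a posterior mixture for N to one for a functional of N, component by
  component.\<close>

lemma distr_mixture:
  assumes Q: "Q \<in> m \<rightarrow>\<^sub>M measure_algebra S" and g[measurable]: "g \<in> S \<rightarrow>\<^sub>M S'"
  shows "distr (mixture S m Q) S' g = mixture S' m (\<lambda>v. distr (Q v) S' g)"
proof (rule measure_eqI)
  have sQ: "sets (Q v) = sets S" if "v \<in> space m" for v
    using measurable_space[OF Q that] by (simp add: space_measure_algebra)
  have gQ: "g \<in> Q v \<rightarrow>\<^sub>M S'" if "v \<in> space m" for v
    using g measurable_cong_sets[OF sQ[OF that] refl] by blast
  have spQ: "space (Q v) = space S" if "v \<in> space m" for v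
    by (rule sets_eq_imp_space_eq[OF sQ[OF that]])
  have Q': "(\<lambda>v. distr (Q v) S' g) \<in> m \<rightarrow>\<^sub>M measure_algebra S'"
  proof (rule measurable_measure_algebra)
    fix A assume A: "A \<in> sets S'"
    have "(\<lambda>v. emeasure (Q v) (g -` A \<inter> space S)) \<in> borel_measurable m"
      using measurable_sets[OF g A] by (intro measurable_compose[OF Q measurable_emeasure_measure_algebra])
    then show "(\<lambda>v. emeasure (distr (Q v) S' g) A) \<in> borel_measurable m"
      by (rule measurable_cong[THEN iffD2, rotated]) (simp add: emeasure_distr gQ A spQ)
  qed simp
  fix A assume "A \<in> sets (distr (mixture S m Q) S' g)"
  then have A: "A \<in> sets S'" by simp
  have "g \<in> mixture S m Q \<rightarrow>\<^sub>M S'" using g measurable_cong_sets[OF sets_mixture refl] by blast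
  then show "emeasure (distr (mixture S m Q) S' g) A = emeasure (mixture S' m (\<lambda>v. distr (Q v) S' g)) A"
    using measurable_sets[OF g A] A
    by (simp add: emeasure_distr emeasure_mixture[OF Q] emeasure_mixture[OF Q'] gQ spQ cong: nn_integral_cong)
qed simp

section \<open>The random measures\<close>

lemma measurable_fst_borel [measurable]:
    "fst \<in> borel_measurable (borel :: ('a::second_countable_topology \<times> 'b::second_countable_topology) measure)"
  and measurable_snd_borel [measurable]:
    "snd \<in> borel_measurable (borel :: ('a::second_countable_topology \<times> 'b::second_countable_topology) measure)"
  by (simp_all add: borel_prod[symmetric])

lemma sets_mu_of [simp]: "sets (mu_of h N) = sets borel" and space_mu_of [simp]: "space (mu_of h N) = UNIV"
  by (simp_all add: mu_of_def)

lemma sets_normalize_measure [simp]: "sets (normalize_measure M) = sets M"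
  and space_normalize_measure [simp]: "space (normalize_measure M) = space M"
  by (simp_all add: normalize_measure_def space_scale_measure)

lemma emeasure_normalize_measure:
  "emeasure (normalize_measure M) A = inverse (emeasure M (space M)) * emeasure M A"
  by (simp add: normalize_measure_def)

lemma sets_P_of [simp]: "sets (P_of h N) = sets borel" and space_P_of [simp]: "space (P_of h N) = UNIV"
  by (simp_all add: P_of_def)

lemma emeasure_P_of: "emeasure (P_of h N) A = inverse (total_mass h N) * emeasure (mu_of h N) A"
  by (simp add: P_of_def emeasure_normalize_measure total_mass_def)

context
  fixes h :: "'s::polish_space \<Rightarrow> real"
  assumes h [measurable]: "h \<in> borel_measurable borel"
begin

lemma emeasure_mu_of:
  fixes N :: "('s \<times> 'y::polish_space) measure"
  assumes N: "sets N = sets borel" and A: "A \<in> sets borel"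
  shows "emeasure (mu_of h N) A = (\<integral>\<^sup>+x. ennreal (h (fst x)) * indicator A (snd x) \<partial>N)"
proof -
  have m: "measurable N M = measurable borel M" for M :: "'z measure" by (rule measurable_cong_sets[OF N refl])
  have [measurable]: "(\<lambda>x. ennreal (h (fst x))) \<in> borel_measurable N" "(\<lambda>(s, y). ennreal (h s)) \<in> borel_measurable N"
    by (simp_all add: measurable_cong_sets[OF N refl] split_beta')
  have [measurable]: "snd \<in> N \<rightarrow>\<^sub>M borel" by (simp add: measurable_cong_sets[OF N refl])
  have [measurable]: "snd -` A \<in> sets N"
    using measurable_sets[OF measurable_snd_borel A] by (simp add: N)
  have "emeasure (mu_of h N) A = emeasure (density N (\<lambda>(s, y). ennreal (h s))) (snd -` A)"
    unfolding mu_of_def using A sets_eq_imp_space_eq[OF N] by (subst emeasure_distr) auto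
  also have "\<dots> = (\<integral>\<^sup>+x. (case x of (s, y) \<Rightarrow> ennreal (h s)) * indicator (snd -` A) x \<partial>N)"
    by (rule emeasure_density) measurable
  also have "\<dots> = (\<integral>\<^sup>+x. ennreal (h (fst x)) * indicator A (snd x) \<partial>N)"
    by (intro nn_integral_cong) (auto simp: indicator_def)
  finally show ?thesis .
qed

lemma total_mass_eq:
  fixes N :: "('s \<times> 'y::polish_space) measure"
  assumes N: "sets N = sets borel"
  shows "total_mass h N = (\<integral>\<^sup>+x. ennreal (h (fst x)) \<partial>N)"
  unfolding total_mass_def by (subst emeasure_mu_of[OF N]) auto

lemma measurable_mu_of [measurable]:
  "mu_of h \<in> measure_algebra (borel :: ('s \<times> 'y::polish_space) measure) \<rightarrow>\<^sub>M measure_algebra borel"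
proof (rule measurable_measure_algebra)
  fix A :: "'y set" assume A[measurable]: "A \<in> sets borel"
  have "(\<lambda>N :: ('s \<times> 'y) measure. \<integral>\<^sup>+x. ennreal (h (fst x)) * indicator A (snd x) \<partial>N) \<in> borel_measurable (measure_algebra borel)"
    by measurable
  then show "(\<lambda>N :: ('s \<times> 'y) measure. emeasure (mu_of h N) A) \<in> borel_measurable (measure_algebra borel)"
    by (rule measurable_cong[THEN iffD2, rotated]) (simp add: space_measure_algebra emeasure_mu_of A)
qed simp

lemma measurable_total_mass [measurable]:
  "total_mass h \<in> borel_measurable (measure_algebra (borel :: ('s \<times> 'y::polish_space) measure))"
  unfolding total_mass_def by (rule measurable_compose[OF measurable_mu_of]) simp

lemma measurable_P_of [measurable]:
  "P_of h \<in> measure_algebra (borel :: ('s \<times> 'y::polish_space) measure) \<rightarrow>\<^sub>M measure_algebra borel"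
proof (rule measurable_measure_algebra)
  fix A :: "'y set" assume A[measurable]: "A \<in> sets borel"
  have "(\<lambda>N :: ('s \<times> 'y) measure. emeasure (mu_of h N) A) \<in> borel_measurable (measure_algebra borel)"
    by (rule measurable_compose[OF measurable_mu_of]) simp
  then show "(\<lambda>N :: ('s \<times> 'y) measure. emeasure (P_of h N) A) \<in> borel_measurable (measure_algebra borel)"
    unfolding emeasure_P_of by measurable
qed simp

end

lemma prob_space_P_of: "0 < total_mass h N \<Longrightarrow> total_mass h N < \<infinity> \<Longrightarrow> prob_space (P_of h N)"
  using ennreal_divide_self[of "total_mass h N"]
  by (intro prob_spaceI) (simp add: emeasure_P_of divide_ennreal_def mult.commute flip: total_mass_def)

section \<open>The intensity measure\<close>

text \<open>One power of x is bounded by (1 + x) * (1 - exp (- x)), and the exponential absorbs the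
  remaining powers. With x = h(s) this makes all tilted moments of order at least 1 finite, because
  1 - exp (- h) is integrable against the intensity.\<close>

lemma exp_moment_bound:
  assumes v: "0 < v" and m: "1 \<le> m"
  obtains c :: real where "0 \<le> c" "\<And>x. 0 \<le> x \<Longrightarrow> x ^ m * exp (- v * x) \<le> c * (1 - exp (- x))"
proof -
  \<comment> \<open>(v * x)^k / k! is a single term of the series of exp (v * x), whose terms are
    all nonnegative.\<close>
  have b: "x ^ k * exp (- v * x) \<le> fact k / v ^ k" if "0 \<le> x" for x k
  proof -
    have "(v * x) ^ k / fact k \<le> exp (v * x)"
      using exp_lower_Taylor_quadratic that v
        sums_le[OF _ sums_single[of k "\<lambda>n. (v * x) ^ n /\<^sub>R fact n"] exp_converges[of "v * x"]]
      by (auto simp: field_simps)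
    then show ?thesis using v by (simp add: exp_minus field_simps power_mult_distrib)
  qed
  obtain k where k: "m = Suc k" using m by (cases m) auto
  have "x ^ m * exp (- v * x) \<le> (fact k / v ^ k + fact m / v ^ m) * (1 - exp (- x))" if x: "0 \<le> x" for x
  proof -
    have "exp (- x) \<le> 1 / (1 + x)"
      using exp_ge_add_one_self[of x] x by (simp add: exp_minus field_simps)
    then have "x \<le> (1 + x) * (1 - exp (- x))" using x by (simp add: field_simps)
    then have "x ^ m * exp (- v * x) \<le> x ^ k * exp (- v * x) * ((1 + x) * (1 - exp (- x)))"
      using mult_left_mono[of x "(1 + x) * (1 - exp (- x))" "x ^ k * exp (- v * x)"] x unfolding k by (simp add: mult_ac)
    also have "\<dots> = (x ^ k * exp (- v * x) + x ^ m * exp (- v * x)) * (1 - exp (- x))"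
      unfolding k by (simp add: algebra_simps)
    also have "\<dots> \<le> (fact k / v ^ k + fact m / v ^ m) * (1 - exp (- x))"
      using x by (intro mult_right_mono add_mono b) auto
    finally show ?thesis .
  qed
  then show thesis using v by (intro that[of "fact k / v ^ k + fact m / v ^ m"]) auto
qed

locale poisson_model =
  fixes \<eta> :: "'y::polish_space measure"
    and \<rho> :: "'y \<Rightarrow> 's::polish_space measure"
    and h :: "'s \<Rightarrow> real"
    and PN :: "('s \<times> 'y) measure measure"
  assumes sets_eta: "sets \<eta> = sets borel" and sigma_finite_eta: "sigma_finite_measure \<eta>"
    and kernel: "sigma_finite_kernel \<rho>"
    and h_measurable [measurable]: "h \<in> borel_measurable borel" and h_pos: "\<And>s. 0 < h s"
    and law: "is_poisson_law (intensity \<rho> \<eta>) PN"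
    and total_mass_AE: "AE m in PN. 0 < total_mass h m \<and> total_mass h m < \<infinity>"
begin

abbreviation "\<nu> \<equiv> intensity \<rho> \<eta>"

lemma sets_nu: "sets \<nu> = sets borel" and space_nu: "space \<nu> = UNIV"
  using sets.sigma_sets_eq[of "borel :: ('s \<times> 'y) measure"] by (simp_all add: intensity_def space_measure_of_conv)

lemma measurable_nu: "measurable \<nu> K = measurable borel K"
  by (rule measurable_cong_sets[OF sets_nu refl])

lemma measurable_eta: "measurable \<eta> K = measurable borel K"
  by (rule measurable_cong_sets[OF sets_eta refl])

lemma space_eta: "space \<eta> = UNIV"
  using sets_eq_imp_space_eq[OF sets_eta] by simp

lemma measure_algebra_nu: "measure_algebra \<nu> = measure_algebra borel"
  by (rule measure_algebra_cong[OF sets_nu])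

sublocale PN: poisson \<nu> PN by standard (rule law)

lemma sets_PN: "sets PN = sets (measure_algebra borel)"
  using PN.sets_L by (simp add: measure_algebra_nu)

lemma space_PN: "space PN = {N. sets N = sets borel}"
  using PN.space_L by (simp add: sets_nu)

lemma measurable_PN: "measurable PN K = measurable (measure_algebra borel) K"
  by (rule measurable_cong_sets[OF sets_PN refl])

text \<open>A vanishing exponent would give exp (- T) the expectation 1, so T = 0 almost surely,
  against the positivity of T. The conclusion also excludes that the intensity is the zero
  measure.\<close>

lemma laplace_h_neq_0: "(\<integral>\<^sup>+x. ennreal (1 - expn (ennreal (h (fst x)))) \<partial>\<nu>) \<noteq> 0"
proof
  assume "(\<integral>\<^sup>+x. ennreal (1 - expn (ennreal (h (fst x)))) \<partial>\<nu>) = 0"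
  have [measurable]: "(\<lambda>x. ennreal (h (fst x))) \<in> borel_measurable \<nu>" unfolding measurable_nu by measurable
  have "(\<integral>\<^sup>+N. expn (\<integral>\<^sup>+x. ennreal (h (fst x)) \<partial>N) \<partial>PN) = 1"
    by (subst poisson_laplace[OF law]) (auto simp: \<open>_ = 0\<close>)
  then have "(\<integral>\<^sup>+N. ennreal (1 - expn (\<integral>\<^sup>+x. ennreal (h (fst x)) \<partial>N)) \<partial>PN) = 0"
    by (simp add: ennreal_minus[symmetric] nn_integral_diff PN.L.emeasure_space_1 del: ennreal_minus)
  then have "AE N in PN. ennreal (1 - expn (\<integral>\<^sup>+x. ennreal (h (fst x)) \<partial>N)) = 0"
    by (subst (asm) nn_integral_0_iff_AE) auto
  with total_mass_AE AE_space have "AE N in PN. False"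
  proof eventually_elim
    case (elim N)
    then show ?case
      using expn_less_1_iff[of "total_mass h N"] by (auto simp: space_PN total_mass_eq[OF h_measurable])
  qed
  then show False by simp
qed

text \<open>A \<open>measure_of\<close> whose set function fails to be a measure is the zero measure. For the intensity
  this is ruled out by the positivity of the total mass.\<close>

lemma nu_measure_space: "measure_space UNIV (sets borel) (\<lambda>B. \<integral>\<^sup>+y. emeasure (\<rho> y) {s. (s, y) \<in> B} \<partial>\<eta>)"
proof (rule ccontr)
  assume "\<not> ?thesis"
  then have 0: "emeasure \<nu> B = 0" for B
    using sets.sigma_sets_eq[of "borel :: ('s \<times> 'y) measure"] by (simp add: intensity_def emeasure_measure_of_conv)
  have *: "AE x in \<nu>. P x" for P by (rule AE_I'[of UNIV]) (auto simp: null_sets_def 0 sets_nu)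
  have "(\<integral>\<^sup>+x. ennreal (1 - expn (ennreal (h (fst x)))) \<partial>\<nu>) = (\<integral>\<^sup>+x. 0 \<partial>\<nu>)"
    by (intro nn_integral_cong_AE *)
  then show False using laplace_h_neq_0 by simp
qed

lemma emeasure_nu: "B \<in> sets borel \<Longrightarrow> emeasure \<nu> B = (\<integral>\<^sup>+y. emeasure (\<rho> y) {s. (s, y) \<in> B} \<partial>\<eta>)"
  using nu_measure_space sets.sigma_sets_eq[of "borel :: ('s \<times> 'y) measure"]
  by (simp add: intensity_def emeasure_measure_of_conv)

text \<open>The integrand of the Laplace exponent of T at 1, so that almost sure finiteness of T
  makes it integrable against \<open>\<nu>\<close>. As it is positive, it serves as the reference
  weight for all later bounds.\<close>

definition g :: "'s \<Rightarrow> real" where "g s = 1 - exp (- h s)"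

lemma g_measurable [measurable]: "g \<in> borel_measurable borel" unfolding g_def by measurable

lemma g_pos: "0 < g s" and g_less_1: "g s < 1" using h_pos[of s] by (auto simp: g_def)

lemma g_integrable: "(\<integral>\<^sup>+x. ennreal (g (fst x)) \<partial>\<nu>) < \<infinity>"
proof -
  have "AE N in PN. (\<integral>\<^sup>+x. ennreal (h (fst x)) \<partial>N) < \<infinity>"
    using total_mass_AE AE_space by eventually_elim (auto simp: space_PN total_mass_eq[OF h_measurable])
  from poisson_laplace_pos[OF law _ this] show ?thesis
    using h_pos by (simp add: measurable_nu g_def expn_ennreal less_imp_le)
qed

lemma sets_rho: "sets (\<rho> y) = sets borel" using kernel by (auto simp: sigma_finite_kernel_def)

lemma space_rho: "space (\<rho> y) = UNIV" using sets_eq_imp_space_eq[OF sets_rho] by simp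

lemma measurable_rho: "measurable (\<rho> y) K = measurable borel K"
  by (rule measurable_cong_sets[OF sets_rho refl])

lemma rho_kernel: "\<rho> \<in> borel \<rightarrow>\<^sub>M measure_algebra borel"
  using kernel by (intro measurable_measure_algebra) (auto simp: sigma_finite_kernel_def)

definition g_mass :: "'y \<Rightarrow> ennreal" where "g_mass y = (\<integral>\<^sup>+s. ennreal (g s) \<partial>\<rho> y)"

lemma g_mass_measurable [measurable]: "g_mass \<in> borel_measurable borel"
  unfolding g_mass_def by (rule measurable_compose[OF rho_kernel]) measurable

text \<open>Computed on the first marginal of \<open>\<nu>\<close>, where the assumed measurability
  of \<open>emeasure (\<rho> y) A\<close> in y suffices. The disintegration of general integrals
  over \<open>\<nu>\<close> relies on this fact and is not yet available.\<close>

lemma g_mass_finite_AE: "AE y in \<eta>. g_mass y < \<infinity>"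
proof -
  have sp: "fst -` A \<in> sets (borel :: ('s \<times> 'y) measure)" if "A \<in> sets borel" for A
    using measurable_sets[OF measurable_fst_borel that] by simp
  have fst_nu: "fst \<in> \<nu> \<rightarrow>\<^sub>M borel" unfolding measurable_nu by measurable
  have em: "emeasure (distr \<nu> borel fst) A = (\<integral>\<^sup>+y. emeasure (\<rho> y) A \<partial>\<eta>)" if "A \<in> sets borel" for A
    using that sp[OF that] by (simp add: emeasure_distr[OF fst_nu] space_nu emeasure_nu)
  have "(\<integral>\<^sup>+y. g_mass y \<partial>\<eta>) = (\<integral>\<^sup>+s. ennreal (g s) \<partial>distr \<nu> borel fst)"
    unfolding g_mass_def
    by (rule nn_integral_mixture_eq[symmetric, where S=borel]) (use rho_kernel em in \<open>auto simp: measurable_eta\<close>)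
  also have "\<dots> = (\<integral>\<^sup>+x. ennreal (g (fst x)) \<partial>\<nu>)" by (rule nn_integral_distr[OF fst_nu]) simp
  finally have "(\<integral>\<^sup>+y. g_mass y \<partial>\<eta>) \<noteq> \<infinity>" using g_integrable by simp
  from nn_integral_noteq_infinite[OF _ this] show ?thesis
    by (simp add: measurable_eta less_top)
qed

text \<open>Positivity of \<open>g\<close> leaves the null measure as the only possibility for
  \<open>\<rho> y\<close>.\<close>

lemma g_mass_0: "g_mass y = 0 \<Longrightarrow> (\<integral>\<^sup>+s. f s \<partial>\<rho> y) = 0"
proof -
  assume "g_mass y = 0"
  then have "AE s in \<rho> y. ennreal (g s) = 0"
    unfolding g_mass_def by (subst (asm) nn_integral_0_iff_AE) (simp_all add: measurable_rho)
  then have "AE s in \<rho> y. f s = 0"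
  proof eventually_elim
    case (elim s)
    then show ?case using g_pos[of s] by (simp add: ennreal_eq_0_iff)
  qed
  then show ?thesis by (subst nn_integral_cong_AE[where v="\<lambda>_. 0"]) auto
qed

text \<open>The normalized kernel \<open>g(s) \<rho>(ds|y) / g_mass y\<close>; it turns statements about the kernel \<open>\<rho>\<close>,
  which is only sigma-finite, into statements about probability kernels.\<close>

definition g_kernel :: "'y \<Rightarrow> 's measure" where
  "g_kernel y = (if 0 < g_mass y \<and> g_mass y < \<infinity> then density (\<rho> y) (\<lambda>s. ennreal (g s) / g_mass y) else return borel undefined)"

lemma g_kernel_kernel: "g_kernel \<in> borel \<rightarrow>\<^sub>M prob_algebra borel"
proof (rule measurable_prob_algebraI)
  have *: "emeasure (g_kernel y) A = (if 0 < g_mass y \<and> g_mass y < \<infinity> then (\<integral>\<^sup>+s. ennreal (g s) * indicator A s \<partial>\<rho> y) / g_mass y else indicator A undefined)"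
    if A: "A \<in> sets borel" for A y
  proof (cases "0 < g_mass y \<and> g_mass y < \<infinity>")
    case True
    have [measurable]: "A \<in> sets (\<rho> y)" "(\<lambda>s. ennreal (g s)) \<in> borel_measurable (\<rho> y)"
      using A by (simp_all add: sets_rho measurable_rho)
    have "emeasure (g_kernel y) A = (\<integral>\<^sup>+s. ennreal (g s) / g_mass y * indicator A s \<partial>\<rho> y)"
      using True unfolding g_kernel_def by (simp add: emeasure_density)
    also have "\<dots> = (\<integral>\<^sup>+s. (ennreal (g s) * indicator A s) / g_mass y \<partial>\<rho> y)"
      by (intro nn_integral_cong) (simp add: divide_ennreal_def mult_ac)
    finally show ?thesis using True by (simp add: nn_integral_divide)
  qed (use A in \<open>auto simp: g_kernel_def\<close>)
  show "prob_space (g_kernel y)" for y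
  proof (rule prob_spaceI)
    have "emeasure (g_kernel y) UNIV = 1"
      by (subst *) (auto simp: g_mass_def[symmetric] ennreal_divide_self)
    moreover have "space (g_kernel y) = UNIV" by (simp add: g_kernel_def space_rho)
    ultimately show "emeasure (g_kernel y) (space (g_kernel y)) = 1" by simp
  qed
  then show "g_kernel \<in> borel \<rightarrow>\<^sub>M subprob_algebra borel"
  proof (intro measurable_subprob_algebra prob_space_imp_subprob_space)
    fix A :: "'s set" assume A: "A \<in> sets borel"
    have [measurable]: "(\<lambda>y. \<integral>\<^sup>+s. ennreal (g s) * indicator A s \<partial>\<rho> y) \<in> borel_measurable borel"
      by (rule measurable_compose[OF rho_kernel]) (use A in measurable)
    show "(\<lambda>y. emeasure (g_kernel y) A) \<in> borel_measurable borel"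
      unfolding *[OF A] by measurable
  qed (auto simp: g_kernel_def sets_rho)
qed

lemma nn_integral_rho_g_kernel:
  assumes y: "g_mass y < \<infinity>" and f[measurable]: "f \<in> borel_measurable borel"
  shows "(\<integral>\<^sup>+s. f s \<partial>\<rho> y) = g_mass y * (\<integral>\<^sup>+s. f s / ennreal (g s) \<partial>g_kernel y)"
proof (cases "g_mass y = 0")
  case True
  then show ?thesis by (simp add: g_mass_0)
next
  case False
  then have gy: "0 < g_mass y \<and> g_mass y < \<infinity>" using y by (simp add: zero_less_iff_neq_zero)
  have [measurable]: "f \<in> borel_measurable (\<rho> y)" "(\<lambda>s. ennreal (g s)) \<in> borel_measurable (\<rho> y)"
    by (simp_all add: measurable_rho)
  have "g_mass y * (\<integral>\<^sup>+s. f s / ennreal (g s) \<partial>g_kernel y) = g_mass y * (\<integral>\<^sup>+s. ennreal (g s) / g_mass y * (f s / ennreal (g s)) \<partial>\<rho> y)"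
    using gy by (simp add: g_kernel_def nn_integral_density)
  also have "\<dots> = (\<integral>\<^sup>+s. g_mass y * (ennreal (g s) / g_mass y * (f s / ennreal (g s))) \<partial>\<rho> y)"
    by (rule nn_integral_cmult[symmetric]) measurable
  also have "\<dots> = (\<integral>\<^sup>+s. f s \<partial>\<rho> y)"
  proof (intro nn_integral_cong)
    fix s
    have "g_mass y * (ennreal (g s) / g_mass y * (f s / ennreal (g s))) = (g_mass y / g_mass y) * (ennreal (g s) / ennreal (g s)) * f s"
      by (simp add: divide_ennreal_def mult_ac)
    also have "g_mass y / g_mass y = 1" using gy by (intro ennreal_divide_self) auto
    also have "ennreal (g s) / ennreal (g s) = 1" using g_pos[of s] by (intro ennreal_divide_self) auto
    finally show "g_mass y * (ennreal (g s) / g_mass y * (f s / ennreal (g s))) = f s" by simp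
  qed
  finally show ?thesis ..
qed

text \<open>Dividing the integrand by \<open>g\<close> moves the integral to the probability kernel
  \<open>g_kernel\<close>, for which joint measurability is known. The guard removes the values of
  \<open>Y\<close> at which \<open>g_mass\<close> is infinite.\<close>

lemma measurable_rho_integral:
  assumes Y[measurable]: "Y \<in> \<Omega> \<rightarrow>\<^sub>M borel" and F[measurable]: "(\<lambda>(\<omega>, s). F \<omega> s) \<in> borel_measurable (\<Omega> \<Otimes>\<^sub>M borel)"
  shows "(\<lambda>\<omega>. if g_mass (Y \<omega>) < \<infinity> then \<integral>\<^sup>+s. F \<omega> s \<partial>\<rho> (Y \<omega>) else 0) \<in> borel_measurable \<Omega>"
proof -
  have K: "(\<lambda>\<omega>. g_kernel (Y \<omega>)) \<in> \<Omega> \<rightarrow>\<^sub>M subprob_algebra borel"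
    using measurable_compose[OF Y measurable_prob_algebraD[OF g_kernel_kernel]] .
  have "(\<lambda>\<omega>. \<integral>\<^sup>+s. F \<omega> s / ennreal (g s) \<partial>g_kernel (Y \<omega>)) \<in> borel_measurable \<Omega>"
    by (rule nn_integral_measurable_subprob_algebra2[OF _ K]) measurable
  then have "(\<lambda>\<omega>. if g_mass (Y \<omega>) < \<infinity> then g_mass (Y \<omega>) * (\<integral>\<^sup>+s. F \<omega> s / ennreal (g s) \<partial>g_kernel (Y \<omega>)) else 0) \<in> borel_measurable \<Omega>"
    by measurable
  moreover have "F \<omega> \<in> borel_measurable borel" if "\<omega> \<in> space \<Omega>" for \<omega>
    using measurable_compose[OF measurable_Pair1'[OF that] F] by simp
  ultimately show ?thesis
    by (subst measurable_cong[where g="\<lambda>\<omega>. if g_mass (Y \<omega>) < \<infinity> then g_mass (Y \<omega>) * (\<integral>\<^sup>+s. F \<omega> s / ennreal (g s) \<partial>g_kernel (Y \<omega>)) else 0"])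
      (auto simp: nn_integral_rho_g_kernel)
qed

lemma nn_integral_nu:
  assumes F[measurable]: "F \<in> borel_measurable borel"
  shows "(\<integral>\<^sup>+x. F x \<partial>\<nu>) = (\<integral>\<^sup>+y. \<integral>\<^sup>+s. F (s, y) \<partial>\<rho> y \<partial>\<eta>)"
proof -
  \<comment> \<open>Set to the null measure on the exceptional set, which is \<eta>-null, so that
    \<open>Q\<close> is measurable everywhere and still mixes to \<open>\<nu>\<close>.\<close>
  define Q where "Q y = (if g_mass y < \<infinity> then distr (\<rho> y) borel (\<lambda>s. (s, y)) else null_measure borel)" for y
  have pair[measurable]: "(\<lambda>s. (s, y)) \<in> borel \<rightarrow>\<^sub>M (borel :: ('s \<times> 'y) measure)" for y
    by (simp add: borel_prod[symmetric])
  have pair': "(\<lambda>s. (s, y)) \<in> \<rho> y \<rightarrow>\<^sub>M (borel :: ('s \<times> 'y) measure)" for y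
    by (simp add: measurable_rho)
  have sw: "(\<lambda>z. (snd z, fst z)) \<in> borel \<Otimes>\<^sub>M borel \<rightarrow>\<^sub>M (borel :: ('s \<times> 'y) measure)"
    by (simp add: borel_prod[symmetric])
  have eQ: "emeasure (Q y) B = (if g_mass y < \<infinity> then \<integral>\<^sup>+s. indicator B (s, y) \<partial>\<rho> y else 0)" if B: "B \<in> sets borel" for B y
  proof -
    have "{s. (s, y) \<in> B} \<in> sets borel" using measurable_sets[OF pair B] by (simp add: vimage_def)
    then have "(\<integral>\<^sup>+s. indicator {s. (s, y) \<in> B} s \<partial>\<rho> y) = emeasure (\<rho> y) {s. (s, y) \<in> B}"
      by (intro nn_integral_indicator) (simp add: sets_rho)
    moreover have "indicator {s. (s, y) \<in> B} s = (indicator B (s, y) :: ennreal)" for s by (simp add: indicator_def)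
    ultimately show ?thesis
      using B by (simp add: Q_def emeasure_distr[OF pair'] space_rho vimage_def)
  qed
  have Qm: "Q \<in> \<eta> \<rightarrow>\<^sub>M measure_algebra borel"
    unfolding measurable_eta
  proof (rule measurable_measure_algebra)
    fix B :: "('s \<times> 'y) set" assume B[measurable]: "B \<in> sets borel"
    have "(\<lambda>(y, s). indicator B (s, y) :: ennreal) \<in> borel_measurable (borel \<Otimes>\<^sub>M borel)"
      using measurable_compose[OF sw borel_measurable_indicator[OF B]] by (simp add: split_beta')
    from measurable_rho_integral[OF measurable_ident_sets[OF refl] this]
    show "(\<lambda>y. emeasure (Q y) B) \<in> borel_measurable borel" unfolding eQ[OF B] by simp
  qed (simp add: Q_def)
  have "(\<integral>\<^sup>+x. F x \<partial>\<nu>) = (\<integral>\<^sup>+y. \<integral>\<^sup>+x. F x \<partial>Q y \<partial>\<eta>)"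
  proof (rule nn_integral_mixture_eq[OF Qm sets_nu])
    fix B :: "('s \<times> 'y) set" assume B: "B \<in> sets borel"
    have "emeasure \<nu> B = (\<integral>\<^sup>+y. emeasure (\<rho> y) {s. (s, y) \<in> B} \<partial>\<eta>)" by (rule emeasure_nu[OF B])
    also have "\<dots> = (\<integral>\<^sup>+y. emeasure (Q y) B \<partial>\<eta>)"
      using g_mass_finite_AE by (intro nn_integral_cong_AE, eventually_elim)
        (simp add: Q_def emeasure_distr[OF pair' B] space_rho vimage_def)
    finally show "emeasure \<nu> B = (\<integral>\<^sup>+y. emeasure (Q y) B \<partial>\<eta>)" .
  qed (simp add: F)
  also have "\<dots> = (\<integral>\<^sup>+y. \<integral>\<^sup>+s. F (s, y) \<partial>\<rho> y \<partial>\<eta>)"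
    using g_mass_finite_AE by (intro nn_integral_cong_AE, eventually_elim)
      (simp add: Q_def nn_integral_distr[OF pair'])
  finally show ?thesis .
qed

text \<open>The level sets g \<ge> 1 / Suc n have finite measure by Markov's inequality and exhaust
  the space since g > 0.\<close>

lemma sigma_finite_nu: "sigma_finite_measure \<nu>"
proof
  let ?A = "\<lambda>n::nat. {x :: 's \<times> 'y. 1 \<le> of_nat (Suc n) * ennreal (g (fst x))}"
  have gn: "(\<lambda>x. ennreal (g (fst x))) \<in> borel_measurable \<nu>" unfolding measurable_nu by measurable
  have Am: "?A n \<in> sets borel" for n by measurable
  have "emeasure \<nu> (?A n) \<noteq> \<infinity>" for n
  proof -
    have "emeasure \<nu> ({x\<in>UNIV. 1 \<le> of_nat (Suc n) * ennreal (g (fst x))} \<inter> UNIV) \<le>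
      of_nat (Suc n) * (\<integral>\<^sup>+x. ennreal (g (fst x)) * indicator UNIV x \<partial>\<nu>)"
      using nn_integral_Markov_inequality[of "\<lambda>x. ennreal (g (fst x))" UNIV \<nu> "of_nat (Suc n)"] gn by (simp add: sets_nu)
    also have "\<dots> < \<infinity>" using g_integrable by (simp add: ennreal_mult_less_top of_nat_less_top)
    finally show ?thesis by simp
  qed
  moreover have "(\<Union>n. ?A n) = UNIV"
  proof (intro equalityI subsetI)
    fix x :: "'s \<times> 'y"
    obtain n where n: "1 / g (fst x) < real n" using reals_Archimedean2 by blast
    have "1 \<le> real (Suc n) * g (fst x)" using n g_pos[of "fst x"] by (simp add: field_simps)
    then have "1 \<le> of_nat (Suc n) * ennreal (g (fst x))"
      using g_pos[of "fst x"] by (simp add: ennreal_of_nat_eq_real_of_nat ennreal_mult[symmetric] less_imp_le del: of_nat_Suc)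
    then show "x \<in> (\<Union>n. ?A n)" by auto
  qed simp
  ultimately show "\<exists>A. countable A \<and> A \<subseteq> sets \<nu> \<and> \<Union>A = space \<nu> \<and> (\<forall>a\<in>A. emeasure \<nu> a \<noteq> \<infinity>)"
    using Am by (intro exI[of _ "range ?A"]) (auto simp: sets_nu space_nu)
qed

end

section \<open>Sums of Dirac masses, and almost sure statements in finite products\<close>

lemma emeasure_weighted_diracs:
  assumes "finite I" and A: "A \<in> sets borel"
  shows "emeasure (weighted_diracs I w x) A = (\<Sum>i\<in>I. w i * indicator A (x i))"
proof -
  have m: "x \<in> point_measure I w \<rightarrow>\<^sub>M borel" by simp
  have "emeasure (weighted_diracs I w x) A = emeasure (point_measure I w) {i\<in>I. x i \<in> A}"
    unfolding weighted_diracs_def emeasure_distr[OF m A] space_point_measure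
    by (rule arg_cong2[of _ _ _ _ emeasure]) auto
  also have "\<dots> = (\<Sum>i | i \<in> I \<and> x i \<in> A. w i)"
    using assms(1) by (subst emeasure_point_measure_finite) (auto intro: sum.cong)
  also have "\<dots> = (\<Sum>i\<in>I. w i * indicator A (x i))"
    using assms(1) by (auto simp: sum.inter_filter[symmetric] indicator_def intro!: sum.mono_neutral_cong_left)
  finally show ?thesis .
qed

lemma sets_weighted_diracs [simp]: "sets (weighted_diracs I w x) = sets borel"
  and space_weighted_diracs [simp]: "space (weighted_diracs I w x) = UNIV"
  by (simp_all add: weighted_diracs_def)

lemma nn_integral_weighted_diracs:
  assumes "finite I" and f: "f \<in> borel_measurable borel"
  shows "(\<integral>\<^sup>+y. f y \<partial>weighted_diracs I w x) = (\<Sum>i\<in>I. w i * f (x i))"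
proof -
  have "(\<integral>\<^sup>+y. f y \<partial>weighted_diracs I w x) = (\<integral>\<^sup>+i. f (x i) \<partial>point_measure I w)"
    unfolding weighted_diracs_def by (subst nn_integral_distr) (use f in auto)
  also have "\<dots> = (\<Sum>i\<in>I. w i * f (x i))"
    using assms(1) by (subst nn_integral_point_measure_finite) (auto intro!: sum.cong simp: mult.commute)
  finally show ?thesis .
qed

text \<open>The exceptional set lies in a box with one null side. The measure of the box is 0 also
  when other sides have infinite mass, as 0 * \<infinity> = 0.\<close>

lemma AE_PiM_component_sigma_finite:
  assumes "sigma_finite_measure M" "finite I" "i \<in> I" "AE x in M. P x"
  shows "AE z in Pi\<^sub>M I (\<lambda>_. M). P (z i)"
proof -
  interpret M: sigma_finite_measure M by fact
  interpret product_sigma_finite "\<lambda>_. M" ..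
  obtain N where N: "{x\<in>space M. \<not> P x} \<subseteq> N" "emeasure M N = 0" "N \<in> sets M"
    using assms(4) by (rule AE_E)
  let ?B = "\<Pi>\<^sub>E j\<in>I. if j = i then N else space M"
  have "emeasure (Pi\<^sub>M I (\<lambda>_. M)) ?B = (\<Prod>j\<in>I. emeasure M (if j = i then N else space M))"
    using assms(2) N by (intro emeasure_PiM) auto
  also have "\<dots> = 0" using assms(2,3) N by (intro prod_zero) auto
  finally have 0: "emeasure (Pi\<^sub>M I (\<lambda>_. M)) ?B = 0" .
  show ?thesis
  proof (rule AE_I[OF _ 0])
    show "?B \<in> sets (Pi\<^sub>M I (\<lambda>_. M))" using assms(2) N by (intro sets_PiM_I_finite) auto
    show "{z\<in>space (Pi\<^sub>M I (\<lambda>_. M)). \<not> P (z i)} \<subseteq> ?B"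
      using N(1) assms(3) by (auto simp: space_PiM PiE_def Pi_def extensional_def)
  qed
qed

text \<open>Records what the laws indexed by blocks need from a partition, without reference to the
  partitioned index set.\<close>

definition blocks :: "nat set set \<Rightarrow> bool" where
  "blocks p \<longleftrightarrow> finite p \<and> (\<forall>C\<in>p. finite C \<and> C \<noteq> {})"

lemma blocks_partition_on: "finite I \<Longrightarrow> partition_on I p \<Longrightarrow> blocks p"
  using finite_elements[of I p] by (auto simp: blocks_def partition_on_def intro: finite_subset)

lemma blocks_card: "blocks p \<Longrightarrow> C \<in> p \<Longrightarrow> 1 \<le> card C"
  by (auto simp: blocks_def Suc_le_eq card_gt_0_iff)

context poisson_model
begin

section \<open>Exponential tilting\<close>

lemma nn_integral_vh:
  fixes N :: "('s \<times> 'y) measure"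
  assumes "sets N = sets borel" "0 \<le> v"
  shows "(\<integral>\<^sup>+x. ennreal (v * h (fst x)) \<partial>N) = ennreal v * total_mass h N"
proof -
  have [measurable]: "(\<lambda>x. ennreal (h (fst x))) \<in> borel_measurable N"
    by (simp add: measurable_cong_sets[OF assms(1) refl])
  show ?thesis
    using assms(2) by (simp add: total_mass_eq[OF h_measurable assms(1)] ennreal_mult' nn_integral_cmult)
qed

lemma measurable_total_mass_PN [measurable]: "total_mass h \<in> borel_measurable PN"
  unfolding measurable_PN by (rule measurable_total_mass[OF h_measurable])

lemma laplace_eq:
  assumes v: "0 \<le> v"
  shows "laplace h PN v = (\<integral>\<^sup>+N. expn (ennreal v * total_mass h N) \<partial>PN)"
  unfolding laplace_def
proof (rule nn_integral_cong_AE)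
  show "AE N in PN. ennreal (exp (- v * enn2real (total_mass h N))) = ennreal (expn (ennreal v * total_mass h N))"
    using total_mass_AE
  proof eventually_elim
    case (elim N)
    then obtain r where "0 \<le> r" "total_mass h N = ennreal r" by (cases "total_mass h N") auto
    then show ?case using v by (simp add: ennreal_mult[symmetric] expn_ennreal)
  qed
qed

lemma laplace_pos: assumes v: "0 \<le> v" shows "0 < laplace h PN v"
proof (rule ccontr)
  assume "\<not> ?thesis"
  then have "AE N in PN. ennreal (expn (ennreal v * total_mass h N)) = 0"
    unfolding laplace_eq[OF v] by (subst nn_integral_0_iff_AE[symmetric]) auto
  with total_mass_AE have "AE N in PN. False"
  proof eventually_elim
    case (elim N)
    then have "ennreal v * total_mass h N < \<top>" by (simp add: ennreal_mult_less_top)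
    from expn_pos[OF this] elim show ?case by simp
  qed
  then show False by simp
qed

lemma laplace_le_1: assumes v: "0 \<le> v" shows "laplace h PN v \<le> 1"
  unfolding laplace_eq[OF v] by (intro PN.L.nn_integral_le_const) auto

lemma laplace_finite: "0 \<le> v \<Longrightarrow> laplace h PN v < \<top>"
  using laplace_le_1[of v] by (auto simp: top_unique intro: le_less_trans)

lemma nn_integral_tilt:
  assumes [measurable]: "f \<in> borel_measurable borel"
  shows "(\<integral>\<^sup>+s. f s \<partial>tilt h v \<rho> y) = (\<integral>\<^sup>+s. ennreal (exp (- v * h s)) * f s \<partial>\<rho> y)"
  unfolding tilt_def by (rule nn_integral_density) (simp_all add: measurable_rho)

lemma sets_tilt: "sets (tilt h v \<rho> y) = sets borel" by (simp add: tilt_def sets_rho)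

lemma measurable_tilt: "measurable (tilt h v \<rho> y) K = measurable borel K"
  by (rule measurable_cong_sets[OF sets_tilt refl])

text \<open>Both measures arise by \<open>measure_of\<close> from set functions on the same
  sigma-algebra, so agreement of these functions suffices; in particular the tilted set function is
  a measure because the density is one.\<close>

lemma intensity_tilt:
  assumes v: "0 \<le> v"
  shows "intensity (tilt h v \<rho>) \<eta> = density \<nu> (\<lambda>x. ennreal (expn (ennreal (v * h (fst x)))))"
proof -
  let ?D = "density \<nu> (\<lambda>x. ennreal (expn (ennreal (v * h (fst x)))))"
  have "?D = measure_of (space ?D) (sets ?D) (emeasure ?D)" by (rule measure_of_of_measure[symmetric])
  also have "\<dots> = measure_of UNIV (sets borel) (emeasure ?D)" by (simp add: sets_nu space_nu)
  also have "\<dots> = intensity (tilt h v \<rho>) \<eta>"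
    unfolding intensity_def[of "tilt h v \<rho>"]
  proof (rule measure_of_eq)
    fix B :: "('s \<times> 'y) set" assume "B \<in> sigma_sets UNIV (sets borel)"
    then have B[measurable]: "B \<in> sets borel" using sets.sigma_sets_eq[of "borel :: ('s \<times> 'y) measure"] by simp
    have pair: "(\<lambda>s. (s, y)) \<in> borel \<rightarrow>\<^sub>M (borel :: ('s \<times> 'y) measure)" for y
      by (simp add: borel_prod[symmetric])
    have Bs: "{s. (s, y) \<in> B} \<in> sets borel" for y using measurable_sets[OF pair B] by (simp add: vimage_def)
    have "emeasure ?D B = (\<integral>\<^sup>+x. ennreal (expn (ennreal (v * h (fst x)))) * indicator B x \<partial>\<nu>)"
      by (rule emeasure_density) (simp_all add: measurable_nu sets_nu)
    also have "\<dots> = (\<integral>\<^sup>+y. \<integral>\<^sup>+s. ennreal (expn (ennreal (v * h s))) * indicator B (s, y) \<partial>\<rho> y \<partial>\<eta>)"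
      by (subst nn_integral_nu) auto
    also have "\<dots> = (\<integral>\<^sup>+y. emeasure (tilt h v \<rho> y) {s. (s, y) \<in> B} \<partial>\<eta>)"
    proof (rule nn_integral_cong)
      fix y
      have "emeasure (tilt h v \<rho> y) {s. (s, y) \<in> B} = (\<integral>\<^sup>+s. ennreal (exp (- v * h s)) * indicator {s. (s, y) \<in> B} s \<partial>\<rho> y)"
        unfolding tilt_def using Bs by (intro emeasure_density) (simp_all add: measurable_rho sets_rho)
      also have "\<dots> = (\<integral>\<^sup>+s. ennreal (expn (ennreal (v * h s))) * indicator B (s, y) \<partial>\<rho> y)"
        using v h_pos by (intro nn_integral_cong) (simp add: expn_ennreal less_imp_le indicator_def)
      finally show "(\<integral>\<^sup>+s. ennreal (expn (ennreal (v * h s))) * indicator B (s, y) \<partial>\<rho> y) = emeasure (tilt h v \<rho> y) {s. (s, y) \<in> B}" ..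
    qed
    finally show "emeasure ?D B = (\<integral>\<^sup>+y. emeasure (tilt h v \<rho> y) {s. (s, y) \<in> B} \<partial>\<eta>)" .
  qed simp
  finally show ?thesis ..
qed

abbreviation "tilted_law v \<equiv> poisson_law (intensity (tilt h v \<rho>) \<eta>)"

text \<open>The tilting rule for the weight v * h(s), whose integral over N is v * T. It turns
  expectations under the tilted law into expectations under \<open>PN\<close> with the factor exp (-
  v T).\<close>

lemma tilted_law_eq:
  assumes v: "0 \<le> v"
  shows "tilted_law v = density PN (\<lambda>N. ennreal (expn (ennreal v * total_mass h N)) / laplace h PN v)"
proof -
  let ?g = "\<lambda>x :: 's \<times> 'y. ennreal (v * h (fst x))"
  have *: "(\<integral>\<^sup>+x. ?g x \<partial>N) = ennreal v * total_mass h N" if "N \<in> space PN" for N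
    using that v by (simp add: space_PN nn_integral_vh)
  have fin: "AE N in PN. (\<integral>\<^sup>+x. ?g x \<partial>N) < \<infinity>"
    using total_mass_AE AE_space by eventually_elim (simp add: * ennreal_mult_less_top)
  have g_mass: "?g \<in> borel_measurable \<nu>" unfolding measurable_nu by measurable
  have Z: "(\<integral>\<^sup>+N. expn (\<integral>\<^sup>+x. ?g x \<partial>N) \<partial>PN) = laplace h PN v"
    unfolding laplace_eq[OF v] by (intro nn_integral_cong) (simp add: *)
  have "tilted_law v = density PN (\<lambda>N. ennreal (expn (\<integral>\<^sup>+x. ?g x \<partial>N)) / laplace h PN v)"
    using poisson_law_eq[OF is_poisson_law_density[OF law g_mass fin]] by (simp add: intensity_tilt[OF v] Z)
  also have "\<dots> = density PN (\<lambda>N. ennreal (expn (ennreal v * total_mass h N)) / laplace h PN v)"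
  proof (rule density_cong)
    show "(\<lambda>N. ennreal (expn (\<integral>\<^sup>+x. ?g x \<partial>N)) / laplace h PN v) \<in> borel_measurable PN"
      using g_mass by measurable
  qed (auto simp: *)
  finally show ?thesis .
qed

lemma sets_tilted_law: "0 \<le> v \<Longrightarrow> sets (tilted_law v) = sets (measure_algebra borel)"
  by (simp add: tilted_law_eq sets_PN)

lemma measurable_tilted_law: "0 \<le> v \<Longrightarrow> measurable (tilted_law v) K = measurable (measure_algebra borel) K"
  by (rule measurable_cong_sets[OF sets_tilted_law refl])

lemma nn_integral_tilted_law:
  fixes f :: "('s \<times> 'y) measure \<Rightarrow> ennreal"
  assumes v: "0 \<le> v" and f: "f \<in> borel_measurable (measure_algebra borel)"
  shows "(\<integral>\<^sup>+N. f N \<partial>tilted_law v) = (\<integral>\<^sup>+N. ennreal (expn (ennreal v * total_mass h N)) * f N \<partial>PN) / laplace h PN v"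
proof -
  have [measurable]: "f \<in> borel_measurable PN" using f by (simp add: measurable_PN)
  have "(\<integral>\<^sup>+N. f N \<partial>tilted_law v) = (\<integral>\<^sup>+N. ennreal (expn (ennreal v * total_mass h N)) / laplace h PN v * f N \<partial>PN)"
    unfolding tilted_law_eq[OF v] by (rule nn_integral_density) measurable
  also have "\<dots> = (\<integral>\<^sup>+N. ennreal (expn (ennreal v * total_mass h N)) * f N / laplace h PN v \<partial>PN)"
    by (intro nn_integral_cong) (simp add: divide_ennreal_def mult_ac)
  finally show ?thesis by (simp add: nn_integral_divide)
qed

lemma ennreal_cancel_laplace: "0 \<le> v \<Longrightarrow> laplace h PN v * (a / laplace h PN v) = a"
  using laplace_pos[of v] laplace_finite[of v] ennreal_mult_divide_eq[of "laplace h PN v" a]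
  by (simp add: ennreal_times_divide mult.commute)

lemma prob_space_tilted_law: assumes v: "0 \<le> v" shows "prob_space (tilted_law v)"
proof (rule prob_spaceI)
  have "emeasure (tilted_law v) (space (tilted_law v)) = (\<integral>\<^sup>+N. 1 \<partial>tilted_law v)" by simp
  also have "\<dots> = laplace h PN v / laplace h PN v"
    using v by (subst nn_integral_tilted_law) (simp_all add: laplace_eq)
  also have "\<dots> = 1" using laplace_pos[OF v] laplace_finite[OF v] by (intro ennreal_divide_self) auto
  finally show "emeasure (tilted_law v) (space (tilted_law v)) = 1" .
qed

lemma total_mass_AE_tilted_law: assumes v: "0 \<le> v" shows "AE N in tilted_law v. 0 < total_mass h N \<and> total_mass h N < \<infinity>"
  unfolding tilted_law_eq[OF v] by (subst AE_density) (use total_mass_AE in auto)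

lemma kappa_tilt: "kappa h m (tilt h v \<rho>) y = (\<integral>\<^sup>+s. ennreal (h s ^ m * exp (- v * h s)) \<partial>\<rho> y)"
  unfolding kappa_def using h_pos
  by (subst nn_integral_tilt) (auto simp: ennreal_mult'' mult.commute less_imp_le intro!: nn_integral_cong)

lemma kappa_measurable [measurable]: "kappa h m (tilt h v \<rho>) \<in> borel_measurable borel"
  unfolding kappa_tilt[abs_def] by (rule measurable_compose[OF rho_kernel]) measurable

lemma kappa_finite:
  assumes "0 < v" "1 \<le> m" "g_mass y < \<infinity>"
  shows "kappa h m (tilt h v \<rho>) y < \<infinity>"
proof -
  obtain c where c: "0 \<le> c" "\<And>x. 0 \<le> x \<Longrightarrow> x ^ m * exp (- v * x) \<le> c * (1 - exp (- x))"
    using exp_moment_bound[OF assms(1,2)] by blast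
  have "kappa h m (tilt h v \<rho>) y \<le> (\<integral>\<^sup>+s. ennreal c * ennreal (g s) \<partial>\<rho> y)"
    unfolding kappa_tilt using c(1) c(2)[OF less_imp_le[OF h_pos]]
    by (intro nn_integral_mono) (simp add: ennreal_mult'[symmetric] g_def ennreal_leI)
  also have "\<dots> = ennreal c * g_mass y" by (simp add: nn_integral_cmult measurable_rho g_mass_def)
  also have "\<dots> < \<infinity>" using assms(3) by (simp add: ennreal_mult_less_top)
  finally show ?thesis .
qed

lemma kappa_total_eq: "kappa_total h m (tilt h v \<rho>) \<eta> = (\<integral>\<^sup>+x. ennreal (h (fst x) ^ m * exp (- v * h (fst x))) \<partial>\<nu>)"
  unfolding kappa_total_def kappa_tilt by (subst nn_integral_nu) auto

lemma kappa_total_finite: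
  assumes "0 < v" "1 \<le> m"
  shows "kappa_total h m (tilt h v \<rho>) \<eta> < \<infinity>"
proof -
  obtain c where c: "0 \<le> c" "\<And>x. 0 \<le> x \<Longrightarrow> x ^ m * exp (- v * x) \<le> c * (1 - exp (- x))"
    using exp_moment_bound[OF assms] by blast
  have "kappa_total h m (tilt h v \<rho>) \<eta> \<le> (\<integral>\<^sup>+x. ennreal c * ennreal (g (fst x)) \<partial>\<nu>)"
    unfolding kappa_total_eq using c(1) c(2)[OF less_imp_le[OF h_pos]]
    by (intro nn_integral_mono) (simp add: ennreal_mult'[symmetric] g_def ennreal_leI)
  also have "\<dots> = ennreal c * (\<integral>\<^sup>+x. ennreal (g (fst x)) \<partial>\<nu>)" by (simp add: nn_integral_cmult measurable_nu)
  also have "\<dots> < \<infinity>" using g_integrable by (simp add: ennreal_mult_less_top)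
  finally show ?thesis .
qed

lemma nn_integral_rho_0_iff:
  assumes [measurable]: "f \<in> borel_measurable borel" and f: "\<And>s. 0 < f s"
  shows "(\<integral>\<^sup>+s. f s \<partial>\<rho> y) = 0 \<longleftrightarrow> g_mass y = 0"
proof -
  have "(\<integral>\<^sup>+s. f s \<partial>\<rho> y) = 0 \<longleftrightarrow> (AE s in \<rho> y. False)"
    using f by (subst nn_integral_0_iff_AE) (auto simp: measurable_rho zero_less_iff_neq_zero)
  also have "\<dots> \<longleftrightarrow> g_mass y = 0"
    unfolding g_mass_def using g_pos by (subst nn_integral_0_iff_AE) (auto simp: measurable_rho not_le ennreal_eq_0_iff)
  finally show ?thesis .
qed

text \<open>Integrals of strictly positive functions against \<open>\<rho> y\<close> vanish
  together, namely when \<open>\<rho> y\<close> is null; hence neither the order m nor v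
  matters.\<close>

lemma kappa_0_iff: "kappa h m (tilt h v \<rho>) y = 0 \<longleftrightarrow> g_mass y = 0"
  unfolding kappa_tilt using h_pos by (intro nn_integral_rho_0_iff) auto

section \<open>The law of \<open>N\<^sup>* + \<Sum> \<delta>\<close>\<close>

text \<open>At such values every jump law is a probability measure. The condition is free of v, so
  the exceptional set of values is chosen once for the whole mixture over v > 0.\<close>

definition good :: "nat set set \<Rightarrow> (nat set \<Rightarrow> 'y) \<Rightarrow> bool" where
  "good p z \<longleftrightarrow> (\<forall>C\<in>p. 0 < g_mass (z C) \<and> g_mass (z C) < \<infinity>)"

abbreviation "jump_laws v p z \<equiv> (\<lambda>C. jump_law h (card C) (tilt h v \<rho>) (z C))"

lemma sets_jump_law: "sets (jump_law h m (tilt h v \<rho>) y) = sets borel"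
  by (simp add: jump_law_def sets_tilt)

lemma nn_integral_jump_law:
  assumes [measurable]: "f \<in> borel_measurable borel"
  shows "(\<integral>\<^sup>+s. f s \<partial>jump_law h m (tilt h v \<rho>) y) =
    (\<integral>\<^sup>+s. ennreal (h s ^ m * exp (- v * h s)) * f s \<partial>\<rho> y) / kappa h m (tilt h v \<rho>) y"
proof -
  let ?k = "kappa h m (tilt h v \<rho>) y"
  have "(\<integral>\<^sup>+s. f s \<partial>jump_law h m (tilt h v \<rho>) y) = (\<integral>\<^sup>+s. ennreal (h s ^ m) / ?k * f s \<partial>tilt h v \<rho> y)"
    unfolding jump_law_def by (rule nn_integral_density) (simp_all add: measurable_tilt)
  also have "\<dots> = (\<integral>\<^sup>+s. ennreal (exp (- v * h s)) * (ennreal (h s ^ m) / ?k * f s) \<partial>\<rho> y)"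
    by (rule nn_integral_tilt) measurable
  also have "\<dots> = (\<integral>\<^sup>+s. (ennreal (h s ^ m * exp (- v * h s)) * f s) / ?k \<partial>\<rho> y)"
    using h_pos by (intro nn_integral_cong) (simp add: divide_ennreal_def ennreal_mult'' mult_ac less_imp_le)
  finally show ?thesis by (simp add: nn_integral_divide measurable_rho)
qed

lemma prob_space_jump_law:
  assumes "0 < v" "1 \<le> m" "0 < g_mass y \<and> g_mass y < \<infinity>"
  shows "prob_space (jump_law h m (tilt h v \<rho>) y)"
proof (rule prob_spaceI)
  have "emeasure (jump_law h m (tilt h v \<rho>) y) (space (jump_law h m (tilt h v \<rho>) y)) = (\<integral>\<^sup>+s. 1 \<partial>jump_law h m (tilt h v \<rho>) y)"
    by simp
  also have "\<dots> = kappa h m (tilt h v \<rho>) y / kappa h m (tilt h v \<rho>) y"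
    by (subst nn_integral_jump_law) (simp_all add: kappa_tilt)
  also have "\<dots> = 1"
    using kappa_finite[of v m y] kappa_0_iff[of m v y] assms by (intro ennreal_divide_self) auto
  finally show "emeasure (jump_law h m (tilt h v \<rho>) y) (space (jump_law h m (tilt h v \<rho>) y)) = 1" .
qed

lemma sets_star_jumps_law:
  assumes "0 \<le> v"
  shows "sets (star_jumps_law h (tilt h v \<rho>) \<eta> p z) = sets (measure_algebra borel \<Otimes>\<^sub>M Pi\<^sub>M p (\<lambda>_. borel))"
  unfolding star_jumps_law_def using assms
  by (intro sets_pair_measure_cong sets_tilted_law sets_PiM_cong refl sets_jump_law)

lemma measurable_star_jumps_law:
  "0 \<le> v \<Longrightarrow> measurable (star_jumps_law h (tilt h v \<rho>) \<eta> p z) K = measurable (measure_algebra borel \<Otimes>\<^sub>M Pi\<^sub>M p (\<lambda>_. borel)) K"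
  by (rule measurable_cong_sets[OF sets_star_jumps_law refl])

lemma space_star_jumps_law:
  "0 \<le> v \<Longrightarrow> space (star_jumps_law h (tilt h v \<rho>) \<eta> p z) = {N. sets N = sets borel} \<times> (\<Pi>\<^sub>E C\<in>p. UNIV)"
  using sets_eq_imp_space_eq[OF sets_star_jumps_law] by (simp add: space_pair_measure space_measure_algebra space_PiM)

lemma prob_space_PiM_jump_laws:
  assumes "0 < v" "blocks p" "good p z"
  shows "prob_space (Pi\<^sub>M p (jump_laws v p z))"
  using assms by (intro prob_space_PiM prob_space_jump_law blocks_card) (auto simp: good_def)

lemma prob_space_star_jumps_law:
  assumes "0 < v" "blocks p" "good p z"
  shows "prob_space (star_jumps_law h (tilt h v \<rho>) \<eta> p z)"
proof -
  interpret tilted_law: prob_space "tilted_law v" by (rule prob_space_tilted_law) (use assms in simp)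
  interpret J: prob_space "Pi\<^sub>M p (jump_laws v p z)" by (rule prob_space_PiM_jump_laws[OF assms])
  interpret pair_prob_space "tilted_law v" "Pi\<^sub>M p (jump_laws v p z)" ..
  show ?thesis unfolding star_jumps_law_def by unfold_locales
qed

lemma nn_integral_star_jumps_law:
  assumes v: "0 < v" and p: "blocks p" "good p z"
    and a[measurable]: "a \<in> borel_measurable (measure_algebra borel)" and b[measurable]: "\<And>C. C \<in> p \<Longrightarrow> b C \<in> borel_measurable borel"
  shows "(\<integral>\<^sup>+(N, J). a N * (\<Prod>C\<in>p. b C (J C)) \<partial>star_jumps_law h (tilt h v \<rho>) \<eta> p z) =
    (\<integral>\<^sup>+N. a N \<partial>tilted_law v) * (\<Prod>C\<in>p. \<integral>\<^sup>+s. b C s \<partial>jump_law h (card C) (tilt h v \<rho>) (z C))"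
proof -
  have v0: "0 \<le> v" using v by simp
  interpret P: prob_space "tilted_law v" by (rule prob_space_tilted_law[OF v0])
  interpret J: prob_space "Pi\<^sub>M p (jump_laws v p z)" by (rule prob_space_PiM_jump_laws[OF v p])
  \<comment> \<open>The jump laws extended to all indices, as the product locale requires; only
    indices in \<open>p\<close> matter.\<close>
  define M where "M C = (if C \<in> p then jump_law h (card C) (tilt h v \<rho>) (z C) else return borel undefined)" for C
  interpret M: prob_space "M C" for C
    using p v by (auto simp: M_def good_def prob_space_return intro!: prob_space_jump_law blocks_card)
  interpret M: product_sigma_finite M ..
  have JM: "Pi\<^sub>M p (jump_laws v p z) = Pi\<^sub>M p M" by (rule PiM_cong) (auto simp: M_def)
  have m: "(\<lambda>(N, J). a N * (\<Prod>C\<in>p. b C (J C))) \<in> borel_measurable (tilted_law v \<Otimes>\<^sub>M Pi\<^sub>M p (jump_laws v p z))"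
  proof -
    have "(\<lambda>(N, J). a N * (\<Prod>C\<in>p. b C (J C))) \<in> borel_measurable (measure_algebra borel \<Otimes>\<^sub>M Pi\<^sub>M p (\<lambda>_. borel))"
      by measurable
    then show ?thesis
      unfolding measurable_star_jumps_law[OF v0, of p z borel, unfolded star_jumps_law_def] .
  qed
  have mb: "(\<lambda>J. \<Prod>C\<in>p. b C (J C)) \<in> borel_measurable (Pi\<^sub>M p (jump_laws v p z))"
  proof -
    have "(\<lambda>J. \<Prod>C\<in>p. b C (J C)) \<in> borel_measurable (Pi\<^sub>M p (\<lambda>_. borel))" by measurable
    moreover have "sets (Pi\<^sub>M p (jump_laws v p z)) = sets (Pi\<^sub>M p (\<lambda>_. borel))"
      by (intro sets_PiM_cong refl sets_jump_law)
    ultimately show ?thesis using measurable_cong_sets[OF _ refl] by blast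
  qed
  have "(\<integral>\<^sup>+(N, J). a N * (\<Prod>C\<in>p. b C (J C)) \<partial>star_jumps_law h (tilt h v \<rho>) \<eta> p z) =
    (\<integral>\<^sup>+N. \<integral>\<^sup>+J. a N * (\<Prod>C\<in>p. b C (J C)) \<partial>Pi\<^sub>M p (jump_laws v p z) \<partial>tilted_law v)"
    unfolding star_jumps_law_def using J.nn_integral_fst[OF m] by simp
  also have "\<dots> = (\<integral>\<^sup>+N. a N * (\<integral>\<^sup>+J. (\<Prod>C\<in>p. b C (J C)) \<partial>Pi\<^sub>M p (jump_laws v p z)) \<partial>tilted_law v)"
    by (intro nn_integral_cong nn_integral_cmult mb)
  also have "\<dots> = (\<integral>\<^sup>+N. a N \<partial>tilted_law v) * (\<integral>\<^sup>+J. (\<Prod>C\<in>p. b C (J C)) \<partial>Pi\<^sub>M p M)"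
    using a by (subst nn_integral_multc) (simp_all add: measurable_tilted_law[OF v0] JM)
  also have "(\<integral>\<^sup>+J. (\<Prod>C\<in>p. b C (J C)) \<partial>Pi\<^sub>M p M) = (\<Prod>C\<in>p. \<integral>\<^sup>+s. b C s \<partial>M C)"
  proof (rule M.product_nn_integral_prod)
    show "finite p" using p by (simp add: blocks_def)
    fix C assume C: "C \<in> p"
    have "b C \<in> borel_measurable (jump_law h (card C) (tilt h v \<rho>) (z C))"
      unfolding measurable_cong_sets[OF sets_jump_law refl] by (rule b[OF C])
    then show "b C \<in> borel_measurable (M C)" using C by (simp add: M_def)
  qed
  also have "\<dots> = (\<Prod>C\<in>p. \<integral>\<^sup>+s. b C s \<partial>jump_law h (card C) (tilt h v \<rho>) (z C))"
    by (intro prod.cong) (simp_all add: M_def)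
  finally show ?thesis .
qed

definition add_points :: "nat set set \<Rightarrow> (nat set \<Rightarrow> 'y) \<Rightarrow> ('s \<times> 'y) measure \<Rightarrow> (nat set \<Rightarrow> 's) \<Rightarrow> ('s \<times> 'y) measure" where
  "add_points p z N J = add_measure N (weighted_diracs p (\<lambda>_. 1) (\<lambda>C. (J C, z C)))"

lemma sets_add_points: "sets (add_points p z N J) = sets N" by (simp add: add_points_def)

lemma nn_integral_add_points:
  assumes "finite p" "sets N = sets borel" "f \<in> borel_measurable borel"
  shows "(\<integral>\<^sup>+x. f x \<partial>add_points p z N J) = (\<integral>\<^sup>+x. f x \<partial>N) + (\<Sum>C\<in>p. f (J C, z C))"
  unfolding add_points_def using assms
  by (subst nn_integral_add_measure) (simp_all add: nn_integral_weighted_diracs measurable_cong_sets[OF assms(2) refl])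

lemma measurable_add_points:
  assumes "finite p"
  shows "(\<lambda>(N, J). add_points p z N J) \<in> measure_algebra borel \<Otimes>\<^sub>M Pi\<^sub>M p (\<lambda>_. borel) \<rightarrow>\<^sub>M measure_algebra borel"
proof (rule measurable_measure_algebra)
  fix A :: "('s \<times> 'y) set" assume A[measurable]: "A \<in> sets borel"
  have [measurable]: "(\<lambda>w. (snd w C, z C)) \<in> measure_algebra borel \<Otimes>\<^sub>M Pi\<^sub>M p (\<lambda>_. borel) \<rightarrow>\<^sub>M (borel :: ('s \<times> 'y) measure)"
    if "C \<in> p" for C
    unfolding borel_prod[symmetric] using that by measurable
  have "(\<lambda>w. emeasure (fst w) A + (\<Sum>C\<in>p. indicator A (snd w C, z C))) \<in>
      borel_measurable (measure_algebra (borel :: ('s \<times> 'y) measure) \<Otimes>\<^sub>M Pi\<^sub>M p (\<lambda>_. borel :: 's measure))"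
    by measurable
  then show "(\<lambda>w. emeasure (case w of (N, J) \<Rightarrow> add_points p z N J) A) \<in> borel_measurable (measure_algebra borel \<Otimes>\<^sub>M Pi\<^sub>M p (\<lambda>_. borel))"
    by (rule measurable_cong[THEN iffD2, rotated])
      (use assms A in \<open>auto simp: space_pair_measure space_measure_algebra add_points_def emeasure_add_measure emeasure_weighted_diracs\<close>)
next
  fix w :: "('s \<times> 'y) measure \<times> (nat set \<Rightarrow> 's)"
  assume "w \<in> space (measure_algebra borel \<Otimes>\<^sub>M Pi\<^sub>M p (\<lambda>_. borel))"
  then show "sets (case w of (N, J) \<Rightarrow> add_points p z N J) = sets borel"
    by (cases w) (simp add: space_pair_measure space_measure_algebra sets_add_points)
qed

abbreviation "N_post_law v p z \<equiv> distr (N_jumps_law h (tilt h v \<rho>) \<eta> p z) (measure_algebra borel) fst"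

lemma N_post_law_eq:
  assumes "0 \<le> v" "finite p"
  shows "N_post_law v p z = distr (star_jumps_law h (tilt h v \<rho>) \<eta> p z) (measure_algebra borel) (\<lambda>(N, J). add_points p z N J)"
proof -
  have "(\<lambda>w. ((\<lambda>(N, J). add_points p z N J) w, snd w)) \<in> star_jumps_law h (tilt h v \<rho>) \<eta> p z \<rightarrow>\<^sub>M measure_algebra borel \<Otimes>\<^sub>M Pi\<^sub>M p (\<lambda>_. borel)"
    unfolding measurable_star_jumps_law[OF assms(1)]
    by (intro measurable_Pair measurable_add_points assms measurable_snd)
  then show ?thesis
    unfolding N_jumps_law_def by (subst distr_distr) (auto simp: comp_def split_beta' add_points_def)
qed

lemma measurable_add_points_star:
  assumes "0 \<le> v" "finite p"
  shows "(\<lambda>(N, J). add_points p z N J) \<in> star_jumps_law h (tilt h v \<rho>) \<eta> p z \<rightarrow>\<^sub>M measure_algebra borel"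
  unfolding measurable_star_jumps_law[OF assms(1)] by (rule measurable_add_points[OF assms(2)])

lemma prob_space_N_post_law:
  assumes "0 < v" "blocks p" "good p z"
  shows "prob_space (N_post_law v p z)"
  using assms by (subst N_post_law_eq) (auto simp: blocks_def intro!: prob_space.prob_space_distr prob_space_star_jumps_law measurable_add_points_star)

abbreviation "raw_kappa_prod v p z \<equiv> (\<Prod>C\<in>p. kappa h (card C) (tilt h v \<rho>) (z C))"

text \<open>Independence of the tilted Poisson measure and the jumps factorizes the functional: the
  added point of a block \<open>C\<close> contributes exp (- f (s, z C)) averaged over its jump
  law.\<close>

lemma N_post_law_laplace:
  assumes v: "0 < v" and p: "blocks p" "good p z" and f[measurable]: "f \<in> borel_measurable borel"
  shows "(\<integral>\<^sup>+N. expn (\<integral>\<^sup>+x. f x \<partial>N) \<partial>N_post_law v p z) =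
    (\<integral>\<^sup>+N. expn (\<integral>\<^sup>+x. f x \<partial>N) \<partial>tilted_law v) *
    (\<Prod>C\<in>p. (\<integral>\<^sup>+s. ennreal (h s ^ card C * exp (- v * h s)) * ennreal (expn (f (s, z C))) \<partial>\<rho> (z C)) / kappa h (card C) (tilt h v \<rho>) (z C))"
proof -
  have v0: "0 \<le> v" and fp: "finite p" using v p by (auto simp: blocks_def)
  have pair[measurable]: "(\<lambda>s. (s, y)) \<in> borel \<rightarrow>\<^sub>M (borel :: ('s \<times> 'y) measure)" for y
    by (simp add: borel_prod[symmetric])
  have "(\<integral>\<^sup>+N. expn (\<integral>\<^sup>+x. f x \<partial>N) \<partial>N_post_law v p z) =
    (\<integral>\<^sup>+w. expn (\<integral>\<^sup>+x. f x \<partial>(case w of (N, J) \<Rightarrow> add_points p z N J)) \<partial>star_jumps_law h (tilt h v \<rho>) \<eta> p z)"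
    unfolding N_post_law_eq[OF v0 fp] by (rule nn_integral_distr[OF measurable_add_points_star[OF v0 fp]]) measurable
  also have "\<dots> = (\<integral>\<^sup>+(N, J). ennreal (expn (\<integral>\<^sup>+x. f x \<partial>N)) * (\<Prod>C\<in>p. ennreal (expn (f (J C, z C)))) \<partial>star_jumps_law h (tilt h v \<rho>) \<eta> p z)"
    using fp by (intro nn_integral_cong)
      (auto simp: space_star_jumps_law[OF v0] nn_integral_add_points expn_add expn_sum ennreal_mult prod_nonneg prod_ennreal[symmetric])
  also have "\<dots> = (\<integral>\<^sup>+N. expn (\<integral>\<^sup>+x. f x \<partial>N) \<partial>tilted_law v) * (\<Prod>C\<in>p. \<integral>\<^sup>+s. expn (f (s, z C)) \<partial>jump_law h (card C) (tilt h v \<rho>) (z C))"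
    by (rule nn_integral_star_jumps_law[OF v p]) measurable
  finally show ?thesis by (simp add: nn_integral_jump_law)
qed

text \<open>Multiplication by the moments clears the denominators of the jump laws. What is left is
  the product over blocks in which the iterated Mecke equation ends.\<close>

lemma raw_kappa_prod_N_post_law_laplace:
  assumes v: "0 < v" and p: "blocks p" "good p z" and f[measurable]: "f \<in> borel_measurable borel"
  shows "raw_kappa_prod v p z * (\<integral>\<^sup>+N. expn (\<integral>\<^sup>+x. f x \<partial>N) \<partial>N_post_law v p z) =
    (\<integral>\<^sup>+N. expn (\<integral>\<^sup>+x. f x \<partial>N) \<partial>tilted_law v) *
    (\<Prod>C\<in>p. \<integral>\<^sup>+s. ennreal (h s ^ card C * exp (- v * h s)) * ennreal (expn (f (s, z C))) \<partial>\<rho> (z C))"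
proof -
  have k: "kappa h (card C) (tilt h v \<rho>) (z C) * (a / kappa h (card C) (tilt h v \<rho>) (z C)) = a" if "C \<in> p" for C a
    using kappa_finite[OF v blocks_card[OF p(1) that], of "z C"] kappa_0_iff[of "card C" v "z C"] p(2) that
      ennreal_mult_divide_eq[of "kappa h (card C) (tilt h v \<rho>) (z C)" a]
    by (auto simp: good_def ennreal_times_divide mult.commute)
  show ?thesis
    unfolding N_post_law_laplace[OF assms] mult.left_commute[of "raw_kappa_prod v p z"] prod.distrib[symmetric]
    by (intro arg_cong2[of _ _ _ _ "(*)"] prod.cong refl) (simp add: k)
qed

section \<open>Joint measurability in the mixing variable and the distinct values\<close>

definition pos_lborel :: "real measure" where "pos_lborel = restrict_space lborel {0<..}"

lemma space_pos_lborel: "space pos_lborel = {0<..}" by (simp add: pos_lborel_def space_restrict_space)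

lemma measurable_pos_lborel: "f \<in> borel_measurable borel \<Longrightarrow> f \<in> borel_measurable pos_lborel"
  unfolding pos_lborel_def by (intro measurable_restrict_space1) simp

lemma measurable_ident_pos_lborel [measurable]: "(\<lambda>v. v) \<in> borel_measurable pos_lborel" by (rule measurable_pos_lborel) simp

text \<open>Totalised by an arbitrary value, so as to be a probability kernel in \<open>(v, z)\<close>.\<close>

definition N_post_law' :: "nat set set \<Rightarrow> real \<times> (nat set \<Rightarrow> 'y) \<Rightarrow> ('s \<times> 'y) measure measure" where
  "N_post_law' p = (\<lambda>(v, z). if good p z then N_post_law v p z else PN)"

lemma measurable_kernel_vz:
  assumes C: "C \<in> p" and b: "b \<in> borel_measurable (borel :: ('s \<times> 'y) measure)"
  shows "(\<lambda>w. if g_mass (snd w C) < \<infinity> then \<integral>\<^sup>+s. ennreal (h s ^ m * exp (- fst w * h s)) * b (s, snd w C) \<partial>\<rho> (snd w C) else 0)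
    \<in> borel_measurable (pos_lborel \<Otimes>\<^sub>M Pi\<^sub>M p (\<lambda>_. borel :: 'y measure))"
proof (rule measurable_rho_integral)
  show "(\<lambda>w. snd w C) \<in> pos_lborel \<Otimes>\<^sub>M Pi\<^sub>M p (\<lambda>_. borel :: 'y measure) \<rightarrow>\<^sub>M borel" using C by measurable
  have [measurable]: "(\<lambda>u. (snd u, snd (fst u) C)) \<in> (pos_lborel \<Otimes>\<^sub>M Pi\<^sub>M p (\<lambda>_. borel :: 'y measure)) \<Otimes>\<^sub>M borel \<rightarrow>\<^sub>M (borel :: ('s \<times> 'y) measure)"
    unfolding borel_prod[symmetric] using C by measurable
  have [measurable]: "(\<lambda>u. b (snd u, snd (fst u) C)) \<in> borel_measurable ((pos_lborel \<Otimes>\<^sub>M Pi\<^sub>M p (\<lambda>_. borel :: 'y measure)) \<Otimes>\<^sub>M borel)"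
    using b by measurable
  show "(\<lambda>(w, s). ennreal (h s ^ m * exp (- fst w * h s)) * b (s, snd w C)) \<in> borel_measurable ((pos_lborel \<Otimes>\<^sub>M Pi\<^sub>M p (\<lambda>_. borel)) \<Otimes>\<^sub>M borel)"
    unfolding split_beta' by measurable
qed

lemma measurable_kernel_vz_1:
  assumes C: "C \<in> p"
  shows "(\<lambda>w. if g_mass (snd w C) < \<infinity> then \<integral>\<^sup>+s. ennreal (h s ^ m * exp (- fst w * h s)) \<partial>\<rho> (snd w C) else 0)
    \<in> borel_measurable (pos_lborel \<Otimes>\<^sub>M Pi\<^sub>M p (\<lambda>_. borel :: 'y measure))"
  using measurable_kernel_vz[OF C, of "\<lambda>_. 1" m] by (simp cong: if_cong)

text \<open>The guard is needed because \<open>\<rho>\<close> is known to be a measurable kernel only off the null set where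
  \<open>g_mass\<close> is infinite.\<close>

definition kappa_prod :: "nat set set \<Rightarrow> real \<times> (nat set \<Rightarrow> 'y) \<Rightarrow> ennreal" where
  "kappa_prod p = (\<lambda>(v, z). \<Prod>C\<in>p. if g_mass (z C) < \<infinity> then kappa h (card C) (tilt h v \<rho>) (z C) else 0)"

lemma kappa_prod_measurable [measurable]: "kappa_prod p \<in> borel_measurable (pos_lborel \<Otimes>\<^sub>M Pi\<^sub>M p (\<lambda>_. borel))"
  unfolding kappa_prod_def kappa_tilt split_beta'
  by (intro borel_measurable_prod_ennreal measurable_kernel_vz_1)

lemma laplace_measurable [measurable]: "laplace h PN \<in> borel_measurable borel"
proof -
  have "(\<lambda>(v, N). ennreal (exp (- v * enn2real (total_mass h N)))) \<in> borel_measurable (borel \<Otimes>\<^sub>M PN)" by measurable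
  from PN.L.borel_measurable_nn_integral[OF this] show ?thesis unfolding laplace_def[abs_def] by simp
qed

end

section \<open>The joint formula for N and rectangles of the sample\<close>

lemma nn_integral_pair_swap:
  assumes "sigma_finite_measure M1" "sigma_finite_measure M2"
    and f: "(\<lambda>(x, y). f x y) \<in> borel_measurable (M1 \<Otimes>\<^sub>M M2)"
  shows "(\<integral>\<^sup>+x. \<integral>\<^sup>+y. f x y \<partial>M2 \<partial>M1) = (\<integral>\<^sup>+y. \<integral>\<^sup>+x. f x y \<partial>M1 \<partial>M2)"
proof -
  interpret M1: sigma_finite_measure M1 by fact
  interpret M2: sigma_finite_measure M2 by fact
  interpret pair_sigma_finite M1 M2 ..
  show ?thesis using Fubini'[OF f] by simp
qed

text \<open>Substitution u = t * v in the Gamma integral. The half-line is open, matching the range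
  of the mixing variable; at the endpoint both integrands are 0, since 0 powr (s - 1) = 0.\<close>

lemma Gamma_scaling:
  assumes s: "0 < s" and t: "0 < t"
  shows "ennreal (t powr (- s)) = (\<integral>\<^sup>+v. ennreal (v powr (s - 1)) * ennreal (exp (- v * t)) \<partial>restrict_space lborel {0<..}) / ennreal (Gamma s)"
proof -
  let ?J = "\<integral>\<^sup>+v. ennreal (v powr (s - 1)) * ennreal (exp (- v * t)) \<partial>restrict_space lborel {0<..}"
  have "ennreal (Gamma s) = \<integral>\<^sup>+u. ennreal (indicator {0..} u * u powr (s - 1) / exp u) \<partial>lborel"
    by (rule Gamma_conv_nn_integral_real[OF s])
  also have "\<dots> = ennreal t * (\<integral>\<^sup>+v. ennreal (indicator {0..} (0 + t * v) * (0 + t * v) powr (s - 1) / exp (0 + t * v)) \<partial>lborel)"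
    using t by (subst nn_integral_real_affine[where c=t and t=0]) auto
  also have "(\<integral>\<^sup>+v. ennreal (indicator {0..} (0 + t * v) * (0 + t * v) powr (s - 1) / exp (0 + t * v)) \<partial>lborel) =
    (\<integral>\<^sup>+v. ennreal (t powr (s - 1)) * (ennreal (v powr (s - 1)) * ennreal (exp (- v * t)) * indicator {0<..} v) \<partial>lborel)"
  proof (intro nn_integral_cong)
    fix v :: real
    show "ennreal (indicator {0..} (0 + t * v) * (0 + t * v) powr (s - 1) / exp (0 + t * v)) =
      ennreal (t powr (s - 1)) * (ennreal (v powr (s - 1)) * ennreal (exp (- v * t)) * indicator {0<..} v)"
      using t by (cases "v > 0"; cases "v = 0")
        (auto simp: powr_mult ennreal_mult[symmetric] exp_minus field_simps zero_le_mult_iff)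
  qed
  also have "\<dots> = ennreal (t powr (s - 1)) * ?J"
    by (subst nn_integral_cmult) (auto simp: nn_integral_restrict_space)
  finally have "ennreal (Gamma s) = ennreal (t powr s) * ?J"
    using t by (simp add: mult.assoc[symmetric] ennreal_mult[symmetric] powr_mult_base)
  moreover have "ennreal (t powr (- s)) * ennreal (t powr s) = 1"
    using t by (simp add: ennreal_mult[symmetric] powr_add[symmetric])
  ultimately have "ennreal (t powr (- s)) * ennreal (Gamma s) = ?J"
    by (simp add: mult.assoc[symmetric])
  moreover have "ennreal (Gamma s) \<noteq> 0" using Gamma_real_pos[OF s] by simp
  ultimately show ?thesis
    using ennreal_mult_divide_eq[of "ennreal (Gamma s)" "ennreal (t powr (- s))"] by simp
qed

text \<open>All coordinates of a block share one value, so a rectangle constrains that value to the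
  intersection of the corresponding sides.\<close>

definition block_inter :: "(nat \<Rightarrow> 'y set) \<Rightarrow> nat set \<Rightarrow> 'y set" where "block_inter B C = (\<Inter>i\<in>C. B i)"

context poisson_model
begin

abbreviation "X \<equiv> measure_algebra (borel :: ('s \<times> 'y) measure)"

abbreviation "\<eta>p p \<equiv> Pi\<^sub>M (p :: nat set set) (\<lambda>_. \<eta>)"

lemma sets_etap: "sets (\<eta>p p) = sets (Pi\<^sub>M p (\<lambda>_. borel))"
  by (intro sets_PiM_cong refl sets_eta)

lemma measurable_etap: "measurable (\<eta>p p) K = measurable (Pi\<^sub>M p (\<lambda>_. borel)) K"
  by (rule measurable_cong_sets[OF sets_etap refl])

lemma product_eta: "product_sigma_finite (\<lambda>_. \<eta>)"
  using sigma_finite_eta by (simp add: product_sigma_finite_def)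

lemma sigma_finite_etap: "finite p \<Longrightarrow> sigma_finite_measure (\<eta>p p)"
  using product_sigma_finite.sigma_finite[OF product_eta] .

lemma sigma_finite_pos_lborel: "sigma_finite_measure pos_lborel"
  unfolding pos_lborel_def by (intro sigma_finite_measure_restrict_space) (simp_all add: sigma_finite_lborel)

lemma g_mass_finite_AE_etap: "finite p \<Longrightarrow> AE z in \<eta>p p. \<forall>C\<in>p. g_mass (z C) < \<infinity>"
  using AE_PiM_component_sigma_finite[OF sigma_finite_eta _ _ g_mass_finite_AE]
  by (subst AE_ball_countable) (auto simp: countable_finite)

text \<open>By the exponential criterion only the Laplace functional has to be measurable in (v, z),
  and it is an explicit combination of guarded integrals against \<open>\<rho>\<close> and of
  expectations under \<open>PN\<close>.\<close>

lemma N_post_law'_kernel: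
  assumes p: "blocks p"
  shows "N_post_law' p \<in> pos_lborel \<Otimes>\<^sub>M Pi\<^sub>M p (\<lambda>_. borel) \<rightarrow>\<^sub>M prob_algebra X"
proof (rule measurable_prob_algebra_measure_algebra)
  fix w assume "w \<in> space (pos_lborel \<Otimes>\<^sub>M Pi\<^sub>M p (\<lambda>_. borel :: 'y measure))"
  then have w: "0 < fst w" by (auto simp: space_pair_measure space_pos_lborel)
  show "prob_space (N_post_law' p w)"
    using w p by (cases w) (auto simp: N_post_law'_def PN.L.prob_space_axioms intro: prob_space_N_post_law)
  show "sets (N_post_law' p w) = sets X" by (cases w) (auto simp: N_post_law'_def sets_PN)
next
  fix f :: "'s \<times> 'y \<Rightarrow> ennreal" assume f[measurable]: "f \<in> borel_measurable borel"
  let ?\<Omega> = "pos_lborel \<Otimes>\<^sub>M Pi\<^sub>M p (\<lambda>_. borel :: 'y measure)"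
  have fp: "finite p" using p by (simp add: blocks_def)
  define a where "a w C b = (if g_mass (snd w C) < \<infinity> then \<integral>\<^sup>+s. ennreal (h s ^ card C * exp (- fst w * h s)) * b (s, snd w C) \<partial>\<rho> (snd w C) else 0)"
    for w :: "real \<times> (nat set \<Rightarrow> 'y)" and C and b :: "'s \<times> 'y \<Rightarrow> ennreal"
  have am[measurable]: "(\<lambda>w. a w C b) \<in> borel_measurable ?\<Omega>" if "C \<in> p" "b \<in> borel_measurable borel" for C b
    unfolding a_def by (rule measurable_kernel_vz[OF that])
  have a1[measurable]: "(\<lambda>w. a w C (\<lambda>x. ennreal (expn (f x)))) \<in> borel_measurable ?\<Omega>"
    "(\<lambda>w. a w C (\<lambda>x. 1)) \<in> borel_measurable ?\<Omega>" if "C \<in> p" for C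
    using that by (auto intro!: am)
  have [measurable]: "(\<lambda>w. snd w C) \<in> ?\<Omega> \<rightarrow>\<^sub>M borel" if "C \<in> p" for C using that by measurable
  have [measurable]: "fst \<in> borel_measurable ?\<Omega>"
    by (rule measurable_compose[OF measurable_fst measurable_ident_pos_lborel])
  have PNf[measurable]: "(\<lambda>N. \<integral>\<^sup>+x. f x \<partial>N) \<in> borel_measurable PN" by (simp add: measurable_PN)
  have [measurable]: "(\<lambda>v. \<integral>\<^sup>+N. ennreal (expn (ennreal v * total_mass h N)) * ennreal (expn (\<integral>\<^sup>+x. f x \<partial>N)) \<partial>PN) \<in> borel_measurable borel"
    by (intro PN.L.borel_measurable_nn_integral) measurable
  have [measurable]: "Measurable.pred ?\<Omega> (\<lambda>w. good p (snd w))"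
    unfolding good_def using fp by measurable
  let ?L = "\<lambda>w. if good p (snd w) then
      ((\<integral>\<^sup>+N. ennreal (expn (ennreal (fst w) * total_mass h N)) * ennreal (expn (\<integral>\<^sup>+x. f x \<partial>N)) \<partial>PN) / laplace h PN (fst w)) *
      (\<Prod>C\<in>p. a w C (\<lambda>x. ennreal (expn (f x))) / a w C (\<lambda>x. 1))
    else \<integral>\<^sup>+N. expn (\<integral>\<^sup>+x. f x \<partial>N) \<partial>PN"
  have "?L \<in> borel_measurable ?\<Omega>" by measurable
  then show "(\<lambda>w. \<integral>\<^sup>+N. expn (\<integral>\<^sup>+x. f x \<partial>N) \<partial>N_post_law' p w) \<in> borel_measurable ?\<Omega>"
  proof (rule measurable_cong[THEN iffD2, rotated])
    fix w assume "w \<in> space ?\<Omega>"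
    then have w: "0 < fst w" by (auto simp: space_pair_measure space_pos_lborel)
    show "(\<integral>\<^sup>+N. expn (\<integral>\<^sup>+x. f x \<partial>N) \<partial>N_post_law' p w) = ?L w"
    proof (cases "good p (snd w)")
      case True
      then have "(\<integral>\<^sup>+N. expn (\<integral>\<^sup>+x. f x \<partial>N) \<partial>N_post_law' p w) = (\<integral>\<^sup>+N. expn (\<integral>\<^sup>+x. f x \<partial>N) \<partial>N_post_law (fst w) p (snd w))"
        by (simp add: N_post_law'_def split_beta')
      also have "\<dots> = ?L w"
        unfolding N_post_law_laplace[OF w p True f]
        using True w by (simp add: nn_integral_tilted_law good_def a_def kappa_tilt cong: prod.cong)
      finally show ?thesis .
    qed (simp add: N_post_law'_def split_beta')
  qed
qed

text \<open>For fixed v > 0 both sides are finite measures in \<open>A\<close>, hence determined by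
  their Laplace functionals. On the left, the test function f and the tilt combine to f + v h in the
  joint moment formula; on the right, the functional of \<open>N_post_law\<close> factorizes over
  the blocks, and integration over the product of copies of \<eta> yields the same product.\<close>

lemma rectangle_formula_fixed_v:
  assumes v: "0 < v" and I: "finite I" and B: "\<And>i. i \<in> I \<Longrightarrow> B i \<in> sets borel" and A: "A \<in> sets X"
  shows "(\<integral>\<^sup>+N. (ennreal (expn (ennreal v * total_mass h N)) * (\<Prod>i\<in>I. emeasure (mu_of h N) (B i))) * indicator A N \<partial>PN) =
    (\<Sum>p | partition_on I p. \<integral>\<^sup>+z. (laplace h PN v * (\<Prod>C\<in>p. indicator (block_inter B C) (z C)) * kappa_prod p (v, z)) *
        emeasure (N_post_law' p (v, z)) A \<partial>\<eta>p p)"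
proof -
  have v0: "0 \<le> v" using v by simp
  let ?parts = "{p. partition_on I p}"
  have fin: "finite ?parts" by (rule finitely_many_partition_on[OF I])
  have bl: "blocks p" "finite p" if "partition_on I p" for p
    using blocks_partition_on[OF I that] by (auto simp: blocks_def)
  have Bcm: "block_inter B C \<in> sets borel" if "partition_on I p" "C \<in> p" for p C
  proof -
    have "C \<subseteq> I" "finite C" "C \<noteq> {}" using that bl(1)[OF that(1)] by (auto simp: partition_on_def blocks_def)
    then show ?thesis unfolding block_inter_def using B by (intro sets.finite_INT) auto
  qed
  define k where "k i x = ennreal (h (fst x)) * indicator (B i) (snd x)" for i and x :: "'s \<times> 'y"
  have km[measurable]: "k i \<in> borel_measurable borel" if "i \<in> I" for i
    unfolding k_def using B[OF that] by measurable
  have mu: "emeasure (mu_of h N) (B i) = (\<integral>\<^sup>+x. k i x \<partial>N)" if "N \<in> space PN" "i \<in> I" for N i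
    using that B unfolding k_def by (intro emeasure_mu_of h_measurable) (auto simp: space_PN)
  have muPN[measurable]: "(\<lambda>N. emeasure (mu_of h N) (B i)) \<in> borel_measurable PN" if "i \<in> I" for i
    unfolding measurable_PN
    by (rule measurable_compose[OF measurable_mu_of[OF h_measurable]]) (use B[OF that] in simp)
  define w where "w N = ennreal (expn (ennreal v * total_mass h N)) * (\<Prod>i\<in>I. emeasure (mu_of h N) (B i))" for N
  have wm[measurable]: "w \<in> borel_measurable PN" unfolding w_def[abs_def] by measurable
  define d where "d p z = laplace h PN v * (\<Prod>C\<in>p. indicator (block_inter B C) (z C)) * kappa_prod p (v, z)" for p z
  have vV: "v \<in> space pos_lborel" using v by (simp add: space_pos_lborel)
  have dm[measurable]: "d p \<in> borel_measurable (\<eta>p p)" if "partition_on I p" for p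
    unfolding measurable_etap d_def
    using Bcm[OF that] measurable_compose[OF measurable_Pair1'[OF vV] kappa_prod_measurable[of p]] by measurable
  define K where "K p z = N_post_law' p (v, z)" for p z
  have K: "K p \<in> Pi\<^sub>M p (\<lambda>_. borel) \<rightarrow>\<^sub>M measure_algebra X" if "partition_on I p" for p
    unfolding K_def using bl[OF that]
    by (intro measurable_measure_algebra_of_prob_algebra measurable_compose[OF measurable_Pair1'[OF vV] N_post_law'_kernel])
  have K': "K p \<in> density (\<eta>p p) (d p) \<rightarrow>\<^sub>M measure_algebra X" if "partition_on I p" for p
    using K[OF that] by (simp add: measurable_etap)
  \<comment> \<open>The right side of the claim as one measure: the finite sum over partitions is a
    mixture with respect to counting measure.\<close>
  define M2 where "M2 = mixture X (count_space ?parts) (\<lambda>p. mixture X (density (\<eta>p p) (d p)) (K p))"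
  have M2k: "(\<lambda>p. mixture X (density (\<eta>p p) (d p)) (K p)) \<in> count_space ?parts \<rightarrow>\<^sub>M measure_algebra X"
    by (simp add: space_measure_algebra)
  have M2: "(\<integral>\<^sup>+N. F N \<partial>M2) = (\<Sum>p | partition_on I p. \<integral>\<^sup>+z. d p z * (\<integral>\<^sup>+N. F N \<partial>K p z) \<partial>\<eta>p p)"
    if F: "F \<in> borel_measurable X" for F
  proof -
    have "(\<integral>\<^sup>+N. F N \<partial>M2) = (\<Sum>p | partition_on I p. \<integral>\<^sup>+N. F N \<partial>mixture X (density (\<eta>p p) (d p)) (K p))"
      unfolding M2_def nn_integral_mixture[OF M2k F] by (rule nn_integral_count_space_finite[OF fin])
    also have "\<dots> = (\<Sum>p | partition_on I p. \<integral>\<^sup>+z. d p z * (\<integral>\<^sup>+N. F N \<partial>K p z) \<partial>\<eta>p p)"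
    proof (rule sum.cong[OF refl])
      fix p assume "p \<in> ?parts"
      then have p: "partition_on I p" by simp
      have "(\<lambda>z. \<integral>\<^sup>+N. F N \<partial>K p z) \<in> borel_measurable (\<eta>p p)"
        using measurable_compose[OF K[OF p] nn_integral_measurable_measure_algebra[OF F]] by (simp add: measurable_etap)
      then show "(\<integral>\<^sup>+N. F N \<partial>mixture X (density (\<eta>p p) (d p)) (K p)) = (\<integral>\<^sup>+z. d p z * (\<integral>\<^sup>+N. F N \<partial>K p z) \<partial>\<eta>p p)"
        unfolding nn_integral_mixture[OF K'[OF p] F] by (rule nn_integral_density[OF dm[OF p]])
    qed
    finally show ?thesis .
  qed
  \<comment> \<open>Within a block all factors are evaluated at the same point, so their product
    collapses to \<open>h ^ card C\<close> and the indicator of the intersection of the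
    sides.\<close>
  have mom: "(\<integral>\<^sup>+N. w N * ennreal (expn (\<integral>\<^sup>+x. f x \<partial>N)) \<partial>PN) =
      (\<Sum>p | partition_on I p. \<Prod>C\<in>p. \<integral>\<^sup>+x. indicator (block_inter B C) (snd x) * (ennreal (h (fst x) ^ card C * exp (- v * h (fst x))) * ennreal (expn (f x))) \<partial>\<nu>) *
      (\<integral>\<^sup>+N. ennreal (expn (ennreal v * total_mass h N)) * ennreal (expn (\<integral>\<^sup>+x. f x \<partial>N)) \<partial>PN)"
    if f[measurable]: "f \<in> borel_measurable borel" for f
  proof -
    let ?f = "\<lambda>x :: 's \<times> 'y. f x + ennreal (v * h (fst x))"
    have fv: "expn (\<integral>\<^sup>+x. ?f x \<partial>N) = expn (\<integral>\<^sup>+x. f x \<partial>N) * expn (ennreal v * total_mass h N)" if "N \<in> space PN" for N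
    proof -
      have N: "sets N = sets borel" using that by (simp add: space_PN)
      have "(\<integral>\<^sup>+x. ?f x \<partial>N) = (\<integral>\<^sup>+x. f x \<partial>N) + (\<integral>\<^sup>+x. ennreal (v * h (fst x)) \<partial>N)"
        by (rule nn_integral_add) (simp_all add: measurable_cong_sets[OF N refl])
      then show ?thesis by (simp add: nn_integral_vh[OF N v0] expn_add)
    qed
    have "(\<integral>\<^sup>+N. w N * ennreal (expn (\<integral>\<^sup>+x. f x \<partial>N)) \<partial>PN) =
      (\<integral>\<^sup>+N. (\<Prod>i\<in>I. \<integral>\<^sup>+x. k i x \<partial>N) * ennreal (expn (\<integral>\<^sup>+x. ?f x \<partial>N)) \<partial>PN)"
      by (intro nn_integral_cong) (simp add: fv w_def mu ennreal_mult mult_ac cong: prod.cong)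
    also have "\<dots> = (\<Sum>p | partition_on I p. \<Prod>C\<in>p. \<integral>\<^sup>+x. (\<Prod>i\<in>C. k i x) * ennreal (expn (?f x)) \<partial>\<nu>) *
        (\<integral>\<^sup>+N. expn (\<integral>\<^sup>+x. ?f x \<partial>N) \<partial>PN)"
      by (rule PN.joint_moment[OF sigma_finite_nu I]) (simp_all add: measurable_nu)
    also have "(\<integral>\<^sup>+N. expn (\<integral>\<^sup>+x. ?f x \<partial>N) \<partial>PN) =
      (\<integral>\<^sup>+N. ennreal (expn (ennreal v * total_mass h N)) * ennreal (expn (\<integral>\<^sup>+x. f x \<partial>N)) \<partial>PN)"
      by (intro nn_integral_cong) (simp add: fv ennreal_mult mult.commute)
    also have "(\<Sum>p | partition_on I p. \<Prod>C\<in>p. \<integral>\<^sup>+x. (\<Prod>i\<in>C. k i x) * ennreal (expn (?f x)) \<partial>\<nu>) =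
      (\<Sum>p | partition_on I p. \<Prod>C\<in>p. \<integral>\<^sup>+x. indicator (block_inter B C) (snd x) * (ennreal (h (fst x) ^ card C * exp (- v * h (fst x))) * ennreal (expn (f x))) \<partial>\<nu>)"
    proof (intro sum.cong prod.cong nn_integral_cong refl)
      fix p C and x :: "'s \<times> 'y" assume "p \<in> ?parts" "C \<in> p"
      then have "finite C" "C \<noteq> {}" using bl(1)[of p] by (auto simp: blocks_def)
      have "(\<Prod>i\<in>C. k i x) = ennreal (h (fst x)) ^ card C * (\<Prod>i\<in>C. indicator (B i) (snd x))"
        by (simp add: k_def prod.distrib)
      also have "(\<Prod>i\<in>C. indicator (B i) (snd x)) = (indicator (block_inter B C) (snd x) :: ennreal)"
      proof (cases "snd x \<in> block_inter B C")
        case False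
        then obtain i where "i \<in> C" "snd x \<notin> B i" by (auto simp: block_inter_def)
        then have "(\<Prod>i\<in>C. indicator (B i) (snd x) :: ennreal) = 0"
          using \<open>finite C\<close> by (intro prod_zero bexI[of _ i]) auto
        then show ?thesis using False by simp
      qed (auto simp: block_inter_def intro!: prod.neutral)
      moreover have "expn (?f x) = expn (f x) * exp (- v * h (fst x))"
        using h_pos[of "fst x"] v by (simp add: expn_add expn_ennreal)
      ultimately show "(\<Prod>i\<in>C. k i x) * ennreal (expn (?f x)) =
        indicator (block_inter B C) (snd x) * (ennreal (h (fst x) ^ card C * exp (- v * h (fst x))) * ennreal (expn (f x)))"
        using h_pos[of "fst x"] by (simp add: ennreal_mult ennreal_power[symmetric] mult_ac)
    qed
    finally show ?thesis .
  qed
  have "density PN w = M2"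
  proof (rule measure_algebra_eqI[where K=borel])
    show "finite_measure (density PN w)"
    proof (rule finite_measureI)
      have "(\<integral>\<^sup>+N. w N \<partial>PN) = (\<Sum>p | partition_on I p. \<Prod>C\<in>p. \<integral>\<^sup>+x. indicator (block_inter B C) (snd x) * (ennreal (h (fst x) ^ card C * exp (- v * h (fst x)))) \<partial>\<nu>) *
        laplace h PN v"
        using mom[of "\<lambda>_. 0"] by (simp add: laplace_eq[OF v0])
      also have "\<dots> \<noteq> \<infinity>"
      proof -
        have "(\<integral>\<^sup>+x. indicator (block_inter B C) (snd x) * (ennreal (h (fst x) ^ card C * exp (- v * h (fst x)))) \<partial>\<nu>) \<noteq> \<top>"
          if "partition_on I p" "C \<in> p" for p C
        proof -
          have "(\<integral>\<^sup>+x. indicator (block_inter B C) (snd x) * (ennreal (h (fst x) ^ card C * exp (- v * h (fst x)))) \<partial>\<nu>)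
            \<le> kappa_total h (card C) (tilt h v \<rho>) \<eta>"
            unfolding kappa_total_eq by (intro nn_integral_mono) (auto simp: indicator_def)
          also have "\<dots> < \<top>" using kappa_total_finite[OF v blocks_card[OF bl(1)[OF that(1)] that(2)]] by simp
          finally show ?thesis by simp
        qed
        then show ?thesis
          using laplace_finite[OF v0] fin by (auto simp: ennreal_mult_eq_top_iff ennreal_prod_eq_top less_top)
      qed
      finally show "emeasure (density PN w) (space (density PN w)) \<noteq> \<infinity>"
        by (simp add: emeasure_density cong: nn_integral_cong)
    qed
    fix f :: "'s \<times> 'y \<Rightarrow> ennreal" assume f[measurable]: "f \<in> borel_measurable borel"
    let ?E = "\<integral>\<^sup>+N. ennreal (expn (ennreal v * total_mass h N)) * ennreal (expn (\<integral>\<^sup>+x. f x \<partial>N)) \<partial>PN"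
    \<comment> \<open>Contribution to the moment of a block with value y, guarded so as to be
      measurable in y.\<close>
    define \<phi> where "\<phi> C y = indicator (block_inter B C) y * (if g_mass y < \<infinity> then
        \<integral>\<^sup>+s. ennreal (h s ^ card C * exp (- v * h s)) * ennreal (expn (f (s, y))) \<partial>\<rho> y else 0)" for C y
    have pm: "(\<lambda>w. (snd w, fst w)) \<in> borel \<Otimes>\<^sub>M borel \<rightarrow>\<^sub>M (borel :: ('s \<times> 'y) measure)"
      by (simp add: borel_prod[symmetric])
    have [measurable]: "(\<lambda>w. f (snd w, fst w)) \<in> borel_measurable (borel \<Otimes>\<^sub>M borel)"
      using measurable_compose[OF pm f] .
    have "(\<lambda>(y, s). ennreal (h s ^ m * exp (- v * h s)) * ennreal (expn (f (s, y)))) \<in> borel_measurable (borel \<Otimes>\<^sub>M borel)" for m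
      unfolding split_beta' by measurable
    from measurable_rho_integral[OF measurable_ident_sets[OF refl] this]
    have [measurable]: "(\<lambda>y. if g_mass y < \<infinity> then \<integral>\<^sup>+s. ennreal (h s ^ m * exp (- v * h s)) * ennreal (expn (f (s, y))) \<partial>\<rho> y else 0) \<in> borel_measurable borel" for m
      by simp
    have \<phi>m: "\<phi> C \<in> borel_measurable borel" if "partition_on I p" "C \<in> p" for p C
      unfolding \<phi>_def using Bcm[OF that] by measurable
    have \<phi>: "(\<integral>\<^sup>+x. indicator (block_inter B C) (snd x) * (ennreal (h (fst x) ^ card C * exp (- v * h (fst x))) * ennreal (expn (f x))) \<partial>\<nu>) = (\<integral>\<^sup>+y. \<phi> C y \<partial>\<eta>)"
      if p: "partition_on I p" "C \<in> p" for p C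
    proof -
      have pr: "(\<lambda>s. (s, y)) \<in> borel \<rightarrow>\<^sub>M (borel :: ('s \<times> 'y) measure)" for y
        by (simp add: borel_prod[symmetric])
      have [measurable]: "(\<lambda>s. f (s, y)) \<in> borel_measurable borel" for y by (rule measurable_compose[OF pr f])
      have "(\<integral>\<^sup>+x. indicator (block_inter B C) (snd x) * (ennreal (h (fst x) ^ card C * exp (- v * h (fst x))) * ennreal (expn (f x))) \<partial>\<nu>) =
        (\<integral>\<^sup>+y. \<integral>\<^sup>+s. indicator (block_inter B C) y * (ennreal (h s ^ card C * exp (- v * h s)) * ennreal (expn (f (s, y)))) \<partial>\<rho> y \<partial>\<eta>)"
        using Bcm[OF p] by (subst nn_integral_nu) auto
      also have "\<dots> = (\<integral>\<^sup>+y. \<phi> C y \<partial>\<eta>)"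
        using g_mass_finite_AE
        by (intro nn_integral_cong_AE, eventually_elim) (simp add: \<phi>_def nn_integral_cmult measurable_rho)
      finally show ?thesis .
    qed
    have "(\<integral>\<^sup>+N. expn (\<integral>\<^sup>+x. f x \<partial>N) \<partial>M2) = (\<Sum>p | partition_on I p. \<integral>\<^sup>+z. d p z * (\<integral>\<^sup>+N. expn (\<integral>\<^sup>+x. f x \<partial>N) \<partial>K p z) \<partial>\<eta>p p)"
      by (rule M2) measurable
    also have "\<dots> = (\<Sum>p | partition_on I p. (\<Prod>C\<in>p. \<integral>\<^sup>+y. \<phi> C y \<partial>\<eta>) * ?E)"
    proof (rule sum.cong[OF refl])
      fix p assume "p \<in> ?parts"
      then have p: "partition_on I p" by simp
      interpret product_sigma_finite "\<lambda>_::nat set. \<eta>" by (rule product_eta)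
      have "(\<integral>\<^sup>+z. d p z * (\<integral>\<^sup>+N. expn (\<integral>\<^sup>+x. f x \<partial>N) \<partial>K p z) \<partial>\<eta>p p) = (\<integral>\<^sup>+z. (\<Prod>C\<in>p. \<phi> C (z C)) * ?E \<partial>\<eta>p p)"
      proof (rule nn_integral_cong_AE)
        show "AE z in \<eta>p p. d p z * (\<integral>\<^sup>+N. expn (\<integral>\<^sup>+x. f x \<partial>N) \<partial>K p z) = (\<Prod>C\<in>p. \<phi> C (z C)) * ?E"
          using g_mass_finite_AE_etap[OF bl(2)[OF p]]
        proof eventually_elim
          case (elim z)
          show ?case
          proof (cases "good p z")
            case True
            have "d p z * (\<integral>\<^sup>+N. expn (\<integral>\<^sup>+x. f x \<partial>N) \<partial>K p z) =
              laplace h PN v * (\<Prod>C\<in>p. indicator (block_inter B C) (z C)) * (raw_kappa_prod v p z * (\<integral>\<^sup>+N. expn (\<integral>\<^sup>+x. f x \<partial>N) \<partial>N_post_law v p z))"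
              using True elim by (simp add: d_def K_def N_post_law'_def kappa_prod_def mult.assoc cong: prod.cong)
            also have "\<dots> = (laplace h PN v * (\<integral>\<^sup>+N. expn (\<integral>\<^sup>+x. f x \<partial>N) \<partial>tilted_law v)) * (\<Prod>C\<in>p. \<phi> C (z C))"
              unfolding raw_kappa_prod_N_post_law_laplace[OF v bl(1)[OF p] True f] \<phi>_def prod.distrib
              using elim by (simp add: mult_ac cong: prod.cong)
            also have "laplace h PN v * (\<integral>\<^sup>+N. expn (\<integral>\<^sup>+x. f x \<partial>N) \<partial>tilted_law v) = ?E"
              by (subst nn_integral_tilted_law[OF v0]) (simp_all add: ennreal_cancel_laplace[OF v0])
            finally show ?thesis by (simp add: mult.commute)
          next
            \<comment> \<open>Some block sits at a value where \<open>\<rho>\<close> is null, so a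
              moment factor vanishes on both sides and the default law inside
              \<open>N_post_law'\<close> is never seen.\<close>
            case False
            then obtain C where C: "C \<in> p" "g_mass (z C) = 0" using elim by (auto simp: good_def zero_less_iff_neq_zero)
            have "kappa_prod p (v, z) = 0"
              unfolding kappa_prod_def using C bl(2)[OF p] by (auto intro!: prod_zero bexI[of _ C] simp: kappa_0_iff)
            moreover have "(\<Prod>C\<in>p. \<phi> C (z C)) = 0"
              using C bl(2)[OF p] by (intro prod_zero bexI[of _ C]) (auto simp: \<phi>_def g_mass_0)
            ultimately show ?thesis by (simp add: d_def)
          qed
        qed
      qed
      also have "\<dots> = (\<integral>\<^sup>+z. (\<Prod>C\<in>p. \<phi> C (z C)) \<partial>\<eta>p p) * ?E"
        using \<phi>m[OF p] by (intro nn_integral_multc) (simp add: measurable_etap)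
      also have "(\<integral>\<^sup>+z. (\<Prod>C\<in>p. \<phi> C (z C)) \<partial>\<eta>p p) = (\<Prod>C\<in>p. \<integral>\<^sup>+y. \<phi> C y \<partial>\<eta>)"
        using \<phi>m[OF p] by (intro product_nn_integral_prod bl(2)[OF p]) (simp add: measurable_eta)
      finally show "(\<integral>\<^sup>+z. d p z * (\<integral>\<^sup>+N. expn (\<integral>\<^sup>+x. f x \<partial>N) \<partial>K p z) \<partial>\<eta>p p) = (\<Prod>C\<in>p. \<integral>\<^sup>+y. \<phi> C y \<partial>\<eta>) * ?E" .
    qed
    also have "\<dots> = (\<Sum>p | partition_on I p. (\<Prod>C\<in>p. \<integral>\<^sup>+x. indicator (block_inter B C) (snd x) * (ennreal (h (fst x) ^ card C * exp (- v * h (fst x))) * ennreal (expn (f x))) \<partial>\<nu>)) * ?E"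
      unfolding sum_distrib_right by (intro sum.cong arg_cong2[of _ _ _ _ "(*)"] prod.cong refl \<phi>[symmetric]) auto
    also have "\<dots> = (\<integral>\<^sup>+N. w N * ennreal (expn (\<integral>\<^sup>+x. f x \<partial>N)) \<partial>PN)" by (rule mom[OF f, symmetric])
    also have "\<dots> = (\<integral>\<^sup>+N. expn (\<integral>\<^sup>+x. f x \<partial>N) \<partial>density PN w)"
      by (rule nn_integral_density[symmetric, OF wm]) (simp add: measurable_PN)
    finally show "(\<integral>\<^sup>+N. expn (\<integral>\<^sup>+x. f x \<partial>N) \<partial>density PN w) = (\<integral>\<^sup>+N. expn (\<integral>\<^sup>+x. f x \<partial>N) \<partial>M2)" ..
  qed (simp_all add: sets_PN M2_def)
  then have "emeasure (density PN w) A = emeasure M2 A" by simp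
  moreover have "emeasure (density PN w) A = (\<integral>\<^sup>+N. w N * indicator A N \<partial>PN)"
    using A by (intro emeasure_density wm) (simp add: sets_PN)
  moreover have "emeasure M2 A = (\<integral>\<^sup>+N. indicator A N \<partial>M2)" using A by (simp add: M2_def)
  moreover have "\<dots> = (\<Sum>p | partition_on I p. \<integral>\<^sup>+z. d p z * emeasure (K p z) A \<partial>\<eta>p p)"
  proof (subst M2)
    show "(\<Sum>p | partition_on I p. \<integral>\<^sup>+z. d p z * (\<integral>\<^sup>+N. indicator A N \<partial>K p z) \<partial>\<eta>p p) =
      (\<Sum>p | partition_on I p. \<integral>\<^sup>+z. d p z * emeasure (K p z) A \<partial>\<eta>p p)"
    proof (intro sum.cong refl nn_integral_cong)
      fix p z
      have "sets (K p z) = sets X" by (simp add: K_def N_post_law'_def sets_PN)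
      then show "d p z * (\<integral>\<^sup>+N. indicator A N \<partial>K p z) = d p z * emeasure (K p z) A" using A by simp
    qed
  qed (use A in simp)
  ultimately show ?thesis by (simp add: w_def d_def K_def)
qed

text \<open>The part of the mixing measure in v that does not depend on the distinct values; the
  moments \<kappa> are kept apart as a function of (v, z).\<close>

definition mix_measure :: "real \<Rightarrow> nat \<Rightarrow> real measure" where
  "mix_measure \<theta> m = density pos_lborel (\<lambda>v. ennreal (v powr (\<theta> + real m - 1)) * laplace h PN v / (ennreal (Gamma (\<theta> + real m)) * neg_moment h PN \<theta>))"

lemma neg_moment_pos: "0 < neg_moment h PN \<theta>"
proof (rule ccontr)
  assume "\<not> ?thesis"
  then have "AE N in PN. ennreal (enn2real (total_mass h N) powr (- \<theta>)) = 0"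
    unfolding neg_moment_def by (subst nn_integral_0_iff_AE[symmetric]) auto
  with total_mass_AE have "AE N in PN. False"
  proof eventually_elim
    case (elim N)
    then have "0 < enn2real (total_mass h N)" by (cases "total_mass h N") auto
    then have "0 < enn2real (total_mass h N) powr (- \<theta>)" by simp
    with elim show ?case by simp
  qed
  then show False by simp
qed

lemma nn_integral_weighted_law:
  assumes "f \<in> borel_measurable X"
  shows "(\<integral>\<^sup>+N. f N \<partial>weighted_law h PN \<theta>) =
    (\<integral>\<^sup>+N. ennreal (enn2real (total_mass h N) powr (- \<theta>)) / neg_moment h PN \<theta> * f N \<partial>PN)"
  unfolding weighted_law_def
  by (rule nn_integral_density) (use assms in \<open>simp_all add: measurable_PN\<close>)

text \<open>By the Gamma integral, \<open>T powr (- (\<theta> + m))\<close> is a mixture over \<open>v\<close> of the exponentials \<open>exp (- v T)\<close>,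
  and each of these tilts the Poisson law into another Poisson law.\<close>

lemma rectangle_formula:
  assumes s: "0 < \<theta> + real (card I)" and c: "neg_moment h PN \<theta> < \<infinity>"
    and I: "finite I" and B: "\<And>i. i \<in> I \<Longrightarrow> B i \<in> sets borel" and A: "A \<in> sets X"
  shows "(\<integral>\<^sup>+N. (\<Prod>i\<in>I. emeasure (P_of h N) (B i)) * indicator A N \<partial>weighted_law h PN \<theta>) =
    (\<Sum>p | partition_on I p. \<integral>\<^sup>+z. (\<Prod>C\<in>p. indicator (block_inter B C) (z C)) *
        (\<integral>\<^sup>+v. kappa_prod p (v, z) * emeasure (N_post_law' p (v, z)) A \<partial>mix_measure \<theta> (card I)) \<partial>\<eta>p p)"
proof -
  let ?c = "neg_moment h PN \<theta>" and ?s = "\<theta> + real (card I)"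
  have muX[measurable]: "(\<lambda>N. emeasure (mu_of h N) (B i)) \<in> borel_measurable X" if "i \<in> I" for i
    by (rule measurable_compose[OF measurable_mu_of[OF h_measurable]]) (use B[OF that] in simp)
  have PX[measurable]: "(\<lambda>N. emeasure (P_of h N) (B i)) \<in> borel_measurable X" if "i \<in> I" for i
    by (rule measurable_compose[OF measurable_P_of[OF h_measurable]]) (use B[OF that] in simp)
  have [measurable]: "A \<in> sets X" by fact
  have [measurable]: "A \<in> sets PN" using A by (simp add: sets_PN)
  have [measurable]: "(\<lambda>N. emeasure (mu_of h N) (B i)) \<in> borel_measurable PN" if "i \<in> I" for i
    unfolding measurable_PN using that by measurable
  let ?u = "\<lambda>v. ennreal (v powr (?s - 1)) / (ennreal (Gamma ?s) * ?c)"
  let ?w = "\<lambda>v N. (ennreal (expn (ennreal v * total_mass h N)) * (\<Prod>i\<in>I. emeasure (mu_of h N) (B i))) * indicator A N"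
  have "(\<integral>\<^sup>+N. (\<Prod>i\<in>I. emeasure (P_of h N) (B i)) * indicator A N \<partial>weighted_law h PN \<theta>) =
    (\<integral>\<^sup>+N. ennreal (enn2real (total_mass h N) powr (- \<theta>)) / ?c * ((\<Prod>i\<in>I. emeasure (P_of h N) (B i)) * indicator A N) \<partial>PN)"
    by (rule nn_integral_weighted_law) measurable
  also have "\<dots> = (\<integral>\<^sup>+N. \<integral>\<^sup>+v. ?u v * ?w v N \<partial>pos_lborel \<partial>PN)"
  proof (rule nn_integral_cong_AE)
    show "AE N in PN. ennreal (enn2real (total_mass h N) powr (- \<theta>)) / ?c * ((\<Prod>i\<in>I. emeasure (P_of h N) (B i)) * indicator A N) =
      (\<integral>\<^sup>+v. ?u v * ?w v N \<partial>pos_lborel)"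
      using total_mass_AE
    proof eventually_elim
      case (elim N)
      then obtain t where t: "0 < t" "total_mass h N = ennreal t" by (cases "total_mass h N") auto
      let ?M = "(\<Prod>i\<in>I. emeasure (mu_of h N) (B i)) * indicator A N"
      \<comment> \<open>Each of the \<open>card I\<close> factors of P = \<mu> / T contributes 1 /
        T, which raises the exponent from \<theta> to \<theta> + \<open>card I\<close>.\<close>
      have "(\<Prod>i\<in>I. emeasure (P_of h N) (B i)) = inverse (ennreal t) ^ card I * (\<Prod>i\<in>I. emeasure (mu_of h N) (B i))"
        by (simp add: emeasure_P_of t prod.distrib)
      then have "ennreal (enn2real (total_mass h N) powr (- \<theta>)) / ?c * ((\<Prod>i\<in>I. emeasure (P_of h N) (B i)) * indicator A N) =
        (ennreal (t powr (- \<theta>)) * inverse (ennreal t) ^ card I) * (?M / ?c)"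
        using t by (simp add: divide_ennreal_def mult_ac)
      also have "ennreal (t powr (- \<theta>)) * inverse (ennreal t) ^ card I = ennreal (t powr (- ?s))"
      proof -
        have "inverse t ^ card I = t powr (- real (card I))"
          using t(1) by (simp add: powr_minus powr_realpow power_inverse)
        then show ?thesis
          using t(1) by (simp add: inverse_ennreal ennreal_power ennreal_mult[symmetric] powr_add[symmetric] algebra_simps)
      qed
      also have "\<dots> = (\<integral>\<^sup>+v. ennreal (v powr (?s - 1)) * ennreal (exp (- v * t)) \<partial>pos_lborel) / ennreal (Gamma ?s)"
        unfolding pos_lborel_def by (rule Gamma_scaling[OF s t(1)])
      also have "\<dots> * (?M / ?c) = (\<integral>\<^sup>+v. ennreal (v powr (?s - 1)) * ennreal (exp (- v * t)) \<partial>pos_lborel) * (?M / (ennreal (Gamma ?s) * ?c))"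
        using Gamma_real_pos[OF s] c by (simp add: divide_ennreal_def ennreal_inverse_mult mult_ac)
      also have "\<dots> = (\<integral>\<^sup>+v. ennreal (v powr (?s - 1)) * ennreal (exp (- v * t)) * (?M / (ennreal (Gamma ?s) * ?c)) \<partial>pos_lborel)"
        by (rule nn_integral_multc[symmetric]) (intro measurable_pos_lborel; measurable)
      also have "\<dots> = (\<integral>\<^sup>+v. ?u v * ?w v N \<partial>pos_lborel)"
      proof (rule nn_integral_cong)
        fix v assume "v \<in> space pos_lborel"
        then have v: "0 < v" by (simp add: space_pos_lborel)
        have "expn (ennreal v * total_mass h N) = exp (- v * t)"
          using v t by (simp add: ennreal_mult[symmetric] expn_ennreal)
        then show "ennreal (v powr (?s - 1)) * ennreal (exp (- v * t)) * (?M / (ennreal (Gamma ?s) * ?c)) = ?u v * ?w v N"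
          by (simp add: divide_ennreal_def mult_ac)
      qed
      finally show ?case .
    qed
  qed
  also have "\<dots> = (\<integral>\<^sup>+v. \<integral>\<^sup>+N. ?u v * ?w v N \<partial>PN \<partial>pos_lborel)"
    by (rule nn_integral_pair_swap[OF PN.L.sigma_finite_measure_axioms sigma_finite_pos_lborel]) measurable
  also have "\<dots> = (\<integral>\<^sup>+v. ?u v * (\<Sum>p | partition_on I p. \<integral>\<^sup>+z. (laplace h PN v * (\<Prod>C\<in>p. indicator (block_inter B C) (z C)) * kappa_prod p (v, z)) *
        emeasure (N_post_law' p (v, z)) A \<partial>\<eta>p p) \<partial>pos_lborel)"
  proof (rule nn_integral_cong)
    fix v assume "v \<in> space pos_lborel"
    then have v: "0 < v" by (simp add: space_pos_lborel)
    have "(\<integral>\<^sup>+N. ?u v * ?w v N \<partial>PN) = ?u v * (\<integral>\<^sup>+N. ?w v N \<partial>PN)"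
      by (rule nn_integral_cmult) measurable
    then show "(\<integral>\<^sup>+N. ?u v * ?w v N \<partial>PN) = ?u v * (\<Sum>p | partition_on I p. \<integral>\<^sup>+z. (laplace h PN v * (\<Prod>C\<in>p. indicator (block_inter B C) (z C)) * kappa_prod p (v, z)) *
        emeasure (N_post_law' p (v, z)) A \<partial>\<eta>p p)"
      by (simp only: rectangle_formula_fixed_v[OF v I B A])
  qed
  also have "\<dots> = (\<Sum>p | partition_on I p. \<integral>\<^sup>+z. (\<Prod>C\<in>p. indicator (block_inter B C) (z C)) *
        (\<integral>\<^sup>+v. kappa_prod p (v, z) * emeasure (N_post_law' p (v, z)) A \<partial>mix_measure \<theta> (card I)) \<partial>\<eta>p p)"
  \<comment> \<open>For each partition separately v and z are exchanged; afterwards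
    \<open>laplace\<close> and the power of v reassemble into the density of
    \<open>mix_measure\<close>.\<close>
  proof -
    let ?d = "\<lambda>p z. \<Prod>C\<in>p. indicator (block_inter B C) (z C) :: ennreal"
    have lV[measurable]: "laplace h PN \<in> borel_measurable pos_lborel" "?u \<in> borel_measurable pos_lborel"
      by (intro measurable_pos_lborel; measurable)+
    { fix p assume p: "partition_on I p"
      have bl: "blocks p" "finite p" using blocks_partition_on[OF I p] by (auto simp: blocks_def)
      have Bcm: "block_inter B C \<in> sets borel" if "C \<in> p" for C
      proof -
        have "C \<subseteq> I" "finite C" "C \<noteq> {}" using p that bl by (auto simp: partition_on_def blocks_def)
        then show ?thesis unfolding block_inter_def using B by (intro sets.finite_INT) auto
      qed
      let ?\<Omega> = "pos_lborel \<Otimes>\<^sub>M \<eta>p p"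
      have sm: "measurable ?\<Omega> K = measurable (pos_lborel \<Otimes>\<^sub>M Pi\<^sub>M p (\<lambda>_. borel)) K" for K :: "'k measure"
        by (intro measurable_cong_sets sets_pair_measure_cong sets_etap refl)
      have [measurable]: "kappa_prod p \<in> borel_measurable ?\<Omega>" unfolding sm by measurable
      have [measurable]: "(\<lambda>w. emeasure (N_post_law' p w) A) \<in> borel_measurable ?\<Omega>"
        unfolding sm using measurable_emeasure_kernel[OF measurable_prob_algebraD[OF N_post_law'_kernel[OF bl(1)]] A] .
      have [measurable]: "?d p \<in> borel_measurable (\<eta>p p)"
        unfolding measurable_etap using Bcm by measurable
      have jm: "(\<lambda>(v, z). ?u v * ((laplace h PN v * ?d p z * kappa_prod p (v, z)) * emeasure (N_post_law' p (v, z)) A)) \<in> borel_measurable ?\<Omega>"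
        by measurable
      have m1: "(\<lambda>z. (laplace h PN v * ?d p z * kappa_prod p (v, z)) * emeasure (N_post_law' p (v, z)) A) \<in> borel_measurable (\<eta>p p)"
        if v: "v \<in> space pos_lborel" for v
        using v by measurable
      have "(\<integral>\<^sup>+v. ?u v * (\<integral>\<^sup>+z. (laplace h PN v * ?d p z * kappa_prod p (v, z)) * emeasure (N_post_law' p (v, z)) A \<partial>\<eta>p p) \<partial>pos_lborel) =
        (\<integral>\<^sup>+v. \<integral>\<^sup>+z. ?u v * ((laplace h PN v * ?d p z * kappa_prod p (v, z)) * emeasure (N_post_law' p (v, z)) A) \<partial>\<eta>p p \<partial>pos_lborel)"
        by (intro nn_integral_cong nn_integral_cmult[symmetric] m1)
      also have "\<dots> = (\<integral>\<^sup>+z. \<integral>\<^sup>+v. ?u v * ((laplace h PN v * ?d p z * kappa_prod p (v, z)) * emeasure (N_post_law' p (v, z)) A) \<partial>pos_lborel \<partial>\<eta>p p)"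
        by (rule nn_integral_pair_swap[OF sigma_finite_pos_lborel sigma_finite_etap[OF bl(2)] jm])
      also have "\<dots> = (\<integral>\<^sup>+z. ?d p z * (\<integral>\<^sup>+v. kappa_prod p (v, z) * emeasure (N_post_law' p (v, z)) A \<partial>mix_measure \<theta> (card I)) \<partial>\<eta>p p)"
      proof (rule nn_integral_cong)
        fix z assume z: "z \<in> space (\<eta>p p)"
        have m2: "(\<lambda>v. kappa_prod p (v, z) * emeasure (N_post_law' p (v, z)) A) \<in> borel_measurable pos_lborel"
          using z by measurable
        have "(\<integral>\<^sup>+v. kappa_prod p (v, z) * emeasure (N_post_law' p (v, z)) A \<partial>mix_measure \<theta> (card I)) =
          (\<integral>\<^sup>+v. ennreal (v powr (?s - 1)) * laplace h PN v / (ennreal (Gamma ?s) * ?c) * (kappa_prod p (v, z) * emeasure (N_post_law' p (v, z)) A) \<partial>pos_lborel)"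
          unfolding mix_measure_def by (rule nn_integral_density[OF _ m2]) (intro measurable_pos_lborel; measurable)
        then have "?d p z * (\<integral>\<^sup>+v. kappa_prod p (v, z) * emeasure (N_post_law' p (v, z)) A \<partial>mix_measure \<theta> (card I)) =
          (\<integral>\<^sup>+v. ?d p z * (ennreal (v powr (?s - 1)) * laplace h PN v / (ennreal (Gamma ?s) * ?c) * (kappa_prod p (v, z) * emeasure (N_post_law' p (v, z)) A)) \<partial>pos_lborel)"
          using m2 by (simp only:) (rule nn_integral_cmult[symmetric], intro borel_measurable_times_ennreal m2 measurable_pos_lborel, measurable)
        also have "\<dots> = (\<integral>\<^sup>+v. ?u v * ((laplace h PN v * ?d p z * kappa_prod p (v, z)) * emeasure (N_post_law' p (v, z)) A) \<partial>pos_lborel)"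
          by (intro nn_integral_cong) (simp add: divide_ennreal_def mult_ac)
        finally show "(\<integral>\<^sup>+v. ?u v * ((laplace h PN v * ?d p z * kappa_prod p (v, z)) * emeasure (N_post_law' p (v, z)) A) \<partial>pos_lborel) =
          ?d p z * (\<integral>\<^sup>+v. kappa_prod p (v, z) * emeasure (N_post_law' p (v, z)) A \<partial>mix_measure \<theta> (card I))" ..
      qed
      finally have "(\<integral>\<^sup>+v. ?u v * (\<integral>\<^sup>+z. (laplace h PN v * ?d p z * kappa_prod p (v, z)) * emeasure (N_post_law' p (v, z)) A \<partial>\<eta>p p) \<partial>pos_lborel) =
        (\<integral>\<^sup>+z. ?d p z * (\<integral>\<^sup>+v. kappa_prod p (v, z) * emeasure (N_post_law' p (v, z)) A \<partial>mix_measure \<theta> (card I)) \<partial>\<eta>p p)" .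
      moreover have "(\<lambda>v. ?u v * (\<integral>\<^sup>+z. (laplace h PN v * ?d p z * kappa_prod p (v, z)) * emeasure (N_post_law' p (v, z)) A \<partial>\<eta>p p)) \<in> borel_measurable pos_lborel"
      proof -
        interpret e: sigma_finite_measure "\<eta>p p" by (rule sigma_finite_etap[OF bl(2)])
        have "(\<lambda>(v, z). (laplace h PN v * ?d p z * kappa_prod p (v, z)) * emeasure (N_post_law' p (v, z)) A) \<in> borel_measurable ?\<Omega>"
          by measurable
        from e.borel_measurable_nn_integral[OF this] show ?thesis by measurable
      qed
      ultimately have "(\<integral>\<^sup>+v. ?u v * (\<integral>\<^sup>+z. (laplace h PN v * ?d p z * kappa_prod p (v, z)) * emeasure (N_post_law' p (v, z)) A \<partial>\<eta>p p) \<partial>pos_lborel) =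
        (\<integral>\<^sup>+z. ?d p z * (\<integral>\<^sup>+v. kappa_prod p (v, z) * emeasure (N_post_law' p (v, z)) A \<partial>mix_measure \<theta> (card I)) \<partial>\<eta>p p)"
        "(\<lambda>v. ?u v * (\<integral>\<^sup>+z. (laplace h PN v * ?d p z * kappa_prod p (v, z)) * emeasure (N_post_law' p (v, z)) A \<partial>\<eta>p p)) \<in> borel_measurable pos_lborel"
        by blast+ }
    note parts = this
    show ?thesis
      unfolding sum_distrib_left
      by (subst nn_integral_sum) (auto simp: parts intro!: sum.cong)
  qed
  finally show ?thesis .
qed

end

section \<open>Vectors with given ties\<close>

text \<open>Decodes a partition and its block values into a vector. It is reversed by
  \<open>ties\<close> and \<open>block_values\<close> when the block values are distinct; coinciding
  values would merge blocks.\<close>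

definition ext_val :: "nat set \<Rightarrow> nat set set \<Rightarrow> (nat set \<Rightarrow> 'y) \<Rightarrow> nat \<Rightarrow> 'y" where
  "ext_val I p z = (\<lambda>i\<in>I. z (THE C. C \<in> p \<and> i \<in> C))"

lemma block_subset: "partition_on I p \<Longrightarrow> C \<in> p \<Longrightarrow> C \<subseteq> I"
  and block_nonempty: "partition_on I p \<Longrightarrow> C \<in> p \<Longrightarrow> C \<noteq> {}"
  by (auto simp: partition_on_def)

lemma block_unique: "partition_on I p \<Longrightarrow> C \<in> p \<Longrightarrow> D \<in> p \<Longrightarrow> i \<in> C \<Longrightarrow> i \<in> D \<Longrightarrow> C = D"
  by (auto simp: partition_on_def disjoint_def)

lemma ext_val_eq:
  assumes p: "partition_on I p" and C: "C \<in> p" "i \<in> C"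
  shows "ext_val I p z i = z C"
proof -
  have "(THE C. C \<in> p \<and> i \<in> C) = C"
    using p C by (intro the_equality) (auto simp: partition_on_def disjoint_def)
  moreover have "i \<in> I" using p C by (auto simp: partition_on_def)
  ultimately show ?thesis by (simp add: ext_val_def)
qed

lemma ext_val_measurable:
  fixes I :: "nat set"
  assumes p: "partition_on I p"
  shows "ext_val I p \<in> Pi\<^sub>M p (\<lambda>_. borel) \<rightarrow>\<^sub>M Pi\<^sub>M I (\<lambda>_. borel)"
proof (rule measurable_PiM_single')
  fix i assume i: "i \<in> I"
  then obtain C where C: "C \<in> p" "i \<in> C" using p by (auto simp: partition_on_def)
  show "(\<lambda>z. ext_val I p z i) \<in> Pi\<^sub>M p (\<lambda>_. borel) \<rightarrow>\<^sub>M borel"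
    unfolding ext_val_eq[OF p C] using C by measurable
qed (auto simp: ext_val_def)

lemma ext_val_PiE:
  assumes p: "partition_on I p"
  shows "ext_val I p z \<in> (\<Pi>\<^sub>E i\<in>I. B i) \<longleftrightarrow> (\<forall>C\<in>p. z C \<in> block_inter B C)" (is "?l = ?r")
proof
  assume l: ?l
  show ?r
  proof (intro ballI)
    fix C assume C: "C \<in> p"
    have "z C \<in> B i" if i: "i \<in> C" for i
    proof -
      have "i \<in> I" using p C i by (auto simp: partition_on_def)
      then show ?thesis using PiE_mem[OF l, of i] by (simp add: ext_val_eq[OF p C i])
    qed
    then show "z C \<in> block_inter B C" by (simp add: block_inter_def)
  qed
next
  assume r: ?r
  have "ext_val I p z i \<in> B i" if "i \<in> I" for i
  proof -
    obtain C where C: "C \<in> p" "i \<in> C" using p \<open>i \<in> I\<close> by (auto simp: partition_on_def)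
    then show ?thesis using r by (auto simp: ext_val_eq[OF p C] block_inter_def)
  qed
  then show ?l by (auto simp: PiE_iff ext_val_def)
qed

text \<open>Replaces an equation between set systems by comparisons of pairs of coordinates, which
  for finite \<open>I\<close> makes the event measurable.\<close>

lemma ties_eq_iff:
  assumes p: "partition_on I p"
  shows "ties I y = p \<longleftrightarrow> (\<forall>i\<in>I. \<forall>j\<in>I. y i = y j \<longleftrightarrow> (\<exists>C\<in>p. i \<in> C \<and> j \<in> C))" (is "?l = ?r")
proof
  assume l: ?l
  show ?r
  proof (intro ballI iffI)
    fix i j assume ij: "i \<in> I" "j \<in> I" "y i = y j"
    have "{k \<in> I. y k = y i} \<in> p" using l ij by (auto simp: ties_def)
    then show "\<exists>C\<in>p. i \<in> C \<and> j \<in> C" using ij by (intro bexI) auto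
  next
    fix i j assume ij: "i \<in> I" "j \<in> I" "\<exists>C\<in>p. i \<in> C \<and> j \<in> C"
    then show "y i = y j" using l by (auto simp: ties_def)
  qed
next
  assume r: ?r
  have C: "C = {j \<in> I. y j = y i}" if "C \<in> p" "i \<in> C" for C i
  proof -
    have CI: "C \<subseteq> I" using p that by (auto simp: partition_on_def)
    have iI: "i \<in> I" using CI that by auto
    have "j \<in> C" if j: "j \<in> I" "y j = y i" for j
    proof -
      obtain C' where "C' \<in> p" "j \<in> C'" "i \<in> C'"
        using bspec[OF bspec[OF r j(1)] iI] j(2) by auto
      then have "C' = C" using p \<open>C \<in> p\<close> \<open>i \<in> C\<close> by (auto simp: partition_on_def disjoint_def)
      then show ?thesis using \<open>j \<in> C'\<close> by simp
    qed
    moreover have "y j = y i" if j: "j \<in> C" for j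
      using bspec[OF bspec[OF r, of j] iI] j CI \<open>C \<in> p\<close> \<open>i \<in> C\<close> by auto
    ultimately show ?thesis using CI by auto
  qed
  show ?l
  proof (intro equalityI subsetI)
    fix D assume "D \<in> ties I y"
    then obtain i where i: "i \<in> I" "D = {j \<in> I. y j = y i}" by (auto simp: ties_def)
    obtain C where "C \<in> p" "i \<in> C" using p i by (auto simp: partition_on_def)
    then show "D \<in> p" using C[of C i] i(2) by simp
  next
    fix D assume D: "D \<in> p"
    then obtain i where "i \<in> D" using block_nonempty[OF p] by blast
    moreover have "i \<in> I" using block_subset[OF p D] calculation by auto
    ultimately show "D \<in> ties I y"
      unfolding ties_def by (intro image_eqI[of _ _ i] C[OF D])
  qed
qed

lemma partition_on_ties: "partition_on I (ties I y)"
  by (auto simp: partition_on_def ties_def disjoint_def)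

lemma ties_ext_val:
  assumes p: "partition_on I p" and z: "inj_on z p"
  shows "ties I (ext_val I p z) = p"
  unfolding ties_eq_iff[OF p]
proof (intro ballI)
  fix i j assume "i \<in> I" "j \<in> I"
  then obtain C D where CD: "C \<in> p" "i \<in> C" "D \<in> p" "j \<in> D" using p by (auto simp: partition_on_def)
  have "ext_val I p z i = ext_val I p z j \<longleftrightarrow> C = D"
    using z CD by (auto simp: ext_val_eq[OF p CD(1,2)] ext_val_eq[OF p CD(3,4)] inj_on_def)
  also have "\<dots> \<longleftrightarrow> (\<exists>C\<in>p. i \<in> C \<and> j \<in> C)"
    using block_unique[OF p] CD by metis
  finally show "ext_val I p z i = ext_val I p z j \<longleftrightarrow> (\<exists>C\<in>p. i \<in> C \<and> j \<in> C)" .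
qed

lemma block_values_ext_val:
  assumes I: "finite I" and p: "partition_on I p" and z: "z \<in> extensional p"
  shows "block_values p (ext_val I p z) = z"
proof (rule ext)
  fix C
  show "block_values p (ext_val I p z) C = z C"
  proof (cases "C \<in> p")
    case True
    then have "finite C" "C \<noteq> {}"
      using block_subset[OF p] block_nonempty[OF p] finite_subset[OF _ I] by auto
    then have "Min C \<in> C" by simp
    then show ?thesis using True by (simp add: block_values_def ext_val_eq[OF p True])
  qed (use z in \<open>auto simp: block_values_def extensional_def\<close>)
qed

lemma block_values_measurable:
  assumes I: "finite I" and p: "partition_on I p"
  shows "block_values p \<in> Pi\<^sub>M I (\<lambda>_. borel) \<rightarrow>\<^sub>M Pi\<^sub>M p (\<lambda>_. borel)"
  unfolding block_values_def
proof (rule measurable_restrict)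
  fix C assume C: "C \<in> p"
  then have "finite C" "C \<noteq> {}" "C \<subseteq> I"
    using block_subset[OF p] block_nonempty[OF p] finite_subset[OF _ I] by auto
  then have "Min C \<in> I" by (meson Min_in subsetD)
  then show "(\<lambda>y. y (Min C)) \<in> Pi\<^sub>M I (\<lambda>_. borel) \<rightarrow>\<^sub>M borel" by measurable
qed

lemma ties_measurable:
  assumes I: "finite I"
  shows "ties I \<in> Pi\<^sub>M I (\<lambda>_. borel :: 'y::{second_countable_topology, t2_space} measure) \<rightarrow>\<^sub>M count_space {p. partition_on I p}"
proof (subst measurable_count_space_eq2)
  show "finite {p. partition_on I p}" by (rule finitely_many_partition_on[OF I])
  have "ties I -` {p} \<inter> space (Pi\<^sub>M I (\<lambda>_. borel :: 'y measure)) \<in> sets (Pi\<^sub>M I (\<lambda>_. borel))"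
    if p: "partition_on I p" for p
  proof -
    have [measurable]: "Measurable.pred (Pi\<^sub>M I (\<lambda>_. borel :: 'y measure)) (\<lambda>y. y i = y j)" if "i \<in> I" "j \<in> I" for i j
      using that by (intro pred_intros_logic measurable_equality_set[THEN pred_def[THEN iffD2]]) measurable
    have "ties I -` {p} \<inter> space (Pi\<^sub>M I (\<lambda>_. borel :: 'y measure)) =
      {y \<in> space (Pi\<^sub>M I (\<lambda>_. borel)). \<forall>i\<in>I. \<forall>j\<in>I. y i = y j \<longleftrightarrow> (\<exists>C\<in>p. i \<in> C \<and> j \<in> C)}"
      unfolding ties_eq_iff[OF p, symmetric] by auto
    also have "\<dots> \<in> sets (Pi\<^sub>M I (\<lambda>_. borel))"
      using I by measurable
    finally show ?thesis .
  qed
  then show "ties I \<in> space (Pi\<^sub>M I (\<lambda>_. borel :: 'y measure)) \<rightarrow> {p. partition_on I p} \<and>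
    (\<forall>p\<in>{p. partition_on I p}. ties I -` {p} \<inter> space (Pi\<^sub>M I (\<lambda>_. borel :: 'y measure)) \<in> sets (Pi\<^sub>M I (\<lambda>_. borel)))"
    using partition_on_ties by auto
qed

lemma emeasure_singleton_nonatomic:
  assumes "nonatomic M" "{x} \<in> sets M"
  shows "emeasure M {x} = 0"
proof (rule ccontr)
  assume "emeasure M {x} \<noteq> 0"
  then obtain B where "B \<subseteq> {x}" "0 < emeasure M B" "emeasure M B < emeasure M {x}"
    using assms by (auto simp: nonatomic_def zero_less_iff_neq_zero)
  then show False by (cases "B = {}") (auto simp: subset_singleton_iff)
qed

text \<open>When coordinate \<open>C\<close> is integrated first, coincidence with coordinate
  \<open>D\<close> confines it to a single point, which has measure zero. There are finitely many
  such pairs.\<close>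

lemma AE_PiM_inj_on:
  fixes M :: "'y::{second_countable_topology, t2_space} measure"
  assumes "sigma_finite_measure M" "sets M = sets borel" "nonatomic M" and p: "finite p"
  shows "AE z in Pi\<^sub>M p (\<lambda>_. M). inj_on z p"
proof -
  interpret M: sigma_finite_measure M by fact
  interpret product_sigma_finite "\<lambda>_. M" ..
  have sp: "sets (Pi\<^sub>M q (\<lambda>_. M)) = sets (Pi\<^sub>M q (\<lambda>_. borel))" for q :: "'a set"
    by (intro sets_PiM_cong refl assms)
  have m: "measurable (Pi\<^sub>M q (\<lambda>_. M)) K = measurable (Pi\<^sub>M q (\<lambda>_. borel)) K" for q :: "'a set" and K :: "'k measure"
    by (rule measurable_cong_sets[OF sp refl])
  have ne: "AE z in Pi\<^sub>M p (\<lambda>_. M). z C \<noteq> z D" if CD: "C \<in> p" "D \<in> p" "C \<noteq> D" for C D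
  proof -
    let ?S = "{z \<in> space (Pi\<^sub>M p (\<lambda>_. M)). z C = z D}"
    have S: "?S \<in> sets (Pi\<^sub>M p (\<lambda>_. M))"
      by (rule measurable_equality_set) (use CD in \<open>simp_all add: m\<close>)
    have p': "p = insert C (p - {C})" "finite (p - {C})" "C \<notin> p - {C}" using CD p by auto
    have "emeasure (Pi\<^sub>M p (\<lambda>_. M)) ?S = (\<integral>\<^sup>+z. indicator ?S z \<partial>Pi\<^sub>M p (\<lambda>_. M))" using S by simp
    also have "\<dots> = (\<integral>\<^sup>+z. \<integral>\<^sup>+x. indicator ?S (z(C := x)) \<partial>M \<partial>Pi\<^sub>M (p - {C}) (\<lambda>_. M))"
      using product_nn_integral_insert[OF p'(2,3), of "indicator ?S"] S p'(1) by simp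
    also have "\<dots> \<le> (\<integral>\<^sup>+z. emeasure M {z D} \<partial>Pi\<^sub>M (p - {C}) (\<lambda>_. M))"
    proof (intro nn_integral_mono)
      fix z
      have "(\<integral>\<^sup>+x. indicator ?S (z(C := x)) \<partial>M) \<le> (\<integral>\<^sup>+x. indicator {z D} x \<partial>M)"
        using CD by (intro nn_integral_mono) (auto simp: indicator_def)
      then show "(\<integral>\<^sup>+x. indicator ?S (z(C := x)) \<partial>M) \<le> emeasure M {z D}"
        by (simp add: assms(2))
    qed
    also have "\<dots> = 0" using emeasure_singleton_nonatomic[OF assms(3)] by (simp add: assms(2))
    finally have "emeasure (Pi\<^sub>M p (\<lambda>_. M)) ?S = 0" by simp
    with S show ?thesis by (intro AE_I[of _ _ ?S]) auto
  qed
  have "AE z in Pi\<^sub>M p (\<lambda>_. M). \<forall>C\<in>p. \<forall>D\<in>p. C \<noteq> D \<longrightarrow> z C \<noteq> z D"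
    using p ne by (simp add: AE_ball_countable countable_finite)
  then show ?thesis by eventually_elim (auto simp: inj_on_def)
qed

context poisson_model
begin

section \<open>The joint law of \<open>N\<close> and the sample\<close>

lemma mix_measure_nn_integral:
  assumes f: "f \<in> borel_measurable pos_lborel"
  shows "(\<integral>\<^sup>+v. f v \<partial>mix_measure \<theta> m) = (\<integral>\<^sup>+v. ennreal (v powr (\<theta> + real m - 1)) * laplace h PN v / (ennreal (Gamma (\<theta> + real m)) * neg_moment h PN \<theta>) * f v \<partial>pos_lborel)"
  unfolding mix_measure_def by (rule nn_integral_density[OF _ f]) (intro measurable_pos_lborel; measurable)

lemma space_mix_measure: "space (mix_measure \<theta> m) = {0<..}" by (simp add: mix_measure_def space_pos_lborel)

text \<open>Densities with respect to the product of copies of \<open>\<eta>\<close>, one per block, of the distinct values on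
  the event that the partition is \<open>p\<close>; in \<open>joint_density\<close> also with \<open>N \<in> A\<close>.\<close>

definition joint_density :: "real \<Rightarrow> nat \<Rightarrow> nat set set \<Rightarrow> ('s \<times> 'y) measure set \<Rightarrow> (nat set \<Rightarrow> 'y) \<Rightarrow> ennreal" where
  "joint_density \<theta> m p A z = (\<integral>\<^sup>+v. kappa_prod p (v, z) * emeasure (N_post_law' p (v, z)) A \<partial>mix_measure \<theta> m)"

definition values_density :: "real \<Rightarrow> nat \<Rightarrow> nat set set \<Rightarrow> (nat set \<Rightarrow> 'y) \<Rightarrow> ennreal" where
  "values_density \<theta> m p z = (\<integral>\<^sup>+v. kappa_prod p (v, z) \<partial>mix_measure \<theta> m)"

lemma N_post_law'_measurable:
  assumes "blocks p" "A \<in> sets X"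
  shows "(\<lambda>w. emeasure (N_post_law' p w) A) \<in> borel_measurable (pos_lborel \<Otimes>\<^sub>M Pi\<^sub>M p (\<lambda>_. borel))"
  using measurable_emeasure_kernel[OF measurable_prob_algebraD[OF N_post_law'_kernel[OF assms(1)]] assms(2)] .

lemma borel_measurable_mix_measure_integral:
  assumes "(\<lambda>(v, z). F v z) \<in> borel_measurable (pos_lborel \<Otimes>\<^sub>M M)"
  shows "(\<lambda>z. \<integral>\<^sup>+v. F v z \<partial>mix_measure \<theta> m) \<in> borel_measurable M"
proof -
  interpret pos_lborel: sigma_finite_measure pos_lborel by (rule sigma_finite_pos_lborel)
  have [measurable]: "(\<lambda>(v, z). F v z) \<in> borel_measurable (pos_lborel \<Otimes>\<^sub>M M)" by fact
  have [measurable]: "laplace h PN \<in> borel_measurable pos_lborel" by (rule measurable_pos_lborel) simp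
  have "(\<lambda>(z, v). ennreal (v powr (\<theta> + real m - 1)) * laplace h PN v / (ennreal (Gamma (\<theta> + real m)) * neg_moment h PN \<theta>) * F v z) \<in> borel_measurable (M \<Otimes>\<^sub>M pos_lborel)"
    by measurable
  from pos_lborel.borel_measurable_nn_integral[OF this]
  show ?thesis
    by (rule measurable_cong[THEN iffD2, rotated]) (rule mix_measure_nn_integral, measurable)
qed

lemma joint_density_measurable [measurable]:
  assumes "blocks p" "A \<in> sets X"
  shows "joint_density \<theta> m p A \<in> borel_measurable (Pi\<^sub>M p (\<lambda>_. borel))"
proof -
  have [measurable]: "(\<lambda>w. emeasure (N_post_law' p w) A) \<in> borel_measurable (pos_lborel \<Otimes>\<^sub>M Pi\<^sub>M p (\<lambda>_. borel))"
    by (rule N_post_law'_measurable[OF assms])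
  show ?thesis unfolding joint_density_def[abs_def] by (rule borel_measurable_mix_measure_integral) measurable
qed

lemma values_density_measurable [measurable]: "values_density \<theta> m p \<in> borel_measurable (Pi\<^sub>M p (\<lambda>_. borel))"
  unfolding values_density_def[abs_def] by (rule borel_measurable_mix_measure_integral) measurable

lemma N_post_law'_prob: "blocks p \<Longrightarrow> 0 < v \<Longrightarrow> prob_space (N_post_law' p (v, z))"
  by (auto simp: N_post_law'_def PN.L.prob_space_axioms intro: prob_space_N_post_law)

lemma sets_N_post_law': "sets (N_post_law' p w) = sets X" by (cases w) (simp add: N_post_law'_def sets_PN)

lemma joint_density_space: "blocks p \<Longrightarrow> joint_density \<theta> m p (space X) z = values_density \<theta> m p z"
  unfolding joint_density_def values_density_def
proof (rule nn_integral_cong)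
  fix v assume "blocks p" "v \<in> space (mix_measure \<theta> m)"
  then interpret prob_space "N_post_law' p (v, z)" by (intro N_post_law'_prob) (auto simp: space_mix_measure)
  show "kappa_prod p (v, z) * emeasure (N_post_law' p (v, z)) (space X) = kappa_prod p (v, z)"
    using emeasure_space_1 sets_eq_imp_space_eq[OF sets_N_post_law', of p "(v, z)"] by simp
qed

lemma joint_density_le_values_density: "blocks p \<Longrightarrow> joint_density \<theta> m p A z \<le> values_density \<theta> m p z"
  unfolding joint_density_def values_density_def
proof (rule nn_integral_mono)
  fix v assume "blocks p" "v \<in> space (mix_measure \<theta> m)"
  then interpret prob_space "N_post_law' p (v, z)" by (intro N_post_law'_prob) (auto simp: space_mix_measure)
  show "kappa_prod p (v, z) * emeasure (N_post_law' p (v, z)) A \<le> kappa_prod p (v, z)"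
    using mult_left_mono[OF emeasure_le_1, of "kappa_prod p (v, z)"] by simp
qed

text \<open>Rectangles determine a finite measure on the product space, so \<open>R\<close> is a sum
  over partitions of images under \<open>ext_val\<close>. It is left abstract in order to cover the
  law of the given sample, its part on an event for N, and the first coordinates of an infinite
  sequence.\<close>

lemma joint_law:
  assumes s: "0 < \<theta> + real (card I)" and c: "neg_moment h PN \<theta> < \<infinity>" and I: "finite I" and A: "A \<in> sets X"
    and R: "finite_measure R" "sets R = sets (Pi\<^sub>M I (\<lambda>_. borel))"
    and eq: "\<And>B. (\<And>i. i \<in> I \<Longrightarrow> B i \<in> sets borel) \<Longrightarrow> emeasure R (\<Pi>\<^sub>E i\<in>I. B i) =
      (\<integral>\<^sup>+N. (\<Prod>i\<in>I. emeasure (P_of h N) (B i)) * indicator A N \<partial>weighted_law h PN \<theta>)"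
    and F: "F \<in> borel_measurable (Pi\<^sub>M I (\<lambda>_. borel))"
  shows "(\<integral>\<^sup>+y. F y \<partial>R) = (\<Sum>p | partition_on I p. \<integral>\<^sup>+z. F (ext_val I p z) * joint_density \<theta> (card I) p A z \<partial>\<eta>p p)"
proof -
  let ?S = "Pi\<^sub>M I (\<lambda>_. borel :: 'y measure)" and ?parts = "{p. partition_on I p}"
  have fin: "finite ?parts" by (rule finitely_many_partition_on[OF I])
  have bl: "blocks p" "finite p" if "partition_on I p" for p
    using blocks_partition_on[OF I that] by (auto simp: blocks_def)
  have um: "joint_density \<theta> (card I) p A \<in> borel_measurable (\<eta>p p)" if "partition_on I p" for p
    unfolding measurable_etap by (rule joint_density_measurable[OF bl(1)[OF that] A])
  have em: "ext_val I p \<in> density (\<eta>p p) (joint_density \<theta> (card I) p A) \<rightarrow>\<^sub>M ?S" if "partition_on I p" for p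
    using ext_val_measurable[OF that] by (simp add: measurable_etap)
  define Rp where "Rp p = distr (density (\<eta>p p) (joint_density \<theta> (card I) p A)) ?S (ext_val I p)" for p
  define R2 where "R2 = mixture ?S (count_space ?parts) Rp"
  have k: "Rp \<in> count_space ?parts \<rightarrow>\<^sub>M measure_algebra ?S"
    by (simp add: space_measure_algebra Rp_def)
  have R2: "(\<integral>\<^sup>+y. G y \<partial>R2) = (\<Sum>p | partition_on I p. \<integral>\<^sup>+z. G (ext_val I p z) * joint_density \<theta> (card I) p A z \<partial>\<eta>p p)"
    if G: "G \<in> borel_measurable ?S" for G
  proof -
    have "(\<integral>\<^sup>+y. G y \<partial>R2) = (\<Sum>p | partition_on I p. \<integral>\<^sup>+y. G y \<partial>Rp p)"
      unfolding R2_def nn_integral_mixture[OF k G] by (rule nn_integral_count_space_finite[OF fin])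
    also have "\<dots> = (\<Sum>p | partition_on I p. \<integral>\<^sup>+z. G (ext_val I p z) * joint_density \<theta> (card I) p A z \<partial>\<eta>p p)"
    proof (rule sum.cong[OF refl])
      fix p assume "p \<in> ?parts"
      then have p: "partition_on I p" by simp
      have Ge: "(\<lambda>z. G (ext_val I p z)) \<in> borel_measurable (\<eta>p p)"
        using measurable_compose[OF ext_val_measurable[OF p] G] by (simp add: measurable_etap)
      have "(\<integral>\<^sup>+y. G y \<partial>Rp p) = (\<integral>\<^sup>+z. G (ext_val I p z) \<partial>density (\<eta>p p) (joint_density \<theta> (card I) p A))"
        unfolding Rp_def by (subst nn_integral_distr[OF em[OF p]]) (use G in auto)
      also have "\<dots> = (\<integral>\<^sup>+z. joint_density \<theta> (card I) p A z * G (ext_val I p z) \<partial>\<eta>p p)"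
        by (rule nn_integral_density[OF um[OF p] Ge])
      finally show "(\<integral>\<^sup>+y. G y \<partial>Rp p) = (\<integral>\<^sup>+z. G (ext_val I p z) * joint_density \<theta> (card I) p A z \<partial>\<eta>p p)"
        by (simp add: mult.commute)
    qed
    finally show ?thesis .
  qed
  have "R = R2"
  proof (rule measure_eqI_PiM_finite[OF I R(2), where A="\<lambda>_. space ?S"])
    show "sets R2 = sets ?S" by (simp add: R2_def)
    show "range (\<lambda>_. space ?S) \<subseteq> prod_algebra I (\<lambda>_. borel)"
      using I by (auto simp: space_PiM intro!: prod_algebraI_finite)
    show "emeasure R (space ?S) \<noteq> \<infinity>"
      using finite_measure.emeasure_finite[OF R(1)] by simp
    fix B :: "nat \<Rightarrow> 'y set" assume B: "\<And>i. i \<in> I \<Longrightarrow> B i \<in> sets borel"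
    have Bm: "(\<Pi>\<^sub>E i\<in>I. B i) \<in> sets ?S" using I B by (intro sets_PiM_I_finite) auto
    have "emeasure R2 (\<Pi>\<^sub>E i\<in>I. B i) = (\<integral>\<^sup>+y. indicator (\<Pi>\<^sub>E i\<in>I. B i) y \<partial>R2)"
      using Bm by (simp add: R2_def)
    also have "\<dots> = (\<Sum>p | partition_on I p. \<integral>\<^sup>+z. indicator (\<Pi>\<^sub>E i\<in>I. B i) (ext_val I p z) * joint_density \<theta> (card I) p A z \<partial>\<eta>p p)"
      using Bm by (intro R2) simp
    also have "\<dots> = (\<Sum>p | partition_on I p. \<integral>\<^sup>+z. (\<Prod>C\<in>p. indicator (block_inter B C) (z C)) * joint_density \<theta> (card I) p A z \<partial>\<eta>p p)"
    proof (intro sum.cong nn_integral_cong arg_cong2[of _ _ _ _ "(*)"] refl)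
      fix p z assume "p \<in> ?parts"
      then have p: "partition_on I p" by simp
      show "indicator (\<Pi>\<^sub>E i\<in>I. B i) (ext_val I p z) = (\<Prod>C\<in>p. indicator (block_inter B C) (z C) :: ennreal)"
      proof (cases "\<forall>C\<in>p. z C \<in> block_inter B C")
        case False
        then obtain C where "C \<in> p" "z C \<notin> block_inter B C" by auto
        then have "(\<Prod>C\<in>p. indicator (block_inter B C) (z C) :: ennreal) = 0"
          using bl(2)[OF p] by (intro prod_zero bexI[of _ C]) auto
        then show ?thesis using False ext_val_PiE[OF p, of z B] by simp
      qed (use ext_val_PiE[OF p, of z B] in \<open>auto intro!: prod.neutral\<close>)
    qed
    also have "\<dots> = (\<integral>\<^sup>+N. (\<Prod>i\<in>I. emeasure (P_of h N) (B i)) * indicator A N \<partial>weighted_law h PN \<theta>)"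
      unfolding joint_density_def by (rule rectangle_formula[OF s c I B A, symmetric])
    also have "\<dots> = emeasure R (\<Pi>\<^sub>E i\<in>I. B i)" by (rule eq[OF B, symmetric])
    finally show "emeasure R (\<Pi>\<^sub>E i\<in>I. B i) = emeasure R2 (\<Pi>\<^sub>E i\<in>I. B i)" ..
  qed (simp add: space_PiM)
  then show ?thesis using R2[OF F] by simp
qed

end

text \<open>Checked on boxes, where the integral of the product factorizes. It turns a product of
  value laws into one density with respect to copies of \<eta>.\<close>

lemma emeasure_PiM_density:
  assumes \<eta>: "sigma_finite_measure \<eta>" and p: "finite p"
    and f: "\<And>i. i \<in> p \<Longrightarrow> f i \<in> borel_measurable \<eta>" and pr: "\<And>i. i \<in> p \<Longrightarrow> prob_space (density \<eta> (f i))"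
    and D: "D \<in> sets (Pi\<^sub>M p (\<lambda>_. \<eta>))"
  shows "emeasure (Pi\<^sub>M p (\<lambda>i. density \<eta> (f i))) D = (\<integral>\<^sup>+z. (\<Prod>i\<in>p. f i (z i)) * indicator D z \<partial>Pi\<^sub>M p (\<lambda>_. \<eta>))"
proof -
  interpret \<eta>: sigma_finite_measure \<eta> by fact
  interpret E: product_sigma_finite "\<lambda>_. \<eta>" ..
  define M where "M i = (if i \<in> p then density \<eta> (f i) else \<eta>)" for i
  have "sigma_finite_measure (M i)" for i
    using pr[of i] \<eta> by (auto simp: M_def prob_space_imp_sigma_finite)
  then interpret M: product_sigma_finite M by (simp add: product_sigma_finite_def)
  have [measurable]: "(\<lambda>z. f i (z i)) \<in> borel_measurable (Pi\<^sub>M p (\<lambda>_. \<eta>))" if "i \<in> p" for i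
    using that f by (intro measurable_compose[OF measurable_component_singleton]) auto
  have s: "sets (Pi\<^sub>M p (\<lambda>_. \<eta>)) = sets (Pi\<^sub>M p M)" by (intro sets_PiM_cong) (auto simp: M_def)
  have "density (Pi\<^sub>M p (\<lambda>_. \<eta>)) (\<lambda>z. \<Prod>i\<in>p. f i (z i)) = Pi\<^sub>M p M"
  proof (rule M.PiM_eqI[OF p])
    fix A assume A: "\<And>i. i \<in> p \<Longrightarrow> A i \<in> sets (M i)"
    then have A': "\<And>i. i \<in> p \<Longrightarrow> A i \<in> sets \<eta>" by (simp add: M_def)
    have m: "(\<lambda>x. f i x * indicator (A i) x) \<in> borel_measurable \<eta>" if "i \<in> p" for i
      using f[OF that] A'[OF that] by measurable
    have "emeasure (density (Pi\<^sub>M p (\<lambda>_. \<eta>)) (\<lambda>z. \<Prod>i\<in>p. f i (z i))) (Pi\<^sub>E p A) =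
      (\<integral>\<^sup>+z. (\<Prod>i\<in>p. f i (z i)) * indicator (Pi\<^sub>E p A) z \<partial>Pi\<^sub>M p (\<lambda>_. \<eta>))"
      using p A' by (intro emeasure_density sets_PiM_I_finite) auto
    also have "\<dots> = (\<integral>\<^sup>+z. (\<Prod>i\<in>p. f i (z i) * indicator (A i) (z i)) \<partial>Pi\<^sub>M p (\<lambda>_. \<eta>))"
    proof (rule nn_integral_cong)
      fix z assume "z \<in> space (Pi\<^sub>M p (\<lambda>_. \<eta>))"
      then have z: "z \<in> extensional p" by (simp add: space_PiM PiE_iff)
      show "(\<Prod>i\<in>p. f i (z i)) * indicator (Pi\<^sub>E p A) z = (\<Prod>i\<in>p. f i (z i) * indicator (A i) (z i))"
      proof (cases "\<forall>i\<in>p. z i \<in> A i")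
        case False
        then obtain i where "i \<in> p" "z i \<notin> A i" by auto
        then have "(\<Prod>i\<in>p. f i (z i) * indicator (A i) (z i)) = 0" "z \<notin> Pi\<^sub>E p A"
          using p by (auto intro!: prod_zero bexI[of _ i])
        then show ?thesis by simp
      qed (use z in \<open>auto simp: PiE_iff intro!: prod.cong\<close>)
    qed
    also have "\<dots> = (\<Prod>i\<in>p. \<integral>\<^sup>+x. f i x * indicator (A i) x \<partial>\<eta>)"
      by (rule E.product_nn_integral_prod[OF p m])
    also have "\<dots> = (\<Prod>i\<in>p. emeasure (M i) (A i))"
      using f A' by (intro prod.cong) (auto simp: M_def emeasure_density)
    finally show "emeasure (density (Pi\<^sub>M p (\<lambda>_. \<eta>)) (\<lambda>z. \<Prod>i\<in>p. f i (z i))) (Pi\<^sub>E p A) = (\<Prod>i\<in>p. emeasure (M i) (A i))" .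
  qed (simp add: s)
  moreover have "Pi\<^sub>M p M = Pi\<^sub>M p (\<lambda>i. density \<eta> (f i))" by (rule PiM_cong) (auto simp: M_def)
  ultimately have "emeasure (Pi\<^sub>M p (\<lambda>i. density \<eta> (f i))) D = emeasure (density (Pi\<^sub>M p (\<lambda>_. \<eta>)) (\<lambda>z. \<Prod>i\<in>p. f i (z i))) D"
    by simp
  also have "\<dots> = (\<integral>\<^sup>+z. (\<Prod>i\<in>p. f i (z i)) * indicator D z \<partial>Pi\<^sub>M p (\<lambda>_. \<eta>))"
    using D by (intro emeasure_density) auto
  finally show ?thesis .
qed

context poisson_model
begin

section \<open>The law of the partition and of the distinct values\<close>

text \<open>As h > 0, a vanishing moment would make \<open>\<nu>\<close> null, which the nonzero
  Laplace exponent of T excludes.\<close>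

lemma kappa_total_pos: "0 < kappa_total h m (tilt h v \<rho>) \<eta>"
proof (rule ccontr)
  assume "\<not> ?thesis"
  then have 0: "(\<integral>\<^sup>+x. ennreal (h (fst x) ^ m * exp (- v * h (fst x))) \<partial>\<nu>) = 0"
    by (simp add: kappa_total_eq)
  have "AE x in \<nu>. ennreal (h (fst x) ^ m * exp (- v * h (fst x))) = 0"
    using 0 by (subst (asm) nn_integral_0_iff_AE) (simp_all add: measurable_nu)
  then have "AE x in \<nu>. ennreal (1 - expn (ennreal (h (fst x)))) = 0"
  proof eventually_elim
    case (elim x)
    have "0 < h (fst x) ^ m * exp (- v * h (fst x))" using h_pos[of "fst x"] by simp
    with elim show ?case by simp
  qed
  then have "(\<integral>\<^sup>+x. ennreal (1 - expn (ennreal (h (fst x)))) \<partial>\<nu>) = 0"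
    by (subst nn_integral_0_iff_AE) (simp_all add: measurable_nu)
  then show False using laplace_h_neq_0 by simp
qed

lemma prob_space_value_law:
  assumes "0 < v" "1 \<le> m"
  shows "prob_space (value_law h m (tilt h v \<rho>) \<eta>)"
proof (rule prob_spaceI)
  let ?t = "kappa_total h m (tilt h v \<rho>) \<eta>"
  have "emeasure (value_law h m (tilt h v \<rho>) \<eta>) (space (value_law h m (tilt h v \<rho>) \<eta>)) =
    (\<integral>\<^sup>+y. kappa h m (tilt h v \<rho>) y / ?t \<partial>\<eta>)"
    unfolding value_law_def by (subst emeasure_density) (auto simp: measurable_eta cong: nn_integral_cong)
  also have "\<dots> = ?t / ?t"
    by (subst nn_integral_divide) (simp_all add: kappa_total_def measurable_eta)
  also have "\<dots> = 1"
    using kappa_total_finite[OF assms] kappa_total_pos[of m v] by (intro ennreal_divide_self) auto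
  finally show "emeasure (value_law h m (tilt h v \<rho>) \<eta>) (space (value_law h m (tilt h v \<rho>) \<eta>)) = 1" .
qed

lemma kappa_total_measurable [measurable]: "(\<lambda>v. kappa_total h m (tilt h v \<rho>) \<eta>) \<in> borel_measurable borel"
proof -
  interpret sigma_finite_measure \<nu> by (rule sigma_finite_nu)
  have f: "(\<lambda>x. h (fst x)) \<in> borel_measurable \<nu>" unfolding measurable_nu by measurable
  have "(\<lambda>(v, x). ennreal (h (fst x) ^ m * exp (- v * h (fst x)))) \<in> borel_measurable (borel \<Otimes>\<^sub>M \<nu>)"
    using f by measurable
  from borel_measurable_nn_integral[OF this] show ?thesis unfolding kappa_total_eq by simp
qed

lemma kappa_prod_AE:
  assumes "finite p"
  shows "AE z in \<eta>p p. kappa_prod p (v, z) = raw_kappa_prod v p z"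
  using g_mass_finite_AE_etap[OF assms] by eventually_elim (simp add: kappa_prod_def)

text \<open>The totals \<open>kappa_total\<close> in the denominators of the value laws cancel
  against the product in \<open>mix_joint\<close>; exchanging v and z then leaves the integral of
  \<open>values_density\<close>.\<close>

lemma partition_values_law:
  assumes p: "blocks p" and D: "D \<in> sets (Pi\<^sub>M p (\<lambda>_. borel))"
  shows "(\<integral>\<^sup>+v. emeasure (Pi\<^sub>M p (\<lambda>C. value_law h (card C) (tilt h v \<rho>) \<eta>)) D \<partial>mix_joint h \<rho> \<eta> PN \<theta> m p) =
    (\<integral>\<^sup>+z. indicator D z * values_density \<theta> m p z \<partial>\<eta>p p)"
proof -
  have fp: "finite p" using p by (simp add: blocks_def)
  let ?t = "\<lambda>v. \<Prod>C\<in>p. kappa_total h (card C) (tilt h v \<rho>) \<eta>"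
  let ?c = "ennreal (Gamma (\<theta> + real m)) * neg_moment h PN \<theta>"
  let ?e = "\<lambda>v. emeasure (Pi\<^sub>M p (\<lambda>C. value_law h (card C) (tilt h v \<rho>) \<eta>)) D"
  let ?I = "\<lambda>v. \<integral>\<^sup>+z. kappa_prod p (v, z) * indicator D z \<partial>\<eta>p p"
  let ?q = "\<lambda>v. ennreal (v powr (\<theta> + real m - 1)) * laplace h PN v / ?c"
  interpret E: sigma_finite_measure "\<eta>p p" by (rule sigma_finite_etap[OF fp])
  have sm: "measurable (pos_lborel \<Otimes>\<^sub>M \<eta>p p) K = measurable (pos_lborel \<Otimes>\<^sub>M Pi\<^sub>M p (\<lambda>_. borel)) K" for K :: "'k measure"
    by (intro measurable_cong_sets sets_pair_measure_cong sets_etap refl)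
  have Wm[measurable]: "kappa_prod p \<in> borel_measurable (pos_lborel \<Otimes>\<^sub>M \<eta>p p)" unfolding sm by measurable
  have [measurable]: "D \<in> sets (\<eta>p p)" using D by (simp add: sets_etap)
  have [measurable]: "laplace h PN \<in> borel_measurable pos_lborel" "?t \<in> borel_measurable pos_lborel"
    by (intro measurable_pos_lborel; measurable)+
  have "(\<lambda>(v, z). kappa_prod p (v, z) * indicator D z) \<in> borel_measurable (pos_lborel \<Otimes>\<^sub>M \<eta>p p)" by measurable
  from E.borel_measurable_nn_integral[OF this] have Im[measurable]: "?I \<in> borel_measurable pos_lborel" by simp
  have e: "?t v * ?e v = ?I v" "?e v = ?I v / ?t v" if v: "v \<in> space pos_lborel" for v
  proof -
    have v: "0 < v" using v by (simp add: space_pos_lborel)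
    have t: "0 < kappa_total h (card C) (tilt h v \<rho>) \<eta>" "kappa_total h (card C) (tilt h v \<rho>) \<eta> < \<top>" if "C \<in> p" for C
      using kappa_total_pos kappa_total_finite[OF v blocks_card[OF p that]] by auto
    have T: "?t v \<noteq> 0" "?t v \<noteq> \<top>"
      using fp by (auto simp: prod_zero_iff ennreal_prod_eq_top dest: t)
    have "?e v = (\<integral>\<^sup>+z. (\<Prod>C\<in>p. kappa h (card C) (tilt h v \<rho>) (z C) / kappa_total h (card C) (tilt h v \<rho>) \<eta>) * indicator D z \<partial>\<eta>p p)"
      unfolding value_law_def using prob_space_value_law[OF v blocks_card[OF p]]
      by (intro emeasure_PiM_density sigma_finite_eta fp) (auto simp: measurable_eta value_law_def)
    also have "\<dots> = (\<integral>\<^sup>+z. (kappa_prod p (v, z) * indicator D z) / ?t v \<partial>\<eta>p p)"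
    proof (rule nn_integral_cong_AE, use kappa_prod_AE[OF fp, of v] in eventually_elim)
      fix z assume *: "kappa_prod p (v, z) = raw_kappa_prod v p z"
      \<comment> \<open>The inverse of the product splits because every total is finite; in general
        0 and \<infinity> would interfere.\<close>
      have "(\<Prod>C\<in>p. inverse (kappa_total h (card C) (tilt h v \<rho>) \<eta>)) = inverse (?t v)"
        using fp t
      proof (induction p rule: finite_induct)
        case (insert C q)
        have "(\<Prod>C\<in>q. kappa_total h (card C) (tilt h v \<rho>) \<eta>) \<noteq> \<top>" "kappa_total h (card C) (tilt h v \<rho>) \<eta> \<noteq> \<top>"
          using insert by (auto simp: ennreal_prod_eq_top less_top)
        with insert show ?case by (simp add: ennreal_inverse_mult less_top)
      qed simp
      then show "(\<Prod>C\<in>p. kappa h (card C) (tilt h v \<rho>) (z C) / kappa_total h (card C) (tilt h v \<rho>) \<eta>) * indicator D z =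
        kappa_prod p (v, z) * indicator D z / ?t v"
        unfolding * by (simp add: divide_ennreal_def prod.distrib mult_ac)
    qed
    also have "\<dots> = ?I v / ?t v"
      using v by (intro nn_integral_divide) (simp add: space_pos_lborel)
    finally show 1: "?e v = ?I v / ?t v" .
    show "?t v * ?e v = ?I v"
      unfolding 1 using T ennreal_mult_divide_eq[of "?t v" "?I v"] by (simp add: ennreal_times_divide mult.commute)
  qed
  have em: "?e \<in> borel_measurable pos_lborel"
    by (rule measurable_cong[THEN iffD2, OF e(2)]) measurable
  have "(\<integral>\<^sup>+v. ?e v \<partial>mix_joint h \<rho> \<eta> PN \<theta> m p) = (\<integral>\<^sup>+v. (?t v * ennreal (v powr (\<theta> + real m - 1)) * laplace h PN v / ?c) * ?e v \<partial>pos_lborel)"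
    unfolding mix_joint_def pos_lborel_def[symmetric] by (rule nn_integral_density[OF _ em]) measurable
  also have "\<dots> = (\<integral>\<^sup>+v. ?q v * ?I v \<partial>pos_lborel)"
  proof (rule nn_integral_cong)
    fix v assume v: "v \<in> space pos_lborel"
    have "(?t v * ennreal (v powr (\<theta> + real m - 1)) * laplace h PN v / ?c) * ?e v = ?q v * (?t v * ?e v)"
      by (simp add: divide_ennreal_def mult_ac)
    then show "(?t v * ennreal (v powr (\<theta> + real m - 1)) * laplace h PN v / ?c) * ?e v = ?q v * ?I v"
      unfolding e(1)[OF v] .
  qed
  also have "\<dots> = (\<integral>\<^sup>+v. \<integral>\<^sup>+z. ?q v * (kappa_prod p (v, z) * indicator D z) \<partial>\<eta>p p \<partial>pos_lborel)"
    by (intro nn_integral_cong nn_integral_cmult[symmetric]) measurable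
  also have "\<dots> = (\<integral>\<^sup>+z. \<integral>\<^sup>+v. ?q v * (kappa_prod p (v, z) * indicator D z) \<partial>pos_lborel \<partial>\<eta>p p)"
    by (rule nn_integral_pair_swap[OF sigma_finite_pos_lborel sigma_finite_etap[OF fp]]) measurable
  also have "\<dots> = (\<integral>\<^sup>+z. indicator D z * values_density \<theta> m p z \<partial>\<eta>p p)"
  proof (rule nn_integral_cong)
    fix z assume "z \<in> space (\<eta>p p)"
    then have z: "z \<in> space (Pi\<^sub>M p (\<lambda>_. borel))" by (simp add: space_PiM space_eta)
    have Wz: "(\<lambda>v. kappa_prod p (v, z)) \<in> borel_measurable pos_lborel"
      by (rule measurable_compose[OF measurable_Pair2'[OF z] kappa_prod_measurable])
    have "(\<integral>\<^sup>+v. ?q v * (kappa_prod p (v, z) * indicator D z) \<partial>pos_lborel) = (\<integral>\<^sup>+v. indicator D z * (?q v * kappa_prod p (v, z)) \<partial>pos_lborel)"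
      by (simp add: mult_ac)
    also have "\<dots> = indicator D z * (\<integral>\<^sup>+v. ?q v * kappa_prod p (v, z) \<partial>pos_lborel)"
      using Wz z by (intro nn_integral_cmult) measurable
    finally show "(\<integral>\<^sup>+v. ?q v * (kappa_prod p (v, z) * indicator D z) \<partial>pos_lborel) = indicator D z * values_density \<theta> m p z"
      unfolding values_density_def mix_measure_nn_integral[OF Wz] .
  qed
  finally show ?thesis .
qed

lemma partition_prob_eq:
  assumes p: "blocks p"
  shows "partition_prob h \<rho> \<eta> PN \<theta> m p = (\<integral>\<^sup>+z. values_density \<theta> m p z \<partial>\<eta>p p)"
proof -
  let ?S = "space (Pi\<^sub>M p (\<lambda>_. borel :: 'y measure))"
  have "partition_prob h \<rho> \<eta> PN \<theta> m p = (\<integral>\<^sup>+v. 1 \<partial>mix_joint h \<rho> \<eta> PN \<theta> m p)"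
    by (simp add: partition_prob_def)
  also have "\<dots> = (\<integral>\<^sup>+v. emeasure (Pi\<^sub>M p (\<lambda>C. value_law h (card C) (tilt h v \<rho>) \<eta>)) ?S \<partial>mix_joint h \<rho> \<eta> PN \<theta> m p)"
  proof (rule nn_integral_cong)
    fix v assume "v \<in> space (mix_joint h \<rho> \<eta> PN \<theta> m p)"
    then have v: "0 < v" by (simp add: mix_joint_def space_restrict_space)
    interpret prob_space "Pi\<^sub>M p (\<lambda>C. value_law h (card C) (tilt h v \<rho>) \<eta>)"
      using v p by (intro prob_space_PiM prob_space_value_law blocks_card)
    have "?S = space (Pi\<^sub>M p (\<lambda>C. value_law h (card C) (tilt h v \<rho>) \<eta>))"
      by (simp add: space_PiM value_law_def space_eta)
    then show "1 = emeasure (Pi\<^sub>M p (\<lambda>C. value_law h (card C) (tilt h v \<rho>) \<eta>)) ?S"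
      using emeasure_space_1 by simp
  qed
  also have "\<dots> = (\<integral>\<^sup>+z. indicator ?S z * values_density \<theta> m p z \<partial>\<eta>p p)" by (rule partition_values_law[OF p]) simp
  also have "\<dots> = (\<integral>\<^sup>+z. values_density \<theta> m p z \<partial>\<eta>p p)"
    by (intro nn_integral_cong) (simp add: space_PiM space_eta)
  finally show ?thesis .
qed

text \<open>For a constant kernel the moment \<kappa> does not depend on y, so it cancels from the
  density and leaves only \<eta> to be normalized. The result is free of v and of the block size,
  which lets the mixture over v factorize.\<close>

lemma value_law_constant:
  assumes \<rho>: "\<forall>y y'. \<rho> y = \<rho> y'" and v: "0 < v" "1 \<le> m"
  shows "value_law h m (tilt h v \<rho>) \<eta> = normalize_measure \<eta>"
proof (rule measure_eqI)
  let ?t = "kappa_total h m (tilt h v \<rho>) \<eta>" and ?k = "\<lambda>y. kappa h m (tilt h v \<rho>) y"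
  have k: "?k y = ?k undefined" for y using \<rho> by (metis (no_types, lifting) kappa_tilt)
  have t: "?t = ?k undefined * emeasure \<eta> (space \<eta>)"
    unfolding kappa_total_def using nn_integral_cong[of \<eta> ?k "\<lambda>_. ?k undefined", OF k] by simp
  have k0: "?k undefined \<noteq> 0" "emeasure \<eta> (space \<eta>) \<noteq> 0" and kt: "?k undefined \<noteq> \<top>" "emeasure \<eta> (space \<eta>) \<noteq> \<top>"
    using kappa_total_pos[of m v] kappa_total_finite[OF v] unfolding t
    by (auto simp: ennreal_mult_less_top)
  fix A assume "A \<in> sets (value_law h m (tilt h v \<rho>) \<eta>)"
  then have A: "A \<in> sets \<eta>" by (simp add: value_law_def)
  have "emeasure (value_law h m (tilt h v \<rho>) \<eta>) A = (\<integral>\<^sup>+y. ?k y / ?t * indicator A y \<partial>\<eta>)"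
    unfolding value_law_def using A by (intro emeasure_density) (auto simp: measurable_eta)
  also have "\<dots> = ?k undefined / ?t * emeasure \<eta> A"
  proof -
    have "(\<integral>\<^sup>+y. ?k y / ?t * indicator A y \<partial>\<eta>) = (\<integral>\<^sup>+y. ?k undefined / ?t * indicator A y \<partial>\<eta>)"
    proof (rule nn_integral_cong)
      fix y show "?k y / ?t * indicator A y = ?k undefined / ?t * indicator A y" using k[of y] by simp
    qed
    then show ?thesis using A by (simp add: nn_integral_cmult_indicator)
  qed
  also have "?k undefined / ?t = inverse (emeasure \<eta> (space \<eta>))"
    using k0 kt ennreal_divide_self[of "?k undefined"] unfolding t
    by (simp add: divide_ennreal_def ennreal_inverse_mult less_top mult.assoc[symmetric])
  finally show "emeasure (value_law h m (tilt h v \<rho>) \<eta>) A = emeasure (normalize_measure \<eta>) A"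
    by (simp add: emeasure_normalize_measure)
qed (simp add: value_law_def)

lemma partition_values_law_constant:
  assumes \<rho>: "\<forall>y y'. \<rho> y = \<rho> y'" and p: "blocks p"
  shows "(\<integral>\<^sup>+v. emeasure (Pi\<^sub>M p (\<lambda>C. value_law h (card C) (tilt h v \<rho>) \<eta>)) D \<partial>mix_joint h \<rho> \<eta> PN \<theta> m p) =
    partition_prob h \<rho> \<eta> PN \<theta> m p * emeasure (Pi\<^sub>M p (\<lambda>_. normalize_measure \<eta>)) D"
proof -
  have "(\<integral>\<^sup>+v. emeasure (Pi\<^sub>M p (\<lambda>C. value_law h (card C) (tilt h v \<rho>) \<eta>)) D \<partial>mix_joint h \<rho> \<eta> PN \<theta> m p) =
    (\<integral>\<^sup>+v. emeasure (Pi\<^sub>M p (\<lambda>_. normalize_measure \<eta>)) D \<partial>mix_joint h \<rho> \<eta> PN \<theta> m p)"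
  proof (rule nn_integral_cong)
    fix v assume "v \<in> space (mix_joint h \<rho> \<eta> PN \<theta> m p)"
    then have v: "0 < v" by (simp add: mix_joint_def space_restrict_space)
    have "Pi\<^sub>M p (\<lambda>C. value_law h (card C) (tilt h v \<rho>) \<eta>) = Pi\<^sub>M p (\<lambda>_. normalize_measure \<eta>)"
      by (intro PiM_cong refl value_law_constant \<rho> v blocks_card[OF p])
    then show "emeasure (Pi\<^sub>M p (\<lambda>C. value_law h (card C) (tilt h v \<rho>) \<eta>)) D = emeasure (Pi\<^sub>M p (\<lambda>_. normalize_measure \<eta>)) D"
      by simp
  qed
  then show ?thesis by (simp add: partition_prob_def mult.commute)
qed

section \<open>The posterior kernel\<close>

text \<open>Under these conditions the normalization in \<open>mix_posterior\<close> is by a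
  positive finite constant, a multiple of \<open>values_density\<close>.\<close>

definition regular_values :: "real \<Rightarrow> nat \<Rightarrow> nat set set \<Rightarrow> (nat set \<Rightarrow> 'y) \<Rightarrow> bool" where
  "regular_values \<theta> m p z \<longleftrightarrow> good p z \<and> 0 < values_density \<theta> m p z \<and> values_density \<theta> m p z < \<infinity>"

abbreviation "N_mixture \<theta> m p z \<equiv> mixture X (mix_posterior h \<rho> PN \<theta> m p z) (\<lambda>v. N_post_law v p z)"

text \<open>\<open>PN\<close> serves as an arbitrary probability law at irregular values, so that
  the kernel is defined on the whole space.\<close>

definition block_kernel :: "real \<Rightarrow> nat \<Rightarrow> nat set set \<Rightarrow> (nat set \<Rightarrow> 'y) \<Rightarrow> ('s \<times> 'y) measure measure" where
  "block_kernel \<theta> m p z = (if regular_values \<theta> m p z then N_mixture \<theta> m p z else PN)"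

lemma sets_mix_posterior: "sets (mix_posterior h \<rho> PN \<theta> m p z) = sets pos_lborel"
  by (simp add: mix_posterior_def pos_lborel_def)

lemma space_mix_posterior: "space (mix_posterior h \<rho> PN \<theta> m p z) = {0<..}"
  by (simp add: mix_posterior_def space_restrict_space)

text \<open>The weight normalized in \<open>mix_posterior\<close> is that of
  \<open>kappa_prod\<close> with respect to \<open>mix_measure\<close>, multiplied by
  \<Gamma>(\<theta> + m) E[T powr (- \<theta>)]. This constant is positive and finite and
  cancels.\<close>

lemma nn_integral_mix_posterior:
  assumes s: "0 < \<theta> + real m" and c: "neg_moment h PN \<theta> < \<infinity>" and z: "regular_values \<theta> m p z" "z \<in> space (Pi\<^sub>M p (\<lambda>_. borel))"
    and f: "f \<in> borel_measurable pos_lborel"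
  shows "(\<integral>\<^sup>+v. f v \<partial>mix_posterior h \<rho> PN \<theta> m p z) = (\<integral>\<^sup>+v. kappa_prod p (v, z) * f v \<partial>mix_measure \<theta> m) / values_density \<theta> m p z"
proof -
  let ?c = "ennreal (Gamma (\<theta> + real m)) * neg_moment h PN \<theta>"
  have c0: "?c \<noteq> 0" "?c \<noteq> \<top>"
    using Gamma_real_pos[OF s] neg_moment_pos[of \<theta>] c by (auto simp: ennreal_mult_eq_top_iff)
  let ?w = "\<lambda>v. raw_kappa_prod v p z * ennreal (v powr (\<theta> + real m - 1)) * laplace h PN v"
  have kappa_prod: "kappa_prod p (v, z) = raw_kappa_prod v p z" for v
    using z by (simp add: regular_values_def good_def kappa_prod_def cong: prod.cong)
  have Wz: "(\<lambda>v. kappa_prod p (v, z)) \<in> borel_measurable pos_lborel" using z(2) by measurable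
  have lm: "laplace h PN \<in> borel_measurable pos_lborel" by (rule measurable_pos_lborel) simp
  have wm: "?w \<in> borel_measurable pos_lborel" using Wz lm unfolding kappa_prod by measurable
  have *: "(\<integral>\<^sup>+v. ?w v * g v \<partial>pos_lborel) = ?c * (\<integral>\<^sup>+v. kappa_prod p (v, z) * g v \<partial>mix_measure \<theta> m)" if g: "g \<in> borel_measurable pos_lborel" for g
  proof -
    have "?c * (\<integral>\<^sup>+v. kappa_prod p (v, z) * g v \<partial>mix_measure \<theta> m) =
      (\<integral>\<^sup>+v. ?c * (ennreal (v powr (\<theta> + real m - 1)) * laplace h PN v / ?c * (kappa_prod p (v, z) * g v)) \<partial>pos_lborel)"
      using g Wz lm by (subst mix_measure_nn_integral) (auto intro!: nn_integral_cmult[symmetric])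
    also have "\<dots> = (\<integral>\<^sup>+v. ?w v * g v \<partial>pos_lborel)"
    proof (rule nn_integral_cong)
      fix v
      have "?c * (ennreal (v powr (\<theta> + real m - 1)) * laplace h PN v / ?c * (kappa_prod p (v, z) * g v)) = (?c / ?c) * (?w v * g v)"
        unfolding kappa_prod by (simp add: divide_ennreal_def mult_ac)
      also have "?c / ?c = 1" using c0 by (intro ennreal_divide_self) (auto simp: less_top)
      finally show "?c * (ennreal (v powr (\<theta> + real m - 1)) * laplace h PN v / ?c * (kappa_prod p (v, z) * g v)) = ?w v * g v" by simp
    qed
    finally show ?thesis ..
  qed
  let ?D = "density pos_lborel ?w"
  have tot: "emeasure ?D (space ?D) = ?c * values_density \<theta> m p z"
    using *[of "\<lambda>_. 1"] by (simp add: emeasure_density wm values_density_def cong: nn_integral_cong)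
  have "(\<integral>\<^sup>+v. f v \<partial>mix_posterior h \<rho> PN \<theta> m p z) = inverse (?c * values_density \<theta> m p z) * (\<integral>\<^sup>+v. f v \<partial>?D)"
    unfolding mix_posterior_def normalize_measure_def pos_lborel_def[symmetric] tot
    using f by (intro nn_integral_scale_measure) simp
  also have "(\<integral>\<^sup>+v. f v \<partial>?D) = ?c * (\<integral>\<^sup>+v. kappa_prod p (v, z) * f v \<partial>mix_measure \<theta> m)"
    using nn_integral_density[OF wm f] *[OF f] by simp
  also have "inverse (?c * values_density \<theta> m p z) = inverse ?c * inverse (values_density \<theta> m p z)"
    using c0 z(1) by (intro ennreal_inverse_mult) (auto simp: less_top regular_values_def)
  also have "inverse ?c * inverse (values_density \<theta> m p z) * (?c * (\<integral>\<^sup>+v. kappa_prod p (v, z) * f v \<partial>mix_measure \<theta> m)) = (?c / ?c) * ((\<integral>\<^sup>+v. kappa_prod p (v, z) * f v \<partial>mix_measure \<theta> m) / values_density \<theta> m p z)"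
    unfolding divide_ennreal_def by (simp only: mult_ac)
  also have "?c / ?c = 1" using c0 by (intro ennreal_divide_self) (auto simp: less_top)
  finally show ?thesis by simp
qed

lemma N_post_law_kernel_mix_posterior:
  assumes p: "blocks p" and z: "good p z" "z \<in> space (Pi\<^sub>M p (\<lambda>_. borel))"
  shows "(\<lambda>v. N_post_law v p z) \<in> mix_posterior h \<rho> PN \<theta> m p z \<rightarrow>\<^sub>M measure_algebra X"
proof -
  have "(\<lambda>v. N_post_law' p (v, z)) \<in> pos_lborel \<rightarrow>\<^sub>M prob_algebra X"
    by (rule measurable_compose[OF measurable_Pair2'[OF z(2)] N_post_law'_kernel[OF p]])
  then show ?thesis
    using z(1) by (simp add: N_post_law'_def measurable_cong_sets[OF sets_mix_posterior refl] measurable_measure_algebra_of_prob_algebra)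
qed

text \<open>Bayes' formula: joint density over marginal density. It also yields measurability of the
  mixture in the values, since both densities are measurable.\<close>

lemma emeasure_N_mixture:
  assumes s: "0 < \<theta> + real m" and c: "neg_moment h PN \<theta> < \<infinity>" and p: "blocks p"
    and z: "regular_values \<theta> m p z" "z \<in> space (Pi\<^sub>M p (\<lambda>_. borel))" and A: "A \<in> sets X"
  shows "emeasure (N_mixture \<theta> m p z) A = joint_density \<theta> m p A z / values_density \<theta> m p z"
proof -
  have g: "good p z" using z by (simp add: regular_values_def)
  have N_post_law': "N_post_law' p (v, z) = N_post_law v p z" for v using g by (simp add: N_post_law'_def)
  have m: "(\<lambda>v. emeasure (N_post_law v p z) A) \<in> borel_measurable pos_lborel"
    using measurable_compose[OF measurable_Pair2'[OF z(2)] N_post_law'_measurable[OF p A]] by (simp add: N_post_law')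
  show ?thesis
    unfolding emeasure_mixture[OF N_post_law_kernel_mix_posterior[OF p g z(2)] A] nn_integral_mix_posterior[OF s c z m] joint_density_def N_post_law' ..
qed

lemma block_kernel_kernel:
  assumes s: "0 < \<theta> + real m" and c: "neg_moment h PN \<theta> < \<infinity>" and p: "blocks p"
  shows "block_kernel \<theta> m p \<in> Pi\<^sub>M p (\<lambda>_. borel) \<rightarrow>\<^sub>M prob_algebra X"
proof (rule measurable_prob_algebraI)
  have fp: "finite p" using p by (simp add: blocks_def)
  have e: "emeasure (block_kernel \<theta> m p z) A = (if regular_values \<theta> m p z then joint_density \<theta> m p A z / values_density \<theta> m p z else emeasure PN A)"
    if "z \<in> space (Pi\<^sub>M p (\<lambda>_. borel))" "A \<in> sets X" for z A
    using emeasure_N_mixture[OF s c p _ that] by (simp add: block_kernel_def)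
  have pr: "prob_space (block_kernel \<theta> m p z)" if z: "z \<in> space (Pi\<^sub>M p (\<lambda>_. borel))" for z
  proof (rule prob_spaceI)
    have sp: "space (block_kernel \<theta> m p z) = space X"
      using sets_eq_imp_space_eq[OF sets_PN] by (simp add: block_kernel_def)
    show "emeasure (block_kernel \<theta> m p z) (space (block_kernel \<theta> m p z)) = 1"
    proof (cases "regular_values \<theta> m p z")
      case True
      then have "values_density \<theta> m p z / values_density \<theta> m p z = 1" by (intro ennreal_divide_self) (auto simp: regular_values_def)
      then show ?thesis using e[OF z, of "space X"] True by (simp add: sp joint_density_space[OF p])
    qed (use PN.L.emeasure_space_1 in \<open>simp add: block_kernel_def\<close>)
  qed
  then show "\<And>z. z \<in> space (Pi\<^sub>M p (\<lambda>_. borel)) \<Longrightarrow> prob_space (block_kernel \<theta> m p z)" .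
  show "block_kernel \<theta> m p \<in> Pi\<^sub>M p (\<lambda>_. borel) \<rightarrow>\<^sub>M subprob_algebra X"
  proof (rule measurable_subprob_algebra)
    fix A assume A: "A \<in> sets X"
    have [measurable]: "joint_density \<theta> m p A \<in> borel_measurable (Pi\<^sub>M p (\<lambda>_. borel))" by (rule joint_density_measurable[OF p A])
    have [measurable]: "Measurable.pred (Pi\<^sub>M p (\<lambda>_. borel)) (\<lambda>z. regular_values \<theta> m p z)"
      unfolding regular_values_def good_def using fp by measurable
    show "(\<lambda>z. emeasure (block_kernel \<theta> m p z) A) \<in> borel_measurable (Pi\<^sub>M p (\<lambda>_. borel))"
      by (rule measurable_cong[THEN iffD2, OF e[OF _ A]]) measurable
  qed (use pr in \<open>auto simp: block_kernel_def sets_PN prob_space_imp_subprob_space\<close>)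
qed

text \<open>An integrable density is finite almost everywhere. If some \<open>z C\<close> has
  \<open>g_mass\<close> zero, then \<open>kappa_prod\<close> vanishes for every v, and so does the
  density.\<close>

lemma regular_values_AE:
  assumes p: "blocks p" and fin: "(\<integral>\<^sup>+z. values_density \<theta> m p z \<partial>\<eta>p p) \<noteq> \<infinity>"
  shows "AE z in \<eta>p p. regular_values \<theta> m p z \<or> values_density \<theta> m p z = 0"
proof -
  have fp: "finite p" using p by (simp add: blocks_def)
  have "AE z in \<eta>p p. values_density \<theta> m p z \<noteq> \<infinity>"
    using fin by (intro nn_integral_noteq_infinite) (simp_all add: measurable_etap)
  with g_mass_finite_AE_etap[OF fp] show ?thesis
  proof eventually_elim
    case (elim z)
    show ?case
    proof (cases "good p z")
      case False
      then obtain C where C: "C \<in> p" "g_mass (z C) = 0" using elim by (auto simp: good_def zero_less_iff_neq_zero)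
      have "kappa_prod p (v, z) = 0" for v
        unfolding kappa_prod_def using C fp by (auto intro!: prod_zero bexI[of _ C] simp: kappa_0_iff)
      then show ?thesis by (simp add: values_density_def)
    qed (use elim in \<open>auto simp: regular_values_def zero_less_iff_neq_zero less_top\<close>)
  qed
qed

definition post_kernel :: "real \<Rightarrow> nat set \<Rightarrow> (nat \<Rightarrow> 'y) \<Rightarrow> ('s \<times> 'y) measure measure" where
  "post_kernel \<theta> I y = block_kernel \<theta> (card I) (ties I y) (block_values (ties I y) y)"

text \<open>Case distinction over the finitely many partitions, since the space of block values
  changes with the partition.\<close>

lemma post_kernel_measurable:
  assumes s: "0 < \<theta> + real (card I)" and c: "neg_moment h PN \<theta> < \<infinity>" and I: "finite I"
  shows "post_kernel \<theta> I \<in> Pi\<^sub>M I (\<lambda>_. borel) \<rightarrow>\<^sub>M prob_algebra X"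
  unfolding post_kernel_def[abs_def]
  by (rule measurable_compose_countable'[OF _ ties_measurable[OF I]])
    (use I in \<open>auto intro!: measurable_compose[OF block_values_measurable block_kernel_kernel] s c blocks_partition_on countable_finite finitely_many_partition_on\<close>)

text \<open>The place where the absence of atoms enters: for almost all z distinct blocks carry
  distinct values, so decoding can be reversed.\<close>

lemma ext_val_AE:
  assumes "nonatomic \<eta>" and I: "finite I" and p: "partition_on I p"
  shows "AE z in \<eta>p p. ties I (ext_val I p z) = p \<and> block_values p (ext_val I p z) = z"
proof -
  have "finite p" using blocks_partition_on[OF I p] by (simp add: blocks_def)
  from AE_PiM_inj_on[OF sigma_finite_eta sets_eta assms(1) this] AE_space
  show ?thesis
    by eventually_elim (auto simp: ties_ext_val[OF p] block_values_ext_val[OF I p] space_PiM PiE_iff)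
qed

end

text \<open>A measurable image of a regular conditional distribution is one for the image variable.
  The posteriors of \<mu> and P follow in this way from that of N, and the candidate
  \<open>Q'\<close> has to match only almost everywhere.\<close>

lemma is_posterior_image:
  assumes post: "is_posterior M S X R Y Q" and g: "g \<in> S \<rightarrow>\<^sub>M S'"
    and eq: "AE y in distr M R Y. distr (Q y) S' g = Q' y"
  shows "is_posterior M S' (\<lambda>w. g (X w)) R Y Q'"
proof -
  obtain K where X: "X \<in> M \<rightarrow>\<^sub>M S" and Y: "Y \<in> M \<rightarrow>\<^sub>M R" and K: "K \<in> R \<rightarrow>\<^sub>M prob_algebra S"
    and dis: "\<And>A B. A \<in> sets S \<Longrightarrow> B \<in> sets R \<Longrightarrow> emeasure M {w \<in> space M. X w \<in> A \<and> Y w \<in> B} =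
           (\<integral>\<^sup>+y\<in>B. emeasure (K y) A \<partial>distr M R Y)"
    and KQ: "AE y in distr M R Y. K y = Q y"
    using post unfolding is_posterior_def by (elim conjE bexE) blast
  let ?K = "\<lambda>y. distr (K y) S' g"
  have K': "?K \<in> R \<rightarrow>\<^sub>M prob_algebra S'"
    by (rule measurable_compose[OF K measurable_distr_prob_space[OF g]])
  have dis': "emeasure M {w \<in> space M. g (X w) \<in> A \<and> Y w \<in> B} = (\<integral>\<^sup>+y\<in>B. emeasure (?K y) A \<partial>distr M R Y)"
    if A: "A \<in> sets S'" and B: "B \<in> sets R" for A B
  proof -
    have "{w \<in> space M. g (X w) \<in> A \<and> Y w \<in> B} = {w \<in> space M. X w \<in> g -` A \<inter> space S \<and> Y w \<in> B}"
      using measurable_space[OF X] by auto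
    also have "emeasure M \<dots> = (\<integral>\<^sup>+y\<in>B. emeasure (K y) (g -` A \<inter> space S) \<partial>distr M R Y)"
      by (rule dis[OF measurable_sets[OF g A] B])
    also have "\<dots> = (\<integral>\<^sup>+y\<in>B. emeasure (?K y) A \<partial>distr M R Y)"
    proof (rule nn_integral_cong)
      fix y assume "y \<in> space (distr M R Y)"
      then have y: "sets (K y) = sets S" using measurable_space[OF K, of y] by (simp add: space_prob_algebra)
      have "g \<in> K y \<rightarrow>\<^sub>M S'" using g by (simp add: measurable_cong_sets[OF y refl])
      then show "emeasure (K y) (g -` A \<inter> space S) * indicator B y = emeasure (?K y) A * indicator B y"
        using A sets_eq_imp_space_eq[OF y] by (simp add: emeasure_distr)
    qed
    finally show ?thesis .
  qed
  moreover have "AE y in distr M R Y. ?K y = Q' y"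
    using KQ eq by eventually_elim simp
  moreover have "(\<lambda>w. g (X w)) \<in> M \<rightarrow>\<^sub>M S'" using X g by measurable
  ultimately show ?thesis
    unfolding is_posterior_def using Y K' by (intro conjI bexI[of _ ?K] ballI) simp_all
qed

section \<open>Laws of finite samples\<close>

lemma ties_restrict: "ties I (restrict y I) = ties I y"
  unfolding ties_def by (rule image_cong) auto

context poisson_model
begin

lemma prob_space_weighted_law:
  assumes c: "neg_moment h PN \<theta> < \<infinity>"
  shows "prob_space (weighted_law h PN \<theta>)"
proof (rule prob_spaceI)
  have "emeasure (weighted_law h PN \<theta>) (space (weighted_law h PN \<theta>)) = (\<integral>\<^sup>+N. 1 \<partial>weighted_law h PN \<theta>)" by simp
  also have "\<dots> = neg_moment h PN \<theta> / neg_moment h PN \<theta>"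
    by (subst nn_integral_weighted_law) (simp_all add: nn_integral_divide neg_moment_def)
  also have "\<dots> = 1" using neg_moment_pos[of \<theta>] c by (intro ennreal_divide_self) auto
  finally show "emeasure (weighted_law h PN \<theta>) (space (weighted_law h PN \<theta>)) = 1" .
qed

lemma sets_weighted_law: "sets (weighted_law h PN \<theta>) = sets X"
  by (simp add: weighted_law_def sets_PN)

lemma total_mass_AE_weighted_law: "AE N in weighted_law h PN \<theta>. 0 < total_mass h N \<and> total_mass h N < \<infinity>"
  unfolding weighted_law_def by (subst AE_density) (use total_mass_AE in auto)

lemma neg_moment_0: "neg_moment h PN 0 < \<infinity>"
proof -
  have "neg_moment h PN 0 \<le> 1"
    unfolding neg_moment_def by (intro PN.L.nn_integral_le_const) auto
  then show ?thesis by (rule le_less_trans) simp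
qed

text \<open>Isolates what the marginal formulas use from conditional independence, so that they
  apply both to the given sample and to the first coordinates of an infinite exchangeable
  sequence.\<close>

definition has_rectangles :: "real \<Rightarrow> nat set \<Rightarrow> (nat \<Rightarrow> 'y) measure \<Rightarrow> bool" where
  "has_rectangles \<theta> I R \<longleftrightarrow> prob_space R \<and> sets R = sets (Pi\<^sub>M I (\<lambda>_. borel)) \<and>
    (\<forall>B. (\<forall>i\<in>I. B i \<in> sets borel) \<longrightarrow> emeasure R (\<Pi>\<^sub>E i\<in>I. B i) =
      (\<integral>\<^sup>+N. (\<Prod>i\<in>I. emeasure (P_of h N) (B i)) \<partial>weighted_law h PN \<theta>))"

lemma has_rectangles_unique:
  assumes "has_rectangles \<theta> I R" "has_rectangles \<theta> I R'" "finite I"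
  shows "R = R'"
proof (rule measure_eqI_PiM_finite[where I=I and M="\<lambda>_. borel" and A="\<lambda>_. space (Pi\<^sub>M I (\<lambda>_. borel))"])
  interpret R: prob_space R using assms by (simp add: has_rectangles_def)
  show "emeasure R (space (Pi\<^sub>M I (\<lambda>_. borel))) \<noteq> \<infinity>" by simp
  show "range (\<lambda>_. space (Pi\<^sub>M I (\<lambda>_. borel))) \<subseteq> prod_algebra I (\<lambda>_. borel)"
    using assms(3) by (auto simp: space_PiM intro!: prod_algebraI_finite)
qed (use assms in \<open>auto simp: has_rectangles_def\<close>)

lemma sample_integral:
  assumes R: "has_rectangles \<theta> I R" and s: "0 < \<theta> + real (card I)" and c: "neg_moment h PN \<theta> < \<infinity>" and I: "finite I"
    and F: "F \<in> borel_measurable (Pi\<^sub>M I (\<lambda>_. borel))"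
  shows "(\<integral>\<^sup>+y. F y \<partial>R) = (\<Sum>p | partition_on I p. \<integral>\<^sup>+z. F (ext_val I p z) * values_density \<theta> (card I) p z \<partial>\<eta>p p)"
proof -
  have "(\<integral>\<^sup>+y. F y \<partial>R) = (\<Sum>p | partition_on I p. \<integral>\<^sup>+z. F (ext_val I p z) * joint_density \<theta> (card I) p (space X) z \<partial>\<eta>p p)"
  proof (rule joint_law[OF s c I _ _ _ _ F])
    show "finite_measure R" "sets R = sets (Pi\<^sub>M I (\<lambda>_. borel))"
      using R by (auto simp: has_rectangles_def prob_space.finite_measure)
    fix B :: "nat \<Rightarrow> 'y set" assume B: "\<And>i. i \<in> I \<Longrightarrow> B i \<in> sets borel"
    have "space (weighted_law h PN \<theta>) = space X" by (rule sets_eq_imp_space_eq[OF sets_weighted_law])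
    then have "(\<integral>\<^sup>+N. (\<Prod>i\<in>I. emeasure (P_of h N) (B i)) * indicator (space X) N \<partial>weighted_law h PN \<theta>) =
      (\<integral>\<^sup>+N. (\<Prod>i\<in>I. emeasure (P_of h N) (B i)) \<partial>weighted_law h PN \<theta>)"
      by (intro nn_integral_cong) simp
    then show "emeasure R (\<Pi>\<^sub>E i\<in>I. B i) =
      (\<integral>\<^sup>+N. (\<Prod>i\<in>I. emeasure (P_of h N) (B i)) * indicator (space X) N \<partial>weighted_law h PN \<theta>)"
      using R B by (simp add: has_rectangles_def)
  qed simp
  also have "\<dots> = (\<Sum>p | partition_on I p. \<integral>\<^sup>+z. F (ext_val I p z) * values_density \<theta> (card I) p z \<partial>\<eta>p p)"
    using blocks_partition_on[OF I] by (intro sum.cong refl nn_integral_cong) (simp add: joint_density_space)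
  finally show ?thesis .
qed

text \<open>In the sum over partitions q, the decoded vector has ties exactly q for almost all z;
  only the term q = p meets the event.\<close>

lemma sample_partition_law:
  assumes R: "has_rectangles \<theta> I R" and s: "0 < \<theta> + real (card I)" and c: "neg_moment h PN \<theta> < \<infinity>" and I: "finite I"
    and na: "nonatomic \<eta>" and p: "partition_on I p" and D: "D \<in> sets (Pi\<^sub>M p (\<lambda>_. borel))"
  shows "emeasure R {y \<in> space (Pi\<^sub>M I (\<lambda>_. borel)). ties I y = p \<and> block_values p y \<in> D} =
    (\<integral>\<^sup>+z. indicator D z * values_density \<theta> (card I) p z \<partial>\<eta>p p)"
proof -
  let ?S = "Pi\<^sub>M I (\<lambda>_. borel :: 'y measure)"
  let ?B = "{y \<in> space ?S. ties I y = p \<and> block_values p y \<in> D}"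
  have "?B = (ties I -` {p} \<inter> space ?S) \<inter> (block_values p -` D \<inter> space ?S)" by auto
  also have "\<dots> \<in> sets ?S"
    using measurable_sets[OF ties_measurable[OF I], of "{p}"] measurable_sets[OF block_values_measurable[OF I p] D] p
    by auto
  finally have B: "?B \<in> sets ?S" .
  have ext: "ext_val I q z \<in> space ?S" for q z by (simp add: space_PiM PiE_iff ext_val_def)
  have fin: "finite {p. partition_on I p}" by (rule finitely_many_partition_on[OF I])
  have "emeasure R ?B = (\<integral>\<^sup>+y. indicator ?B y \<partial>R)"
    using B R by (simp add: has_rectangles_def)
  also have "\<dots> = (\<Sum>q | partition_on I q. \<integral>\<^sup>+z. indicator ?B (ext_val I q z) * values_density \<theta> (card I) q z \<partial>\<eta>p q)"
    using B by (intro sample_integral[OF R s c I]) simp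
  also have "\<dots> = (\<Sum>q | partition_on I q. if q = p then \<integral>\<^sup>+z. indicator D z * values_density \<theta> (card I) q z \<partial>\<eta>p q else 0)"
  proof (rule sum.cong[OF refl])
    fix q assume "q \<in> {p. partition_on I p}"
    then have q: "partition_on I q" by simp
    have "(\<integral>\<^sup>+z. indicator ?B (ext_val I q z) * values_density \<theta> (card I) q z \<partial>\<eta>p q) =
      (\<integral>\<^sup>+z. (if q = p then indicator D z * values_density \<theta> (card I) q z else 0) \<partial>\<eta>p q)"
      using ext_val_AE[OF na I q]
      by (intro nn_integral_cong_AE, eventually_elim) (use ext in \<open>auto simp: indicator_def\<close>)
    then show "(\<integral>\<^sup>+z. indicator ?B (ext_val I q z) * values_density \<theta> (card I) q z \<partial>\<eta>p q) =
      (if q = p then \<integral>\<^sup>+z. indicator D z * values_density \<theta> (card I) q z \<partial>\<eta>p q else 0)" by simp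
  qed
  also have "\<dots> = (\<integral>\<^sup>+z. indicator D z * values_density \<theta> (card I) p z \<partial>\<eta>p p)"
    using p by (subst sum.delta[OF fin]) auto
  finally show ?thesis .
qed

lemma sample_partition_prob:
  assumes R: "has_rectangles \<theta> I R" and s: "0 < \<theta> + real (card I)" and c: "neg_moment h PN \<theta> < \<infinity>" and I: "finite I"
    and na: "nonatomic \<eta>" and p: "partition_on I p"
  shows "emeasure R {y \<in> space (Pi\<^sub>M I (\<lambda>_. borel)). ties I y = p} = partition_prob h \<rho> \<eta> PN \<theta> (card I) p"
proof -
  have "{y \<in> space (Pi\<^sub>M I (\<lambda>_. borel :: 'y measure)). ties I y = p} =
    {y \<in> space (Pi\<^sub>M I (\<lambda>_. borel)). ties I y = p \<and> block_values p y \<in> space (Pi\<^sub>M p (\<lambda>_. borel))}"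
    by (auto simp: space_PiM block_values_def)
  also have "emeasure R \<dots> = (\<integral>\<^sup>+z. indicator (space (Pi\<^sub>M p (\<lambda>_. borel))) z * values_density \<theta> (card I) p z \<partial>\<eta>p p)"
    by (rule sample_partition_law[OF R s c I na p]) simp
  also have "\<dots> = (\<integral>\<^sup>+z. values_density \<theta> (card I) p z \<partial>\<eta>p p)"
    by (intro nn_integral_cong) (simp add: space_PiM space_eta)
  finally show ?thesis by (simp add: partition_prob_eq[OF blocks_partition_on[OF I p]])
qed

section \<open>Conditionally i.i.d. samples\<close>

context
  fixes M :: "'w measure" and N :: "'w \<Rightarrow> ('s \<times> 'y) measure" and Y :: "nat \<Rightarrow> 'w \<Rightarrow> 'y"
    and \<theta> :: real and n :: nat
  assumes s: "0 < \<theta> + real n" and c: "neg_moment h PN \<theta> < \<infinity>" and na: "nonatomic \<eta>"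
    and M: "prob_space M" and N_law: "distr M X N = weighted_law h PN \<theta>"
    and iid: "cond_iid M X N {1..n} Y (P_of h)"
begin

interpretation M: prob_space M by (rule M)

abbreviation "I \<equiv> {1..n}"
abbreviation "Yv \<equiv> sample_vec n Y"
abbreviation "S \<equiv> Pi\<^sub>M {1..n} (\<lambda>_. borel :: 'y measure)"

lemma N_measurable: "N \<in> M \<rightarrow>\<^sub>M X" using iid by (simp add: cond_iid_def)

lemma Yv_measurable: "Yv \<in> M \<rightarrow>\<^sub>M S"
  unfolding sample_vec_def using iid by (intro measurable_restrict) (simp add: cond_iid_def)

lemma iid_rectangle:
  assumes "A \<in> sets X" "\<And>i. i \<in> I \<Longrightarrow> B i \<in> sets borel"
  shows "emeasure M {w \<in> space M. N w \<in> A \<and> Yv w \<in> (\<Pi>\<^sub>E i\<in>I. B i)} =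
    (\<integral>\<^sup>+N. (\<Prod>i\<in>I. emeasure (P_of h N) (B i)) * indicator A N \<partial>weighted_law h PN \<theta>)"
proof -
  have "{w \<in> space M. N w \<in> A \<and> Yv w \<in> (\<Pi>\<^sub>E i\<in>I. B i)} = {w \<in> space M. N w \<in> A \<and> (\<forall>i\<in>I. Y i w \<in> B i)}"
    by (auto simp: sample_vec_def PiE_iff)
  then show ?thesis using iid assms by (simp add: cond_iid_def N_law)
qed

lemma sample_has_rectangles: "has_rectangles \<theta> I (distr M S Yv)"
  unfolding has_rectangles_def
proof (intro conjI allI impI)
  show "prob_space (distr M S Yv)" by (rule M.prob_space_distr[OF Yv_measurable])
  fix B :: "nat \<Rightarrow> 'y set" assume B: "\<forall>i\<in>I. B i \<in> sets borel"
  have sp: "space (weighted_law h PN \<theta>) = space X" by (rule sets_eq_imp_space_eq[OF sets_weighted_law])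
  have "emeasure (distr M S Yv) (\<Pi>\<^sub>E i\<in>I. B i) = emeasure M {w \<in> space M. N w \<in> space X \<and> Yv w \<in> (\<Pi>\<^sub>E i\<in>I. B i)}"
    using B measurable_space[OF N_measurable]
    by (subst emeasure_distr[OF Yv_measurable]) (auto intro!: sets_PiM_I_finite arg_cong[of _ _ "emeasure M"])
  also have "\<dots> = (\<integral>\<^sup>+N. (\<Prod>i\<in>I. emeasure (P_of h N) (B i)) \<partial>weighted_law h PN \<theta>)"
    using B by (subst iid_rectangle) (auto simp: sp intro!: nn_integral_cong)
  finally show "emeasure (distr M S Yv) (\<Pi>\<^sub>E i\<in>I. B i) = (\<integral>\<^sup>+N. (\<Prod>i\<in>I. emeasure (P_of h N) (B i)) \<partial>weighted_law h PN \<theta>)" .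
qed simp

lemma sample_joint:
  assumes A: "A \<in> sets X" and B: "B \<in> sets S"
  shows "emeasure M {w \<in> space M. N w \<in> A \<and> Yv w \<in> B} =
    (\<Sum>p | partition_on I p. \<integral>\<^sup>+z. indicator B (ext_val I p z) * joint_density \<theta> n p A z \<partial>\<eta>p p)"
proof -
  let ?A = "N -` A \<inter> space M"
  have Am[measurable]: "?A \<in> sets M" by (rule measurable_sets[OF N_measurable A])
  \<comment> \<open>Law of the sample on the event N \<in> A, a finite measure that need not have
    mass one.\<close>
  let ?R = "distr (density M (indicator ?A)) S Yv"
  have Yd: "Yv \<in> density M (indicator ?A) \<rightarrow>\<^sub>M S" using Yv_measurable by simp
  have R: "emeasure ?R C = emeasure M {w \<in> space M. N w \<in> A \<and> Yv w \<in> C}" if C: "C \<in> sets S" for C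
  proof -
    have [measurable]: "Yv -` C \<inter> space M \<in> sets M" by (rule measurable_sets[OF Yv_measurable C])
    have "emeasure ?R C = (\<integral>\<^sup>+w. indicator ?A w * indicator (Yv -` C \<inter> space M) w \<partial>M)"
      unfolding emeasure_distr[OF Yd C] space_density by (rule emeasure_density) measurable
    also have "\<dots> = emeasure M (?A \<inter> (Yv -` C \<inter> space M))"
      by (simp add: indicator_inter_arith[symmetric])
    also have "?A \<inter> (Yv -` C \<inter> space M) = {w \<in> space M. N w \<in> A \<and> Yv w \<in> C}" by auto
    finally show ?thesis .
  qed
  have "emeasure ?R B = (\<integral>\<^sup>+y. indicator B y \<partial>?R)" using B by simp
  also have "\<dots> = (\<Sum>p | partition_on I p. \<integral>\<^sup>+z. indicator B (ext_val I p z) * joint_density \<theta> (card I) p A z \<partial>\<eta>p p)"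
  proof (rule joint_law[OF _ c _ A])
    show "finite_measure ?R"
      using R[of "space S"] by (intro finite_measureI) simp
    fix B :: "nat \<Rightarrow> 'y set" assume B: "\<And>i. i \<in> I \<Longrightarrow> B i \<in> sets borel"
    have "(\<Pi>\<^sub>E i\<in>I. B i) \<in> sets S" using B by (intro sets_PiM_I_finite) auto
    then show "emeasure ?R (\<Pi>\<^sub>E i\<in>I. B i) =
      (\<integral>\<^sup>+N. (\<Prod>i\<in>I. emeasure (P_of h N) (B i)) * indicator A N \<partial>weighted_law h PN \<theta>)"
      unfolding R[OF \<open>(\<Pi>\<^sub>E i\<in>I. B i) \<in> sets S\<close>] by (intro iid_rectangle A B)
  qed (use s B in simp_all)
  finally show ?thesis using R[OF B] by simp
qed

lemma sample_values_law:
  assumes p: "partition_on I p" and D: "D \<in> sets (Pi\<^sub>M p (\<lambda>_. borel))"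
  shows "emeasure M {w \<in> space M. ties I (Yv w) = p \<and> block_values p (Yv w) \<in> D} =
    (\<integral>\<^sup>+v. emeasure (Pi\<^sub>M p (\<lambda>C. value_law h (card C) (tilt h v \<rho>) \<eta>)) D \<partial>mix_joint h \<rho> \<eta> PN \<theta> n p)"
proof -
  let ?B = "{y \<in> space S. ties I y = p \<and> block_values p y \<in> D}"
  have "?B = (ties I -` {p} \<inter> space S) \<inter> (block_values p -` D \<inter> space S)" by auto
  also have "\<dots> \<in> sets S"
    using measurable_sets[OF ties_measurable[of I], of "{p}"] measurable_sets[OF block_values_measurable[OF _ p] D] p
    by auto
  finally have B: "?B \<in> sets S" .
  have "emeasure M {w \<in> space M. ties I (Yv w) = p \<and> block_values p (Yv w) \<in> D} = emeasure (distr M S Yv) ?B"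
    using B measurable_space[OF Yv_measurable]
    by (subst emeasure_distr[OF Yv_measurable]) (auto intro!: arg_cong[of _ _ "emeasure M"])
  also have "\<dots> = (\<integral>\<^sup>+z. indicator D z * values_density \<theta> (card I) p z \<partial>\<eta>p p)"
    by (rule sample_partition_law[OF sample_has_rectangles _ c _ na p D]) (use s in simp_all)
  also have "\<dots> = (\<integral>\<^sup>+v. emeasure (Pi\<^sub>M p (\<lambda>C. value_law h (card C) (tilt h v \<rho>) \<eta>)) D \<partial>mix_joint h \<rho> \<eta> PN \<theta> n p)"
    using partition_values_law[OF blocks_partition_on[OF _ p] D] by simp
  finally show ?thesis .
qed

text \<open>The integral of \<open>values_density\<close> is the probability that the ties form p,
  hence finite.\<close>

lemma regular_values_AE_ext_val:
  assumes p: "partition_on I p"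
  shows "AE z in \<eta>p p. regular_values \<theta> n p z \<or> values_density \<theta> n p z = 0"
proof (rule regular_values_AE)
  show "blocks p" by (rule blocks_partition_on[OF _ p]) simp
  interpret D: prob_space "distr M S Yv" by (rule M.prob_space_distr[OF Yv_measurable])
  have "(\<integral>\<^sup>+z. values_density \<theta> n p z \<partial>\<eta>p p) = emeasure (distr M S Yv) {y \<in> space S. ties I y = p}"
    using sample_partition_prob[OF sample_has_rectangles _ c _ na p] s
      partition_prob_eq[OF blocks_partition_on[OF _ p], of \<theta> n] by simp
  then show "(\<integral>\<^sup>+z. values_density \<theta> n p z \<partial>\<eta>p p) \<noteq> \<infinity>"
    using D.emeasure_finite[of "{y \<in> space S. ties I y = p}"] by simp
qed

text \<open>Up to null sets, irregular values occur only where \<open>values_density\<close>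
  vanishes, and there the law of the sample has no mass.\<close>

lemma regular_values_AE_sample: "AE y in distr M S Yv. regular_values \<theta> n (ties I y) (block_values (ties I y) y)"
proof -
  let ?P = "\<lambda>y. regular_values \<theta> n (ties I y) (block_values (ties I y) y)"
  have Pm[measurable]: "Measurable.pred S ?P"
  proof (rule measurable_compose_countable'[OF _ ties_measurable])
    show "countable {p. partition_on I p}" by (intro countable_finite finitely_many_partition_on) simp
    fix p assume "p \<in> {p. partition_on I p}"
    then have p: "partition_on I p" by simp
    have fp: "finite p" using blocks_partition_on[OF _ p] by (simp add: blocks_def)
    have "Measurable.pred (Pi\<^sub>M p (\<lambda>_. borel)) (\<lambda>z. regular_values \<theta> n p z)"
      unfolding regular_values_def good_def using fp by measurable
    from measurable_compose[OF block_values_measurable[OF _ p] this]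
    show "Measurable.pred S (\<lambda>y. regular_values \<theta> n p (block_values p y))" by simp
  qed simp
  have Ps: "{y \<in> space S. \<not> ?P y} \<in> sets S" by measurable
  have Fm: "(\<lambda>y. indicator {y \<in> space S. \<not> ?P y} y :: ennreal) \<in> borel_measurable S" using Ps by simp
  have "emeasure (distr M S Yv) {y \<in> space S. \<not> ?P y} = (\<integral>\<^sup>+y. indicator {y \<in> space S. \<not> ?P y} y \<partial>distr M S Yv)"
    using Ps by simp
  also have "\<dots> = (\<Sum>p | partition_on I p. \<integral>\<^sup>+z. indicator {y \<in> space S. \<not> ?P y} (ext_val I p z) * values_density \<theta> (card I) p z \<partial>\<eta>p p)"
    by (rule sample_integral[OF sample_has_rectangles _ c _ Fm]) (use s in simp_all)
  also have "\<dots> = (\<Sum>p | partition_on I p. \<integral>\<^sup>+z. 0 \<partial>\<eta>p p)"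
  proof (intro sum.cong refl nn_integral_cong_AE)
    fix p assume "p \<in> {p. partition_on I p}"
    then have p: "partition_on I p" by simp
    show "AE z in \<eta>p p. indicator {y \<in> space S. \<not> ?P y} (ext_val I p z) * values_density \<theta> (card I) p z = 0"
      using ext_val_AE[OF na finite_atLeastAtMost p] regular_values_AE_ext_val[OF p] by eventually_elim auto
  qed
  finally have "emeasure (distr M S Yv) {y \<in> space S. \<not> ?P y} = 0" by simp
  then show ?thesis using Ps by (intro AE_I[of _ _ "{y \<in> space S. \<not> ?P y}"]) auto
qed

text \<open>The kernel multiplied by \<open>values_density\<close> must return
  \<open>joint_density\<close>. At regular values this is Bayes' formula; elsewhere both are almost
  everywhere 0, since the joint density is dominated by the marginal one.\<close>

lemma posterior_N: "is_posterior M X N S Yv (\<lambda>y. N_mixture \<theta> n (ties I y) (block_values (ties I y) y))"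
  unfolding is_posterior_def
proof (intro conjI bexI[of _ "post_kernel \<theta> I"] ballI)
  have s': "0 < \<theta> + real (card I)" using s by simp
  show "N \<in> M \<rightarrow>\<^sub>M X" by (rule N_measurable)
  show "Yv \<in> M \<rightarrow>\<^sub>M S" by (rule Yv_measurable)
  show K: "post_kernel \<theta> I \<in> S \<rightarrow>\<^sub>M prob_algebra X" by (rule post_kernel_measurable[OF s' c]) simp
  show "AE y in distr M S Yv. post_kernel \<theta> I y = N_mixture \<theta> n (ties I y) (block_values (ties I y) y)"
    using regular_values_AE_sample by eventually_elim (simp add: post_kernel_def block_kernel_def)
  fix A B assume A: "A \<in> sets X" and B: "B \<in> sets S"
  have Km: "(\<lambda>y. emeasure (post_kernel \<theta> I y) A) \<in> borel_measurable S"
    using measurable_emeasure_kernel[OF measurable_prob_algebraD[OF K] A] .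
  have "(\<integral>\<^sup>+y\<in>B. emeasure (post_kernel \<theta> I y) A \<partial>distr M S Yv) =
    (\<Sum>p | partition_on I p. \<integral>\<^sup>+z. (emeasure (post_kernel \<theta> I (ext_val I p z)) A * indicator B (ext_val I p z)) * values_density \<theta> (card I) p z \<partial>\<eta>p p)"
    using Km B by (intro sample_integral[OF sample_has_rectangles s' c]) simp_all
  also have "\<dots> = (\<Sum>p | partition_on I p. \<integral>\<^sup>+z. indicator B (ext_val I p z) * joint_density \<theta> n p A z \<partial>\<eta>p p)"
  proof (intro sum.cong refl nn_integral_cong_AE)
    fix p assume "p \<in> {p. partition_on I p}"
    then have p: "partition_on I p" by simp
    have bl: "blocks p" by (rule blocks_partition_on[OF _ p]) simp
    show "AE z in \<eta>p p. (emeasure (post_kernel \<theta> I (ext_val I p z)) A * indicator B (ext_val I p z)) * values_density \<theta> (card I) p z =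
      indicator B (ext_val I p z) * joint_density \<theta> n p A z"
      using ext_val_AE[OF na finite_atLeastAtMost p] regular_values_AE_ext_val[OF p] AE_space
    proof eventually_elim
      case (elim z)
      then have e: "ties I (ext_val I p z) = p" "block_values p (ext_val I p z) = z" by auto
      have z: "z \<in> space (Pi\<^sub>M p (\<lambda>_. borel))" using elim by (simp add: space_PiM space_eta)
      have K: "post_kernel \<theta> I (ext_val I p z) = block_kernel \<theta> n p z" unfolding post_kernel_def e by simp
      show ?case
      proof (cases "regular_values \<theta> n p z")
        case True
        then have Z0: "values_density \<theta> n p z \<noteq> 0" "values_density \<theta> n p z \<noteq> \<top>" by (auto simp: regular_values_def)
        have "emeasure (block_kernel \<theta> n p z) A * values_density \<theta> n p z = joint_density \<theta> n p A z / values_density \<theta> n p z * values_density \<theta> n p z"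
          using True emeasure_N_mixture[OF s c bl True z A] by (simp add: block_kernel_def)
        also have "\<dots> = joint_density \<theta> n p A z"
          using Z0 ennreal_mult_divide_eq[of "values_density \<theta> n p z" "joint_density \<theta> n p A z"]
          by (simp add: ennreal_times_divide mult.commute)
        finally have "joint_density \<theta> n p A z = emeasure (block_kernel \<theta> n p z) A * values_density \<theta> n p z" ..
        then show ?thesis unfolding K by (simp add: mult_ac)
      next
        case False
        then have "values_density \<theta> n p z = 0" using elim by simp
        moreover then have "joint_density \<theta> n p A z = 0" using joint_density_le_values_density[OF bl, of \<theta> n A z] by simp
        ultimately show ?thesis by simp
      qed
    qed
  qed
  also have "\<dots> = emeasure M {w \<in> space M. N w \<in> A \<and> Yv w \<in> B}" by (rule sample_joint[OF A B, symmetric])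
  finally show "emeasure M {w \<in> space M. N w \<in> A \<and> Yv w \<in> B} = (\<integral>\<^sup>+y\<in>B. emeasure (post_kernel \<theta> I y) A \<partial>distr M S Yv)" ..
qed

end

section \<open>The posterior laws of \<open>\<mu>\<close> and \<open>P\<close>\<close>

lemma mu_of_add_points:
  assumes N: "sets N = sets borel" and p: "finite p"
  shows "mu_of h (add_points p z N J) = add_measure (mu_of h N) (weighted_diracs p (\<lambda>C. ennreal (h (J C))) z)"
proof (rule measure_eqI)
  fix A assume "A \<in> sets (mu_of h (add_points p z N J))"
  then have A[measurable]: "A \<in> sets borel" by simp
  have "emeasure (mu_of h (add_points p z N J)) A = (\<integral>\<^sup>+x. ennreal (h (fst x)) * indicator A (snd x) \<partial>add_points p z N J)"
    by (rule emeasure_mu_of[OF h_measurable _ A]) (simp add: sets_add_points N)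
  also have "\<dots> = emeasure (mu_of h N) A + (\<Sum>C\<in>p. ennreal (h (J C)) * indicator A (z C))"
    by (subst nn_integral_add_points[OF p N]) (simp_all add: emeasure_mu_of[OF h_measurable N A])
  finally show "emeasure (mu_of h (add_points p z N J)) A =
    emeasure (add_measure (mu_of h N) (weighted_diracs p (\<lambda>C. ennreal (h (J C))) z)) A"
    using p by (simp add: emeasure_add_measure emeasure_weighted_diracs)
qed simp

lemma distr_N_post_law_mu_of:
  assumes v: "0 \<le> v" and p: "finite p"
  shows "distr (N_post_law v p z) (measure_algebra borel) (mu_of h) = mu_law h (tilt h v \<rho>) \<eta> p z"
proof -
  have "distr (N_post_law v p z) (measure_algebra borel) (mu_of h) =
    distr (star_jumps_law h (tilt h v \<rho>) \<eta> p z) (measure_algebra borel) (mu_of h \<circ> (\<lambda>(N, J). add_points p z N J))"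
    unfolding N_post_law_eq[OF assms] by (rule distr_distr[OF measurable_mu_of[OF h_measurable] measurable_add_points_star[OF assms]])
  also have "\<dots> = mu_law h (tilt h v \<rho>) \<eta> p z"
    unfolding mu_law_def
    by (rule distr_cong) (auto simp: space_star_jumps_law[OF v] mu_of_add_points p)
  finally show ?thesis .
qed

lemma emeasure_post_P:
  assumes N: "sets N = sets borel" and p: "finite p" and A: "A \<in> sets borel"
  shows "emeasure (post_P h p z N J) A =
    (let H = (\<Sum>C\<in>p. ennreal (h (J C))); q = total_mass h N / (total_mass h N + H)
     in q * emeasure (P_of h N) A + (1 - q) * (inverse H * (\<Sum>C\<in>p. ennreal (h (J C)) * indicator A (z C))))"
  unfolding post_P_def Let_def using p A
  by (subst emeasure_add_measure) (simp_all add: emeasure_weighted_diracs mult.assoc)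

lemma sets_post_P: "sets (post_P h p z N J) = sets borel"
  by (simp add: post_P_def Let_def)

text \<open>With t the mass of \<mu> before and k the mass of the added atoms, division by t + k
  splits into t / (t + k) times the first normalized measure plus k / (t + k) times the
  second.\<close>

lemma P_of_add_points:
  assumes N: "sets N = sets borel" and p: "finite p" and T: "0 < total_mass h N" "total_mass h N < \<infinity>"
  shows "P_of h (add_points p z N J) = post_P h p z N J"
proof (rule measure_eqI)
  fix A assume "A \<in> sets (P_of h (add_points p z N J))"
  then have A: "A \<in> sets borel" by simp
  let ?H = "\<Sum>C\<in>p. ennreal (h (J C))" and ?S = "\<Sum>C\<in>p. ennreal (h (J C)) * indicator A (z C)"
  have mu: "emeasure (mu_of h (add_points p z N J)) B = emeasure (mu_of h N) B + (\<Sum>C\<in>p. ennreal (h (J C)) * indicator B (z C))"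
    if "B \<in> sets borel" for B
    unfolding mu_of_add_points[OF N p] using that p by (simp add: emeasure_add_measure emeasure_weighted_diracs)
  have TH: "total_mass h (add_points p z N J) = total_mass h N + ?H"
    using mu[of UNIV] by (simp add: total_mass_def)
  obtain t where t: "0 < t" "total_mass h N = ennreal t" using T by (cases "total_mass h N") auto
  define k where "k = (\<Sum>C\<in>p. h (J C))"
  have k: "0 \<le> k" "?H = ennreal k" using h_pos by (auto simp: k_def sum_nonneg less_imp_le)
  have q: "ennreal t / (ennreal t + ennreal k) = ennreal (t / (t + k))"
    using t k by (simp add: divide_ennreal ennreal_plus[symmetric] del: ennreal_plus)
  have q1: "1 - ennreal (t / (t + k)) = ennreal (k / (t + k))"
    using t k by (simp add: ennreal_1[symmetric] ennreal_minus field_simps del: ennreal_1)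
  have 1: "ennreal (t / (t + k)) * inverse (ennreal t) = inverse (ennreal (t + k))"
    using t k by (simp add: inverse_ennreal ennreal_mult[symmetric] field_simps del: ennreal_plus)
  have 2: "ennreal (k / (t + k)) * (inverse (ennreal k) * ?S) = inverse (ennreal (t + k)) * ?S"
  proof (cases "k = 0")
    \<comment> \<open>As h > 0, k = 0 only for empty \<open>p\<close>; then the sum over the atoms
      is empty, and the value of \<open>inverse 0\<close> does not matter.\<close>
    case True
    then have "h (J C) = 0" if "C \<in> p" for C
      using that p h_pos by (auto simp: k_def sum_nonneg_eq_0_iff less_imp_le)
    then have "p = {}" using h_pos by (metis less_irrefl equals0I)
    then show ?thesis by simp
  next
    case False
    then have "ennreal (k / (t + k)) * inverse (ennreal k) = inverse (ennreal (t + k))"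
      using t k by (simp add: inverse_ennreal ennreal_mult[symmetric] field_simps del: ennreal_plus)
    then show ?thesis by (simp add: mult.assoc[symmetric])
  qed
  have "emeasure (P_of h (add_points p z N J)) A = inverse (ennreal (t + k)) * (emeasure (mu_of h N) A + ?S)"
    using t k by (simp add: emeasure_P_of TH mu[OF A])
  also have "\<dots> = ennreal (t / (t + k)) * (inverse (ennreal t) * emeasure (mu_of h N) A) + ennreal (k / (t + k)) * (inverse (ennreal k) * ?S)"
    unfolding 2 by (simp only: distrib_left mult.assoc[symmetric] 1)
  also have "\<dots> = emeasure (post_P h p z N J) A"
    unfolding emeasure_post_P[OF N p A] Let_def k(2) t(2) q q1 by (simp add: emeasure_P_of t(2))
  finally show "emeasure (P_of h (add_points p z N J)) A = emeasure (post_P h p z N J) A" .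
qed (simp add: sets_post_P)

lemma measurable_post_P:
  assumes p: "finite p"
  shows "(\<lambda>(N, J). post_P h p z N J) \<in> X \<Otimes>\<^sub>M Pi\<^sub>M p (\<lambda>_. borel) \<rightarrow>\<^sub>M measure_algebra borel"
proof (rule measurable_measure_algebra)
  fix A :: "'y set" assume A[measurable]: "A \<in> sets borel"
  let ?\<Omega> = "X \<Otimes>\<^sub>M Pi\<^sub>M p (\<lambda>_. borel :: 's measure)"
  have [measurable]: "(\<lambda>N. emeasure (P_of h N) A) \<in> borel_measurable X"
    by (rule measurable_compose[OF measurable_P_of[OF h_measurable]]) simp
  have [measurable]: "total_mass h \<in> borel_measurable X" by (rule measurable_total_mass[OF h_measurable])
  have "(\<lambda>w. let H = (\<Sum>C\<in>p. ennreal (h (snd w C))); q = total_mass h (fst w) / (total_mass h (fst w) + H)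
     in q * emeasure (P_of h (fst w)) A + (1 - q) * (inverse H * (\<Sum>C\<in>p. ennreal (h (snd w C)) * indicator A (z C)))) \<in> borel_measurable ?\<Omega>"
    unfolding Let_def by measurable
  then show "(\<lambda>w. emeasure (case w of (N, J) \<Rightarrow> post_P h p z N J) A) \<in> borel_measurable ?\<Omega>"
    by (rule measurable_cong[THEN iffD2, rotated])
      (clarsimp simp: space_pair_measure space_measure_algebra emeasure_post_P[OF _ p A])
next
  fix w assume "w \<in> space (X \<Otimes>\<^sub>M Pi\<^sub>M p (\<lambda>_. borel :: 's measure))"
  show "sets (case w of (N, J) \<Rightarrow> post_P h p z N J) = sets borel" by (simp add: split_beta' sets_post_P)
qed

text \<open>The decomposition of P requires a positive finite mass of the Poisson part. This holds
  almost surely under the tilted law, which has a density with respect to \<open>PN\<close>, so the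
  two maps are compared almost everywhere.\<close>

lemma distr_N_post_law_P_of:
  assumes v: "0 < v" and p: "blocks p" "good p z"
  shows "distr (N_post_law v p z) (measure_algebra borel) (P_of h) = P_law h (tilt h v \<rho>) \<eta> p z"
proof -
  have v0: "0 \<le> v" and fp: "finite p" using v p by (auto simp: blocks_def)
  let ?star = "star_jumps_law h (tilt h v \<rho>) \<eta> p z"
  interpret tilted_law: prob_space "tilted_law v" by (rule prob_space_tilted_law[OF v0])
  interpret J: prob_space "Pi\<^sub>M p (jump_laws v p z)" by (rule prob_space_PiM_jump_laws[OF v p])
  interpret pair_sigma_finite "tilted_law v" "Pi\<^sub>M p (jump_laws v p z)" ..
  have [measurable]: "total_mass h \<in> borel_measurable (tilted_law v)"
    unfolding measurable_tilted_law[OF v0] by (rule measurable_total_mass[OF h_measurable])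
  have AE: "AE w in ?star. 0 < total_mass h (fst w) \<and> total_mass h (fst w) < \<infinity>"
    unfolding star_jumps_law_def
    by (rule AE_pair_measure) (measurable, use total_mass_AE_tilted_law[OF v0] in auto)
  have "distr (N_post_law v p z) (measure_algebra borel) (P_of h) =
    distr ?star (measure_algebra borel) (P_of h \<circ> (\<lambda>(N, J). add_points p z N J))"
    unfolding N_post_law_eq[OF v0 fp] by (rule distr_distr[OF measurable_P_of[OF h_measurable] measurable_add_points_star[OF v0 fp]])
  also have "\<dots> = P_law h (tilt h v \<rho>) \<eta> p z"
    unfolding P_law_def
  proof (rule distr_cong_AE)
    show "AE w in ?star. (P_of h \<circ> (\<lambda>(N, J). add_points p z N J)) w = (case w of (N, J) \<Rightarrow> post_P h p z N J)"
      using AE AE_space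
    proof eventually_elim
      case (elim w)
      obtain N J where w: "w = (N, J)" by force
      then have "sets N = sets borel" using elim by (auto simp: space_star_jumps_law[OF v0])
      from P_of_add_points[OF this fp, of z J] elim show ?case by (simp add: w)
    qed
    show "P_of h \<circ> (\<lambda>(N, J). add_points p z N J) \<in> ?star \<rightarrow>\<^sub>M measure_algebra borel"
      by (rule measurable_comp[OF measurable_add_points_star[OF v0 fp] measurable_P_of[OF h_measurable]])
    show "(\<lambda>(N, J). post_P h p z N J) \<in> ?star \<rightarrow>\<^sub>M measure_algebra borel"
      unfolding measurable_star_jumps_law[OF v0] by (rule measurable_post_P[OF fp])
  qed simp_all
  finally show ?thesis .
qed

lemma distr_N_mixture:
  assumes p: "blocks p" and z: "regular_values \<theta> m p z" "z \<in> space (Pi\<^sub>M p (\<lambda>_. borel))"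
    and f: "f \<in> X \<rightarrow>\<^sub>M S'" and Q: "\<And>v. 0 < v \<Longrightarrow> distr (N_post_law v p z) S' f = Q v"
  shows "distr (N_mixture \<theta> m p z) S' f = mixture S' (mix_posterior h \<rho> PN \<theta> m p z) Q"
proof -
  have "distr (N_mixture \<theta> m p z) S' f = mixture S' (mix_posterior h \<rho> PN \<theta> m p z) (\<lambda>v. distr (N_post_law v p z) S' f)"
    using z by (intro distr_mixture[OF N_post_law_kernel_mix_posterior[OF p] f]) (auto simp: regular_values_def)
  also have "\<dots> = mixture S' (mix_posterior h \<rho> PN \<theta> m p z) Q"
    by (intro mixture_cong_AE AE_I2) (simp add: space_mix_posterior Q)
  finally show ?thesis .
qed

section \<open>The exchangeable sequence\<close>

text \<open>Replaces P by a point mass on the negligible event of zero or infinite total mass,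
  because the infinite product below requires a probability measure for every N.\<close>

definition P' :: "('s \<times> 'y) measure \<Rightarrow> 'y measure" where
  "P' N = (if 0 < total_mass h N \<and> total_mass h N < \<infinity> then P_of h N else return borel undefined)"

lemma prob_space_P': "prob_space (P' N)"
  by (auto simp: P'_def prob_space_P_of prob_space_return)

lemma sets_P': "sets (P' N) = sets borel" by (simp add: P'_def)

lemma space_P': "space (P' N) = UNIV" by (simp add: P'_def)

lemma P'_measurable:
  assumes "A \<in> sets borel"
  shows "(\<lambda>N. emeasure (P' N) A) \<in> borel_measurable X"
proof -
  have [measurable]: "(\<lambda>N. emeasure (P_of h N) A) \<in> borel_measurable X"
    by (rule measurable_compose[OF measurable_P_of[OF h_measurable]]) (use assms in simp)
  have [measurable]: "total_mass h \<in> borel_measurable X" by (rule measurable_total_mass[OF h_measurable])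
  have "(\<lambda>N. if 0 < total_mass h N \<and> total_mass h N < \<infinity> then emeasure (P_of h N) A else emeasure (return borel undefined) A) \<in> borel_measurable X"
    by measurable
  then show ?thesis by (rule measurable_cong[THEN iffD2, rotated]) (simp add: P'_def)
qed

abbreviation "seq_space \<equiv> Pi\<^sub>M {1..} (\<lambda>_::nat. borel :: 'y measure)"

definition seq_kernel :: "('s \<times> 'y) measure \<Rightarrow> (nat \<Rightarrow> 'y) measure" where
  "seq_kernel N = Pi\<^sub>M {1..} (\<lambda>_. P' N)"

lemma sets_seq_kernel: "sets (seq_kernel N) = sets seq_space"
  unfolding seq_kernel_def by (intro sets_PiM_cong refl sets_P')

lemma emeasure_seq_kernel:
  assumes "finite J" "J \<subseteq> {1..}" "\<And>i. i \<in> J \<Longrightarrow> B i \<in> sets borel"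
  shows "emeasure (seq_kernel N) (prod_emb {1..} (\<lambda>_. borel) J (Pi\<^sub>E J B)) = (\<Prod>i\<in>J. emeasure (P' N) (B i))"
proof -
  interpret P': prob_space "P' N" by (rule prob_space_P')
  interpret product_prob_space "\<lambda>_::nat. P' N" "{1..}" ..
  have "prod_emb {1..} (\<lambda>_. borel) J (Pi\<^sub>E J B) = prod_emb {1..} (\<lambda>_. P' N) J (Pi\<^sub>E J B)"
    by (simp add: prod_emb_def space_P')
  then show ?thesis
    unfolding seq_kernel_def by (simp only:) (rule emeasure_PiM_emb, use assms in \<open>simp_all add: sets_P'\<close>)
qed

text \<open>Finite-dimensional cylinders are stable under intersection and generate the product
  sigma-algebra; on them the kernel is a finite product of evaluations.\<close>

lemma seq_kernel_measurable: "seq_kernel \<in> X \<rightarrow>\<^sub>M prob_algebra seq_space"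
proof (rule measurable_prob_algebra_generated[OF sets_PiM Int_stable_prod_algebra prod_algebra_sets_into_space])
  show "prob_space (seq_kernel N)" for N
    unfolding seq_kernel_def by (intro prob_space_PiM prob_space_P')
  show "sets (seq_kernel N) = sets seq_space" for N by (rule sets_seq_kernel)
  fix A :: "(nat \<Rightarrow> 'y) set" assume "A \<in> prod_algebra {1..} (\<lambda>_. borel)"
  then obtain J E where A: "A = prod_emb {1..} (\<lambda>_. borel) J (\<Pi>\<^sub>E j\<in>J. E j)"
    and J: "finite J" "J \<subseteq> {1..}" "\<And>j. j \<in> J \<Longrightarrow> E j \<in> sets borel"
    by (force elim!: prod_algebraE)
  have [measurable]: "(\<lambda>N. emeasure (P' N) (E j)) \<in> borel_measurable X" if "j \<in> J" for j
    by (rule P'_measurable[OF J(3)[OF that]])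
  have "(\<lambda>N. \<Prod>j\<in>J. emeasure (P' N) (E j)) \<in> borel_measurable X" by measurable
  then show "(\<lambda>N. emeasure (seq_kernel N) A) \<in> borel_measurable X"
    by (simp only: A emeasure_seq_kernel[OF J])
qed

text \<open>A mixture of i.i.d. sequences in de Finetti's form. It provides one infinite sequence
  whose samples of all sizes are consistent, as the notion of an EPPF demands.\<close>

definition seq_law :: "real \<Rightarrow> (nat \<Rightarrow> 'y) measure" where
  "seq_law \<theta> = weighted_law h PN \<theta> \<bind> seq_kernel"

context
  fixes \<theta> :: real
  assumes c: "neg_moment h PN \<theta> < \<infinity>"
begin

lemma weighted_law_prob_algebra: "weighted_law h PN \<theta> \<in> space (prob_algebra X)"
  using prob_space_weighted_law[OF c] by (simp add: space_prob_algebra sets_weighted_law)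

lemma sets_seq_law: "sets (seq_law \<theta>) = sets seq_space"
proof -
  have "space (weighted_law h PN \<theta>) \<noteq> {}" by (rule prob_space.not_empty[OF prob_space_weighted_law[OF c]])
  then show ?thesis
    unfolding seq_law_def by (intro sets_bind) (simp_all add: sets_seq_kernel)
qed

lemma emeasure_seq_law:
  assumes "A \<in> sets seq_space"
  shows "emeasure (seq_law \<theta>) A = (\<integral>\<^sup>+N. emeasure (seq_kernel N) A \<partial>weighted_law h PN \<theta>)"
  unfolding seq_law_def by (rule emeasure_bind_prob_algebra[OF weighted_law_prob_algebra seq_kernel_measurable assms])

lemma prob_space_seq_law: "prob_space (seq_law \<theta>)"
proof (rule prob_spaceI)
  interpret W: prob_space "weighted_law h PN \<theta>" by (rule prob_space_weighted_law[OF c])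
  have "emeasure (seq_kernel N) (space seq_space) = 1" for N
  proof -
    interpret prob_space "seq_kernel N" unfolding seq_kernel_def by (intro prob_space_PiM prob_space_P')
    show ?thesis using emeasure_space_1 sets_eq_imp_space_eq[OF sets_seq_kernel, of N] by simp
  qed
  then have "emeasure (seq_law \<theta>) (space seq_space) = 1"
    by (subst emeasure_seq_law) (simp_all add: W.emeasure_space_1)
  then show "emeasure (seq_law \<theta>) (space (seq_law \<theta>)) = 1"
    using sets_eq_imp_space_eq[OF sets_seq_law] by simp
qed

lemma emeasure_seq_law_cylinder:
  assumes J: "finite J" "J \<subseteq> {1..}" "\<And>i. i \<in> J \<Longrightarrow> B i \<in> sets borel"
  shows "emeasure (seq_law \<theta>) (prod_emb {1..} (\<lambda>_. borel) J (Pi\<^sub>E J B)) =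
    (\<integral>\<^sup>+N. (\<Prod>i\<in>J. emeasure (P_of h N) (B i)) \<partial>weighted_law h PN \<theta>)"
proof -
  have "emeasure (seq_law \<theta>) (prod_emb {1..} (\<lambda>_. borel) J (Pi\<^sub>E J B)) = (\<integral>\<^sup>+N. (\<Prod>i\<in>J. emeasure (P' N) (B i)) \<partial>weighted_law h PN \<theta>)"
  proof -
    have "prod_emb {1..} (\<lambda>_. borel) J (Pi\<^sub>E J B) \<in> sets seq_space" using J by (intro sets_PiM_I) auto
    from emeasure_seq_law[OF this] show ?thesis by (simp only: emeasure_seq_kernel[OF J])
  qed
  also have "\<dots> = (\<integral>\<^sup>+N. (\<Prod>i\<in>J. emeasure (P_of h N) (B i)) \<partial>weighted_law h PN \<theta>)"
    using total_mass_AE_weighted_law[of \<theta>]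
    by (intro nn_integral_cong_AE, eventually_elim) (simp add: P'_def)
  finally show ?thesis .
qed

text \<open>Cylinder probabilities are mixtures of products over the coordinates, all with the same
  factor law, hence unchanged by a permutation of indices; and cylinders determine a finite
  measure.\<close>

lemma exchangeable_seq_law: "exchangeable_seq (seq_law \<theta>)"
  unfolding exchangeable_seq_def
proof (intro conjI allI impI)
  show "prob_space (seq_law \<theta>)" by (rule prob_space_seq_law)
  show "sets (seq_law \<theta>) = sets seq_space" by (rule sets_seq_law)
  fix L :: "nat set" and f assume L: "finite L" "L \<subseteq> {1..}" "f permutes L"
  have sp: "space (seq_law \<theta>) = space seq_space" by (rule sets_eq_imp_space_eq[OF sets_seq_law])
  have f1: "f i \<in> {1..} \<longleftrightarrow> i \<in> {1..}" for i
    using L permutes_in_image[OF L(3), of i] permutes_not_in[OF L(3), of i] by (cases "i \<in> L") auto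
  have fm: "(\<lambda>y. y \<circ> f) \<in> seq_space \<rightarrow>\<^sub>M seq_space"
  proof (rule measurable_PiM_single')
    show "(\<lambda>y. (y \<circ> f) i) \<in> seq_space \<rightarrow>\<^sub>M borel" if "i \<in> {1..}" for i
      using f1[of i] that by (simp add: measurable_component_singleton)
    show "(\<lambda>y. y \<circ> f) \<in> space seq_space \<rightarrow> (\<Pi>\<^sub>E i\<in>{1..}. space borel)"
      using f1 by (auto simp: space_PiM PiE_iff extensional_def)
  qed
  have fm': "(\<lambda>y. y \<circ> f) \<in> seq_law \<theta> \<rightarrow>\<^sub>M seq_law \<theta>"
    using fm by (simp add: measurable_cong_sets[OF sets_seq_law sets_seq_law])
  show "distr (seq_law \<theta>) (seq_law \<theta>) (\<lambda>y. y \<circ> f) = seq_law \<theta>"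
  proof (rule measure_eqI_PiM_infinite[symmetric, of "seq_law \<theta>" "{1..}" "\<lambda>_. borel"])
    show "finite_measure (seq_law \<theta>)" by (rule prob_space.finite_measure[OF prob_space_seq_law])
    fix B :: "nat \<Rightarrow> 'y set" and J assume J: "finite J" "J \<subseteq> {1..}" "\<And>i. i \<in> J \<Longrightarrow> B i \<in> sets borel"
    let ?E = "prod_emb {1..} (\<lambda>_. borel :: 'y measure)"
    have inj: "inj f" using permutes_inj[OF L(3)] .
    have invf: "inv f (f i) = i" for i using inj by simp
    have J': "finite (f ` J)" "f ` J \<subseteq> {1..}" "\<And>i. i \<in> f ` J \<Longrightarrow> B (inv f i) \<in> sets borel"
      using J f1 by (auto simp: invf)
    have "emeasure (distr (seq_law \<theta>) (seq_law \<theta>) (\<lambda>y. y \<circ> f)) (?E J (Pi\<^sub>E J B)) =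
      emeasure (seq_law \<theta>) ((\<lambda>y. y \<circ> f) -` ?E J (Pi\<^sub>E J B) \<inter> space (seq_law \<theta>))"
      using J by (intro emeasure_distr[OF fm']) (auto simp: sets_seq_law intro!: sets_PiM_I)
    \<comment> \<open>The preimage is the cylinder over the permuted coordinates, each side being
      carried along by the inverse of f.\<close>
    also have "(\<lambda>y. y \<circ> f) -` ?E J (Pi\<^sub>E J B) \<inter> space (seq_law \<theta>) = ?E (f ` J) (Pi\<^sub>E (f ` J) (\<lambda>i. B (inv f i)))"
    proof -
      have *: "y \<in> ?E K (Pi\<^sub>E K C) \<longleftrightarrow> y \<in> space seq_space \<and> (\<forall>i\<in>K. y i \<in> C i)" for y K and C :: "nat \<Rightarrow> 'y set"
        by (auto simp: prod_emb_def space_PiM PiE_iff)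
      have **: "y \<circ> f \<in> space seq_space" if "y \<in> space seq_space" for y using measurable_space[OF fm that] .
      show ?thesis
      proof (rule set_eqI)
        fix y
        show "y \<in> (\<lambda>y. y \<circ> f) -` ?E J (Pi\<^sub>E J B) \<inter> space (seq_law \<theta>) \<longleftrightarrow> y \<in> ?E (f ` J) (Pi\<^sub>E (f ` J) (\<lambda>i. B (inv f i)))"
          unfolding Int_iff vimage_eq * sp using **[of y] by (auto simp: invf)
      qed
    qed
    also have "emeasure (seq_law \<theta>) \<dots> = (\<integral>\<^sup>+N. (\<Prod>i\<in>f ` J. emeasure (P_of h N) (B (inv f i))) \<partial>weighted_law h PN \<theta>)"
      by (rule emeasure_seq_law_cylinder[OF J'])
    also have "\<dots> = (\<integral>\<^sup>+N. (\<Prod>i\<in>J. emeasure (P_of h N) (B i)) \<partial>weighted_law h PN \<theta>)"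
      using inj by (simp add: prod.reindex inj_on_subset invf)
    also have "\<dots> = emeasure (seq_law \<theta>) (?E J (Pi\<^sub>E J B))"
      by (rule emeasure_seq_law_cylinder[OF J, symmetric])
    finally show "emeasure (seq_law \<theta>) (?E J (Pi\<^sub>E J B)) =
      emeasure (distr (seq_law \<theta>) (seq_law \<theta>) (\<lambda>y. y \<circ> f)) (?E J (Pi\<^sub>E J B))" ..
  qed (simp_all add: sets_seq_law)
qed

lemma restrict_seq_law_measurable: "(\<lambda>y. restrict y {1..m}) \<in> seq_law \<theta> \<rightarrow>\<^sub>M Pi\<^sub>M {1..m} (\<lambda>_. borel)"
  unfolding measurable_cong_sets[OF sets_seq_law refl]
  by (intro measurable_restrict_subset) auto

lemma seq_law_has_rectangles:
  "has_rectangles \<theta> {1..m} (distr (seq_law \<theta>) (Pi\<^sub>M {1..m} (\<lambda>_. borel)) (\<lambda>y. restrict y {1..m}))"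
  unfolding has_rectangles_def
proof (intro conjI allI impI)
  show "prob_space (distr (seq_law \<theta>) (Pi\<^sub>M {1..m} (\<lambda>_. borel)) (\<lambda>y. restrict y {1..m}))"
    by (rule prob_space.prob_space_distr[OF prob_space_seq_law restrict_seq_law_measurable])
  fix B :: "nat \<Rightarrow> 'y set" assume B: "\<forall>i\<in>{1..m}. B i \<in> sets borel"
  have sp: "space (seq_law \<theta>) = space seq_space" by (rule sets_eq_imp_space_eq[OF sets_seq_law])
  have "emeasure (distr (seq_law \<theta>) (Pi\<^sub>M {1..m} (\<lambda>_. borel)) (\<lambda>y. restrict y {1..m})) (\<Pi>\<^sub>E i\<in>{1..m}. B i) =
    emeasure (seq_law \<theta>) ((\<lambda>y. restrict y {1..m}) -` (\<Pi>\<^sub>E i\<in>{1..m}. B i) \<inter> space (seq_law \<theta>))"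
    using B by (intro emeasure_distr[OF restrict_seq_law_measurable] sets_PiM_I_finite) auto
  also have "(\<lambda>y. restrict y {1..m}) -` (\<Pi>\<^sub>E i\<in>{1..m}. B i) \<inter> space (seq_law \<theta>) = prod_emb {1..} (\<lambda>_. borel) {1..m} (\<Pi>\<^sub>E i\<in>{1..m}. B i)"
    by (auto simp: prod_emb_def sp space_PiM)
  also have "emeasure (seq_law \<theta>) \<dots> = (\<integral>\<^sup>+N. (\<Prod>i\<in>{1..m}. emeasure (P_of h N) (B i)) \<partial>weighted_law h PN \<theta>)"
    using B by (intro emeasure_seq_law_cylinder) auto
  finally show "emeasure (distr (seq_law \<theta>) (Pi\<^sub>M {1..m} (\<lambda>_. borel)) (\<lambda>y. restrict y {1..m})) (\<Pi>\<^sub>E i\<in>{1..m}. B i) =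
    (\<integral>\<^sup>+N. (\<Prod>i\<in>{1..m}. emeasure (P_of h N) (B i)) \<partial>weighted_law h PN \<theta>)" .
qed simp

text \<open>The first m coordinates form a sample of size m from P, so the partition formula holds
  along the whole sequence. The condition \<theta> + m > 0 is that of the Gamma integral.\<close>

lemma eppf_seq_law:
  assumes na: "nonatomic \<eta>" and s: "0 < \<theta> + real m" and p: "partition_on {1..m} p"
  shows "eppf (seq_law \<theta>) m p = partition_prob h \<rho> \<eta> PN \<theta> m p"
proof -
  let ?S = "Pi\<^sub>M {1..m} (\<lambda>_. borel :: 'y measure)" and ?r = "\<lambda>y. restrict y {1..m}"
  have "{y \<in> space ?S. ties {1..m} y = p} = ties {1..m} -` {p} \<inter> space ?S" by auto
  then have B: "{y \<in> space ?S. ties {1..m} y = p} \<in> sets ?S"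
    using measurable_sets[OF ties_measurable[of "{1..m}"], of "{p}"] p by simp
  have "eppf (seq_law \<theta>) m p = emeasure (distr (seq_law \<theta>) ?S ?r) {y \<in> space ?S. ties {1..m} y = p}"
    unfolding eppf_def emeasure_distr[OF restrict_seq_law_measurable B]
    using measurable_space[OF restrict_seq_law_measurable, of _ m]
    by (intro arg_cong[of _ _ "emeasure (seq_law \<theta>)"]) (auto simp: ties_restrict)
  also have "\<dots> = partition_prob h \<rho> \<eta> PN \<theta> m p"
    using sample_partition_prob[OF seq_law_has_rectangles _ c _ na p] s by simp
  finally show ?thesis .
qed

end

end

section \<open>Marginal, partition and posterior laws of the normalized random measure\<close>

theorem theorem5p2:
  fixes \<eta> :: "'y::polish_space measure"
    and \<rho> :: "'y \<Rightarrow> 's::polish_space measure"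
    and h :: "'s \<Rightarrow> real"
    and PN :: "('s \<times> 'y) measure measure"
    and \<theta> :: real and n :: nat
    and M :: "'w measure"
    and N :: "'w \<Rightarrow> ('s \<times> 'y) measure"
    and Y :: "nat \<Rightarrow> 'w \<Rightarrow> 'y"
  assumes "sets \<eta> = sets borel" and "sigma_finite_measure \<eta>" and "nonatomic \<eta>"
    and "sigma_finite_kernel \<rho>"
    and "h \<in> borel_measurable borel" and "\<And>s. 0 < h s"
    and "(\<forall>y y'. \<rho> y = \<rho> y') \<Longrightarrow> finite_measure \<eta>"
    and "is_poisson_law (intensity \<rho> \<eta>) PN"
    and "AE m in PN. 0 < total_mass h m \<and> total_mass h m < \<infinity>"
    and "1 \<le> n" and "0 < \<theta> + real n"
    and "\<theta> \<noteq> 0 \<Longrightarrow> neg_moment h PN \<theta> < \<infinity> \<and> neg_moment h PN (\<theta> + real n) < \<infinity>"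
    and "prob_space M"
    and "distr M (measure_algebra borel) N = weighted_law h PN \<theta>"
    and "cond_iid M (measure_algebra borel) N {1..n} Y (P_of h)"
  shows
    \<comment> \<open>(i)\<close>
    "(\<forall>p D. partition_on {1..n} p \<longrightarrow> D \<in> sets (Pi\<^sub>M p (\<lambda>_. borel)) \<longrightarrow>
        emeasure M {w \<in> space M. ties {1..n} (sample_vec n Y w) = p \<and> block_values p (sample_vec n Y w) \<in> D} =
        (\<integral>\<^sup>+v. emeasure (Pi\<^sub>M p (\<lambda>C. value_law h (card C) (tilt h v \<rho>) \<eta>)) D
            \<partial>mix_joint h \<rho> \<eta> PN \<theta> n p))
     \<and>
     (\<exists>Q :: (nat \<Rightarrow> 'y) measure.
        exchangeable_seq Q \<and>
        distr Q (Pi\<^sub>M {1..n} (\<lambda>_. borel)) (\<lambda>y. restrict y {1..n}) =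
          distr M (Pi\<^sub>M {1..n} (\<lambda>_. borel)) (sample_vec n Y) \<and>
        (\<forall>m p. 1 \<le> m \<longrightarrow> 0 < \<theta> + real m \<longrightarrow> partition_on {1..m} p \<longrightarrow>
           eppf Q m p = partition_prob h \<rho> \<eta> PN \<theta> m p))
     \<and>
     ((\<forall>y y'. \<rho> y = \<rho> y') \<longrightarrow>
      (\<forall>p D. partition_on {1..n} p \<longrightarrow> D \<in> sets (Pi\<^sub>M p (\<lambda>_. borel)) \<longrightarrow>
        emeasure M {w \<in> space M. ties {1..n} (sample_vec n Y w) = p \<and> block_values p (sample_vec n Y w) \<in> D} =
        partition_prob h \<rho> \<eta> PN \<theta> n p * emeasure (Pi\<^sub>M p (\<lambda>_. normalize_measure \<eta>)) D))
     \<and> \<comment> \<open>(ii)\<close>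
     is_posterior M (measure_algebra borel) N (Pi\<^sub>M {1..n} (\<lambda>_. borel)) (sample_vec n Y)
       (\<lambda>y. let p = ties {1..n} y; ys = block_values p y in
          mixture (measure_algebra borel) (mix_posterior h \<rho> PN \<theta> n p ys)
            (\<lambda>v. distr (N_jumps_law h (tilt h v \<rho>) \<eta> p ys) (measure_algebra borel) fst))
     \<and>
     is_posterior M (measure_algebra borel) (\<lambda>w. mu_of h (N w)) (Pi\<^sub>M {1..n} (\<lambda>_. borel)) (sample_vec n Y)
       (\<lambda>y. let p = ties {1..n} y; ys = block_values p y in
          mixture (measure_algebra borel) (mix_posterior h \<rho> PN \<theta> n p ys)
            (\<lambda>v. mu_law h (tilt h v \<rho>) \<eta> p ys))
     \<and> \<comment> \<open>(iii)\<close>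
     is_posterior M (measure_algebra borel) (\<lambda>w. P_of h (N w)) (Pi\<^sub>M {1..n} (\<lambda>_. borel)) (sample_vec n Y)
       (\<lambda>y. let p = ties {1..n} y; ys = block_values p y in
          mixture (measure_algebra borel) (mix_posterior h \<rho> PN \<theta> n p ys)
            (\<lambda>v. P_law h (tilt h v \<rho>) \<eta> p ys))"
proof -
  interpret poisson_model \<eta> \<rho> h PN by (rule poisson_model.intro; fact)
  \<comment> \<open>For \<theta> = 0 the moment is at most 1; for other \<theta> its finiteness is
    assumed.\<close>
  have c: "neg_moment h PN \<theta> < \<infinity>"
    using neg_moment_0 assms(12) by (cases "\<theta> = 0") auto
  note ctx = \<open>0 < \<theta> + real n\<close> c \<open>nonatomic \<eta>\<close> \<open>prob_space M\<close>
    \<open>distr M (measure_algebra borel) N = weighted_law h PN \<theta>\<close>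
    \<open>cond_iid M (measure_algebra borel) N {1..n} Y (P_of h)\<close>
  have bl: "blocks p" if "partition_on {1..n} p" for p by (rule blocks_partition_on[OF _ that]) simp
  have i: "emeasure M {w \<in> space M. ties {1..n} (sample_vec n Y w) = p \<and> block_values p (sample_vec n Y w) \<in> D} =
        (\<integral>\<^sup>+v. emeasure (Pi\<^sub>M p (\<lambda>C. value_law h (card C) (tilt h v \<rho>) \<eta>)) D \<partial>mix_joint h \<rho> \<eta> PN \<theta> n p)"
    if "partition_on {1..n} p" "D \<in> sets (Pi\<^sub>M p (\<lambda>_. borel))" for p D
    by (rule sample_values_law[OF ctx that])
  \<comment> \<open>The same sequence law serves for all m. Its first n coordinates have the law of
    the given sample because the two share their rectangle probabilities.\<close>
  have Q: "exchangeable_seq (seq_law \<theta>) \<and>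
        distr (seq_law \<theta>) (Pi\<^sub>M {1..n} (\<lambda>_. borel)) (\<lambda>y. restrict y {1..n}) =
          distr M (Pi\<^sub>M {1..n} (\<lambda>_. borel)) (sample_vec n Y) \<and>
        (\<forall>m p. 1 \<le> m \<longrightarrow> 0 < \<theta> + real m \<longrightarrow> partition_on {1..m} p \<longrightarrow>
           eppf (seq_law \<theta>) m p = partition_prob h \<rho> \<eta> PN \<theta> m p)"
    by (intro conjI allI impI exchangeable_seq_law[OF c] eppf_seq_law[OF c \<open>nonatomic \<eta>\<close>]
      has_rectangles_unique[OF seq_law_has_rectangles[OF c] sample_has_rectangles[OF ctx] finite_atLeastAtMost])
  \<comment> \<open>The side conditions under which the mixture for N can be mapped component by
    component; they hold for almost every sample.\<close>
  have good: "AE y in distr M (Pi\<^sub>M {1..n} (\<lambda>_. borel)) (sample_vec n Y).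
      regular_values \<theta> n (ties {1..n} y) (block_values (ties {1..n} y) y) \<and> blocks (ties {1..n} y) \<and>
      block_values (ties {1..n} y) y \<in> space (Pi\<^sub>M (ties {1..n} y) (\<lambda>_. borel))"
    using regular_values_AE_sample[OF ctx]
    by eventually_elim (auto simp: bl partition_on_ties space_PiM block_values_def)
  \<comment> \<open>A common rule for \<mu> and P: the posterior of N is mapped by f inside the
    mixture over v, where only v > 0 and good values occur.\<close>
  have post: "is_posterior M (measure_algebra borel) (\<lambda>w. f (N w)) (Pi\<^sub>M {1..n} (\<lambda>_. borel)) (sample_vec n Y)
       (\<lambda>y. let p = ties {1..n} y; ys = block_values p y in
          mixture (measure_algebra borel) (mix_posterior h \<rho> PN \<theta> n p ys) (\<lambda>v. Q p ys v))"
    if f: "f \<in> measure_algebra borel \<rightarrow>\<^sub>M measure_algebra borel"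
      and Q: "\<And>p ys v. 0 < v \<Longrightarrow> blocks p \<Longrightarrow> good p ys \<Longrightarrow> distr (N_post_law v p ys) (measure_algebra borel) f = Q p ys v"
    for f :: "('s \<times> 'y) measure \<Rightarrow> 'y measure" and Q
  proof (rule is_posterior_image[OF posterior_N[OF ctx] f])
    show "AE y in distr M (Pi\<^sub>M {1..n} (\<lambda>_. borel)) (sample_vec n Y).
      distr (N_mixture \<theta> n (ties {1..n} y) (block_values (ties {1..n} y) y)) (measure_algebra borel) f =
      (let p = ties {1..n} y; ys = block_values p y in
          mixture (measure_algebra borel) (mix_posterior h \<rho> PN \<theta> n p ys) (\<lambda>v. Q p ys v))"
      using good
    proof eventually_elim
      case (elim y)
      then show ?case
        unfolding Let_def by (intro distr_N_mixture f Q) (auto simp: regular_values_def)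
    qed
  qed
  show ?thesis
  proof (intro conjI allI impI)
    show "\<exists>Q :: (nat \<Rightarrow> 'y) measure.
        exchangeable_seq Q \<and>
        distr Q (Pi\<^sub>M {1..n} (\<lambda>_. borel)) (\<lambda>y. restrict y {1..n}) =
          distr M (Pi\<^sub>M {1..n} (\<lambda>_. borel)) (sample_vec n Y) \<and>
        (\<forall>m p. 1 \<le> m \<longrightarrow> 0 < \<theta> + real m \<longrightarrow> partition_on {1..m} p \<longrightarrow>
           eppf Q m p = partition_prob h \<rho> \<eta> PN \<theta> m p)"
      using Q by blast
    show "is_posterior M (measure_algebra borel) N (Pi\<^sub>M {1..n} (\<lambda>_. borel)) (sample_vec n Y)
       (\<lambda>y. let p = ties {1..n} y; ys = block_values p y in
          mixture (measure_algebra borel) (mix_posterior h \<rho> PN \<theta> n p ys)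
            (\<lambda>v. distr (N_jumps_law h (tilt h v \<rho>) \<eta> p ys) (measure_algebra borel) fst))"
      unfolding Let_def by (rule posterior_N[OF ctx])
    show "is_posterior M (measure_algebra borel) (\<lambda>w. mu_of h (N w)) (Pi\<^sub>M {1..n} (\<lambda>_. borel)) (sample_vec n Y)
       (\<lambda>y. let p = ties {1..n} y; ys = block_values p y in
          mixture (measure_algebra borel) (mix_posterior h \<rho> PN \<theta> n p ys)
            (\<lambda>v. mu_law h (tilt h v \<rho>) \<eta> p ys))"
      by (rule post[OF measurable_mu_of[OF h_measurable]]) (auto simp: distr_N_post_law_mu_of blocks_def)
    show "is_posterior M (measure_algebra borel) (\<lambda>w. P_of h (N w)) (Pi\<^sub>M {1..n} (\<lambda>_. borel)) (sample_vec n Y)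
       (\<lambda>y. let p = ties {1..n} y; ys = block_values p y in
          mixture (measure_algebra borel) (mix_posterior h \<rho> PN \<theta> n p ys)
            (\<lambda>v. P_law h (tilt h v \<rho>) \<eta> p ys))"
      by (rule post[OF measurable_P_of[OF h_measurable]]) (rule distr_N_post_law_P_of)
    fix p D assume p: "partition_on {1..n} p" and D: "D \<in> sets (Pi\<^sub>M p (\<lambda>_. borel :: 'y measure))"
    show "emeasure M {w \<in> space M. ties {1..n} (sample_vec n Y w) = p \<and> block_values p (sample_vec n Y w) \<in> D} =
        (\<integral>\<^sup>+v. emeasure (Pi\<^sub>M p (\<lambda>C. value_law h (card C) (tilt h v \<rho>) \<eta>)) D \<partial>mix_joint h \<rho> \<eta> PN \<theta> n p)"
      by (rule i[OF p D])
    assume \<rho>: "\<forall>y y'. \<rho> y = \<rho> y'"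
    show "emeasure M {w \<in> space M. ties {1..n} (sample_vec n Y w) = p \<and> block_values p (sample_vec n Y w) \<in> D} =
        partition_prob h \<rho> \<eta> PN \<theta> n p * emeasure (Pi\<^sub>M p (\<lambda>_. normalize_measure \<eta>)) D"
      unfolding i[OF p D] by (rule partition_values_law_constant[OF \<rho> bl[OF p]])
  qed
qed

end
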